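(* Let $\mathcal{R}$ be a bounded Reinhardt domain in $\mathbb{C}^n$, let $2\le p<\infty$ and let $q$ be conjugate to $p$. Suppose $\big|\widetilde{\mathbf{B}^p}\big|$ is bounded on $L^p(\mathcal{R})$. Then: (i) The map $\Phi_p:A^q(\mathcal{R})\to A^p(\mathcal{R})'$, $\Phi_p(g)(f)=\int_{\mathcal{R}}f\,\overline{g}\,dV$, is surjective and $\ker\Phi_p=N^{q,p}(\mathcal{R})$. (ii) There is a linear homeomorphism of Banach spaces $A^p(\mathcal{R})'\cong G^{q,p}(\mathcal{R})$. (iii) There is a topological direct sum representation $$A^q(\mathcal{R})'=\Phi_q(A^p(\mathcal{R}))\oplus\overline{\mathrm{span}}_{A^q(\mathcal{R})'}\big\{a_\alpha:\alpha\in\mathcal{S}(\mathcal{R},L^q)\setminus\mathcal{S}(\mathcal{R},L^p)\big\},$$ where $\Phi_q:A^p(\mathcal{R})\to A^q(\mathcal{R})'$ is $\Phi_q(g)(f)=\int_{\mathcal{R}}f\,\overline{g}\,dV$.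
   Context: A domain $\mathcal{R}\subset\mathbb{C}^n$ is Reinhardt if it is invariant under $(z_1,\dots,z_n)\mapsto(e^{i\theta_1}z_1,\dots,e^{i\theta_n}z_n)$ for all real $\theta_j$. $A^p(\mathcal{R})$ is the Bergman space of holomorphic functions in $L^p(\mathcal{R})$ (Lebesgue measure $dV$), with the $L^p$ norm; $X'$ is the dual of a normed space $X$. Each holomorphic $f$ on $\mathcal{R}$ has a unique Laurent expansion $f=\sum_{\alpha\in\mathbb{Z}^n}a_\alpha(f)e_\alpha$, $e_\alpha(z)=z^\alpha$, converging uniformly on compact sets; $a_\alpha$ is the $\alpha$-th coefficient functional. $\mathcal{S}(\mathcal{R},L^p)=\{\alpha\in\mathbb{Z}^n:e_\alpha\in A^p(\mathcal{R})\}$. Define $G^{q,p}(\mathcal{R})=\overline{\mathrm{span}}_{A^q(\mathcal{R})}\{e_\alpha:\alpha\in\mathcal{S}(\mathcal{R},L^p)\}$ and $N^{q,p}(\mathcal{R})=\overline{\mathrm{span}}_{A^q(\mathcal{R})}\{e_\alpha:\alpha\in\mathcal{S}(\mathcal{R},L^q)\setminus\mathcal{S}(\mathcal{R},L^p)\}$, closed linear spans in $A^q(\mathcal{R})$. The $L^p$ sub-Bergman projection $\widetilde{\mathbf{B}^p}$ is the orthogonal projection of $L^2(\mathcal{R})$ onto the $L^2$-closure of $A^p(\mathcal{R})$; its kernel is $\widetilde{B^p}(z,w)=\sum_{\alpha\in\mathcal{S}(\mathcal{R},L^p)}\frac{e_\alpha(z)\overline{e_\alpha(w)}}{\|e_\alpha\|_2^2}$,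 and $\big|\widetilde{\mathbf{B}^p}\big|f(z)=\int_{\mathcal{R}}\big|\widetilde{B^p}(z,w)\big|f(w)\,dV(w)$. *)

theory Defs
  imports "HOL-Analysis.Analysis" "HOL-Library.Function_Algebras"
begin

section \<open>Normed spaces of scalar functions\<close>

text \<open>
  The Bergman spaces depend on the domain and the exponent, and their duals are spaces of functionals
  on them.  A normed space is therefore a pair \<open>(V, N)\<close> of a set of functions \<open>V\<close> on a type \<open>'x\<close> and a
  norm \<open>N\<close> on it.  Taking the functions in \<open>V\<close> themselves as points, the dual of \<open>(V, N)\<close> is again of
  this form, with \<open>'x \<Rightarrow> complex\<close> in place of \<open>'x\<close>.
\<close>

definition fscale :: "complex \<Rightarrow> ('x \<Rightarrow> complex) \<Rightarrow> 'x \<Rightarrow> complex" where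
  "fscale c f = (\<lambda>x. c * f x)"

global_interpretation cfun: vector_space "fscale :: complex \<Rightarrow> ('x \<Rightarrow> complex) \<Rightarrow> 'x \<Rightarrow> complex"
  by unfold_locales (auto simp: fscale_def fun_eq_iff algebra_simps)

definition linear_map_on :: "('x \<Rightarrow> complex) set \<Rightarrow> (('x \<Rightarrow> complex) \<Rightarrow> ('y \<Rightarrow> complex)) \<Rightarrow> bool" where
  "linear_map_on V T \<longleftrightarrow>
     (\<forall>u\<in>V. \<forall>v\<in>V. T (u + v) = T u + T v) \<and> (\<forall>c. \<forall>u\<in>V. T (fscale c u) = fscale c (T u))"

definition norm_on :: "('x \<Rightarrow> complex) set \<Rightarrow> (('x \<Rightarrow> complex) \<Rightarrow> real) \<Rightarrow> bool" where
  "norm_on V N \<longleftrightarrow>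
     (\<forall>u\<in>V. 0 \<le> N u \<and> (N u = 0 \<longleftrightarrow> u = 0)) \<and>
     (\<forall>c. \<forall>u\<in>V. N (fscale c u) = cmod c * N u) \<and>
     (\<forall>u\<in>V. \<forall>v\<in>V. N (u + v) \<le> N u + N v)"

text \<open>
  The locale \<open>Metric_space\<close> asks for nonnegativity on the whole type, hence the value 0 off \<open>V\<close>.
\<close>

definition norm_dist ::
  "('x \<Rightarrow> complex) set \<Rightarrow> (('x \<Rightarrow> complex) \<Rightarrow> real) \<Rightarrow> ('x \<Rightarrow> complex) \<Rightarrow> ('x \<Rightarrow> complex) \<Rightarrow> real" where
  "norm_dist V N u v = (if u \<in> V \<and> v \<in> V then N (u - v) else 0)"

definition norm_topology ::
  "('x \<Rightarrow> complex) set \<Rightarrow> (('x \<Rightarrow> complex) \<Rightarrow> real) \<Rightarrow> ('x \<Rightarrow> complex) topology" where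
  "norm_topology V N = Metric_space.mtopology V (norm_dist V N)"

definition banach_on :: "('x \<Rightarrow> complex) set \<Rightarrow> (('x \<Rightarrow> complex) \<Rightarrow> real) \<Rightarrow> bool" where
  "banach_on V N \<longleftrightarrow>
     cfun.subspace V \<and> norm_on V N \<and> Metric_space.mcomplete V (norm_dist V N)"

definition closed_span ::
  "('x \<Rightarrow> complex) set \<Rightarrow> (('x \<Rightarrow> complex) \<Rightarrow> real) \<Rightarrow> ('x \<Rightarrow> complex) set \<Rightarrow> ('x \<Rightarrow> complex) set" where
  "closed_span V N E = norm_topology V N closure_of cfun.span E"

definition linearly_homeomorphic ::
  "('x \<Rightarrow> complex) set \<Rightarrow> (('x \<Rightarrow> complex) \<Rightarrow> real) \<Rightarrow>
   ('y \<Rightarrow> complex) set \<Rightarrow> (('y \<Rightarrow> complex) \<Rightarrow> real) \<Rightarrow> bool" where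
  "linearly_homeomorphic V N W M \<longleftrightarrow>
     (\<exists>T. linear_map_on V T \<and> homeomorphic_map (norm_topology V N) (norm_topology W M) T)"

text \<open>
  \<open>V\<close> is the topological direct sum of \<open>U\<close> and \<open>W\<close>: every element of \<open>V\<close> is uniquely \<open>u + w\<close>, and it
  depends continuously on \<open>(u, w)\<close> and conversely.
\<close>

definition topological_direct_sum ::
  "('x \<Rightarrow> complex) set \<Rightarrow> (('x \<Rightarrow> complex) \<Rightarrow> real) \<Rightarrow>
   ('x \<Rightarrow> complex) set \<Rightarrow> ('x \<Rightarrow> complex) set \<Rightarrow> bool" where
  "topological_direct_sum V N U W \<longleftrightarrow>
     U \<subseteq> V \<and> W \<subseteq> V \<and> cfun.subspace U \<and> cfun.subspace W \<and>
     homeomorphic_map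
       (prod_topology (subtopology (norm_topology V N) U) (subtopology (norm_topology V N) W))
       (norm_topology V N) (\<lambda>(u, w). u + w)"

text \<open>
  Functionals are set to 0 off \<open>V\<close>, so that a functional on \<open>V\<close> is represented by exactly one element.
\<close>

definition dual_space ::
  "('x \<Rightarrow> complex) set \<Rightarrow> (('x \<Rightarrow> complex) \<Rightarrow> real) \<Rightarrow> (('x \<Rightarrow> complex) \<Rightarrow> complex) set" where
  "dual_space V N = {\<phi>.
     (\<forall>u\<in>V. \<forall>v\<in>V. \<phi> (u + v) = \<phi> u + \<phi> v) \<and> (\<forall>c. \<forall>u\<in>V. \<phi> (fscale c u) = c * \<phi> u) \<and>
     (\<exists>C. \<forall>u\<in>V. cmod (\<phi> u) \<le> C * N u) \<and> (\<forall>u. u \<notin> V \<longrightarrow> \<phi> u = 0)}"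

definition dual_norm ::
  "('x \<Rightarrow> complex) set \<Rightarrow> (('x \<Rightarrow> complex) \<Rightarrow> real) \<Rightarrow> (('x \<Rightarrow> complex) \<Rightarrow> complex) \<Rightarrow> real" where
  "dual_norm V N \<phi> = (SUP u\<in>{u \<in> V. N u \<le> 1}. cmod (\<phi> u))"


section \<open>Reinhardt domains and Bergman spaces\<close>

definition reinhardt_domain :: "(complex ^ 'n) set \<Rightarrow> bool" where
  "reinhardt_domain R \<longleftrightarrow>
     open R \<and> connected R \<and> R \<noteq> {} \<and>
     (\<forall>\<theta> :: real ^ 'n. \<forall>z\<in>R. (\<chi> j. exp (\<i> * of_real (\<theta> $ j)) * z $ j) \<in> R)"

definition holomorphic_Cn :: "(complex ^ 'n \<Rightarrow> complex) \<Rightarrow> (complex ^ 'n) set \<Rightarrow> bool" where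
  "holomorphic_Cn f R \<longleftrightarrow>
     (\<forall>z\<in>R. \<exists>D. (f has_derivative D) (at z) \<and> (\<forall>c v. D (c *s v) = c * D v))"

text \<open>
  Lebesgue measure on \<open>R\<close>, on its Borel sets.  The Lebesgue-measurable functions give the same \<open>L\<^sup>p\<close>
  spaces, up to equality almost everywhere.
\<close>

abbreviation dV :: "(complex ^ 'n) set \<Rightarrow> (complex ^ 'n) measure" where
  "dV R \<equiv> restrict_space lborel R"

definition Lp :: "(complex ^ 'n) set \<Rightarrow> real \<Rightarrow> (complex ^ 'n \<Rightarrow> complex) set" where
  "Lp R p = {f \<in> borel_measurable (dV R). integrable (dV R) (\<lambda>z. cmod (f z) powr p)}"

definition Lp_norm :: "(complex ^ 'n) set \<Rightarrow> real \<Rightarrow> (complex ^ 'n \<Rightarrow> complex) \<Rightarrow> real" where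
  "Lp_norm R p f = (LINT z|dV R. cmod (f z) powr p) powr (1 / p)"

text \<open>
  A holomorphic function on \<open>R\<close> is represented by its extension by 0 to \<open>\<complex>\<^sup>n\<close>.
\<close>

definition bergman :: "(complex ^ 'n) set \<Rightarrow> real \<Rightarrow> (complex ^ 'n \<Rightarrow> complex) set" where
  "bergman R p = {f \<in> Lp R p. holomorphic_Cn f R \<and> (\<forall>z. z \<notin> R \<longrightarrow> f z = 0)}"

text \<open>
  If \<open>\<alpha> $ j < 0\<close> and \<open>R\<close> meets \<open>{z. z $ j = 0}\<close>, then \<open>z\<^sup>\<alpha>\<close> is not defined on all of \<open>R\<close>.  The function
  below has the value 0 at the points in question; it is unbounded near some of them, hence it is not
  holomorphic on \<open>R\<close> and does not belong to any Bergman space.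
\<close>

definition e_mono :: "(complex ^ 'n) set \<Rightarrow> int ^ 'n \<Rightarrow> complex ^ 'n \<Rightarrow> complex" where
  "e_mono R \<alpha> z = (if z \<in> R then \<Prod>j\<in>UNIV. (z $ j) powi (\<alpha> $ j) else 0)"

definition mono_exps :: "(complex ^ 'n) set \<Rightarrow> real \<Rightarrow> (int ^ 'n) set" where
  "mono_exps R p = {\<alpha>. e_mono R \<alpha> \<in> bergman R p}"

text \<open>
  The coefficient family of the unique Laurent expansion.  Convergence is unconditional: it is
  along the net of the finite sets of exponents, uniformly on each compact subset of \<open>R\<close>.
\<close>

definition laurent_coeff ::
  "(complex ^ 'n) set \<Rightarrow> (complex ^ 'n \<Rightarrow> complex) \<Rightarrow> int ^ 'n \<Rightarrow> complex" where
  "laurent_coeff R f = (THE a.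
     (\<forall>\<alpha>. a \<alpha> \<noteq> 0 \<longrightarrow> holomorphic_Cn (e_mono R \<alpha>) R) \<and>
     (\<forall>K. compact K \<and> K \<subseteq> R \<longrightarrow>
        uniform_limit K (\<lambda>A z. \<Sum>\<alpha>\<in>A. a \<alpha> * e_mono R \<alpha> z) f (finite_subsets_at_top UNIV)))"

definition coeff_functional ::
  "(complex ^ 'n) set \<Rightarrow> real \<Rightarrow> int ^ 'n \<Rightarrow> (complex ^ 'n \<Rightarrow> complex) \<Rightarrow> complex" where
  "coeff_functional R p \<alpha> f = (if f \<in> bergman R p then laurent_coeff R f \<alpha> else 0)"

abbreviation bergman_dual ::
  "(complex ^ 'n) set \<Rightarrow> real \<Rightarrow> ((complex ^ 'n \<Rightarrow> complex) \<Rightarrow> complex) set" where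
  "bergman_dual R p \<equiv> dual_space (bergman R p) (Lp_norm R p)"

abbreviation bergman_dual_norm ::
  "(complex ^ 'n) set \<Rightarrow> real \<Rightarrow> ((complex ^ 'n \<Rightarrow> complex) \<Rightarrow> complex) \<Rightarrow> real" where
  "bergman_dual_norm R p \<equiv> dual_norm (bergman R p) (Lp_norm R p)"

definition G_space :: "(complex ^ 'n) set \<Rightarrow> real \<Rightarrow> real \<Rightarrow> (complex ^ 'n \<Rightarrow> complex) set" where
  "G_space R q p = closed_span (bergman R q) (Lp_norm R q) (e_mono R ` mono_exps R p)"

definition N_space :: "(complex ^ 'n) set \<Rightarrow> real \<Rightarrow> real \<Rightarrow> (complex ^ 'n \<Rightarrow> complex) set" where
  "N_space R q p =
     closed_span (bergman R q) (Lp_norm R q) (e_mono R ` (mono_exps R q - mono_exps R p))"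

text \<open>
  \<open>Phi R p g\<close> is a functional on \<open>bergman R p\<close>; it is conjugate-linear in \<open>g\<close>.
\<close>

definition Phi ::
  "(complex ^ 'n) set \<Rightarrow> real \<Rightarrow> (complex ^ 'n \<Rightarrow> complex) \<Rightarrow> (complex ^ 'n \<Rightarrow> complex) \<Rightarrow> complex" where
  "Phi R p g f = (if f \<in> bergman R p then LINT z|dV R. f z * cnj (g z) else 0)"


section \<open>The sub-Bergman kernel\<close>

definition sub_bergman_kernel ::
  "(complex ^ 'n) set \<Rightarrow> real \<Rightarrow> complex ^ 'n \<Rightarrow> complex ^ 'n \<Rightarrow> complex" where
  "sub_bergman_kernel R p z w =
     (\<Sum>\<^sub>\<infinity>\<alpha>\<in>mono_exps R p. e_mono R \<alpha> z * cnj (e_mono R \<alpha> w) / of_real ((Lp_norm R 2 (e_mono R \<alpha>))\<^sup>2))"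

definition abs_sub_bergman ::
  "(complex ^ 'n) set \<Rightarrow> real \<Rightarrow> (complex ^ 'n \<Rightarrow> complex) \<Rightarrow> complex ^ 'n \<Rightarrow> complex" where
  "abs_sub_bergman R p f z = (LINT w|dV R. of_real (cmod (sub_bergman_kernel R p z w)) * f w)"

text \<open>
  The Bochner integral of a non-integrable function is 0, so boundedness has to include that the
  integral defining the operator exists for almost every \<open>z\<close>.
\<close>

definition abs_sub_bergman_bounded :: "(complex ^ 'n) set \<Rightarrow> real \<Rightarrow> bool" where
  "abs_sub_bergman_bounded R p \<longleftrightarrow>
     (\<exists>C. \<forall>f\<in>Lp R p.
        (AE z in dV R. integrable (dV R) (\<lambda>w. of_real (cmod (sub_bergman_kernel R p z w)) * f w)) \<and>
        abs_sub_bergman R p f \<in> Lp R p \<and>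
        Lp_norm R p (abs_sub_bergman R p f) \<le> C * Lp_norm R p f)"

end

theory Submission
  imports Defs "HOL-Complex_Analysis.Cauchy_Integral_Formula"
begin

text \<open>
  Averaging over the torus against a character extracts the Laurent components of a function, and
  averaging against positive trigonometric polynomials that concentrate at 1 shows that monomials are
  dense in the Bergman spaces.  By the Riesz representation of functionals by continuous functions
  of the conjugate Lebesgue space, the coefficient functionals are dense in the duals.

  The hypothesis enters through one fact: for \<open>h\<close> in \<open>L\<^sup>p\<close>, the series \<open>b = \<Sum>\<^sub>\<alpha> \<langle>h, e\<^sub>\<alpha>\<rangle> e\<^sub>\<alpha> / \<parallel>e\<^sub>\<alpha>\<parallel>\<^sup>2\<close>
  over the exponents of \<open>A\<^sup>p\<close> is dominated by the absolute sub-Bergman operator applied to \<open>\<bar>h\<bar>\<close>.  Hence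
  \<open>b\<close> lies in \<open>A\<^sup>p\<close> with \<open>\<parallel>b\<parallel> \<le> C \<parallel>h\<parallel>\<close>, and it induces the same functional on \<open>A\<^sup>p\<close> as \<open>h\<close>.  Applied to
  the \<open>L\<^sup>p\<close> function that norms \<open>g\<close>, this gives \<open>\<parallel>g\<parallel>\<^sub>q \<le> C \<parallel>\<Phi>\<^sub>p g\<parallel>\<close> for \<open>g\<close> in \<open>A\<^sup>p\<close> and then, by
  density, for \<open>g\<close> in \<open>G\<^sup>q\<^sup>,\<^sup>p\<close>.  So \<open>\<Phi>\<^sub>p\<close> has closed range on \<open>G\<^sup>q\<^sup>,\<^sup>p\<close>, and the range is
  dense.  Applied to a function \<open>h\<close> that represents a functional on \<open>A\<^sup>q\<close>, it gives the first component
  of the direct sum; the rest annihilates the monomials of \<open>A\<^sup>p\<close>.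
\<close>

section \<open>Normed spaces of functions\<close>

text \<open>A functional is represented by an extremal problem: the element of least norm with value
  1, which exists by uniform convexity and completeness. In a Bergman space this minimiser is
  holomorphic, so the representing function is continuous. Continuity matters, because peak averages
  are known to converge only pointwise on torus orbits of continuous functions; a Scheffe argument
  then upgrades this to the norm. The condition \<open>2 <= p\<close> places the exponents of
  \<open>A^p\<close> among those of \<open>A^2\<close> and of \<open>A^q\<close>. So
  \<open>e_\<alpha>\<close> has a finite nonzero \<open>L^2\<close> norm where the kernel divides by
  it, and functions in \<open>L^p\<close> have coefficients by Cauchy-Schwarz. An exponent of
  \<open>A^q\<close> outside \<open>A^p\<close> is invisible to \<open>A^p\<close>, since no
  function there has a nonzero coefficient at it: this produces both \<open>N\<close> and the second
  summand in (iii). Boundedness is assumed for a positive kernel. This gives a pointwise majorant of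
  the series for each \<open>h\<close>, so the projection is defined on all of \<open>L^p\<close> by
  its series and needs no extension by continuity.\<close>

locale normed_function_space =
  fixes V :: "('x \<Rightarrow> complex) set" and N :: "('x \<Rightarrow> complex) \<Rightarrow> real"
  assumes cfun_subspace: "cfun.subspace V" and norm_on: "norm_on V N"
begin

lemma norm_nonneg: "u \<in> V \<Longrightarrow> 0 \<le> N u"
  and norm_eq_0: "u \<in> V \<Longrightarrow> N u = 0 \<longleftrightarrow> u = 0"
  and norm_fscale: "u \<in> V \<Longrightarrow> N (fscale c u) = cmod c * N u"
  and norm_add: "u \<in> V \<Longrightarrow> v \<in> V \<Longrightarrow> N (u + v) \<le> N u + N v"
  using norm_on by (auto simp: norm_on_def)

lemmas mem_zero = cfun.subspace_0[OF cfun_subspace]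
  and mem_add = cfun.subspace_add[OF cfun_subspace]
  and mem_diff = cfun.subspace_diff[OF cfun_subspace]
  and mem_fscale = cfun.subspace_scale[OF cfun_subspace]

lemma norm_of_zero: "N 0 = 0"
  using norm_eq_0[OF mem_zero] by simp

lemma norm_diff_commute:
  assumes "u \<in> V" "v \<in> V"
  shows "N (u - v) = N (v - u)"
proof -
  have "v - u = fscale (-1) (u - v)"
    by (auto simp: fscale_def fun_eq_iff)
  thus ?thesis using norm_fscale[of "u - v" "-1"] mem_diff assms by simp
qed

lemma norm_triangle: 
  assumes "u \<in> V" "v \<in> V" "w \<in> V"
  shows "N (u - w) \<le> N (u - v) + N (v - w)"
  using norm_add[of "u - v" "v - w"] mem_diff assms by simp

lemma norm_diff: 
  assumes "u \<in> V" "v \<in> V" shows "N (u - v) \<le> N u + N v"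
  using norm_triangle[of u 0 v] norm_diff_commute[of 0 v] assms mem_zero by simp

sublocale Metric_space V "norm_dist V N"
proof
  fix x y z
  show "0 \<le> norm_dist V N x y"
    by (auto simp: norm_dist_def norm_nonneg mem_diff)
  show "norm_dist V N x y = norm_dist V N y x"
    by (auto simp: norm_dist_def norm_diff_commute)
  show "x \<in> V \<Longrightarrow> y \<in> V \<Longrightarrow> norm_dist V N x y = 0 \<longleftrightarrow> x = y"
    by (auto simp: norm_dist_def norm_eq_0 mem_diff norm_of_zero)
  show "norm_dist V N x z \<le> norm_dist V N x y + norm_dist V N y z" if "x \<in> V" "y \<in> V" "z \<in> V"
    using that by (auto simp: norm_dist_def norm_triangle)
qed

lemma topspace_norm_topology [simp]: "topspace (norm_topology V N) = V"
  by (simp add: norm_topology_def)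

section \<open>Closures and closed linear spans\<close>

lemma closure_of_iff:
  assumes "S \<subseteq> V"
  shows "x \<in> norm_topology V N closure_of S \<longleftrightarrow> x \<in> V \<and> (\<forall>e>0. \<exists>s\<in>S. N (x - s) < e)"
  using assms unfolding norm_topology_def metric_closure_of by (fastforce simp: norm_dist_def)

lemma span_subset: "E \<subseteq> V \<Longrightarrow> cfun.span E \<subseteq> V"
  by (rule cfun.span_minimal[OF _ cfun_subspace])

lemma closed_span_iff:
  assumes "E \<subseteq> V"
  shows "x \<in> closed_span V N E \<longleftrightarrow> x \<in> V \<and> (\<forall>e>0. \<exists>s\<in>cfun.span E. N (x - s) < e)"
  unfolding closed_span_def using closure_of_iff span_subset assms by blast

lemma span_subset_closed_span: "E \<subseteq> V \<Longrightarrow> cfun.span E \<subseteq> closed_span V N E"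
proof
  fix x assume E: "E \<subseteq> V" and x: "x \<in> cfun.span E"
  hence "N (x - x) = 0" by (simp add: norm_of_zero)
  thus "x \<in> closed_span V N E" using span_subset[OF E] x by (force simp: closed_span_iff[OF E])
qed

lemma closed_span_closed:
  assumes "E \<subseteq> V" "x \<in> V" "\<And>e. e > 0 \<Longrightarrow> \<exists>s\<in>closed_span V N E. N (x - s) < e"
  shows "x \<in> closed_span V N E"
proof -
  have "\<exists>s\<in>cfun.span E. N (x - s) < e" if e: "e > 0" for e
  proof -
    obtain y where y: "y \<in> closed_span V N E" "N (x - y) < e/2"
      using assms(3)[OF half_gt_zero[OF e]] by blast
    then obtain s where s: "s \<in> cfun.span E" "N (y - s) < e/2"
      using half_gt_zero[OF e] unfolding closed_span_iff[OF assms(1)] by blast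
    have "N (x - s) \<le> N (x - y) + N (y - s)"
      using norm_triangle assms y s span_subset[OF assms(1)]
      by (meson closed_span_iff subsetD)
    thus ?thesis using y s by force
  qed
  thus ?thesis using assms by (auto simp: closed_span_iff)
qed

lemma subspace_closed_span:
  assumes "E \<subseteq> V" shows "cfun.subspace (closed_span V N E)"
proof (rule cfun.subspaceI)
  note iff = closed_span_iff[OF assms] and sp = subsetD[OF span_subset[OF assms]]
  show "0 \<in> closed_span V N E"
    using span_subset_closed_span[OF assms] cfun.span_zero by blast
  fix x y c assume x: "x \<in> closed_span V N E" 
  show "x + y \<in> closed_span V N E" if y: "y \<in> closed_span V N E"
    unfolding iff
  proof (intro conjI allI impI)
    show "x + y \<in> V" using x y mem_add by (auto simp: iff)
    fix e :: real assume e: "e > 0"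
    then obtain s t where s: "s \<in> cfun.span E" "N (x - s) < e/2" and t: "t \<in> cfun.span E" "N (y - t) < e/2"
      using x y half_gt_zero[OF e] unfolding iff by blast
    have "x + y - (s + t) = (x - s) + (y - t)" by simp
    moreover have "N ((x - s) + (y - t)) \<le> N (x - s) + N (y - t)"
      using norm_add[OF mem_diff mem_diff, of x s y t] x y s t sp by (auto simp: iff)
    ultimately have "N (x + y - (s + t)) \<le> N (x - s) + N (y - t)" by metis
    thus "\<exists>s\<in>cfun.span E. N (x + y - s) < e"
      using s t cfun.span_add[OF s(1) t(1)] by force
  qed
  show "fscale c x \<in> closed_span V N E"
    unfolding iff
  proof (intro conjI allI impI)
    show "fscale c x \<in> V" using x mem_fscale by (auto simp: iff)
    fix e :: real assume e: "e > 0"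
    then obtain s where s: "s \<in> cfun.span E" "N (x - s) < e / (cmod c + 1)"
      using x unfolding iff by (metis add_nonneg_pos divide_pos_pos norm_ge_zero zero_less_one)
    have "N (fscale c x - fscale c s) = cmod c * N (x - s)"
      using norm_fscale[of "x - s" c] x s sp by (simp add: iff mem_diff cfun.scale_right_diff_distrib)
    also have "\<dots> \<le> (cmod c + 1) * N (x - s)"
      using norm_nonneg[of "x - s"] x s sp by (intro mult_right_mono) (auto simp: iff mem_diff)
    also have "\<dots> < e" using s(2) by (simp add: pos_less_divide_eq add_nonneg_pos mult.commute)
    finally show "\<exists>s\<in>cfun.span E. N (fscale c x - s) < e"
      using s cfun.span_scale by blast
  qed
qed

lemma normed_closed_span: "E \<subseteq> V \<Longrightarrow> normed_function_space (closed_span V N E) N"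
  using subspace_closed_span[of E] norm_on closed_span_iff[of E]
  by unfold_locales (auto simp: norm_on_def)

section \<open>Completeness in terms of sequences and the norm\<close>

lemma mcompleteI:
  assumes "\<And>s. (\<And>n. s n \<in> V) \<Longrightarrow> (\<And>e. e > 0 \<Longrightarrow> \<exists>M. \<forall>m\<ge>M. \<forall>n\<ge>M. N (s m - s n) < e)
    \<Longrightarrow> \<exists>x\<in>V. (\<lambda>n. N (s n - x)) \<longlonglongrightarrow> 0"
  shows mcomplete
  unfolding mcomplete_def
proof (intro allI impI)
  fix s :: "nat \<Rightarrow> _" assume s: "MCauchy s"
  hence sV: "s n \<in> V" for n by (auto simp: MCauchy_def)
  have "\<exists>M. \<forall>m\<ge>M. \<forall>n\<ge>M. N (s m - s n) < e" if "e > 0" for e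
    using s that sV unfolding MCauchy_def norm_dist_def by simp
  then obtain x where x: "x \<in> V" "(\<lambda>n. N (s n - x)) \<longlonglongrightarrow> 0" using assms sV by blast
  have "limitin mtopology s x sequentially"
    unfolding limit_metric_sequentially
  proof (intro conjI x allI impI)
    fix e :: real assume "e > 0"
    then obtain M where "\<forall>n\<ge>M. norm (N (s n - x) - 0) < e"
      using LIMSEQ_D[OF x(2)] by blast
    thus "\<exists>M. \<forall>n\<ge>M. s n \<in> V \<and> norm_dist V N (s n) x < e"
      using sV x(1) by (intro exI[of _ M]) (auto simp: norm_dist_def abs_less_iff)
  qed
  thus "\<exists>x. limitin mtopology s x sequentially" by blast
qed

lemma mcompleteD:
  assumes mcomplete "\<And>n. s n \<in> V" "\<And>e. e > 0 \<Longrightarrow> \<exists>M. \<forall>m\<ge>M. \<forall>n\<ge>M. N (s m - s n) < e"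
  obtains x where "x \<in> V" "(\<lambda>n. N (s n - x)) \<longlonglongrightarrow> 0"
proof -
  have "MCauchy s"
    unfolding MCauchy_def norm_dist_def using assms(2,3) by (simp add: image_subset_iff)
  then obtain x where x: "limitin mtopology s x sequentially"
    using assms(1) by (auto simp: mcomplete_def)
  have "(\<lambda>n. N (s n - x)) \<longlonglongrightarrow> 0"
  proof (rule LIMSEQ_I)
    fix e :: real assume "e > 0"
    then obtain M where M: "\<And>n. n \<ge> M \<Longrightarrow> s n \<in> V \<and> norm_dist V N (s n) x < e"
      using x unfolding limit_metric_sequentially by blast
    hence "norm (N (s n - x) - 0) < e" if "n \<ge> M" for n
      using M[OF that] x norm_nonneg[of "s n - x"] by (auto simp: norm_dist_def limit_metric_sequentially mem_diff)
    thus "\<exists>M. \<forall>n\<ge>M. norm (N (s n - x) - 0) < e" by blast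
  qed
  thus ?thesis using that x by (auto simp: limit_metric_sequentially)
qed

lemma banach_closed_span:
  assumes mcomplete "E \<subseteq> V"
  shows "banach_on (closed_span V N E) N"
proof -
  interpret W: normed_function_space "closed_span V N E" N by (rule normed_closed_span[OF assms(2)])
  have sub: "closed_span V N E \<subseteq> V" using closed_span_iff[OF assms(2)] by blast
  have "W.mcomplete"
  proof (rule W.mcompleteI)
    fix s assume s: "\<And>n::nat. s n \<in> closed_span V N E"
      and "\<And>e. e > 0 \<Longrightarrow> \<exists>M. \<forall>m\<ge>M. \<forall>n\<ge>M. N (s m - s n) < e"
    then obtain x where x: "x \<in> V" "(\<lambda>n. N (s n - x)) \<longlonglongrightarrow> 0"
      using mcompleteD[OF assms(1)] sub by (metis subsetD)
    have "x \<in> closed_span V N E"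
    proof (rule closed_span_closed[OF assms(2) x(1)])
      fix e :: real assume "e > 0"
      then obtain n where "norm (N (s n - x) - 0) < e" using LIMSEQ_D[OF x(2)] by blast
      thus "\<exists>s\<in>closed_span V N E. N (x - s) < e"
        using s[of n] norm_diff_commute[of "s n" x] x sub by (intro bexI[of _ "s n"]) auto
    qed
    thus "\<exists>x\<in>closed_span V N E. (\<lambda>n. N (s n - x)) \<longlonglongrightarrow> 0" using x by blast
  qed
  thus ?thesis using W.cfun_subspace W.norm_on by (simp add: banach_on_def)
qed

section \<open>Lipschitz maps, homeomorphisms and direct sums\<close>

lemma continuous_map_norm_topology:
  assumes "\<And>x. x \<in> topspace X \<Longrightarrow> f x \<in> V"
    "\<And>x e. x \<in> topspace X \<Longrightarrow> e > 0 \<Longrightarrow> \<exists>U. openin X U \<and> x \<in> U \<and> (\<forall>y\<in>U. N (f x - f y) < e)"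
  shows "continuous_map X (norm_topology V N) f"
  unfolding norm_topology_def continuous_map_to_metric
proof (intro ballI allI impI)
  fix x and e :: real assume x: "x \<in> topspace X" and e: "e > 0"
  then obtain U where U: "openin X U" "x \<in> U" "\<forall>y\<in>U. N (f x - f y) < e" using assms(2) by blast
  moreover have "y \<in> topspace X" if "y \<in> U" for y using U(1) that openin_subset by blast
  ultimately show "\<exists>U. openin X U \<and> x \<in> U \<and> (\<forall>y\<in>U. f y \<in> mball (f x) e)"
    using assms(1) x by (intro exI[of _ U]) (auto simp: norm_dist_def)
qed

lemma openin_norm_ball: "u \<in> V \<Longrightarrow> openin (norm_topology V N) {v \<in> V. N (u - v) < e}"
proof -
  assume u: "u \<in> V"
  hence "{v \<in> V. N (u - v) < e} = mball u e" by (auto simp: norm_dist_def)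
  thus ?thesis by (simp add: norm_topology_def)
qed

lemma lipschitz_continuous_map:
  assumes "normed_function_space W M" "\<And>u. u \<in> V \<Longrightarrow> T u \<in> W"
    and T: "\<And>u v. u \<in> V \<Longrightarrow> v \<in> V \<Longrightarrow> M (T u - T v) \<le> C * N (u - v)"
  shows "continuous_map (norm_topology V N) (norm_topology W M) T"
proof -
  interpret W: normed_function_space W M by fact
  show ?thesis
  proof (rule W.continuous_map_norm_topology)
    show "x \<in> topspace (norm_topology V N) \<Longrightarrow> T x \<in> W" for x using assms by simp
    fix x and e :: real assume x: "x \<in> topspace (norm_topology V N)" and e: "e > 0"
    \<comment> \<open>\<open>C\<close> may be zero or negative; dividing by
      \<open>\<bar>C\<bar> + 1\<close> keeps the radius positive.\<close>
    define U where "U = {v \<in> V. N (x - v) < e / (\<bar>C\<bar> + 1)}"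
    have "M (T x - T y) < e" if "y \<in> U" for y
    proof -
      have "M (T x - T y) \<le> C * N (x - y)" using T x that by (auto simp: U_def)
      also have "\<dots> \<le> (\<bar>C\<bar> + 1) * N (x - y)"
        using norm_nonneg[of "x - y"] x that by (intro mult_right_mono) (auto simp: U_def mem_diff)
      also have "\<dots> < e" using that by (auto simp: U_def pos_less_divide_eq mult.commute)
      finally show ?thesis .
    qed
    moreover have "x \<in> U" using x e by (simp add: U_def norm_of_zero)
    moreover have "openin (norm_topology V N) U" using openin_norm_ball x by (simp add: U_def)
    ultimately show "\<exists>U. openin (norm_topology V N) U \<and> x \<in> U \<and> (\<forall>y\<in>U. M (T x - T y) < e)" by blast
  qed
qed

text \<open>The lower estimate makes the inverse Lipschitz with constant \<open>D\<close>. Only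
  differences of images occur, so linearity of \<open>T\<close> does not enter.\<close>

lemma bilipschitz_homeomorphic_map:
  assumes W: "normed_function_space W M" and bij: "bij_betw T V W"
    and T: "\<And>u v. u \<in> V \<Longrightarrow> v \<in> V \<Longrightarrow> M (T u - T v) \<le> C * N (u - v)"
    and T': "\<And>u v. u \<in> V \<Longrightarrow> v \<in> V \<Longrightarrow> N (u - v) \<le> D * M (T u - T v)"
  shows "homeomorphic_map (norm_topology V N) (norm_topology W M) T"
proof -
  interpret W: normed_function_space W M by fact
  define S where "S = the_inv_into V T"
  have S: "S w \<in> V" "T (S w) = w" if "w \<in> W" for w
    using bij that unfolding S_def bij_betw_def by (auto simp: the_inv_into_f_f)
  have "homeomorphic_maps (norm_topology V N) (norm_topology W M) T S"
    unfolding homeomorphic_maps_def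
  proof (intro conjI ballI)
    show "continuous_map (norm_topology V N) (norm_topology W M) T"
      using lipschitz_continuous_map[OF W, of T C] T bij by (auto simp: bij_betw_def)
    show "continuous_map (norm_topology W M) (norm_topology V N) S"
    proof (rule W.lipschitz_continuous_map[OF normed_function_space_axioms S(1)])
      fix u v assume "u \<in> W" "v \<in> W"
      thus "N (S u - S v) \<le> D * M (u - v)" using T'[of "S u" "S v"] S by simp
    qed
  qed (use S bij in \<open>auto simp: S_def bij_betw_def the_inv_into_f_f\<close>)
  thus ?thesis using homeomorphic_map_maps by blast
qed

text \<open>
  Since \<open>A\<close> and \<open>B\<close> meet only in 0, the bound on \<open>N a\<close> says that the projection onto \<open>A\<close> along \<open>B\<close> is
  continuous.
\<close>

lemma topological_direct_sumI:
  assumes A: "cfun.subspace A" "A \<subseteq> V" and B: "cfun.subspace B" "B \<subseteq> V" and 0: "A \<inter> B \<subseteq> {0}"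
    and dec: "\<And>v. v \<in> V \<Longrightarrow> \<exists>a\<in>A. \<exists>b\<in>B. v = a + b \<and> N a \<le> C * N v"
  shows "topological_direct_sum V N A B"
proof -
  obtain f g where fg: "\<And>v. v \<in> V \<Longrightarrow> f v \<in> A \<and> g v \<in> B \<and> v = f v + g v \<and> N (f v) \<le> C * N v"
    using dec by metis
  have uniq: "a = a' \<and> b = b'" if "a \<in> A" "a' \<in> A" "b \<in> B" "b' \<in> B" "a + b = a' + b'" for a a' b b'
  proof -
    have "a - a' = b' - b" using that(5) by (simp add: algebra_simps)
    hence "a - a' \<in> A \<inter> B"
      using cfun.subspace_diff[OF A(1) that(1,2)] cfun.subspace_diff[OF B(1) that(4,3)] by simp
    hence "a = a'" using 0 by auto
    thus ?thesis using that by simp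
  qed
  have fsum: "f (a + b) = a" "g (a + b) = b" if "a \<in> A" "b \<in> B" for a b
    using uniq[of "f (a + b)" a "g (a + b)" b] fg[of "a + b"] that A B mem_add by (auto simp: subset_iff)
  \<comment> \<open>The components are picked by choice; uniqueness of the decomposition makes them
    additive, so a bound on their norms is a Lipschitz estimate.\<close>
  have fdiff: "f u - f v = f (u - v)" "g u - g v = g (u - v)" if "u \<in> V" "v \<in> V" for u v
  proof -
    have "u - v = (f u + g u) - (f v + g v)" using fg[OF that(1)] fg[OF that(2)] by simp
    hence "u - v = (f u - f v) + (g u - g v)" by simp
    thus "f u - f v = f (u - v)" "g u - g v = g (u - v)"
      using fsum[of "f u - f v" "g u - g v"] cfun.subspace_diff[OF A(1)] cfun.subspace_diff[OF B(1)] fg that by auto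
  qed
  \<comment> \<open>The second projection is the identity minus the first, hence the extra 1 in the
    constant.\<close>
  have Ng: "N (g v) \<le> (1 + C) * N v" if "v \<in> V" for v
  proof -
    have "g v = v - f v" using fg[OF that] by (metis add_diff_cancel_left')
    moreover have "N (v - f v) \<le> N v + C * N v"
      using norm_diff[of v "f v"] fg[OF that] that A(2) by fastforce
    ultimately show ?thesis by (metis distrib_right mult_1)
  qed
  let ?P = "prod_topology (subtopology (norm_topology V N) A) (subtopology (norm_topology V N) B)"
  have "homeomorphic_maps ?P (norm_topology V N) (\<lambda>(u, w). u + w) (\<lambda>v. (f v, g v))"
    unfolding homeomorphic_maps_def
  proof (intro conjI ballI)
    show "continuous_map ?P (norm_topology V N) (\<lambda>(u, w). u + w)"
    proof (rule continuous_map_norm_topology)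
      fix x assume "x \<in> topspace ?P"
      then obtain a b where x: "x = (a, b)" "a \<in> V" "b \<in> V" "a \<in> A" "b \<in> B" by auto
      thus "(case x of (u, w) \<Rightarrow> u + w) \<in> V" using mem_add by simp
      fix e :: real assume e: "e > 0"
      define U where "U = (A \<inter> {v \<in> V. N (a - v) < e/2}) \<times> (B \<inter> {v \<in> V. N (b - v) < e/2})"
      have "openin ?P U"
        unfolding U_def openin_prod_Times_iff
        by (intro disjI2 conjI openin_subtopology_Int2 openin_norm_ball x)
      moreover have "x \<in> U" using x e by (auto simp: U_def norm_of_zero)
      moreover have "N ((case x of (u, w) \<Rightarrow> u + w) - (case y of (u, w) \<Rightarrow> u + w)) < e" if yU: "y \<in> U" for y
      proof -
        obtain c d where y: "y = (c, d)" "c \<in> V" "d \<in> V" "N (a - c) < e/2" "N (b - d) < e/2"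
          using yU by (auto simp: U_def)
        have "(a + b) - (c + d) = (a - c) + (b - d)" by simp
        moreover have "N ((a - c) + (b - d)) \<le> N (a - c) + N (b - d)"
          using norm_add[of "a - c" "b - d"] mem_diff x y by simp
        ultimately have "N ((a + b) - (c + d)) \<le> N (a - c) + N (b - d)" by metis
        thus ?thesis using x y by simp
      qed
      ultimately show "\<exists>U. openin ?P U \<and> x \<in> U \<and>
          (\<forall>y\<in>U. N ((case x of (u, w) \<Rightarrow> u + w) - (case y of (u, w) \<Rightarrow> u + w)) < e)" by blast
    qed
    have "continuous_map (norm_topology V N) (norm_topology V N) f"
      using fg A by (intro lipschitz_continuous_map[where C=C] normed_function_space_axioms)
        (auto simp: fdiff mem_diff)
    moreover have "continuous_map (norm_topology V N) (norm_topology V N) g"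
      using fg B Ng by (intro lipschitz_continuous_map[where C="1+C"] normed_function_space_axioms)
        (auto simp: fdiff mem_diff)
    ultimately show "continuous_map (norm_topology V N) ?P (\<lambda>v. (f v, g v))"
      using fg by (auto intro!: continuous_map_pairedI simp: continuous_map_in_subtopology)
    show "(\<lambda>v. (f v, g v)) (case x of (u, w) \<Rightarrow> u + w) = x" if "x \<in> topspace ?P" for x
      using that fsum by auto
    show "(case (f y, g y) of (u, w) \<Rightarrow> u + w) = y" if "y \<in> topspace (norm_topology V N)" for y
      using that fg by auto
  qed
  thus ?thesis
    unfolding topological_direct_sum_def using A B homeomorphic_map_maps by blast
qed

section \<open>The dual of a normed space of functions\<close>

lemma dual_space_add: "\<phi> \<in> dual_space V N \<Longrightarrow> u \<in> V \<Longrightarrow> v \<in> V \<Longrightarrow> \<phi> (u + v) = \<phi> u + \<phi> v"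
  and dual_space_fscale: "\<phi> \<in> dual_space V N \<Longrightarrow> u \<in> V \<Longrightarrow> \<phi> (fscale c u) = c * \<phi> u"
  and dual_space_outside: "\<phi> \<in> dual_space V N \<Longrightarrow> u \<notin> V \<Longrightarrow> \<phi> u = 0"
  by (auto simp: dual_space_def)

lemma dual_space_zero: "\<phi> \<in> dual_space V N \<Longrightarrow> \<phi> 0 = 0"
  using dual_space_fscale[of \<phi> 0 0] mem_zero by (simp add: fscale_def zero_fun_def)

lemma dual_space_diff: "\<phi> \<in> dual_space V N \<Longrightarrow> u \<in> V \<Longrightarrow> v \<in> V \<Longrightarrow> \<phi> (u - v) = \<phi> u - \<phi> v"
  using dual_space_add[of \<phi> "u - v" v] mem_diff by simp

lemma dual_space_sum:
  assumes "\<phi> \<in> dual_space V N" "finite A" "\<And>a. a \<in> A \<Longrightarrow> f a \<in> V"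
  shows "\<phi> (\<Sum>a\<in>A. f a) = (\<Sum>a\<in>A. \<phi> (f a)) \<and> (\<Sum>a\<in>A. f a) \<in> V"
  using assms(2,3)
  by (induction A) (auto simp: dual_space_zero[OF assms(1)] dual_space_add[OF assms(1)] mem_zero mem_add)

lemma dual_spaceI:
  assumes "\<And>u v. u \<in> V \<Longrightarrow> v \<in> V \<Longrightarrow> \<phi> (u + v) = \<phi> u + \<phi> v" "\<And>c u. u \<in> V \<Longrightarrow> \<phi> (fscale c u) = c * \<phi> u"
    "\<And>u. u \<in> V \<Longrightarrow> cmod (\<phi> u) \<le> C * N u" "\<And>u. u \<notin> V \<Longrightarrow> \<phi> u = 0"
  shows "\<phi> \<in> dual_space V N"
  using assms unfolding dual_space_def by blast

lemma dual_norm_bound: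
  assumes "\<phi> \<in> dual_space V N" "u \<in> V"
  shows "cmod (\<phi> u) \<le> dual_norm V N \<phi> * N u"
proof (cases "N u = 0")
  case True
  thus ?thesis using norm_eq_0[OF assms(2)] dual_space_zero[OF assms(1)] norm_of_zero by simp
next
  case False
  hence pos: "N u > 0" using norm_nonneg assms(2) by (simp add: less_le)
  obtain C where C: "\<And>u. u \<in> V \<Longrightarrow> cmod (\<phi> u) \<le> C * N u"
    using assms(1) unfolding dual_space_def by blast
  \<comment> \<open>\<open>dual_space\<close> provides some real \<open>C\<close>, possibly negative
    when \<open>V\<close> is trivial; on the unit ball \<open>\<bar>C\<bar>\<close> is a bound in
    any case.\<close>
  have bdd: "bdd_above ((\<lambda>u. cmod (\<phi> u)) ` {u \<in> V. N u \<le> 1})"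
  proof (rule bdd_aboveI2)
    fix v assume v: "v \<in> {u \<in> V. N u \<le> 1}"
    have "C * N v \<le> \<bar>C\<bar> * 1"
      using v norm_nonneg[of v] by (intro mult_mono) auto
    thus "cmod (\<phi> v) \<le> \<bar>C\<bar>" using C[of v] v by auto
  qed
  define v where "v = fscale (of_real (1 / N u)) u"
  have v: "v \<in> V" "N v = 1"
    using assms(2) pos mem_fscale norm_fscale[OF assms(2), of "of_real (1 / N u)"]
    by (auto simp: v_def norm_divide)
  have "cmod (\<phi> v) \<le> dual_norm V N \<phi>"
    unfolding dual_norm_def using v by (intro cSUP_upper[OF _ bdd]) auto
  also have "cmod (\<phi> v) = cmod (\<phi> u) / N u"
    using dual_space_fscale[OF assms] pos by (simp add: v_def norm_mult norm_divide)
  finally show ?thesis using pos by (simp add: field_simps)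
qed

lemma dual_norm_le:
  assumes "0 \<le> C" "\<And>u. u \<in> V \<Longrightarrow> cmod (\<phi> u) \<le> C * N u"
  shows "dual_norm V N \<phi> \<le> C"
  unfolding dual_norm_def
proof (rule cSUP_least)
  show "{u \<in> V. N u \<le> 1} \<noteq> {}" using mem_zero norm_of_zero by force
  fix u assume u: "u \<in> {u \<in> V. N u \<le> 1}"
  thus "cmod (\<phi> u) \<le> C"
    using assms(2)[of u] mult_left_mono[OF _ assms(1), of "N u" 1] by force
qed

text \<open>A negative dual norm would force every value of \<open>\<phi>\<close> to be 0, and then
  the supremum is one of zeros over a nonempty set.\<close>

lemma dual_norm_nonneg: "\<phi> \<in> dual_space V N \<Longrightarrow> 0 \<le> dual_norm V N \<phi>"
proof -
  assume phi: "\<phi> \<in> dual_space V N"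
  show ?thesis
  proof (rule ccontr)
    assume neg: "\<not> ?thesis"
    hence "cmod (\<phi> u) \<le> 0" if "u \<in> V" for u
      using dual_norm_bound[OF phi that] norm_nonneg[OF that] mult_nonpos_nonneg[of "dual_norm V N \<phi>" "N u"] by linarith
    hence "\<phi> u = 0" for u using dual_space_outside[OF phi, of u] by (cases "u \<in> V") auto
    hence "dual_norm V N \<phi> = (SUP u\<in>{u \<in> V. N u \<le> 1}. 0)"
      unfolding dual_norm_def by simp
    moreover have "{u \<in> V. N u \<le> 1} \<noteq> {}" using mem_zero norm_of_zero by force
    ultimately show False using neg by simp
  qed
qed

lemma dual_norm_eq_0: "\<phi> \<in> dual_space V N \<Longrightarrow> dual_norm V N \<phi> = 0 \<longleftrightarrow> \<phi> = 0"
proof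
  assume phi: "\<phi> \<in> dual_space V N" and "dual_norm V N \<phi> = 0"
  hence "\<phi> u = 0" for u using dual_norm_bound[OF phi, of u] dual_space_outside[OF phi, of u]
    by (cases "u \<in> V") auto
  thus "\<phi> = 0" by (auto simp: fun_eq_iff)
next
  assume phi: "\<phi> \<in> dual_space V N" and "\<phi> = 0"
  thus "dual_norm V N \<phi> = 0" using dual_norm_le[of 0 \<phi>] dual_norm_nonneg[OF phi] by simp
qed

lemma normed_dual_space: "normed_function_space (dual_space V N) (dual_norm V N)"
proof
  show sub: "cfun.subspace (dual_space V N)"
  proof (rule cfun.subspaceI)
    show "0 \<in> dual_space V N" using norm_nonneg by (auto simp: dual_space_def intro!: exI[of _ 0])
    fix \<phi> \<psi> c assume p: "\<phi> \<in> dual_space V N"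
    show "\<phi> + \<psi> \<in> dual_space V N" if q: "\<psi> \<in> dual_space V N"
    proof (rule dual_spaceI[where C="dual_norm V N \<phi> + dual_norm V N \<psi>"])
      fix u assume u: "u \<in> V"
      show "cmod ((\<phi> + \<psi>) u) \<le> (dual_norm V N \<phi> + dual_norm V N \<psi>) * N u"
        using norm_triangle_ineq[of "\<phi> u" "\<psi> u"] dual_norm_bound[OF p u] dual_norm_bound[OF q u]
        by (simp add: algebra_simps)
    qed (use p q in \<open>auto simp: dual_space_add dual_space_fscale dual_space_outside algebra_simps\<close>)
    show "fscale c \<phi> \<in> dual_space V N"
    proof (rule dual_spaceI[where C="cmod c * dual_norm V N \<phi>"])
      fix u assume u: "u \<in> V"
      show "cmod (fscale c \<phi> u) \<le> (cmod c * dual_norm V N \<phi>) * N u"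
        using mult_left_mono[OF dual_norm_bound[OF p u], of "cmod c"]
        by (simp add: fscale_def norm_mult mult.assoc)
    next
      show "fscale c \<phi> (fscale d u) = d * fscale c \<phi> u" if "u \<in> V" for d u
        using dual_space_fscale[OF p that, of d] unfolding fscale_def[of c] by simp
      show "fscale c \<phi> (u + v) = fscale c \<phi> u + fscale c \<phi> v" if "u \<in> V" "v \<in> V" for u v
        using dual_space_add[OF p that] unfolding fscale_def by (simp add: distrib_left)
      show "fscale c \<phi> u = 0" if "u \<notin> V" for u
        using dual_space_outside[OF p that] by (simp add: fscale_def)
    qed
  qed
  show "norm_on (dual_space V N) (dual_norm V N)"
    unfolding norm_on_def
  proof (intro conjI ballI allI)
    fix \<phi> \<psi> c assume p: "\<phi> \<in> dual_space V N"
    show "0 \<le> dual_norm V N \<phi>" "dual_norm V N \<phi> = 0 \<longleftrightarrow> \<phi> = 0" 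
      using p dual_norm_nonneg dual_norm_eq_0 by auto
    show "dual_norm V N (fscale c \<phi>) = cmod c * dual_norm V N \<phi>"
    proof (cases "c = 0")
      case True
      have "fscale c \<phi> = 0" using True by (auto simp: fscale_def fun_eq_iff)
      moreover have "dual_norm V N 0 = 0"
        using dual_norm_eq_0[OF cfun.subspace_0[OF sub]] by blast
      ultimately show ?thesis using True by simp
    next
      case False
      \<comment> \<open>The inequality for all scalars suffices: applied with \<open>1/c\<close> to
        \<open>fscale c \<phi>\<close> it gives the reverse inequality.\<close>
      have le: "dual_norm V N (fscale c \<phi>) \<le> cmod c * dual_norm V N \<phi>" if "\<phi> \<in> dual_space V N" for c \<phi>
      proof (rule dual_norm_le)
        show "0 \<le> cmod c * dual_norm V N \<phi>" using dual_norm_nonneg[OF that] by simp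
        show "cmod (fscale c \<phi> u) \<le> (cmod c * dual_norm V N \<phi>) * N u" if u: "u \<in> V" for u
          using mult_left_mono[OF dual_norm_bound[OF \<open>\<phi> \<in> dual_space V N\<close> u], of "cmod c"]
          by (simp add: fscale_def norm_mult mult.assoc)
      qed
      have "fscale (1/c) (fscale c \<phi>) = \<phi>" using False by (auto simp: fscale_def)
      moreover have "fscale c \<phi> \<in> dual_space V N"
        by (rule cfun.subspace_scale[OF sub p])
      ultimately have "dual_norm V N \<phi> \<le> cmod (1/c) * dual_norm V N (fscale c \<phi>)"
        using le[of "fscale c \<phi>" "1/c"] by simp
      thus ?thesis using le[OF p, of c] False by (simp add: norm_divide field_simps)
    qed
    show "dual_norm V N (\<phi> + \<psi>) \<le> dual_norm V N \<phi> + dual_norm V N \<psi>" if q: "\<psi> \<in> dual_space V N"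
    proof (rule dual_norm_le)
      show "cmod ((\<phi> + \<psi>) u) \<le> (dual_norm V N \<phi> + dual_norm V N \<psi>) * N u" if u: "u \<in> V" for u
        using norm_triangle_ineq[of "\<phi> u" "\<psi> u"] dual_norm_bound[OF p u] dual_norm_bound[OF q u]
        by (simp add: algebra_simps)
    qed (use p q dual_norm_nonneg in auto)
  qed
qed

text \<open>The values of a Cauchy sequence converge, and linearity passes to the limit. Letting
  \<open>m\<close> tend to infinity in the Cauchy estimate bounds \<open>s n - \<phi>\<close> by a
  small multiple of the norm, which gives both the boundedness of \<open>\<phi>\<close> and the
  convergence.\<close>

lemma banach_dual_space: "banach_on (dual_space V N) (dual_norm V N)"
proof -
  interpret D: normed_function_space "dual_space V N" "dual_norm V N" by (rule normed_dual_space)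
  have "D.mcomplete"
  proof (rule D.mcompleteI)
    fix s assume s: "\<And>n::nat. s n \<in> dual_space V N"
      and C: "\<And>e. e > 0 \<Longrightarrow> \<exists>M. \<forall>m\<ge>M. \<forall>n\<ge>M. dual_norm V N (s m - s n) < e"
    have bnd: "cmod (s m u - s n u) \<le> dual_norm V N (s m - s n) * N u" if "u \<in> V" for m n u
      using dual_norm_bound[OF D.mem_diff[OF s s] that, of m n] by simp
    have "Cauchy (\<lambda>n. s n u)" if u: "u \<in> V" for u
    proof (rule metric_CauchyI)
      fix e :: real assume e: "e > 0"
      \<comment> \<open>Adding 1 avoids a division by 0 at \<open>u = 0\<close>.\<close>
      have Nu: "0 < N u + 1" using norm_nonneg[OF u] by simp
      obtain M where M: "\<forall>m\<ge>M. \<forall>n\<ge>M. dual_norm V N (s m - s n) < e / (N u + 1)"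
        using C[OF divide_pos_pos[OF e Nu]] by blast
      have "dist (s m u) (s n u) < e" if "m \<ge> M" "n \<ge> M" for m n
      proof -
        have "cmod (s m u - s n u) \<le> dual_norm V N (s m - s n) * N u" by (rule bnd[OF u])
        also have "\<dots> \<le> dual_norm V N (s m - s n) * (N u + 1)"
          using D.norm_nonneg[OF D.mem_diff[OF s s], of m n] by (intro mult_left_mono) auto
        also have "\<dots> < e" using M that Nu by (simp add: pos_less_divide_eq)
        finally show ?thesis by (simp add: dist_norm)
      qed
      thus "\<exists>M. \<forall>m\<ge>M. \<forall>n\<ge>M. dist (s m u) (s n u) < e" by blast
    qed
    hence "\<forall>u\<in>V. \<exists>l. (\<lambda>n. s n u) \<longlonglongrightarrow> l"
      by (simp add: Cauchy_convergent_iff convergent_def)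
    then obtain l where l: "\<And>u. u \<in> V \<Longrightarrow> (\<lambda>n. s n u) \<longlonglongrightarrow> l u" by metis
    define \<phi> where "\<phi> = (\<lambda>u. if u \<in> V then l u else 0)"
    have lim: "(\<lambda>n. s n u) \<longlonglongrightarrow> \<phi> u" for u
      using l dual_space_outside[OF s] by (auto simp: \<phi>_def)
    have close: "\<exists>M. \<forall>n\<ge>M. \<forall>u\<in>V. cmod (s n u - \<phi> u) \<le> e * N u" if e: "e > 0" for e
    proof -
      obtain M where M: "\<forall>m\<ge>M. \<forall>n\<ge>M. dual_norm V N (s m - s n) < e"
        using C[OF e] by blast
      have "cmod (s n u - \<phi> u) \<le> e * N u" if "n \<ge> M" "u \<in> V" for n u
      proof (rule tendsto_upperbound)
        show "(\<lambda>m. cmod (s n u - s m u)) \<longlonglongrightarrow> cmod (s n u - \<phi> u)" by (intro tendsto_intros lim)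
        show "\<forall>\<^sub>F m in sequentially. cmod (s n u - s m u) \<le> e * N u"
          using eventually_ge_at_top[of M]
        proof eventually_elim
          case (elim m)
          have "dual_norm V N (s n - s m) \<le> e" using M elim that(1) by (simp add: less_imp_le)
          hence "dual_norm V N (s n - s m) * N u \<le> e * N u"
            using norm_nonneg[OF that(2)] by (rule mult_right_mono)
          thus ?case using bnd[OF that(2), of n m] by linarith
        qed
      qed simp
      thus ?thesis by blast
    qed
    have add: "\<phi> (u + v) = \<phi> u + \<phi> v" if "u \<in> V" "v \<in> V" for u v
    proof -
      have "(\<lambda>n. s n u + s n v) \<longlonglongrightarrow> \<phi> u + \<phi> v" by (intro tendsto_intros lim)
      hence "(\<lambda>n. s n (u + v)) \<longlonglongrightarrow> \<phi> u + \<phi> v" using dual_space_add[OF s that] by simp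
      thus ?thesis using LIMSEQ_unique[OF lim] by blast
    qed
    have scale: "\<phi> (fscale c u) = c * \<phi> u" if "u \<in> V" for c u
    proof -
      have "(\<lambda>n. c * s n u) \<longlonglongrightarrow> c * \<phi> u" by (intro tendsto_intros lim)
      hence "(\<lambda>n. s n (fscale c u)) \<longlonglongrightarrow> c * \<phi> u" using dual_space_fscale[OF s that] by simp
      thus ?thesis using LIMSEQ_unique[OF lim] by blast
    qed
    have phi: "\<phi> \<in> dual_space V N"
    proof -
      obtain n where n: "\<forall>u\<in>V. cmod (s n u - \<phi> u) \<le> 1 * N u" using close[OF zero_less_one] by blast
      show ?thesis
      proof (rule dual_spaceI[where C="dual_norm V N (s n) + 1"])
        fix u assume u: "u \<in> V"
        have "cmod (\<phi> u) \<le> cmod (s n u) + cmod (s n u - \<phi> u)" using norm_triangle_ineq4[of "s n u" "s n u - \<phi> u"] by simp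
        thus "cmod (\<phi> u) \<le> (dual_norm V N (s n) + 1) * N u"
          using dual_norm_bound[OF s u, of n] bspec[OF n u] by (simp add: algebra_simps)
      next
        show "\<phi> u = 0" if "u \<notin> V" for u using that by (simp add: \<phi>_def)
      qed (rule add scale; assumption)+
    qed
    have "(\<lambda>n. dual_norm V N (s n - \<phi>)) \<longlonglongrightarrow> 0"
    proof (rule LIMSEQ_I)
      fix e :: real assume e: "e > 0"
      obtain M where M: "\<forall>n\<ge>M. \<forall>u\<in>V. cmod (s n u - \<phi> u) \<le> e/2 * N u" using close[OF half_gt_zero[OF e]] by blast
      have "norm (dual_norm V N (s n - \<phi>) - 0) < e" if "n \<ge> M" for n
      proof -
        have "dual_norm V N (s n - \<phi>) \<le> e/2"
          using e M that by (intro dual_norm_le) auto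
        thus ?thesis using D.norm_nonneg[OF D.mem_diff[OF s phi], of n] e by auto
      qed
      thus "\<exists>M. \<forall>n\<ge>M. norm (dual_norm V N (s n - \<phi>) - 0) < e" by blast
    qed
    thus "\<exists>x\<in>dual_space V N. (\<lambda>n. dual_norm V N (s n - x)) \<longlonglongrightarrow> 0" using phi by blast
  qed
  thus ?thesis using D.cfun_subspace D.norm_on by (simp add: banach_on_def)
qed

end

section \<open>Lebesgue spaces\<close>

text \<open>The derivative of \<open>t powr r\<close> increases strictly on the positive axis, so
  the mean value theorem puts the graph strictly above its tangents. The cases with a zero are
  separate, since the derivative is used only at positive points.\<close>

lemma powr_tangent_strict:
  fixes x y r :: real
  assumes "1 < r" "0 \<le> x" "0 \<le> y" "x \<noteq> y"
  shows "x powr r + r * x powr (r - 1) * (y - x) < y powr r"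
proof -
  consider "x = 0" | "x > 0" "y = 0" | "x > 0" "y > 0" using assms by fastforce
  thus ?thesis
  proof cases
    case 1
    thus ?thesis using assms by simp
  next
    case 2
    have "x powr (r - 1) * x = x powr r" using 2 powr_mult_base[of x "r - 1"] by (simp add: mult.commute)
    hence "x powr r + r * x powr (r - 1) * (y - x) = (1 - r) * x powr r" using 2 by (simp add: algebra_simps)
    also have "\<dots> < 0" using 2 assms by (simp add: mult_neg_pos)
    finally show ?thesis using 2 by simp
  next
    case 3
    have D: "((\<lambda>t. t powr r) has_real_derivative r * t powr (r - 1)) (at t)" if "t > 0" for t
      using has_real_derivative_powr[OF that] by simp
    show ?thesis
    proof (cases "x < y")
      case True
      then obtain t where t: "x < t" "t < y" "y powr r - x powr r = (y - x) * (r * t powr (r - 1))"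
        using MVT2[OF True, of "\<lambda>t. t powr r" "\<lambda>t. r * t powr (r - 1)"] D 3 by auto
      have "x powr (r - 1) < t powr (r - 1)" using t 3 assms by (intro powr_less_mono2) auto
      hence "(y - x) * (r * x powr (r - 1)) < (y - x) * (r * t powr (r - 1))" using True assms by simp
      thus ?thesis using t(3) by (simp add: algebra_simps)
    next
      case False
      hence "y < x" using assms by simp
      then obtain t where t: "y < t" "t < x" "x powr r - y powr r = (x - y) * (r * t powr (r - 1))"
        using MVT2[OF \<open>y < x\<close>, of "\<lambda>t. t powr r" "\<lambda>t. r * t powr (r - 1)"] D 3 by auto
      have "t powr (r - 1) < x powr (r - 1)" using t 3 assms by (intro powr_less_mono2) auto
      hence "(x - y) * (r * t powr (r - 1)) < (x - y) * (r * x powr (r - 1))" using \<open>y < x\<close> assms by simp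
      thus ?thesis using t(3) by (simp add: algebra_simps)
    qed
  qed
qed

lemma powr_tangent:
  fixes x y r :: real
  assumes "1 < r" "0 \<le> x" "0 \<le> y"
  shows "x powr r + r * x powr (r - 1) * (y - x) \<le> y powr r"
  using powr_tangent_strict[OF assms] by (cases "x = y") auto

text \<open>The tangent inequality at the combined point \<open>z\<close>, taken towards
  \<open>x\<close> and \<open>y\<close> and averaged with weights \<open>s\<close> and
  \<open>t\<close>: the linear terms cancel.\<close>

lemma powr_convex_combination:
  fixes x y r s t :: real
  assumes "1 < r" "0 \<le> x" "0 \<le> y" "0 \<le> s" "0 \<le> t" "s + t = 1"
  shows "(s * x + t * y) powr r \<le> s * x powr r + t * y powr r"
proof -
  define z where "z = s * x + t * y"
  have z: "0 \<le> z" using assms by (simp add: z_def)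
  define d where "d = r * z powr (r - 1)"
  have "s * (z powr r + d * (x - z)) + t * (z powr r + d * (y - z)) \<le> s * x powr r + t * y powr r"
    using powr_tangent[OF assms(1) z assms(2)] powr_tangent[OF assms(1) z assms(3)] assms
    by (intro add_mono mult_left_mono) (auto simp: d_def)
  also have "s * (z powr r + d * (x - z)) + t * (z powr r + d * (y - z))
      = (s + t) * z powr r + d * (s * x + t * y - (s + t) * z)" by (simp add: algebra_simps)
  also have "\<dots> = z powr r" using assms(6) by (simp add: z_def)
  finally show ?thesis by (simp add: z_def)
qed

lemma powr_add_le:
  fixes x y r :: real
  assumes "1 < r" "0 \<le> x" "0 \<le> y"
  shows "(x + y) powr r \<le> 2 powr r * (x powr r + y powr r)"
proof -
  have "(x + y) powr r = 2 powr r * ((1/2) * x + (1/2) * y) powr r"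
    using assms by (subst powr_mult[symmetric]) auto
  also have "\<dots> \<le> 2 powr r * ((1/2) * x powr r + (1/2) * y powr r)"
    using powr_convex_combination[OF assms, of "1/2" "1/2"] by (intro mult_left_mono) auto
  also have "\<dots> \<le> 2 powr r * (x powr r + y powr r)" by (intro mult_left_mono add_mono) auto
  finally show ?thesis .
qed

text \<open>
  The defect of convexity on the right vanishes only for \<open>a = b\<close>; by homogeneity, it suffices to bound it
  from below on a compact set.
\<close>

lemma cmod_powr_uniformly_convex:
  assumes r: "1 < r" and e: "0 < (e::real)"
  obtains C where "0 \<le> C"
    "\<And>a b. cmod (a - b) powr r \<le> e * (cmod a powr r + cmod b powr r)
      + C * (cmod a powr r + cmod b powr r - 2 * cmod ((a + b) / 2) powr r)"
proof -
  define F where "F = (\<lambda>(a::complex, b). cmod a powr r + cmod b powr r - 2 * cmod ((a + b) / 2) powr r)"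
  define K where "K = {(a::complex, b). cmod a powr r + cmod b powr r = 1 \<and> e \<le> cmod (a - b) powr r}"
  have mid: "cmod ((a + b) / 2) \<le> (1/2) * cmod a + (1/2) * cmod b" for a b :: complex
    using norm_triangle_ineq[of a b] by (simp add: norm_divide)
  have mid': "2 * cmod ((a + b) / 2) powr r \<le> 2 * ((1/2) * cmod a + (1/2) * cmod b) powr r" for a b :: complex
    using mid[of a b] r by (intro mult_left_mono powr_mono2) auto
  have conv: "2 * ((1/2) * cmod a + (1/2) * cmod b) powr r \<le> cmod a powr r + cmod b powr r" for a b :: complex
    using powr_convex_combination[OF r, of "cmod a" "cmod b" "1/2" "1/2"] by simp
  have F_nonneg: "0 \<le> F (a, b)" for a b
    using mid'[of a b] conv[of a b] by (simp add: F_def)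
  \<comment> \<open>A vanishing defect forces equality in two estimates. Strict convexity of the
    power gives \<open>cmod a = cmod b\<close>; equality in the triangle inequality and the
    parallelogram law then give \<open>a = b\<close>.\<close>
  have F_zero: "a = b" if "F (a, b) = 0" for a b
  proof -
    have eq: "2 * ((1/2) * cmod a + (1/2) * cmod b) powr r = cmod a powr r + cmod b powr r"
       "cmod ((a + b) / 2) powr r = ((1/2) * cmod a + (1/2) * cmod b) powr r"
      using that mid'[of a b] conv[of a b] by (auto simp: F_def)
    define z where "z = (1/2) * cmod a + (1/2) * cmod b"
    have ab: "cmod a = cmod b"
    proof (rule ccontr)
      assume "cmod a \<noteq> cmod b"
      hence "z \<noteq> cmod a" "z \<noteq> cmod b" "0 \<le> z" by (auto simp: z_def field_simps)
      hence "z powr r + r * z powr (r - 1) * (cmod a - z) < cmod a powr r"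
        "z powr r + r * z powr (r - 1) * (cmod b - z) < cmod b powr r"
        using powr_tangent_strict[OF r] by simp_all
      moreover have "r * z powr (r - 1) * (cmod a - z) + r * z powr (r - 1) * (cmod b - z) = 0"
        by (simp add: z_def field_simps)
      ultimately show False using eq(1) by (simp add: z_def)
    qed
    have "cmod ((a + b) / 2) = (1/2) * cmod a + (1/2) * cmod b"
      using eq(2) r powr_inj[of r] powr_less_mono2[of r "cmod ((a + b) / 2)" "(1/2) * cmod a + (1/2) * cmod b"] mid[of a b] by force
    hence "cmod (a + b) = 2 * cmod a" using ab by (simp add: norm_divide)
    hence "(cmod (a + b))\<^sup>2 = 4 * (cmod a)\<^sup>2" by (simp add: power2_eq_square)
    moreover have "(cmod (a + b))\<^sup>2 + (cmod (a - b))\<^sup>2 = 2 * (cmod a)\<^sup>2 + 2 * (cmod b)\<^sup>2"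
      unfolding cmod_power2 by (simp add: power2_eq_square algebra_simps)
    ultimately have "(cmod (a - b))\<^sup>2 = 0" using ab by simp
    thus ?thesis by simp
  qed
  have cont: "continuous_on UNIV (\<lambda>x. cmod (f x) powr r)" if "continuous_on UNIV f" for f :: "complex \<times> complex \<Rightarrow> complex"
    using that r by (intro continuous_on_powr' continuous_intros) auto
  have contF: "continuous_on S F" for S
    unfolding F_def case_prod_beta
    by (rule continuous_on_subset[OF _ subset_UNIV]) (intro continuous_intros cont, auto)
  have "closed K"
  proof -
    have "K = {x. cmod (fst x) powr r + cmod (snd x) powr r = 1} \<inter> {x. e \<le> cmod (fst x - snd x) powr r}"
      by (auto simp: K_def)
    thus ?thesis by (auto intro!: closed_Int closed_Collect_eq closed_Collect_le continuous_intros cont)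
  qed
  moreover have "bounded K"
  proof -
    have "cmod a \<le> 1" if "cmod a powr r \<le> 1" for a
      using that r powr_mono2[of "1/r" "cmod a powr r" 1] by (simp add: powr_powr)
    hence "K \<subseteq> cball 0 1 \<times> cball 0 1"
      by (auto simp: K_def) (smt (verit) powr_ge_zero)+
    thus ?thesis using bounded_Times bounded_cball bounded_subset by blast
  qed
  ultimately have "compact K" by (simp add: compact_eq_bounded_closed)
  obtain \<delta> where d: "\<delta> > 0" "\<And>x. x \<in> K \<Longrightarrow> \<delta> \<le> F x"
  proof (cases "K = {}")
    case True
    thus ?thesis using that[of 1] by auto
  next
    case False
    then obtain x0 where x0: "x0 \<in> K" "\<And>x. x \<in> K \<Longrightarrow> F x0 \<le> F x"
      using continuous_attains_inf[OF \<open>compact K\<close> _ contF] by blast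
    obtain a b where ab: "x0 = (a, b)" by force
    have "a \<noteq> b" using x0(1) e by (auto simp: K_def ab)
    hence "F x0 > 0" using F_nonneg[of a b] F_zero[of a b] by (auto simp: ab less_le)
    thus ?thesis using that x0(2) by blast
  qed
  \<comment> \<open>On \<open>K\<close> the left-hand side is at most \<open>2 powr r\<close>, hence
    at most \<open>4 powr r\<close>, and the defect is at least \<open>\<delta>\<close>.\<close>
  define C where "C = 4 powr r / \<delta>"
  have C: "0 \<le> C" using d by (simp add: C_def)
  have unit: "cmod (a - b) powr r \<le> e + C * F (a, b)" if "cmod a powr r + cmod b powr r = 1" for a b
  proof (cases "e \<le> cmod (a - b) powr r")
    case True
    have "cmod (a - b) powr r \<le> (cmod a + cmod b) powr r"
      using norm_triangle_ineq4[of a b] r by (intro powr_mono2) auto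
    also have "\<dots> \<le> 2 powr r * 1" using powr_add_le[OF r, of "cmod a" "cmod b"] that by simp
    also have "\<dots> \<le> 4 powr r" using r by (simp add: powr_mono2)
    also have "\<dots> = C * \<delta>" using d by (simp add: C_def)
    also have "\<dots> \<le> C * F (a, b)" using True that d(2)[of "(a, b)"] C by (intro mult_left_mono) (auto simp: K_def)
    finally show ?thesis using e by simp
  next
    case False
    thus ?thesis using C F_nonneg[of a b] by (smt (verit) mult_nonneg_nonneg)
  qed
  have "cmod (a - b) powr r \<le> e * (cmod a powr r + cmod b powr r) + C * F (a, b)" for a b
  proof (cases "cmod a powr r + cmod b powr r = 0")
    case True
    hence "a = 0" "b = 0" by (smt (verit) powr_ge_zero powr_eq_0_iff norm_eq_zero)+
    thus ?thesis using r by (simp add: F_def)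
  next
    case False
    define S where "S = cmod a powr r + cmod b powr r"
    have S: "S > 0" using False unfolding S_def by (smt (verit) powr_ge_zero)
    \<comment> \<open>This factor scales the pair into the normalisation of \<open>K\<close>; all
      terms are homogeneous of degree \<open>r\<close>.\<close>
    define t where "t = S powr (- 1 / r)"
    have t: "t > 0" "t powr r = 1 / S" using S r by (simp_all add: t_def powr_powr powr_minus_divide powr_divide)
    have sc: "cmod (of_real t * z) powr r = cmod z powr r / S" for z
      using t by (simp add: norm_mult powr_mult)
    have "of_real t * a - of_real t * b = of_real t * (a - b)"
       "(of_real t * a + of_real t * b) / 2 = of_real t * ((a + b) / 2)" by (simp_all add: field_simps)
    hence "F (of_real t * a, of_real t * b) = F (a, b) / S" "cmod (of_real t * a - of_real t * b) powr r = cmod (a - b) powr r / S"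
      unfolding F_def by (simp_all only: prod.case sc) (simp add: add_divide_distrib diff_divide_distrib)
    moreover have "cmod (of_real t * a) powr r + cmod (of_real t * b) powr r = 1"
      using S unfolding sc by (simp add: S_def add_divide_distrib[symmetric])
    ultimately have "cmod (a - b) powr r / S \<le> e + C * (F (a, b) / S)" using unit by metis
    hence "cmod (a - b) powr r \<le> (e + C * (F (a, b) / S)) * S" using S by (simp add: pos_divide_le_eq)
    also have "\<dots> = e * S + C * F (a, b)" using S by (simp add: field_simps)
    finally show ?thesis by (simp add: S_def)
  qed
  thus ?thesis using that[OF C] by (simp add: F_def)
qed

section \<open>Lebesgue spaces over an arbitrary measure: Minkowski, Hoelder and norm
  convergence\<close>

definition lp_space :: "'a measure \<Rightarrow> real \<Rightarrow> ('a \<Rightarrow> complex) set" where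
  "lp_space M r = {f \<in> borel_measurable M. integrable M (\<lambda>z. cmod (f z) powr r)}"

definition lp_norm :: "'a measure \<Rightarrow> real \<Rightarrow> ('a \<Rightarrow> complex) \<Rightarrow> real" where
  "lp_norm M r f = (LINT z|M. cmod (f z) powr r) powr (1 / r)"

lemma Lp_eq_lp_space: "Lp R = lp_space (dV R)" and Lp_norm_eq_lp_norm: "Lp_norm R = lp_norm (dV R)"
  by (simp_all add: fun_eq_iff Lp_def lp_space_def Lp_norm_def lp_norm_def)

lemma lp_spaceD: "f \<in> lp_space M r \<Longrightarrow> f \<in> borel_measurable M"
  "f \<in> lp_space M r \<Longrightarrow> integrable M (\<lambda>z. cmod (f z) powr r)"
  by (auto simp: lp_space_def)

lemma lp_norm_nonneg: "0 \<le> lp_norm M r f"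
  by (simp add: lp_norm_def)

lemma lp_norm_powr: "r > 0 \<Longrightarrow> lp_norm M r f powr r = (LINT z|M. cmod (f z) powr r)"
  by (simp add: lp_norm_def powr_powr)

lemma lp_norm_leI:
  assumes "r > 0" "0 \<le> c" "(LINT z|M. cmod (f z) powr r) \<le> c powr r"
  shows "lp_norm M r f \<le> c"
proof -
  have "lp_norm M r f \<le> (c powr r) powr (1 / r)" unfolding lp_norm_def using assms by (intro powr_mono2) auto
  thus ?thesis using assms by (simp add: powr_powr)
qed

lemma lp_space_dominated:
  assumes "f \<in> borel_measurable M" "g \<in> lp_space M r" "0 < r" "\<And>z. z \<in> space M \<Longrightarrow> cmod (f z) \<le> cmod (g z)"
  shows "f \<in> lp_space M r" "lp_norm M r f \<le> lp_norm M r g"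
proof -
  have le: "cmod (f z) powr r \<le> cmod (g z) powr r" if "z \<in> space M" for z
    using assms that by (intro powr_mono2) auto
  have "integrable M (\<lambda>z. cmod (f z) powr r)"
    by (rule Bochner_Integration.integrable_bound[OF lp_spaceD(2)[OF assms(2)]]) (use assms(1) le in auto)
  thus f: "f \<in> lp_space M r" using assms(1) by (simp add: lp_space_def)
  show "lp_norm M r f \<le> lp_norm M r g"
    unfolding lp_norm_def using assms(3)
    by (intro powr_mono2 integral_mono le lp_spaceD(2)[OF f] lp_spaceD(2)[OF assms(2)]) auto
qed

lemma lp_space_fscale: "f \<in> lp_space M r \<Longrightarrow> fscale c f \<in> lp_space M r"
  by (auto simp: lp_space_def fscale_def norm_mult powr_mult)

lemma lp_norm_fscale: "0 < r \<Longrightarrow> lp_norm M r (fscale c f) = cmod c * lp_norm M r f"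
  by (simp add: lp_norm_def fscale_def norm_mult powr_mult powr_powr)

lemma lp_space_add:
  assumes r: "1 < r" and f: "f \<in> lp_space M r" and g: "g \<in> lp_space M r"
  shows "f + g \<in> lp_space M r"
proof -
  have [measurable]: "f \<in> borel_measurable M" "g \<in> borel_measurable M" using f g lp_spaceD by auto
  have "integrable M (\<lambda>z. cmod (f z + g z) powr r)"
  proof (rule Bochner_Integration.integrable_bound)
    show "integrable M (\<lambda>z. 2 powr r * (cmod (f z) powr r + cmod (g z) powr r))"
      using f g lp_spaceD(2) by (intro integrable_mult_right Bochner_Integration.integrable_add) auto
    have "cmod (f z + g z) powr r \<le> 2 powr r * (cmod (f z) powr r + cmod (g z) powr r)" for z
    proof -
      have "cmod (f z + g z) powr r \<le> (cmod (f z) + cmod (g z)) powr r"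
        using r norm_triangle_ineq by (intro powr_mono2) auto
      thus ?thesis using powr_add_le[OF r, of "cmod (f z)" "cmod (g z)"] by simp
    qed
    thus "AE z in M. norm (cmod (f z + g z) powr r) \<le> norm (2 powr r * (cmod (f z) powr r + cmod (g z) powr r))"
      by (simp add: abs_of_nonneg)
  qed measurable
  thus ?thesis by (simp add: lp_space_def plus_fun_def)
qed

lemma lp_space_zero: "0 \<in> lp_space M r"
  by (simp add: lp_space_def zero_fun_def)

lemma subspace_lp_space: "1 < r \<Longrightarrow> cfun.subspace (lp_space M r)"
  by (rule cfun.subspaceI) (auto intro: lp_space_add lp_space_fscale lp_space_zero)

lemma lp_norm_eq_0_AE:
  assumes "f \<in> lp_space M r" "lp_norm M r f = 0" "r > 0"
  shows "AE z in M. f z = 0"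
proof -
  have "(LINT z|M. cmod (f z) powr r) = 0" using assms by (simp add: lp_norm_def)
  hence "AE z in M. cmod (f z) powr r = 0"
    using integral_nonneg_eq_0_iff_AE[OF lp_spaceD(2)[OF assms(1)]] by simp
  thus ?thesis by (rule AE_mp) (auto intro!: AE_I2)
qed

text \<open>Convexity of the \<open>r\<close>-th power with the weights \<open>A / (A + B)\<close>
  and \<open>B / (A + B)\<close>, where \<open>A\<close> and \<open>B\<close> are the two norms.
  Each is enlarged by \<open>e/2\<close>, so that the divisions make sense even for norm 0.\<close>

lemma lp_norm_add:
  assumes r: "1 < r" and f: "f \<in> lp_space M r" and g: "g \<in> lp_space M r"
  shows "lp_norm M r (f + g) \<le> lp_norm M r f + lp_norm M r g"
proof (rule field_le_epsilon)
  fix e :: real assume e: "e > 0"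
  define A where "A = lp_norm M r f + e/2"
  define B where "B = lp_norm M r g + e/2"
  have AB: "A > 0" "B > 0" using e lp_norm_nonneg[of M r] by (auto simp: A_def B_def add_nonneg_pos)
  define s where "s = A / (A + B)"
  define t where "t = B / (A + B)"
  have st: "0 \<le> s" "0 \<le> t" "s + t = 1" using AB by (auto simp: s_def t_def add_divide_distrib[symmetric])
  have le: "cmod (f z + g z) powr r \<le> (A + B) powr r * (s * (cmod (f z) powr r / A powr r) + t * (cmod (g z) powr r / B powr r))" for z
  proof -
    have "cmod (f z + g z) powr r \<le> (cmod (f z) + cmod (g z)) powr r"
      using r norm_triangle_ineq by (intro powr_mono2) auto
    also have "cmod (f z) + cmod (g z) = (A + B) * (s * (cmod (f z) / A) + t * (cmod (g z) / B))"
    proof -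
      have "(A + B) * s = A" "(A + B) * t = B" using AB by (auto simp: s_def t_def)
      thus ?thesis using AB by (simp add: distrib_left flip: mult.assoc)
    qed
    also have "\<dots> powr r = (A + B) powr r * (s * (cmod (f z) / A) + t * (cmod (g z) / B)) powr r"
      using AB st by (subst powr_mult) auto
    also have "\<dots> \<le> (A + B) powr r * (s * (cmod (f z) / A) powr r + t * (cmod (g z) / B) powr r)"
      using AB st by (intro mult_left_mono powr_convex_combination r) auto
    also have "\<dots> = (A + B) powr r * (s * (cmod (f z) powr r / A powr r) + t * (cmod (g z) powr r / B powr r))"
      using AB by (simp add: powr_divide)
    finally show ?thesis .
  qed
  have If: "(LINT z|M. cmod (f z) powr r) \<le> A powr r" and Ig: "(LINT z|M. cmod (g z) powr r) \<le> B powr r"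
    using r e lp_norm_nonneg[of M r] unfolding A_def B_def lp_norm_powr[symmetric, OF order.strict_trans[OF zero_less_one r]]
    by (intro powr_mono2, auto)+
  have "(LINT z|M. cmod ((f + g) z) powr r) \<le> (LINT z|M. (A + B) powr r * (s * (cmod (f z) powr r / A powr r) + t * (cmod (g z) powr r / B powr r)))"
    using le lp_spaceD(2)[OF lp_space_add[OF r f g]] lp_spaceD(2)[OF f] lp_spaceD(2)[OF g]
    by (intro integral_mono integrable_mult_right Bochner_Integration.integrable_add integrable_divide) auto
  also have "\<dots> = (A + B) powr r * (s * ((LINT z|M. cmod (f z) powr r) / A powr r) + t * ((LINT z|M. cmod (g z) powr r) / B powr r))"
    using lp_spaceD(2)[OF f] lp_spaceD(2)[OF g] by simp
  also have "\<dots> \<le> (A + B) powr r * (s * 1 + t * 1)"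
    using If Ig AB st by (intro mult_left_mono add_mono) auto
  finally have "(LINT z|M. cmod ((f + g) z) powr r) \<le> (A + B) powr r" using st by simp
  hence "lp_norm M r (f + g) \<le> A + B" using r AB by (intro lp_norm_leI) auto
  thus "lp_norm M r (f + g) \<le> lp_norm M r f + lp_norm M r g + e" by (simp add: A_def B_def)
qed

text \<open>Young's inequality for the functions divided by their norms. The norms are enlarged by
  \<open>e > 0\<close> to permit the division, and \<open>e\<close> tends to 0 at the end.\<close>

lemma lp_Holder:
  assumes pq: "1 < r" "1 < s" "1 / r + 1 / s = 1" and f: "f \<in> lp_space M r" and g: "g \<in> lp_space M s"
  shows "integrable M (\<lambda>z. f z * g z)" "(LINT z|M. cmod (f z * g z)) \<le> lp_norm M r f * lp_norm M s g"
    "cmod (LINT z|M. f z * g z) \<le> lp_norm M r f * lp_norm M s g"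
proof -
  have [measurable]: "f \<in> borel_measurable M" "g \<in> borel_measurable M" using f g lp_spaceD by auto
  have Y: "cmod (f z * g z) \<le> cmod (f z) powr r / r + cmod (g z) powr s / s" for z
    using Youngs_inequality[OF pq, of "cmod (f z)" "cmod (g z)"] by (simp add: norm_mult)
  show int: "integrable M (\<lambda>z. f z * g z)"
  proof (rule Bochner_Integration.integrable_bound)
    show "integrable M (\<lambda>z. cmod (f z) powr r / r + cmod (g z) powr s / s)"
      using f g lp_spaceD(2) by (intro Bochner_Integration.integrable_add integrable_divide) auto
    show "AE z in M. norm (f z * g z) \<le> norm (cmod (f z) powr r / r + cmod (g z) powr s / s)"
      using Y pq by (auto simp: abs_of_nonneg)
  qed measurable
  show le: "(LINT z|M. cmod (f z * g z)) \<le> lp_norm M r f * lp_norm M s g"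
  proof (rule tendsto_lowerbound)
    let ?A = "\<lambda>e. lp_norm M r f + e" and ?B = "\<lambda>e. lp_norm M s g + e"
    show "((\<lambda>e. ?A e * ?B e) \<longlongrightarrow> lp_norm M r f * lp_norm M s g) (at_right 0)"
      by (auto intro!: tendsto_eq_intros)
    show "\<forall>\<^sub>F e in at_right 0. (LINT z|M. cmod (f z * g z)) \<le> ?A e * ?B e"
      using eventually_at_right_less[of 0]
    proof eventually_elim
      case (elim e)
      have A: "?A e > 0" "?B e > 0" using elim lp_norm_nonneg[of M] by (auto simp: add_nonneg_pos)
      have Y': "cmod (f z * g z) \<le> ?A e * ?B e * ((cmod (f z) powr r / ?A e powr r) / r + (cmod (g z) powr s / ?B e powr s) / s)" for z
      proof -
        have "cmod (f z * g z) = ?A e * ?B e * ((cmod (f z) / ?A e) * (cmod (g z) / ?B e))" using A by (simp add: norm_mult)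
        also have "\<dots> \<le> ?A e * ?B e * ((cmod (f z) / ?A e) powr r / r + (cmod (g z) / ?B e) powr s / s)"
          using A by (intro mult_left_mono Youngs_inequality pq) auto
        finally show ?thesis using A by (simp add: powr_divide)
      qed
      have If: "(LINT z|M. cmod (f z) powr r) \<le> ?A e powr r" and Ig: "(LINT z|M. cmod (g z) powr s) \<le> ?B e powr s"
        using pq elim lp_norm_nonneg[of M] lp_norm_powr[of r M f] lp_norm_powr[of s M g]
          powr_mono2[of r "lp_norm M r f" "?A e"] powr_mono2[of s "lp_norm M s g" "?B e"] by auto
      have "(LINT z|M. cmod (f z * g z)) \<le> (LINT z|M. ?A e * ?B e * ((cmod (f z) powr r / ?A e powr r) / r + (cmod (g z) powr s / ?B e powr s) / s))"
        using Y' lp_spaceD(2)[OF f] lp_spaceD(2)[OF g] int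
        by (intro integral_mono integrable_mult_right Bochner_Integration.integrable_add integrable_divide integrable_norm) auto
      also have "\<dots> = ?A e * ?B e * (((LINT z|M. cmod (f z) powr r) / ?A e powr r) / r + ((LINT z|M. cmod (g z) powr s) / ?B e powr s) / s)"
        using lp_spaceD(2)[OF f] lp_spaceD(2)[OF g] by simp
      also have "\<dots> \<le> ?A e * ?B e * (1 / r + 1 / s)"
        using If Ig A pq by (intro mult_left_mono add_mono divide_right_mono) auto
      finally show ?case using pq by simp
    qed
  qed simp
  show "cmod (LINT z|M. f z * g z) \<le> lp_norm M r f * lp_norm M s g"
    using integral_norm_bound[of M "\<lambda>z. f z * g z"] le by linarith
qed

lemma lp_space_cnj: "g \<in> lp_space M s \<Longrightarrow> (\<lambda>z. cnj (g z)) \<in> lp_space M s"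
  and lp_norm_cnj: "lp_norm M s (\<lambda>z. cnj (g z)) = lp_norm M s g"
  by (auto simp: lp_space_def lp_norm_def intro: borel_measurable_continuous_on[OF continuous_on_cnj[OF continuous_on_id]])

lemma lp_Holder_cnj:
  assumes "1 < r" "1 < s" "1 / r + 1 / s = 1" "f \<in> lp_space M r" "g \<in> lp_space M s"
  shows "integrable M (\<lambda>z. f z * cnj (g z))" "cmod (LINT z|M. f z * cnj (g z)) \<le> lp_norm M r f * lp_norm M s g"
  using lp_Holder[OF assms(1-4) lp_space_cnj[OF assms(5)]] by (auto simp: lp_norm_cnj)

text \<open>Everything follows from \<open>x powr r \<le> 1 + x powr s\<close>, applied to
  \<open>cmod (f z)\<close> divided by the \<open>L^s\<close> norm; integrating the right-hand side
  gives the total mass plus 1.\<close>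

lemma (in finite_measure) lp_space_mono:
  assumes "1 < r" "r \<le> s" "f \<in> lp_space M s"
  shows "f \<in> lp_space M r" "lp_norm M r f \<le> (measure M (space M) + 1) powr (1/r) * lp_norm M s f"
proof -
  have [measurable]: "f \<in> borel_measurable M" using assms lp_spaceD by auto
  have le: "x powr r \<le> 1 + x powr s" if "0 \<le> x" for x :: real
  proof (cases "x \<le> 1")
    case True
    hence "x powr r \<le> 1" using that assms powr_mono2[of r x 1] by simp
    thus ?thesis by (simp add: add_increasing2)
  next
    case False
    hence "x powr r \<le> x powr s" using assms by (intro powr_mono) auto
    thus ?thesis by simp
  qed
  have int: "integrable M (\<lambda>z. cmod (f z) powr r)"
  proof (rule Bochner_Integration.integrable_bound)
    show "integrable M (\<lambda>z. 1 + cmod (f z) powr s)" using lp_spaceD(2)[OF assms(3)] by simp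
  qed (use le in \<open>auto simp: abs_of_nonneg\<close>)
  thus f: "f \<in> lp_space M r" by (simp add: lp_space_def)
  show "lp_norm M r f \<le> (measure M (space M) + 1) powr (1/r) * lp_norm M s f"
  proof (cases "lp_norm M s f = 0")
    case True
    hence "AE z in M. f z = 0" using lp_norm_eq_0_AE[OF assms(3)] assms by simp
    hence "(LINT z|M. cmod (f z) powr r) = (LINT z|M. 0)" by (intro integral_cong_AE) auto
    thus ?thesis using True by (simp add: lp_norm_def)
  next
    case False
    define c where "c = lp_norm M s f"
    have c: "c > 0" using False lp_norm_nonneg[of M s f] by (simp add: c_def)
    have cs: "c powr s = (LINT z|M. cmod (f z) powr s)" using assms by (simp add: c_def lp_norm_powr)
    have "(LINT z|M. cmod (f z) powr r) \<le> (LINT z|M. c powr r * (1 + cmod (f z) powr s / c powr s))"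
    proof (rule integral_mono[OF int])
      show "integrable M (\<lambda>z. c powr r * (1 + cmod (f z) powr s / c powr s))"
        using lp_spaceD(2)[OF assms(3)] by auto
      show "cmod (f z) powr r \<le> c powr r * (1 + cmod (f z) powr s / c powr s)" for z
        using le[of "cmod (f z) / c"] c by (simp add: powr_divide divide_le_eq mult.commute)
    qed
    also have "\<dots> = c powr r * (measure M (space M) + (LINT z|M. cmod (f z) powr s) / c powr s)"
      using lp_spaceD(2)[OF assms(3)] by simp
    also have "\<dots> = (measure M (space M) + 1) * c powr r" using c by (simp add: cs[symmetric])
    finally have "lp_norm M r f \<le> ((measure M (space M) + 1) * c powr r) powr (1 / r)"
      unfolding lp_norm_def using assms by (intro powr_mono2) auto
    also have "\<dots> = (measure M (space M) + 1) powr (1 / r) * c" using c assms by (simp add: powr_mult powr_powr)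
    finally show ?thesis by (simp add: c_def)
  qed
qed

lemma (in finite_measure) lp_space_integrable:
  assumes "1 < r" "f \<in> lp_space M r"
  shows "integrable M f"
proof (rule Bochner_Integration.integrable_bound)
  show "integrable M (\<lambda>z. 1 + cmod (f z) powr r)" using lp_spaceD(2)[OF assms(2)] by simp
  have "cmod x \<le> 1 + cmod x powr r" for x :: complex
    using assms(1) powr_mono[of 1 r "cmod x"] by (cases "cmod x \<le> 1") (auto simp: add_increasing2)
  thus "AE z in M. norm (f z) \<le> norm (1 + cmod (f z) powr r)" by (auto simp: abs_of_nonneg)
qed (use assms lp_spaceD in auto)

text \<open>The bound of the norms by that of the limit replaces a dominating function. It makes
  \<open>cmod (F n x) powr r\<close> converge in \<open>L^1\<close>, which controls the part of
  \<open>cmod (F n x - f x) powr r\<close> above a fixed multiple of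
  \<open>cmod (f x) powr r\<close>. The part below is dominated by this multiple and tends to 0
  pointwise.\<close>

lemma lp_Scheffe:
  assumes r: "1 < r" and F: "\<And>n::nat. F n \<in> borel_measurable M" and f: "f \<in> lp_space M r"
    and lim: "\<And>x. x \<in> space M \<Longrightarrow> (\<lambda>n. F n x) \<longlonglongrightarrow> f x"
    and Fr: "\<And>n. F n \<in> lp_space M r" "\<And>n. lp_norm M r (F n) \<le> lp_norm M r f"
  shows "(\<lambda>n. lp_norm M r (F n - f)) \<longlonglongrightarrow> 0"
proof -
  note [measurable] = F lp_spaceD(1)[OF f]
  have intF: "integrable M (\<lambda>x. cmod (F n x) powr r)" for n using Fr lp_spaceD by blast
  have intf: "integrable M (\<lambda>x. cmod (f x) powr r)" using f lp_spaceD by blast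
  define A where "A = (\<lambda>n x. \<bar>cmod (F n x) powr r - cmod (f x) powr r\<bar>)"
  have "(\<lambda>n. \<integral>\<^sup>+ x. norm (cmod (F n x) powr r - cmod (f x) powr r) \<partial>M) \<longlonglongrightarrow> 0"
  proof (rule Scheffe_lemma2[OF _ intf])
    show "AE x in M. (\<lambda>n. cmod (F n x) powr r) \<longlonglongrightarrow> cmod (f x) powr r"
      using lim r by (intro AE_I2 tendsto_powr2 tendsto_intros) auto
    fix n
    have "(LINT x|M. cmod (F n x) powr r) \<le> (LINT x|M. cmod (f x) powr r)"
      using Fr(2)[of n] powr_mono2[of r "lp_norm M r (F n)" "lp_norm M r f"] r by (simp add: lp_norm_nonneg lp_norm_powr)
    thus "(\<integral>\<^sup>+ x. norm (cmod (F n x) powr r) \<partial>M) \<le> (\<integral>\<^sup>+ x. norm (cmod (f x) powr r) \<partial>M)"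
      using intF[of n] intf by (simp add: nn_integral_eq_integral)
  qed measurable
  moreover have intA: "integrable M (A n)" for n unfolding A_def using intF intf by auto
  ultimately have "(\<lambda>n. ennreal (LINT x|M. A n x)) \<longlonglongrightarrow> ennreal 0"
    by (subst (asm) nn_integral_eq_integral) (auto simp: A_def)
  hence A0: "(\<lambda>n. LINT x|M. A n x) \<longlonglongrightarrow> 0"
    by (subst (asm) tendsto_ennreal_iff) (auto simp: A_def intro!: integral_nonneg always_eventually)
  define c where "c = (2::real) powr r"
  have c: "c > 0" by (simp add: c_def)
  define D where "D = (\<lambda>n x. cmod (F n x - f x) powr r)"
  define B where "B = (\<lambda>x. c * (2 * cmod (f x) powr r))"
  have DAB: "D n x \<le> c * A n x + min (D n x) (B x)" for n x
  proof -
    have "D n x \<le> (cmod (F n x) + cmod (f x)) powr r"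
      unfolding D_def using r norm_triangle_ineq4 by (intro powr_mono2) auto
    also have "\<dots> \<le> c * (cmod (F n x) powr r + cmod (f x) powr r)" unfolding c_def by (rule powr_add_le[OF r]) auto
    also have "\<dots> \<le> c * (A n x + 2 * cmod (f x) powr r)"
      using c by (intro mult_left_mono) (auto simp: A_def)
    finally have "D n x \<le> c * A n x + B x" by (simp add: B_def algebra_simps)
    thus ?thesis using c by (auto simp: min_def A_def)
  qed
  have intD: "integrable M (D n)" for n
  proof -
    have "F n - f \<in> lp_space M r" using cfun.subspace_diff[OF subspace_lp_space[OF r]] Fr f by blast
    thus ?thesis using lp_spaceD(2)[of "F n - f" M r] by (simp add: D_def)
  qed
  have intB: "integrable M B" using intf by (auto simp: B_def)
  have "(\<lambda>n. LINT x|M. min (D n x) (B x)) \<longlonglongrightarrow> (LINT x|M. 0)"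
  proof (rule integral_dominated_convergence[where w=B])
    show "AE x in M. (\<lambda>n. min (D n x) (B x)) \<longlonglongrightarrow> 0"
    proof (rule AE_I2)
      fix x assume x: "x \<in> space M"
      have "(\<lambda>n. F n x - f x) \<longlonglongrightarrow> f x - f x" by (intro tendsto_intros lim x)
      hence "(\<lambda>n. cmod (F n x - f x) powr r) \<longlonglongrightarrow> 0 powr r"
        using r by (intro tendsto_powr2) (auto intro!: tendsto_norm_zero)
      hence "(\<lambda>n. min (D n x) (B x)) \<longlonglongrightarrow> min 0 (B x)"
        using r by (intro tendsto_min) (auto simp: D_def)
      thus "(\<lambda>n. min (D n x) (B x)) \<longlonglongrightarrow> 0" using c by (simp add: B_def min_def)
    qed
    show "AE x in M. norm (min (D n x) (B x)) \<le> B x" for n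
      using c by (auto simp: D_def B_def min_def)
  qed (use intB in \<open>auto simp: B_def D_def\<close>)
  hence "(\<lambda>n. c * (LINT x|M. A n x) + (LINT x|M. min (D n x) (B x))) \<longlonglongrightarrow> c * 0 + 0"
    by (intro tendsto_intros A0) simp
  moreover have "(LINT x|M. D n x) \<le> c * (LINT x|M. A n x) + (LINT x|M. min (D n x) (B x))" for n
  proof -
    have "(LINT x|M. D n x) \<le> (LINT x|M. c * A n x + min (D n x) (B x))"
      using DAB intA intB intD by (intro integral_mono) (auto intro!: Bochner_Integration.integrable_add integrable_min)
    thus ?thesis using intA intB intD by (simp add: Bochner_Integration.integral_add integrable_min)
  qed
  moreover have "0 \<le> (LINT x|M. D n x)" for n by (auto simp: D_def)
  ultimately have "(\<lambda>n. LINT x|M. D n x) \<longlonglongrightarrow> 0"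
    by (intro tendsto_sandwich[of "\<lambda>_. 0" "\<lambda>n. LINT x|M. D n x" sequentially]) (auto intro!: always_eventually)
  hence "(\<lambda>n. (LINT x|M. D n x) powr (1 / r)) \<longlonglongrightarrow> 0 powr (1 / r)"
    using r by (intro tendsto_powr2) (auto simp: D_def)
  thus ?thesis using r by (simp add: lp_norm_def D_def)
qed

text \<open>The duality map of \<open>L^r\<close>: \<open>r\<close> times it is the gradient of
  \<open>cmod a powr r\<close>. At 0 the factor \<open>a\<close> gives the value 0, also for
  \<open>r < 2\<close>.\<close>

definition lp_dual_map :: "real \<Rightarrow> complex \<Rightarrow> complex" where
  "lp_dual_map r a = of_real (cmod a powr (r - 2)) * a"

lemma cmod_lp_dual_map: "cmod (lp_dual_map r a) = cmod a powr (r - 1)"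
  using powr_mult_base[of "cmod a" "r - 2"] by (simp add: lp_dual_map_def norm_mult mult.commute add.commute)

lemma mult_cnj_lp_dual_map: "a * cnj (lp_dual_map r a) = of_real (cmod a powr r)"
proof -
  have "a * cnj (lp_dual_map r a) = of_real (cmod a powr (r - 2)) * (a * cnj a)" by (simp add: lp_dual_map_def)
  also have "\<dots> = of_real (cmod a powr (r - 2) * (cmod a)\<^sup>2)" by (simp only: complex_norm_square[symmetric] of_real_mult)
  also have "cmod a powr (r - 2) * (cmod a)\<^sup>2 = cmod a powr r"
    using powr_add[of "cmod a" "r - 2" 2] by (cases "a = 0") auto
  finally show ?thesis .
qed

text \<open>Only the origin is delicate: for \<open>r < 2\<close> the first factor is unbounded near
  it, but the modulus of the product is \<open>cmod a powr (r - 1)\<close>, which tends to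
  0.\<close>

lemma continuous_on_lp_dual_map: "1 < r \<Longrightarrow> continuous_on S (lp_dual_map r)"
proof -
  assume r: "1 < r"
  have "isCont (lp_dual_map r) a" for a
  proof (cases "a = 0")
    case True
    have "((\<lambda>x. cmod x powr (r - 1)) \<longlongrightarrow> 0) (at 0)"
      using r tendsto_powr2[OF tendsto_norm_zero[OF tendsto_ident_at], of "\<lambda>_. r - 1" "r - 1" UNIV] by simp
    hence "((\<lambda>x. cmod (lp_dual_map r x)) \<longlongrightarrow> 0) (at 0)" by (simp add: cmod_lp_dual_map)
    hence "(lp_dual_map r \<longlongrightarrow> 0) (at 0)" by (rule tendsto_norm_zero_cancel)
    moreover have "lp_dual_map r 0 = 0" by (simp add: lp_dual_map_def)
    ultimately show ?thesis using True by (simp add: isCont_def)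
  next
    case False
    have "continuous (at a) (\<lambda>x. of_real (cmod x powr (r - 2)) * x)"
      using False by (intro continuous_intros) auto
    thus ?thesis by (simp add: lp_dual_map_def[abs_def])
  qed
  thus ?thesis by (simp add: continuous_at_imp_continuous_on)
qed

lemma borel_measurable_lp_dual_map:
  assumes "1 < r" shows "lp_dual_map r \<in> borel_measurable borel"
  using assms by (intro borel_measurable_continuous_onI continuous_on_lp_dual_map)

text \<open>Conjugate exponents satisfy \<open>(r - 1) * s = r\<close>, so the \<open>s\<close>-th
  power of the new modulus is the \<open>r\<close>-th power of the old one.\<close>

lemma lp_dual_map_mem:
  assumes pq: "1 < r" "1 < s" "1 / r + 1 / s = 1" and f: "f \<in> lp_space M r"
  shows "(\<lambda>z. lp_dual_map r (f z)) \<in> lp_space M s"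
    "lp_norm M s (\<lambda>z. lp_dual_map r (f z)) = lp_norm M r f powr (r - 1)"
proof -
  have rs: "(r - 1) * s = r" using pq by (simp add: field_simps)
  have eq: "cmod (lp_dual_map r (f z)) powr s = cmod (f z) powr r" for z
    by (simp add: cmod_lp_dual_map powr_powr rs)
  have "(\<lambda>z. lp_dual_map r (f z)) \<in> borel_measurable M"
    using measurable_compose[OF lp_spaceD(1)[OF f] borel_measurable_lp_dual_map[OF pq(1)]] .
  thus "(\<lambda>z. lp_dual_map r (f z)) \<in> lp_space M s"
    using lp_spaceD(2)[OF f] by (simp add: lp_space_def eq)
  have "1 / s = (r - 1) / r" using pq by (simp add: field_simps)
  thus "lp_norm M s (\<lambda>z. lp_dual_map r (f z)) = lp_norm M r f powr (r - 1)"
    using pq by (simp add: lp_norm_def eq powr_powr)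
qed

text \<open>The real tangent inequality for the moduli, together with the bound of the real part of
  \<open>b * cnj (lp_dual_map r a)\<close> by its modulus, which is attained at
  \<open>b = a\<close>.\<close>

lemma cmod_powr_tangent:
  assumes "1 < r"
  shows "cmod a powr r + r * Re ((b - a) * cnj (lp_dual_map r a)) \<le> cmod b powr r"
proof -
  have "Re (b * cnj (lp_dual_map r a)) \<le> cmod b * cmod a powr (r - 1)"
    using complex_Re_le_cmod[of "b * cnj (lp_dual_map r a)"] by (simp add: norm_mult cmod_lp_dual_map)
  moreover have "Re (a * cnj (lp_dual_map r a)) = cmod a * cmod a powr (r - 1)"
    using powr_mult_base[of "cmod a" "r - 1"] by (simp only: mult_cnj_lp_dual_map Re_complex_of_real) simp
  ultimately have "Re ((b - a) * cnj (lp_dual_map r a)) \<le> cmod a powr (r - 1) * (cmod b - cmod a)"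
    by (simp add: left_diff_distrib right_diff_distrib mult.commute)
  hence "r * Re ((b - a) * cnj (lp_dual_map r a)) \<le> r * (cmod a powr (r - 1) * (cmod b - cmod a))"
    using assms by (intro mult_left_mono) auto
  thus ?thesis using powr_tangent[OF assms, of "cmod a" "cmod b"] by simp
qed

text \<open>In general \<open>lp_space M r\<close> itself is not normed as a set of functions,
  because nonzero null functions have norm 0. The locale isolates subspaces where the norm is
  definite, as it is for holomorphic functions; completeness takes the place of closedness.\<close>

locale complete_lp_subspace = normed_function_space V "lp_norm M r"
  for V :: "('a \<Rightarrow> complex) set" and M :: "'a measure" and r :: real +
  assumes exponent: "1 < r" and sub_lp: "V \<subseteq> lp_space M r" and complete: mcomplete
begin

text \<open>A minimising sequence is Cauchy: the midpoint of two members still satisfies the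
  constraint, so its integral is at least the infimum and the convexity defect of the pair is small.
  Uniform convexity bounds the difference by this defect.\<close>

lemma ex_min_norm:
  assumes phi: "\<phi> \<in> dual_space V (lp_norm M r)" and "g \<in> V" "\<phi> g = 1"
  obtains f where "f \<in> V" "\<phi> f = 1"
    "\<And>v. v \<in> V \<Longrightarrow> \<phi> v = 1 \<Longrightarrow> (LINT x|M. cmod (f x) powr r) \<le> (LINT x|M. cmod (v x) powr r)"
proof -
  note r = exponent
  define I where "I = (\<lambda>f. LINT x|M. cmod (f x) powr r)"
  define m where "m = Inf (I ` {v \<in> V. \<phi> v = 1})"
  have I: "I f = lp_norm M r f powr r" for f using r by (simp add: I_def lp_norm_powr)
  have I0: "0 \<le> I f" for f by (simp add: I_def)
  have bdd: "bdd_below (I ` {v \<in> V. \<phi> v = 1})" using I0 by (auto intro!: bdd_belowI)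
  have m: "m \<le> I v" if "v \<in> V" "\<phi> v = 1" for v
    unfolding m_def using that by (intro cInf_lower[OF _ bdd]) auto
  have m0: "0 \<le> m" unfolding m_def using assms I0 by (intro cInf_greatest) auto
  have "\<exists>v\<in>V. \<phi> v = 1 \<and> I v < m + 1 / (real n + 1)" for n :: nat
  proof -
    have "Inf (I ` {v \<in> V. \<phi> v = 1}) < m + 1 / (real n + 1)" by (simp add: m_def)
    thus ?thesis using cInf_lessD[of "I ` {v \<in> V. \<phi> v = 1}"] assms by fastforce
  qed
  then obtain f where f: "\<And>n. f n \<in> V" "\<And>n. \<phi> (f n) = 1" "\<And>n. I (f n) < m + 1 / (real n + 1)" by metis
  have small: "\<exists>N. \<forall>n\<ge>N. 1 / (real n + 1) < d" if d: "d > 0" for d :: real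
  proof -
    obtain N where "inverse (real (Suc N)) < d" using reals_Archimedean[OF d] by blast
    hence "1 / (real n + 1) < d" if "n \<ge> N" for n
      using that frac_le[of 1 1 "real N + 1" "real n + 1"] by (simp add: inverse_eq_divide add.commute)
    thus ?thesis by blast
  qed
  have cau: "\<exists>N. \<forall>i\<ge>N. \<forall>j\<ge>N. lp_norm M r (f i - f j) < e" if e: "e > 0" for e
  proof -
    \<comment> \<open>Two integrals of at most \<open>m + 1\<close> make the first error term at
      most \<open>e powr r / 2\<close>; the 1 also covers \<open>m = 0\<close>.\<close>
    define d where "d = e powr r / (4 * (m + 1))"
    have d: "d > 0" using e m0 by (simp add: d_def)
    obtain C where C: "0 \<le> C" "\<And>a b. cmod (a - b) powr r \<le> d * (cmod a powr r + cmod b powr r)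
        + C * (cmod a powr r + cmod b powr r - 2 * cmod ((a + b) / 2) powr r)"
      using cmod_powr_uniformly_convex[OF r d] by blast
    have "e powr r / (4 * (C + 1)) > 0" using e C by simp
    then obtain N where N: "\<And>n. n \<ge> N \<Longrightarrow> 1 / (real n + 1) < e powr r / (4 * (C + 1))" using small by blast
    have "lp_norm M r (f i - f j) < e" if ij: "i \<ge> N" "j \<ge> N" for i j
    proof -
      define h where "h = fscale (1/2) (f i + f j)"
      have h: "h \<in> V" unfolding h_def using f mem_add mem_fscale by blast
      have "\<phi> h = 1" unfolding h_def
        using dual_space_fscale[OF phi mem_add[OF f(1) f(1)]] dual_space_add[OF phi f(1) f(1)] f(2) by simp
      hence mh: "m \<le> I h" using m h by blast
      have hx: "h x = (f i x + f j x) / 2" for x by (simp add: h_def fscale_def)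
      have int: "integrable M (\<lambda>x. cmod (g x) powr r)" if "g \<in> V" for g
        using that sub_lp lp_spaceD(2) by blast
      have "I (f i - f j) \<le> (LINT x|M. d * (cmod (f i x) powr r + cmod (f j x) powr r)
        + C * (cmod (f i x) powr r + cmod (f j x) powr r - 2 * cmod (h x) powr r))"
        unfolding I_def using int[OF f(1)] int[OF h] int[OF mem_diff[OF f(1) f(1)], of i j] C(2)
        by (intro integral_mono Bochner_Integration.integrable_add integrable_mult_right Bochner_Integration.integrable_diff) (auto simp: hx)
      also have "\<dots> = d * (I (f i) + I (f j)) + C * (I (f i) + I (f j) - 2 * I h)"
        using int[OF f(1)] int[OF h] by (simp add: I_def)
      also have "\<dots> \<le> d * (2 * (m + 1)) + C * (e powr r / (2 * (C + 1)))"
      proof (intro add_mono mult_left_mono)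
        have "1 / (real n + 1) \<le> 1" for n by simp
        hence "I (f n) \<le> m + 1" for n using f(3)[of n] by (meson add_left_mono less_imp_le order_trans)
        thus "I (f i) + I (f j) \<le> 2 * (m + 1)" by (smt (verit))
        have "e powr r / (2 * (C + 1)) = 2 * (e powr r / (4 * (C + 1)))" using C(1) by (simp add: field_simps)
        moreover have "I (f i) < m + e powr r / (4 * (C + 1))" "I (f j) < m + e powr r / (4 * (C + 1))"
          using less_trans[OF f(3) add_strict_left_mono[OF N]] ij by blast+
        ultimately show "I (f i) + I (f j) - 2 * I h \<le> e powr r / (2 * (C + 1))"
          using mh by (smt (verit))
      qed (use d C in auto)
      also have "d * (2 * (m + 1)) = e powr r / 2"
      proof -
        have "m + 1 \<noteq> 0" using m0 by simp
        thus ?thesis unfolding d_def by (simp add: divide_simps)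
      qed
      also have "C * (e powr r / (2 * (C + 1))) < e powr r / 2"
        using C e by (simp add: field_simps)
      finally have "lp_norm M r (f i - f j) powr r < e powr r" by (simp only: I field_sum_of_halves)
      thus ?thesis using e r powr_mono2[of r e "lp_norm M r (f i - f j)"] by linarith
    qed
    thus ?thesis by blast
  qed
  obtain g where g: "g \<in> V" "(\<lambda>n. lp_norm M r (f n - g)) \<longlonglongrightarrow> 0"
    by (rule mcompleteD[OF complete f(1) cau])
  have "\<phi> g = 1"
  proof -
    have "(\<lambda>n. dual_norm V (lp_norm M r) \<phi> * lp_norm M r (f n - g)) \<longlonglongrightarrow> dual_norm V (lp_norm M r) \<phi> * 0"
      by (intro tendsto_intros g)
    moreover have "norm (1 - \<phi> g) \<le> dual_norm V (lp_norm M r) \<phi> * lp_norm M r (f n - g)" for n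
      using dual_norm_bound[OF phi mem_diff[OF f(1) g(1)], of n] dual_space_diff[OF phi f(1) g(1), of n] f(2) by simp
    ultimately have "norm (1 - \<phi> g) \<le> 0" by (intro tendsto_lowerbound) auto
    thus ?thesis by simp
  qed
  moreover have "I g \<le> m"
  proof -
    have "(\<lambda>n. lp_norm M r (f n - g) + (m + 1 / (real n + 1)) powr (1 / r)) \<longlonglongrightarrow> 0 + (m + 0) powr (1 / r)"
    proof (intro tendsto_add g)
      have "(\<lambda>n. 1 / (real n + 1)) \<longlonglongrightarrow> 0" using LIMSEQ_inverse_real_of_nat by (simp add: inverse_eq_divide add.commute)
      thus "(\<lambda>n. (m + 1 / (real n + 1)) powr (1 / r)) \<longlonglongrightarrow> (m + 0) powr (1 / r)"
        using r m0 by (intro tendsto_powr2 tendsto_intros) auto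
    qed
    moreover have "lp_norm M r g \<le> lp_norm M r (f n - g) + (m + 1 / (real n + 1)) powr (1 / r)" for n
    proof -
      have "lp_norm M r (f n) \<le> (m + 1 / (real n + 1)) powr (1 / r)"
        using r f(3)[of n] I0[of "f n"] unfolding lp_norm_def I_def by (intro powr_mono2) auto
      thus ?thesis using norm_triangle[OF g(1) f(1) mem_zero, of n] norm_diff_commute[OF g(1) f(1), of n] by simp
    qed
    ultimately have "lp_norm M r g \<le> m powr (1 / r)" by (intro tendsto_lowerbound[where f="\<lambda>n. lp_norm M r (f n - g) + (m + 1 / (real n + 1)) powr (1 / r)"]) auto
    hence "lp_norm M r g powr r \<le> (m powr (1 / r)) powr r" using r lp_norm_nonneg by (intro powr_mono2) auto
    thus ?thesis using r m0 by (simp add: I powr_powr)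
  qed
  ultimately show ?thesis using that[of g] g(1) m by (force simp: I_def)
qed

text \<open>The element \<open>f\<close> of least norm on the hyperplane \<open>\<phi> = 1\<close>
  satisfies the Euler-Lagrange equation: pairing with \<open>lp_dual_map r (f z)\<close> annihilates
  the kernel of \<open>\<phi>\<close>, hence is a multiple of \<open>\<phi>\<close>. The form of
  \<open>h\<close> is part of the conclusion because it makes \<open>h\<close> continuous whenever
  \<open>f\<close> is.\<close>

theorem Riesz:
  assumes pq: "1 < s" "1 / r + 1 / s = 1" and phi: "\<phi> \<in> dual_space V (lp_norm M r)"
  obtains f c h where "f \<in> V" "h = (\<lambda>z. c * lp_dual_map r (f z))" "h \<in> lp_space M s"
    "lp_norm M s h \<le> dual_norm V (lp_norm M r) \<phi>"
    "\<And>u. u \<in> V \<Longrightarrow> \<phi> u = (LINT z|M. u z * cnj (h z))"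
proof (cases "\<forall>u\<in>V. \<phi> u = 0")
  case True
  have "(\<lambda>z. 0) \<in> lp_space M s" using lp_space_zero[of M s] by (simp add: zero_fun_def)
  moreover have "lp_norm M s (\<lambda>z. 0) = 0" by (simp add: lp_norm_def)
  ultimately show ?thesis
    using that[of 0 "\<lambda>z. 0" 0] mem_zero True dual_norm_nonneg[OF phi] by auto
next
  case False
  then obtain u0 where u0: "u0 \<in> V" "\<phi> u0 \<noteq> 0" by blast
  have "\<phi> (fscale (1 / \<phi> u0) u0) = 1" "fscale (1 / \<phi> u0) u0 \<in> V"
    using dual_space_fscale[OF phi u0(1)] u0 mem_fscale by auto
  note r = exponent
  then obtain f where f: "f \<in> V" "\<phi> f = 1"
    and min: "\<And>v. v \<in> V \<Longrightarrow> \<phi> v = 1 \<Longrightarrow> (LINT x|M. cmod (f x) powr r) \<le> (LINT x|M. cmod (v x) powr r)"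
    using ex_min_norm[OF phi \<open>fscale (1 / \<phi> u0) u0 \<in> V\<close> \<open>\<phi> (fscale (1 / \<phi> u0) u0) = 1\<close>] by blast
  define J where "J = lp_dual_map r"
  note [measurable] = borel_measurable_lp_dual_map[OF r]
  have meas: "g \<in> borel_measurable M" if "g \<in> V" for g using that sub_lp lp_spaceD(1) by blast
  have int: "integrable M (\<lambda>x. cmod (g x) powr r)" if "g \<in> V" for g using that sub_lp lp_spaceD(2) by blast
  have intJ: "integrable M (\<lambda>x. u x * cnj (J (g x)))" if "u \<in> V" "g \<in> V" for u g
    using lp_Holder_cnj(1)[OF r pq _ lp_dual_map_mem(1)[OF r pq]] that sub_lp by (auto simp: J_def)
  \<comment> \<open>The tangent inequality is taken at the perturbed function \<open>w n\<close>,
    not at \<open>f\<close>. Minimality of \<open>f\<close> then gives the sign for each positive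
    \<open>t n\<close> without differentiating under the integral, and dominated convergence removes
    the perturbation.\<close>
  have EL1: "0 \<le> Re (LINT x|M. v x * cnj (J (f x)))" if v: "v \<in> V" "\<phi> v = 0" for v
  proof -
    define t where "t = (\<lambda>n::nat. 1 / (real n + 1))"
    have t: "0 < t n" "t n \<le> 1" for n by (auto simp: t_def)
    have t0: "t \<longlonglongrightarrow> 0" unfolding t_def using LIMSEQ_inverse_real_of_nat by (simp add: inverse_eq_divide add.commute)
    define w where "w = (\<lambda>n. f + fscale (of_real (t n)) v)"
    have w: "w n \<in> V" "w n x = f x + t n * v x" for n x
      using f v mem_add mem_fscale by (auto simp: w_def fscale_def)
    have pos: "0 \<le> Re (LINT x|M. v x * cnj (J (w n x)))" for n
    proof -
      have "\<phi> (w n) = 1" unfolding w_def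
        using dual_space_add[OF phi f(1) mem_fscale[OF v(1)]] dual_space_fscale[OF phi v(1)] f v by simp
      hence "(LINT x|M. cmod (f x) powr r) \<le> (LINT x|M. cmod (w n x) powr r)" using min w by blast
      moreover have "(LINT x|M. cmod (w n x) powr r - r * t n * Re (v x * cnj (J (w n x)))) \<le> (LINT x|M. cmod (f x) powr r)"
      proof (rule integral_mono[OF _ int[OF f(1)]])
        show "integrable M (\<lambda>x. cmod (w n x) powr r - r * t n * Re (v x * cnj (J (w n x))))"
          using int[OF w(1)] intJ[OF v(1) w(1), of n] by (intro Bochner_Integration.integrable_diff integrable_mult_right integrable_Re) auto
        show "cmod (w n x) powr r - r * t n * Re (v x * cnj (J (w n x))) \<le> cmod (f x) powr r" for x
          using cmod_powr_tangent[OF r, of "w n x" "f x"] by (simp add: J_def w(2) algebra_simps)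
      qed
      moreover have "(LINT x|M. cmod (w n x) powr r - r * t n * Re (v x * cnj (J (w n x))))
          = (LINT x|M. cmod (w n x) powr r) - r * t n * Re (LINT x|M. v x * cnj (J (w n x)))"
      proof -
        note iv = intJ[OF v(1) w(1), of n]
        have "(LINT x|M. cmod (w n x) powr r - r * t n * Re (v x * cnj (J (w n x))))
          = (LINT x|M. cmod (w n x) powr r) - (LINT x|M. r * t n * Re (v x * cnj (J (w n x))))"
          by (rule Bochner_Integration.integral_diff[OF int[OF w(1)] integrable_mult_right[OF integrable_Re[OF iv]]])
        also have "(LINT x|M. r * t n * Re (v x * cnj (J (w n x)))) = r * t n * Re (LINT x|M. v x * cnj (J (w n x)))"
          unfolding integral_Re[OF iv, symmetric] by (rule integral_mult_right_zero)
        finally show ?thesis .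
      qed
      ultimately have "0 \<le> r * t n * Re (LINT x|M. v x * cnj (J (w n x)))" by linarith
      moreover have "0 < r * t n" using t(1)[of n] r by simp
      ultimately show ?thesis using zero_le_mult_iff[of "r * t n"] by (smt (verit))
    qed
    have "(\<lambda>n. LINT x|M. v x * cnj (J (w n x))) \<longlonglongrightarrow> (LINT x|M. v x * cnj (J (f x)))"
    proof (rule integral_dominated_convergence[where w="\<lambda>x. (cmod (f x) + cmod (v x)) powr (r - 1) * cmod (v x)"])
      have "(\<lambda>x. of_real (cmod (f x)) + of_real (cmod (v x)) :: complex) \<in> lp_space M r"
        using lp_space_add[OF r, of "\<lambda>x. of_real (cmod (f x))" M "\<lambda>x. of_real (cmod (v x))"] meas[OF f(1)] meas[OF v(1)] int[OF f(1)] int[OF v(1)]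
        by (auto simp: lp_space_def plus_fun_def)
      hence "integrable M (\<lambda>x. cmod (v x * cnj (J (of_real (cmod (f x)) + of_real (cmod (v x))))))"
        using lp_Holder_cnj(1)[OF r pq, of v M] lp_dual_map_mem(1)[OF r pq] v sub_lp by (intro integrable_norm) (auto simp: J_def)
      moreover have "cmod (complex_of_real (cmod (f x)) + complex_of_real (cmod (v x))) = cmod (f x) + cmod (v x)" for x
        by (metis abs_of_nonneg add_nonneg_nonneg norm_ge_zero norm_of_real of_real_add)
      ultimately show "integrable M (\<lambda>x. (cmod (f x) + cmod (v x)) powr (r - 1) * cmod (v x))"
        by (simp add: norm_mult J_def cmod_lp_dual_map mult.commute)
      show "AE x in M. (\<lambda>n. v x * cnj (J (w n x))) \<longlonglongrightarrow> v x * cnj (J (f x))"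
      proof (rule AE_I2)
        fix x
        have "(\<lambda>n. f x + t n * v x) \<longlonglongrightarrow> f x + complex_of_real 0 * v x" by (intro tendsto_intros t0)
        hence "(\<lambda>n. w n x) \<longlonglongrightarrow> f x" by (simp add: w)
        moreover have "isCont J (f x)" using continuous_on_lp_dual_map[OF r, of UNIV] by (simp add: J_def continuous_on_eq_continuous_at)
        ultimately have "(\<lambda>n. J (w n x)) \<longlonglongrightarrow> J (f x)" using isCont_tendsto_compose by blast
        thus "(\<lambda>n. v x * cnj (J (w n x))) \<longlonglongrightarrow> v x * cnj (J (f x))" by (intro tendsto_intros)
      qed
      fix n
      have "cmod (w n x) \<le> cmod (f x) + cmod (v x)" for x
      proof -
        have "cmod (w n x) \<le> cmod (f x) + t n * cmod (v x)"
          using norm_triangle_ineq[of "f x" "t n * v x"] t(1)[of n] by (simp add: w norm_mult)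
        thus ?thesis using mult_right_mono[OF t(2)[of n], of "cmod (v x)"] by simp
      qed
      hence "cmod (w n x) powr (r - 1) * cmod (v x) \<le> (cmod (f x) + cmod (v x)) powr (r - 1) * cmod (v x)" for x
        using r by (intro mult_right_mono powr_mono2) auto
      thus "AE x in M. norm (v x * cnj (J (w n x))) \<le> (cmod (f x) + cmod (v x)) powr (r - 1) * cmod (v x)"
        by (auto simp: norm_mult J_def cmod_lp_dual_map mult.commute)
    qed (use intJ[OF v(1) f(1)] intJ[OF v(1) w(1)] in auto)
    hence "(\<lambda>n. Re (LINT x|M. v x * cnj (J (w n x)))) \<longlonglongrightarrow> Re (LINT x|M. v x * cnj (J (f x)))" by (rule tendsto_Re)
    thus ?thesis using pos by (intro LIMSEQ_le_const) auto
  qed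
  have EL: "(LINT x|M. v x * cnj (J (f x))) = 0" if v: "v \<in> V" "\<phi> v = 0" for v
  proof -
    \<comment> \<open>The multiples of \<open>v\<close> by 1, -1, \<open>\<i>\<close> and
      \<open>-\<i>\<close> turn the one-sided inequality into vanishing.\<close>
    have c: "0 \<le> Re (c * (LINT x|M. v x * cnj (J (f x))))" for c
      using EL1[of "fscale c v"] dual_space_fscale[OF phi v(1)] mem_fscale[OF v(1)] v by (simp add: fscale_def mult.assoc)
    show ?thesis using c[of 1] c[of "-1"] c[of \<i>] c[of "-\<i>"] by (simp add: complex_eq_iff)
  qed
  define m where "m = (LINT x|M. cmod (f x) powr r)"
  have "f \<noteq> 0" using f(2) dual_space_zero[OF phi] by auto
  hence N: "lp_norm M r f > 0" using norm_eq_0[OF f(1)] lp_norm_nonneg[of M r f] by simp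
  have m: "m = lp_norm M r f powr r" "m > 0" using r N by (simp_all add: m_def lp_norm_powr[symmetric])
  define h where "h = (\<lambda>z. complex_of_real (1 / m) * lp_dual_map r (f z))"
  have hs: "h = fscale (of_real (1 / m)) (\<lambda>z. lp_dual_map r (f z))" by (simp add: h_def fscale_def)
  have fl: "f \<in> lp_space M r" using f sub_lp by blast
  show ?thesis
  proof (rule that[OF f(1) h_def])
    show "h \<in> lp_space M s" unfolding hs by (intro lp_space_fscale lp_dual_map_mem[OF r pq fl])
    \<comment> \<open>The norm of \<open>h\<close> turns out to be \<open>1 / lp_norm M r f\<close>,
      and \<open>\<phi> f = 1\<close> bounds this by the dual norm.\<close>
    have "lp_norm M s h = (1 / m) * lp_norm M r f powr (r - 1)"
      unfolding hs using pq m(2) by (subst lp_norm_fscale) (auto simp: lp_dual_map_mem[OF r pq fl] norm_divide)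
    also have "\<dots> = 1 / lp_norm M r f" using N by (simp add: m(1) powr_diff)
    also have "\<dots> \<le> dual_norm V (lp_norm M r) \<phi>" using dual_norm_bound[OF phi f(1)] f(2) N by (simp add: divide_le_eq)
    finally show "lp_norm M s h \<le> dual_norm V (lp_norm M r) \<phi>" .
    fix u assume u: "u \<in> V"
    define v where "v = u - fscale (\<phi> u) f"
    have v: "v \<in> V" "\<phi> v = 0" using u f mem_diff mem_fscale dual_space_diff[OF phi] dual_space_fscale[OF phi f(1)] by (auto simp: v_def)
    have "0 = (LINT x|M. u x * cnj (J (f x)) - \<phi> u * (f x * cnj (J (f x))))"
      using EL[OF v] by (simp add: v_def fscale_def left_diff_distrib mult.assoc)
    also have "\<dots> = (LINT x|M. u x * cnj (J (f x))) - \<phi> u * (LINT x|M. f x * cnj (J (f x)))"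
      using intJ[OF u f(1)] intJ[OF f(1) f(1)] by (subst Bochner_Integration.integral_diff) auto
    also have "(LINT x|M. f x * cnj (J (f x))) = of_real m" by (simp add: J_def mult_cnj_lp_dual_map m_def)
    finally have "(LINT x|M. u x * cnj (J (f x))) = \<phi> u * of_real m" by simp
    moreover have "(LINT z|M. u z * cnj (h z)) = (LINT z|M. of_real (1 / m) * (u z * cnj (J (f z))))"
      by (simp add: h_def J_def mult_ac)
    ultimately show "\<phi> u = (LINT z|M. u z * cnj (h z))" using m(2) by simp
  qed
qed

end

section \<open>Averages over the torus\<close>

lemma nn_integral_lborel_translate:
  fixes f :: "'a::euclidean_space \<Rightarrow> ennreal"
  assumes "f \<in> borel_measurable borel"
  shows "(\<integral>\<^sup>+x. f (c + x) \<partial>lborel) = (\<integral>\<^sup>+x. f x \<partial>lborel)"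
proof -
  have "(\<integral>\<^sup>+x. f x \<partial>lborel) = (\<integral>\<^sup>+x. f x \<partial>distr lborel borel ((+) c))" by (simp add: lborel_distr_plus)
  also have "\<dots> = (\<integral>\<^sup>+x. f (c + x) \<partial>lborel)" using assms by (subst nn_integral_distr) auto
  finally show ?thesis by simp
qed

text \<open>
  A translation-invariant measure is determined by its value on a ball: evaluate the double integral of
  the product of the indicator functions of \<open>A\<close> and of the ball in both orders.
\<close>

lemma lborel_distr_isometry:
  fixes f :: "'a::euclidean_space \<Rightarrow> 'a"
  assumes lin: "linear f" and iso: "\<And>x. norm (f x) = norm x"
  shows "distr lborel borel f = lborel"
proof -
  \<comment> \<open>The double integral does not compare \<open>h\<close> with the identity but with
    the reflection, whose value is the same for every isometry \<open>h\<close>. Taking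
    \<open>h = id\<close> as well cancels it.\<close>
  have refl: "emeasure lborel {x. h x \<in> A} = emeasure lborel {x. - x \<in> A}"
    if A[measurable]: "A \<in> sets borel" and h: "linear h" "\<And>x. norm (h x) = norm x" for A and h :: "'a \<Rightarrow> 'a"
  proof -
    define B where "B = ball (0::'a) 1"
    have B: "emeasure lborel B \<noteq> 0" "emeasure lborel B \<noteq> \<infinity>"
      using content_ball_pos[of 1 "0::'a"] emeasure_lborel_ball_finite[of "0::'a" 1] 
      by (auto simp: B_def measure_def)
    have [measurable]: "B \<in> sets borel" by (simp add: B_def)
    have [measurable]: "h \<in> borel_measurable borel"
      using linear_continuous_on[of h UNIV] h(1) by (intro borel_measurable_continuous_onI) (auto simp: linear_conv_bounded_linear)
    have inj: "inj h" using h linear_injective_0[OF h(1)] by (metis norm_eq_zero)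
    hence surj: "surj h" using linear_injective_imp_surjective[OF h(1)] by blast
    define g where "g = inv h"
    have g: "h (g y) = y" for y using surj by (simp add: g_def surj_f_inv_f)
    let ?a = "indicator A :: 'a \<Rightarrow> ennreal" and ?b = "indicator B :: 'a \<Rightarrow> ennreal"
    have hB: "?b (h x) = ?b x" for x by (simp add: B_def indicator_def h)
    have "emeasure lborel {x. h x \<in> A} * emeasure lborel B = (\<integral>\<^sup>+x. ?a (h x) * (\<integral>\<^sup>+y. ?b y \<partial>lborel) \<partial>lborel)"
    proof -
      have "(\<integral>\<^sup>+x. ?a (h x) \<partial>lborel) = emeasure lborel {x. h x \<in> A}"
      proof -
        have "{x. h x \<in> A} \<in> sets lborel" by measurable
        hence "emeasure lborel {x. h x \<in> A} = (\<integral>\<^sup>+x. indicator {x. h x \<in> A} x \<partial>lborel)" by (rule nn_integral_indicator[symmetric])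
        thus ?thesis by (simp add: indicator_def)
      qed
      thus ?thesis by (simp add: nn_integral_multc)
    qed
    also have "\<dots> = (\<integral>\<^sup>+x. (\<integral>\<^sup>+y. ?a (h x) * ?b (h x + y) \<partial>lborel) \<partial>lborel)"
    proof (rule nn_integral_cong)
      fix x
      have "(\<integral>\<^sup>+y. ?b y \<partial>lborel) = (\<integral>\<^sup>+y. ?b (h x + y) \<partial>lborel)" by (rule nn_integral_lborel_translate[symmetric]) measurable
      thus "?a (h x) * (\<integral>\<^sup>+y. ?b y \<partial>lborel) = (\<integral>\<^sup>+y. ?a (h x) * ?b (h x + y) \<partial>lborel)"
        by (simp add: nn_integral_cmult)
    qed
    also have "\<dots> = (\<integral>\<^sup>+y. (\<integral>\<^sup>+x. ?a (h x) * ?b (h x + y) \<partial>lborel) \<partial>lborel)"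
      by (rule lborel_pair.Fubini'[symmetric]) measurable
    \<comment> \<open>Translating \<open>x\<close> by \<open>- g y\<close>, a preimage of
      \<open>- y\<close> under \<open>h\<close>, moves the shift from the ball to
      \<open>A\<close>.\<close>
    also have "\<dots> = (\<integral>\<^sup>+y. (\<integral>\<^sup>+x. ?a (h x - y) * ?b (h x) \<partial>lborel) \<partial>lborel)"
    proof (rule nn_integral_cong)
      fix y
      have "(\<integral>\<^sup>+x. ?a (h x) * ?b (h x + y) \<partial>lborel) = (\<integral>\<^sup>+x. ?a (h (- g y + x)) * ?b (h (- g y + x) + y) \<partial>lborel)"
        by (rule nn_integral_lborel_translate[symmetric]) measurable
      moreover have "h (- g y + x) = h x - y" for x
        using linear_add[OF h(1), of "- g y" x] linear_neg[OF h(1)] by (simp add: g)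
      ultimately show "(\<integral>\<^sup>+x. ?a (h x) * ?b (h x + y) \<partial>lborel) = (\<integral>\<^sup>+x. ?a (h x - y) * ?b (h x) \<partial>lborel)"
        by simp
    qed
    also have "\<dots> = (\<integral>\<^sup>+x. (\<integral>\<^sup>+y. ?a (h x - y) * ?b (h x) \<partial>lborel) \<partial>lborel)"
      by (rule lborel_pair.Fubini') measurable
    also have "\<dots> = (\<integral>\<^sup>+x. (\<integral>\<^sup>+y. ?a (- y) \<partial>lborel) * ?b x \<partial>lborel)"
    proof (rule nn_integral_cong)
      fix x
      have "(\<integral>\<^sup>+y. ?a (h x - y) \<partial>lborel) = (\<integral>\<^sup>+y. ?a (h x - (h x + y)) \<partial>lborel)"
        by (rule nn_integral_lborel_translate[symmetric]) measurable
      thus "(\<integral>\<^sup>+y. ?a (h x - y) * ?b (h x) \<partial>lborel) = (\<integral>\<^sup>+y. ?a (- y) \<partial>lborel) * ?b x"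
        by (simp add: nn_integral_multc hB)
    qed
    also have "\<dots> = emeasure lborel {x. - x \<in> A} * emeasure lborel B"
    proof -
      have "(\<integral>\<^sup>+y. ?a (- y) \<partial>lborel) = emeasure lborel {x. - x \<in> A}"
      proof -
        have "{x. - x \<in> A} \<in> sets lborel" by measurable
        hence "emeasure lborel {x. - x \<in> A} = (\<integral>\<^sup>+x. indicator {x. - x \<in> A} x \<partial>lborel)" by (rule nn_integral_indicator[symmetric])
        thus ?thesis by (simp add: indicator_def)
      qed
      thus ?thesis by (simp add: nn_integral_cmult)
    qed
    finally have "emeasure lborel B * emeasure lborel {x. h x \<in> A} = emeasure lborel B * emeasure lborel {x. - x \<in> A}"
      by (simp only: mult.commute)
    thus ?thesis using B by (auto simp: ennreal_mult_cancel_left)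
  qed
  have [measurable]: "f \<in> borel_measurable borel"
    using linear_continuous_on[of f UNIV] lin by (intro borel_measurable_continuous_onI) (auto simp: linear_conv_bounded_linear)
  show ?thesis
  proof (rule measure_eqI)
    fix A assume "A \<in> sets (distr lborel borel f)"
    hence A: "A \<in> sets borel" by simp
    have "emeasure (distr lborel borel f) A = emeasure lborel {x. f x \<in> A}"
      using A by (subst emeasure_distr) (auto simp: vimage_def)
    also have "\<dots> = emeasure lborel {x. id x \<in> A}"
      using refl[OF A lin iso] refl[OF A linear_id] by simp
    finally show "emeasure (distr lborel borel f) A = emeasure lborel A" by simp
  qed simp
qed

lemma borel_measurable_vec:
  fixes f :: "'b \<Rightarrow> complex ^ 'n"
  assumes "\<And>j. (\<lambda>x. f x $ j) \<in> borel_measurable M"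
  shows "f \<in> borel_measurable M"
proof -
  have "f = (\<lambda>x. \<Sum>j\<in>UNIV. axis j (f x $ j))"
    by (auto simp: fun_eq_iff vec_eq_iff axis_def)
  moreover have "continuous_on UNIV (axis j :: complex \<Rightarrow> complex ^ 'n)" for j
    unfolding axis_def 
  proof (intro continuous_on_vec_lambda)
    show "continuous_on UNIV (\<lambda>x. if i = j then x else 0 :: complex)" for i by (cases "i = j") auto
  qed
  hence "(\<lambda>x. axis j (f x $ j) :: complex ^ 'n) \<in> borel_measurable M" for j
    by (intro borel_measurable_continuous_on[OF _ assms])
  ultimately show ?thesis using borel_measurable_sum[of UNIV "\<lambda>j x. axis j (f x $ j)" M] by simp
qed

section \<open>The torus, its characters and the coordinate hyperplanes\<close>

definition torus :: "(complex ^ 'n) set" where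
  "torus = {u. \<forall>j. cmod (u $ j) = 1}"

text \<open>On \<open>torus\<close> this is the group inverse. On all of \<open>\<complex>^n\<close>
  it is a real-linear isometry.\<close>

definition cnj_vec :: "complex ^ 'n \<Rightarrow> complex ^ 'n" where
  "cnj_vec z = (\<chi> j. cnj (z $ j))"

text \<open>The set on which every Laurent monomial is defined and nonzero; it is open, dense and of
  full measure.\<close>

definition nonzero_coords :: "(complex ^ 'n) set" where
  "nonzero_coords = {z. \<forall>j. z $ j \<noteq> 0}"

text \<open>The monomial without the cutoff in \<open>e_mono\<close>; restricted to
  \<open>torus\<close> it is a character.\<close>

definition zpow :: "int ^ 'n \<Rightarrow> complex ^ 'n \<Rightarrow> complex" where
  "zpow \<alpha> z = (\<Prod>j\<in>UNIV. (z $ j) powi (\<alpha> $ j))"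

lemma cnj_vec_nth [simp]: "cnj_vec z $ j = cnj (z $ j)"
  by (simp add: cnj_vec_def)

lemma cnj_vec_cnj_vec [simp]: "cnj_vec (cnj_vec z) = z"
  by (simp add: vec_eq_iff)

lemma torus_nth: "u \<in> torus \<Longrightarrow> cmod (u $ j) = 1"
  by (simp add: torus_def)

lemma torus_nth_nonzero: "u \<in> torus \<Longrightarrow> u $ j \<noteq> 0"
  using torus_nth[of u j] by (auto simp del: norm_eq_zero)

lemma torus_one [simp]: "1 \<in> torus"
  and torus_mult: "u \<in> torus \<Longrightarrow> v \<in> torus \<Longrightarrow> u * v \<in> torus"
  and torus_cnj_vec [simp]: "cnj_vec u \<in> torus \<longleftrightarrow> u \<in> torus"
  by (auto simp: torus_def norm_mult)

lemma torus_mult_cnj_vec: "u \<in> torus \<Longrightarrow> u * cnj_vec u = 1"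
  by (auto simp: torus_def vec_eq_iff complex_norm_square[symmetric])

lemma mult_cnj_vec_cancel:
  assumes "u \<in> torus" shows "u * (cnj_vec u * z) = z" "cnj_vec u * (u * z) = z"
proof -
  have "u * (cnj_vec u * z) = (u * cnj_vec u) * z" "cnj_vec u * (u * z) = (u * cnj_vec u) * z"
    by (simp_all add: mult_ac)
  thus "u * (cnj_vec u * z) = z" "cnj_vec u * (u * z) = z" using torus_mult_cnj_vec[OF assms] by simp_all
qed

lemma norm_torus_mult: "u \<in> torus \<Longrightarrow> norm (u * z) = norm z"
  and norm_cnj_vec: "norm (cnj_vec z) = norm z"
  by (simp_all add: norm_vec_def torus_def norm_mult)

lemma linear_mult_vec: "linear (\<lambda>z :: complex ^ 'n. u * z)"
  and linear_cnj_vec: "linear (cnj_vec :: complex ^ 'n \<Rightarrow> _)"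
  by (rule linearI; simp add: vec_eq_iff algebra_simps)+

lemma continuous_on_mult_vec [continuous_intros]:
  fixes f g :: "'a::topological_space \<Rightarrow> complex ^ 'n"
  assumes "continuous_on S f" "continuous_on S g"
  shows "continuous_on S (\<lambda>x. f x * g x)"
proof -
  have eq: "(\<lambda>x. f x * g x) = (\<lambda>x. \<chi> j. f x $ j * g x $ j)" by (auto simp: vec_eq_iff)
  show ?thesis unfolding eq by (intro continuous_intros assms)
qed

lemma continuous_on_cnj_vec [continuous_intros]:
  "continuous_on S f \<Longrightarrow> continuous_on S (\<lambda>x. cnj_vec (f x :: complex ^ 'n))"
  unfolding cnj_vec_def by (intro continuous_intros)

lemma compact_torus: "compact (torus :: (complex ^ 'n) set)"
proof -
  have "closed (torus :: (complex ^ 'n) set)"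
    unfolding torus_def by (intro closed_Collect_all closed_Collect_eq continuous_intros)
  moreover have "norm u \<le> sqrt (real CARD('n))" if "u \<in> torus" for u :: "complex ^ 'n"
    using that by (simp add: torus_def norm_vec_def L2_set_def)
  ultimately show ?thesis by (auto simp: compact_eq_bounded_closed bounded_iff)
qed

lemma zpow_mult: "zpow \<alpha> (u * z) = zpow \<alpha> u * zpow \<alpha> z"
  by (simp add: zpow_def power_int_mult_distrib prod.distrib)

lemma zpow_zero [simp]: "zpow 0 z = 1"
  by (simp add: zpow_def)

lemma zpow_add: "z \<in> nonzero_coords \<Longrightarrow> zpow (\<alpha> + \<beta>) z = zpow \<alpha> z * zpow \<beta> z"
  by (simp add: zpow_def nonzero_coords_def power_int_add prod.distrib)

lemma zpow_uminus: "zpow (- \<alpha>) z = inverse (zpow \<alpha> z)"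
  using prod_inversef[of "\<lambda>j. (z $ j) powi (\<alpha> $ j)" UNIV] by (simp add: zpow_def power_int_minus o_def)

lemma zpow_cnj_vec: "zpow \<alpha> (cnj_vec z) = cnj (zpow \<alpha> z)"
  by (simp add: zpow_def)

lemma zpow_nonzero: "z \<in> nonzero_coords \<Longrightarrow> zpow \<alpha> z \<noteq> 0"
  by (simp add: zpow_def nonzero_coords_def)

lemma torus_subset_nonzero_coords: "u \<in> torus \<Longrightarrow> u \<in> nonzero_coords"
  by (simp add: nonzero_coords_def torus_nth_nonzero)

lemma cmod_zpow_torus: "u \<in> torus \<Longrightarrow> cmod (zpow \<alpha> u) = 1"
  by (simp add: zpow_def torus_def norm_power_int prod_norm[symmetric])

lemma zpow_uminus_torus: "u \<in> torus \<Longrightarrow> zpow (- \<alpha>) u = cnj (zpow \<alpha> u)"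
  using cmod_zpow_torus[of u \<alpha>] by (simp add: zpow_uminus inverse_complex_def complex_eq_iff cmod_def)

lemma continuous_on_zpow:
  assumes "S \<subseteq> nonzero_coords" shows "continuous_on S (zpow \<alpha>)"
  unfolding zpow_def using assms by (intro continuous_intros) (auto simp: nonzero_coords_def)

lemma open_nonzero_coords: "open (nonzero_coords :: (complex ^ 'n) set)"
proof -
  have "nonzero_coords = (\<Inter>j\<in>UNIV. {z :: complex ^ 'n. z $ j \<noteq> 0})" by (auto simp: nonzero_coords_def)
  moreover have "open (\<Inter>j\<in>UNIV. {z :: complex ^ 'n. z $ j \<noteq> 0})"
    by (intro open_INT ballI open_Collect_neq continuous_intros) auto
  ultimately show ?thesis by simp
qed

text \<open>The complex hyperplane \<open>z $ j = 0\<close> lies in the real hyperplane where the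
  real part of \<open>z $ j\<close> vanishes, which is negligible.\<close>

lemma AE_nonzero_coords: "AE z in lborel. (z :: complex ^ 'n) \<in> nonzero_coords"
proof -
  have "AE z in lborel. (z :: complex ^ 'n) $ j \<noteq> 0" for j
  proof -
    have "negligible {z :: complex ^ 'n. axis j 1 \<bullet> z = 0}" by (rule negligible_hyperplane) (simp add: axis_eq_0_iff)
    hence "negligible {z :: complex ^ 'n. z $ j = 0}"
      by (rule negligible_subset) (auto simp: inner_axis inner_commute)
    moreover have "closed {z :: complex ^ 'n. z $ j = 0}" by (intro closed_Collect_eq continuous_intros)
    ultimately have "{z :: complex ^ 'n. z $ j = 0} \<in> null_sets lborel"
      by (simp add: negligible_iff_null_sets null_sets_completion_iff borel_closed)
    thus ?thesis by (auto dest: AE_not_in)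
  qed
  hence "AE z in lborel. \<forall>j\<in>UNIV. (z :: complex ^ 'n) $ j \<noteq> 0" by (intro AE_finite_allI) auto
  thus ?thesis by (simp add: nonzero_coords_def)
qed

section \<open>Haar measure on the torus\<close>

text \<open>
  Junk value: \<open>sgn 0 = 0\<close> would leave the torus, hence the case distinction.
\<close>

definition phase :: "complex ^ 'n \<Rightarrow> complex ^ 'n" where
  "phase w = (\<chi> j. if w $ j = 0 then 1 else sgn (w $ j))"

text \<open>
  Obtaining the Haar measure of the torus from the uniform distribution on the ball reduces its
  invariance to that of Lebesgue measure.
\<close>

definition torus_measure :: "(complex ^ 'n) measure" where
  "torus_measure = distr (uniform_measure lborel (ball 0 1)) (restrict_space borel torus) phase"

lemma phase_torus: "phase w \<in> torus"
  by (simp add: phase_def torus_def norm_sgn)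

lemma measurable_phase [measurable]: "phase \<in> borel \<rightarrow>\<^sub>M restrict_space borel torus"
proof (rule measurable_restrict_space2)
  show "phase \<in> borel_measurable (borel :: (complex ^ 'n) measure)"
  proof (rule borel_measurable_vec)
    fix j
    have [measurable]: "(\<lambda>w :: complex ^ 'n. w $ j) \<in> borel_measurable borel"
      by (intro borel_measurable_continuous_onI continuous_intros)
    show "(\<lambda>w :: complex ^ 'n. phase w $ j) \<in> borel_measurable borel"
      unfolding phase_def sgn_div_norm by simp measurable
  qed
qed (simp add: phase_torus)

lemma space_torus_measure [simp]: "space torus_measure = torus"
  and sets_torus_measure [measurable_cong]: "sets torus_measure = sets (restrict_space borel torus)"
  by (simp_all add: torus_measure_def space_restrict_space)

lemma ball_positive_finite:
  "emeasure lborel (ball (0::complex ^ 'n) 1) \<noteq> 0" "emeasure lborel (ball (0::complex ^ 'n) 1) \<noteq> \<infinity>"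
  using content_ball_pos[of 1 "0::complex ^ 'n"] emeasure_lborel_ball_finite[of "0::complex ^ 'n" 1]
  by (auto simp: measure_def)

lemma emeasure_torus_measure:
  fixes A :: "(complex ^ 'n) set"
  assumes "A \<in> sets torus_measure"
  shows "emeasure torus_measure A = emeasure lborel (ball 0 1 \<inter> phase -` A) / emeasure lborel (ball (0::complex ^ 'n) 1)"
proof -
  have A: "A \<in> sets (restrict_space borel torus)" using assms by (simp add: sets_torus_measure)
  have "phase -` A \<in> sets (borel :: (complex ^ 'n) measure)" using measurable_sets[OF measurable_phase A] by simp
  thus ?thesis unfolding torus_measure_def using A by (subst emeasure_distr) (auto intro: measurable_phase)
qed

lemma emeasure_torus [simp]: "emeasure torus_measure (torus :: (complex ^ 'n) set) = 1"
proof -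
  have "(torus :: (complex ^ 'n) set) \<in> sets torus_measure" by (metis sets.top space_torus_measure)
  thus ?thesis using ball_positive_finite[where 'n='n] by (subst emeasure_torus_measure) (auto simp: phase_torus vimage_def intro!: ennreal_divide_self[OF _ top.not_eq_extremum[THEN iffD1]] simp flip: zero_less_iff_neq_zero)
qed

interpretation torus_measure: finite_measure "torus_measure :: (complex ^ 'n) measure"
  by (rule finite_measureI) simp

lemma measure_torus [simp]: "measure torus_measure (torus :: (complex ^ 'n) set) = 1"
  by (simp add: measure_def)

text \<open>\<open>L\<close> preserves Lebesgue measure and the unit ball, and it commutes with
  \<open>phase\<close> off the coordinate hyperplanes, which form a null set. So it preserves the
  image of the uniform distribution.\<close>

lemma torus_measure_invariant:
  fixes L :: "complex ^ 'n \<Rightarrow> complex ^ 'n"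
  assumes lin: "linear L" and iso: "\<And>x. norm (L x) = norm x"
    and Lt: "\<And>u. u \<in> torus \<Longrightarrow> L u \<in> torus" and ph: "\<And>w. w \<in> nonzero_coords \<Longrightarrow> phase (L w) = L (phase w)"
  shows "distr torus_measure torus_measure L = torus_measure"
proof (rule measure_eqI)
  have cont: "continuous_on UNIV L" using lin by (simp add: linear_continuous_on linear_conv_bounded_linear)
  have [measurable]: "L \<in> borel_measurable borel" using cont by (rule borel_measurable_continuous_onI)
  have LT: "L \<in> torus_measure \<rightarrow>\<^sub>M torus_measure"
    using Lt by (intro measurable_restrict_space3[THEN measurable_cong_sets[OF sets_torus_measure sets_torus_measure, THEN equalityD2, THEN subsetD]]) auto
  fix A assume "A \<in> sets (distr torus_measure torus_measure L)"
  hence A: "A \<in> sets torus_measure" by simp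
  have LA: "L -` A \<inter> torus \<in> sets torus_measure" using measurable_sets[OF LT A] by simp
  have pA: "phase -` B \<in> sets borel" if "B \<in> sets torus_measure" for B :: "(complex ^ 'n) set"
    using measurable_sets[OF measurable_phase, of B] that by (simp add: sets_torus_measure)
  have "emeasure (distr torus_measure torus_measure L) A = emeasure torus_measure (L -` A \<inter> torus)"
    using LT A by (simp add: emeasure_distr)
  also have "emeasure lborel (ball 0 1 \<inter> phase -` (L -` A \<inter> torus)) = emeasure lborel (L -` (ball 0 1 \<inter> phase -` A))"
  proof (rule emeasure_eq_AE)
    show "AE w in lborel. w \<in> ball 0 1 \<inter> phase -` (L -` A \<inter> torus) \<longleftrightarrow> w \<in> L -` (ball 0 1 \<inter> phase -` A)"
      using AE_nonzero_coords by eventually_elim (auto simp: iso ph phase_torus)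
    show "ball 0 1 \<inter> phase -` (L -` A \<inter> torus) \<in> sets lborel" using pA[OF LA] by auto
    show "L -` (ball 0 1 \<inter> phase -` A) \<in> sets lborel"
      using measurable_sets[of L borel borel "ball 0 1 \<inter> phase -` A"] pA[OF A] by auto
  qed
  hence "emeasure torus_measure (L -` A \<inter> torus) = emeasure lborel (L -` (ball 0 1 \<inter> phase -` A)) / emeasure lborel (ball (0::complex ^ 'n) 1)"
    unfolding emeasure_torus_measure[OF LA] by (rule arg_cong)
  also have "emeasure lborel (L -` (ball 0 1 \<inter> phase -` A)) = emeasure (distr lborel borel L) (ball 0 1 \<inter> phase -` A)"
    using pA[OF A] by (subst emeasure_distr) auto
  also have "\<dots> / emeasure lborel (ball (0::complex ^ 'n) 1) = emeasure torus_measure A"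
    by (simp add: lborel_distr_isometry[OF lin iso] emeasure_torus_measure[OF A])
  finally show "emeasure (distr torus_measure torus_measure L) A = emeasure torus_measure A" .
qed simp

lemma torus_measure_mult:
  assumes "(u :: complex ^ 'n) \<in> torus" shows "distr torus_measure torus_measure (\<lambda>v. u * v) = torus_measure"
proof (rule torus_measure_invariant)
  fix w :: "complex ^ 'n" assume "w \<in> nonzero_coords"
  thus "phase (u * w) = u * phase w"
    using assms by (simp add: phase_def vec_eq_iff nonzero_coords_def torus_nth_nonzero sgn_div_norm torus_nth norm_mult)
qed (use assms in \<open>auto intro: linear_mult_vec norm_torus_mult torus_mult\<close>)

lemma torus_measure_cnj: "distr torus_measure torus_measure cnj_vec = (torus_measure :: (complex ^ 'n) measure)"
proof (rule torus_measure_invariant)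
  fix w :: "complex ^ 'n" assume "w \<in> nonzero_coords"
  thus "phase (cnj_vec w) = cnj_vec (phase w)"
    by (auto simp: phase_def vec_eq_iff nonzero_coords_def sgn_div_norm)
qed (auto intro: linear_cnj_vec norm_cnj_vec)

lemma measurable_torus_mult: "(u :: complex ^ 'n) \<in> torus \<Longrightarrow> (\<lambda>v. u * v) \<in> torus_measure \<rightarrow>\<^sub>M torus_measure"
  and measurable_torus_cnj: "cnj_vec \<in> torus_measure \<rightarrow>\<^sub>M (torus_measure :: (complex ^ 'n) measure)"
proof -
  have meas: "(L :: complex ^ 'n \<Rightarrow> _) \<in> torus_measure \<rightarrow>\<^sub>M torus_measure" if "continuous_on UNIV L" "\<And>v. v \<in> torus \<Longrightarrow> L v \<in> torus" for L
    using that(2) borel_measurable_continuous_onI[OF that(1)]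
    unfolding measurable_cong_sets[OF sets_torus_measure sets_torus_measure]
    by (intro measurable_restrict_space3) auto
  show "(\<lambda>v. u * v) \<in> torus_measure \<rightarrow>\<^sub>M torus_measure" if "u \<in> torus"
  proof -
    have "continuous_on UNIV (\<lambda>v. u * v)" by (intro continuous_intros)
    thus ?thesis by (rule meas) (rule torus_mult[OF that])
  qed
  show "cnj_vec \<in> torus_measure \<rightarrow>\<^sub>M (torus_measure :: (complex ^ 'n) measure)"
    using continuous_on_cnj_vec[OF continuous_on_id[of UNIV]] by (intro meas) auto
qed

lemma integral_torus_mult:
  fixes f :: "complex ^ 'n \<Rightarrow> 'b::{banach, second_countable_topology}"
  assumes "u \<in> torus" "f \<in> borel_measurable torus_measure"
  shows "(LINT v|torus_measure. f (u * v)) = (LINT v|torus_measure. f v)"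
  using integral_distr[OF measurable_torus_mult[OF assms(1)] assms(2)] torus_measure_mult[OF assms(1)] by simp

lemma integral_torus_cnj:
  fixes f :: "complex ^ 'n \<Rightarrow> 'b::{banach, second_countable_topology}"
  assumes "f \<in> borel_measurable torus_measure"
  shows "(LINT v|torus_measure. f (cnj_vec v)) = (LINT v|torus_measure. f v)"
  using integral_distr[OF measurable_torus_cnj assms] torus_measure_cnj[where 'n='n] by simp

lemma borel_measurable_torus:
  assumes "continuous_on torus f"
  shows "f \<in> borel_measurable (torus_measure :: (complex ^ 'n) measure)"
  using borel_measurable_continuous_on_restrict[OF assms]
  by (simp add: measurable_cong_sets[OF sets_torus_measure refl])

lemma integrable_torus:
  fixes f :: "complex ^ 'n \<Rightarrow> 'b::{banach, second_countable_topology}"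
  assumes "continuous_on torus f"
  shows "integrable torus_measure f"
proof -
  have "compact (f ` torus)" by (rule compact_continuous_image[OF assms compact_torus])
  then obtain B where "\<And>u. u \<in> torus \<Longrightarrow> norm (f u) \<le> B" using compact_imp_bounded bounded_iff by (metis imageI)
  thus ?thesis by (intro torus_measure.integrable_const_bound[where B=B] borel_measurable_torus assms AE_I2) simp
qed

lemma continuous_on_zpow_torus [continuous_intros]: "continuous_on torus (zpow \<alpha>)"
  by (rule continuous_on_zpow) (auto intro: torus_subset_nonzero_coords)

text \<open>For a nonzero exponent, rotating one coordinate by the angle
  \<open>pi / \<alpha> $ j\<close> gives a torus element at which the character is -1. Invariance
  then makes the integral equal to its negative.\<close>

lemma integral_zpow_torus: "(LINT u|torus_measure. zpow \<alpha> u) = (if \<alpha> = 0 then 1 else 0)"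
proof (cases "\<alpha> = 0")
  case True
  thus ?thesis by (simp add: zpow_def)
next
  case False
  then obtain j where j: "\<alpha> $ j \<noteq> 0" by (auto simp: vec_eq_iff)
  define u where "u = (\<chi> i. if i = j then cis (pi / of_int (\<alpha> $ j)) else 1)"
  have u: "u \<in> torus" by (simp add: u_def torus_def)
  have "zpow \<alpha> u = (\<Prod>i\<in>UNIV. if i = j then - 1 else 1)"
    unfolding zpow_def using j by (intro prod.cong) (auto simp: u_def cis_power_int)
  also have "\<dots> = -1" by simp
  finally have mu: "zpow \<alpha> u = -1" .
  have "(LINT v|torus_measure. zpow \<alpha> v) = (LINT v|torus_measure. zpow \<alpha> (u * v))"
    by (rule integral_torus_mult[symmetric, OF u borel_measurable_torus]) (rule continuous_on_zpow_torus)
  also have "\<dots> = - (LINT v|torus_measure. zpow \<alpha> v)" by (simp add: zpow_mult mu)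
  finally show ?thesis using False by simp
qed

text \<open>The point \<open>u / (2 * norm u)\<close> lies in the unit ball and has phase
  \<open>u\<close>. Near it \<open>phase\<close> is continuous, so the preimage of \<open>G\<close>
  contains a nonempty open set.\<close>

lemma torus_measure_open_positive:
  assumes "open (G :: (complex ^ 'n) set)" "u \<in> G" "u \<in> torus"
  shows "measure torus_measure (G \<inter> torus) > 0"
proof -
  have Gs: "G \<inter> torus \<in> sets torus_measure"
    using assms(1) unfolding sets_torus_measure by (auto simp: sets_restrict_space intro!: image_eqI[of _ _ G])
  define W where "W = ball 0 1 \<inter> nonzero_coords \<inter> phase -` G"
  have "continuous_on nonzero_coords (phase :: complex ^ 'n \<Rightarrow> _)"
  proof -
    have "continuous_on nonzero_coords (\<lambda>w :: complex ^ 'n. \<chi> j. sgn (w $ j))"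
      unfolding nonzero_coords_def sgn_div_norm by (intro continuous_intros) auto
    thus ?thesis by (rule continuous_on_eq) (auto simp: phase_def nonzero_coords_def vec_eq_iff)
  qed
  hence W: "open W"
    unfolding W_def Int_assoc by (intro open_Int continuous_open_preimage open_nonzero_coords assms) auto
  define c where "c = 1 / (2 * norm u)"
  have "u \<noteq> 0" using torus_nth_nonzero[OF assms(3)] by auto
  hence c: "c > 0" "norm (c *\<^sub>R u) = 1/2" by (auto simp: c_def)
  have "phase (c *\<^sub>R u) = u"
    using c(1) torus_nth[OF assms(3)] torus_nth_nonzero[OF assms(3)] by (simp add: phase_def vec_eq_iff sgn_div_norm norm_scaleR)
  hence "c *\<^sub>R u \<in> W" using c assms torus_nth_nonzero[OF assms(3)] by (auto simp: W_def nonzero_coords_def)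
  hence W0: "emeasure lborel W \<noteq> 0"
  proof -
    obtain e where e: "e > 0" "ball (c *\<^sub>R u) e \<subseteq> W" using W \<open>c *\<^sub>R u \<in> W\<close> open_contains_ball by blast
    have "0 < emeasure lborel (ball (c *\<^sub>R u) e)"
      using content_ball_pos[OF e(1), of "c *\<^sub>R u"] by (auto simp: measure_def zero_less_iff_neq_zero)
    also have "\<dots> \<le> emeasure lborel W" using e W by (intro emeasure_mono) auto
    finally show ?thesis by simp
  qed
  have "emeasure lborel W \<le> emeasure lborel (ball 0 1 \<inter> phase -` (G \<inter> torus))"
    using measurable_sets[OF measurable_phase, of "G \<inter> torus"] Gs
    by (intro emeasure_mono) (auto simp: W_def phase_torus sets_torus_measure)
  hence "emeasure lborel (ball 0 1 \<inter> phase -` (G \<inter> torus)) \<noteq> 0" using W0 by auto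
  hence "emeasure torus_measure (G \<inter> torus) \<noteq> 0"
    using ball_positive_finite[where 'n='n] unfolding emeasure_torus_measure[OF Gs] by (simp add: ennreal_divide_eq_0_iff)
  thus ?thesis by (simp add: torus_measure.emeasure_eq_measure zero_less_measure_iff)
qed

section \<open>Trigonometric polynomials and kernels that concentrate at 1\<close>

definition trig_poly :: "(complex ^ 'n \<Rightarrow> complex) \<Rightarrow> bool" where
  "trig_poly P \<longleftrightarrow> (\<exists>A c. finite A \<and> (\<forall>u\<in>torus. P u = (\<Sum>\<alpha>\<in>A. c \<alpha> * zpow \<alpha> u)))"

lemma trig_poly_scale: "trig_poly P \<Longrightarrow> trig_poly (\<lambda>u. a * P u)"
proof -
  assume "trig_poly P"
  then obtain A c where "finite A" "\<forall>u\<in>torus. P u = (\<Sum>\<alpha>\<in>A. c \<alpha> * zpow \<alpha> u)" by (auto simp: trig_poly_def)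
  thus ?thesis unfolding trig_poly_def
    by (intro exI[of _ A] exI[of _ "\<lambda>\<alpha>. a * c \<alpha>"]) (auto simp: sum_distrib_left mult.assoc)
qed

lemma trig_poly_add:
  assumes "trig_poly P" "trig_poly Q" shows "trig_poly (\<lambda>u. P u + Q u)"
proof -
  obtain A c where A: "finite A" "\<forall>u\<in>torus. P u = (\<Sum>\<alpha>\<in>A. c \<alpha> * zpow \<alpha> u)" using assms by (auto simp: trig_poly_def)
  obtain B d where B: "finite B" "\<forall>u\<in>torus. Q u = (\<Sum>\<alpha>\<in>B. d \<alpha> * zpow \<alpha> u)" using assms by (auto simp: trig_poly_def)
  define e where "e = (\<lambda>\<alpha>. (if \<alpha> \<in> A then c \<alpha> else 0) + (if \<alpha> \<in> B then d \<alpha> else 0))"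
  have "P u + Q u = (\<Sum>\<alpha>\<in>A \<union> B. e \<alpha> * zpow \<alpha> u)" if "u \<in> torus" for u
  proof -
    have "(\<Sum>\<alpha>\<in>A. c \<alpha> * zpow \<alpha> u) = (\<Sum>\<alpha>\<in>A \<union> B. (if \<alpha> \<in> A then c \<alpha> else 0) * zpow \<alpha> u)"
      using A(1) B(1) by (intro sum.mono_neutral_cong_left) auto
    moreover have "(\<Sum>\<alpha>\<in>B. d \<alpha> * zpow \<alpha> u) = (\<Sum>\<alpha>\<in>A \<union> B. (if \<alpha> \<in> B then d \<alpha> else 0) * zpow \<alpha> u)"
      using A(1) B(1) by (intro sum.mono_neutral_cong_left) auto
    ultimately show ?thesis using A(2) B(2) that by (simp add: e_def distrib_right sum.distrib)
  qed
  thus ?thesis unfolding trig_poly_def using A(1) B(1) by (intro exI[of _ "A \<union> B"] exI[of _ e]) auto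
qed

lemma trig_poly_mult_zpow:
  assumes "trig_poly P" shows "trig_poly (\<lambda>u. zpow \<beta> u * P u)"
proof -
  obtain A c where A: "finite A" "\<forall>u\<in>torus. P u = (\<Sum>\<alpha>\<in>A. c \<alpha> * zpow \<alpha> u)" using assms by (auto simp: trig_poly_def)
  have "zpow \<beta> u * P u = (\<Sum>\<alpha>\<in>(+) \<beta> ` A. c (\<alpha> - \<beta>) * zpow \<alpha> u)" if "u \<in> torus" for u
    using A that by (simp add: sum.reindex sum_distrib_left zpow_add torus_subset_nonzero_coords mult_ac)
  thus ?thesis unfolding trig_poly_def using A(1)
    by (intro exI[of _ "(+) \<beta> ` A"] exI[of _ "\<lambda>\<alpha>. c (\<alpha> - \<beta>)"]) auto
qed

lemma trig_poly_sum:
  "finite J \<Longrightarrow> (\<And>j. j \<in> J \<Longrightarrow> trig_poly (P j)) \<Longrightarrow> trig_poly (\<lambda>u. \<Sum>j\<in>J. P j u)"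
proof (induction J rule: finite_induct)
  case empty
  show ?case unfolding trig_poly_def by (intro exI[of _ "{}"]) auto
next
  case (insert x F)
  thus ?case using trig_poly_add by fastforce
qed

lemma trig_poly_one: "trig_poly (\<lambda>u. 1)"
  unfolding trig_poly_def by (intro exI[of _ "{0}"] exI[of _ "\<lambda>_. 1"]) simp

text \<open>The mean of the real parts, moved from the range -1 to 1 into the range 0 to 1.
  Nonnegativity on the torus makes the normalised powers kernels of \<open>L^1\<close> norm 1, so
  averaging against them is a contraction.\<close>

definition peak :: "complex ^ 'n \<Rightarrow> real" where
  "peak u = 1/2 + (\<Sum>j\<in>UNIV. Re (u $ j)) / (2 * real CARD('n))"

lemma zpow_axis: "zpow (axis j k) u = (u $ j) powi k"
proof -
  have "zpow (axis j k) u = (\<Prod>i\<in>UNIV. if i = j then (u $ j) powi k else 1)"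
    unfolding zpow_def by (intro prod.cong) (auto simp: axis_def)
  thus ?thesis by simp
qed

text \<open>The real part of \<open>u $ j\<close> is the mean of \<open>u $ j\<close> and its
  inverse, so \<open>peak\<close> is a combination of characters. This holds only on the torus,
  which is why \<open>trig_poly\<close> asks for equality only there.\<close>

lemma trig_poly_peak_power: "trig_poly (\<lambda>u :: complex ^ 'n. of_real (peak u ^ N))"
proof (induction N)
  case 0
  thus ?case by (simp add: trig_poly_one)
next
  case (Suc N)
  let ?P = "\<lambda>u :: complex ^ 'n. complex_of_real (peak u ^ N)"
  \<comment> \<open>The weight \<open>1 / (2 n)\<close> of each coordinate in \<open>peak\<close>,
    times the 1/2 from the formula for the real part.\<close>
  let ?c = "1 / (4 * of_nat CARD('n)) :: complex"
  have "trig_poly (\<lambda>u. (1/2) * ?P u + (\<Sum>j\<in>UNIV. ?c * (zpow (axis j 1) u * ?P u) + ?c * (zpow (axis j (- 1)) u * ?P u)))"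
    by (intro trig_poly_add trig_poly_scale trig_poly_sum trig_poly_mult_zpow Suc) auto
  then obtain A c where A: "finite A" "\<And>u. u \<in> torus \<Longrightarrow> (1/2) * ?P u + (\<Sum>j\<in>UNIV. ?c * (zpow (axis j 1) u * ?P u) + ?c * (zpow (axis j (- 1)) u * ?P u)) = (\<Sum>\<alpha>\<in>A. c \<alpha> * zpow \<alpha> u)"
    by (auto simp: trig_poly_def)
  have "complex_of_real (peak u ^ Suc N) = (1/2) * ?P u + (\<Sum>j\<in>UNIV. ?c * (zpow (axis j 1) u * ?P u) + ?c * (zpow (axis j (- 1)) u * ?P u))"
    if "u \<in> torus" for u :: "complex ^ 'n"
  proof -
    have "inverse (u $ j) = cnj (u $ j)" for j
      using torus_nth[OF that, of j] by (simp add: inverse_complex_def complex_eq_iff cmod_def)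
    hence "zpow (axis j 1) u + zpow (axis j (- 1)) u = of_real (2 * Re (u $ j))" for j
      by (simp add: zpow_axis power_int_minus complex_eq_iff)
    hence "(\<Sum>j\<in>UNIV. ?c * (zpow (axis j 1) u * ?P u) + ?c * (zpow (axis j (- 1)) u * ?P u))
      = (\<Sum>j\<in>UNIV. ?c * ?P u * of_real (2 * Re (u $ j)))"
      by (intro sum.cong refl) (metis (no_types, lifting) distrib_left distrib_right mult.assoc mult.commute)
    also have "\<dots> = ?c * ?P u * of_real (2 * (\<Sum>j\<in>UNIV. Re (u $ j)))"
      by (simp only: sum_distrib_left of_real_sum)
    finally show ?thesis by (simp add: peak_def field_simps)
  qed
  hence "\<forall>u\<in>torus. complex_of_real (peak u ^ Suc N) = (\<Sum>\<alpha>\<in>A. c \<alpha> * zpow \<alpha> u)" using A(2) by simp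
  thus ?case using A(1) unfolding trig_poly_def by blast
qed

lemma continuous_on_peak [continuous_intros]: "continuous_on S peak"
  unfolding peak_def by (intro continuous_intros) auto

lemma peak_range:
  assumes "(u :: complex ^ 'n) \<in> torus"
  shows "0 \<le> peak u" "peak u \<le> 1" "peak u = 1 \<longleftrightarrow> u = 1"
proof -
  let ?n = "real CARD('n)"
  have n: "?n > 0" by simp
  have re: "\<bar>Re (u $ j)\<bar> \<le> 1" for j using abs_Re_le_cmod[of "u $ j"] torus_nth[OF assms, of j] by simp
  have "(\<Sum>j\<in>(UNIV::'n set). -1) \<le> (\<Sum>j\<in>UNIV. Re (u $ j))" using re by (intro sum_mono) (smt (verit))
  thus "0 \<le> peak u" using n by (simp add: peak_def field_simps)
  have "(\<Sum>j\<in>UNIV. Re (u $ j)) \<le> (\<Sum>j\<in>(UNIV::'n set). 1)" using re by (intro sum_mono) (smt (verit))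
  thus "peak u \<le> 1" using n by (simp add: peak_def field_simps)
  show "peak u = 1 \<longleftrightarrow> u = 1"
  proof
    assume "peak u = 1"
    hence "(\<Sum>j\<in>UNIV. 1 - Re (u $ j)) = 0" using n by (simp add: peak_def field_simps sum_subtractf)
    moreover have "0 \<le> 1 - Re (u $ j)" for j using re[of j] by simp
    ultimately have "1 - Re (u $ j) = 0" for j by (simp add: sum_nonneg_eq_0_iff)
    moreover have "(Re (u $ j))\<^sup>2 + (Im (u $ j))\<^sup>2 = 1" for j using torus_nth[OF assms, of j] by (simp add: cmod_def)
    ultimately show "u = 1" by (simp add: vec_eq_iff complex_eq_iff)
  qed (use n in \<open>simp add: peak_def\<close>)
qed

text \<open>
  \<open>peak_kernel N\<close> is a trigonometric polynomial of mean 1, and these kernels concentrate at 1, where \<open>peak\<close> has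
  its only maximum on the torus.
\<close>

definition peak_kernel :: "nat \<Rightarrow> complex ^ 'n \<Rightarrow> real" where
  "peak_kernel N u = peak u ^ N / (LINT v|torus_measure. peak (v :: complex ^ 'n) ^ N)"

text \<open>On the neighbourhood of 1 where \<open>peak\<close> exceeds \<open>\<rho>\<close> the
  integrand is at least \<open>\<rho> ^ N\<close>, and \<open>\<mu>\<close> is the mass of this
  neighbourhood. The normalising integrals thus decay no faster than \<open>\<rho> ^ N\<close> for
  any \<open>\<rho> < 1\<close>.\<close>

lemma peak_mass:
  assumes "\<rho> < 1" "0 \<le> \<rho>"
  obtains \<mu> where "\<mu> > 0" "\<And>N. \<mu> * \<rho> ^ N \<le> (LINT v|torus_measure. peak (v :: complex ^ 'n) ^ N)"
proof -
  define G where "G = {u :: complex ^ 'n. \<rho> < peak u}"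
  have G: "open G" unfolding G_def by (intro open_Collect_less continuous_intros)
  have "1 \<in> G" using peak_range(3)[OF torus_one, where 'n='n] assms by (simp add: G_def)
  hence mu: "measure torus_measure (G \<inter> torus) > 0" using torus_measure_open_positive[OF G] torus_one by blast
  have Gs: "G \<inter> torus \<in> sets torus_measure"
    using G unfolding sets_torus_measure by (auto simp: sets_restrict_space intro!: image_eqI[of _ _ G])
  have "measure torus_measure (G \<inter> torus) * \<rho> ^ N \<le> (LINT v|torus_measure. peak (v :: complex ^ 'n) ^ N)" for N
  proof -
    have "measure torus_measure (G \<inter> torus) * \<rho> ^ N = (LINT v|torus_measure. \<rho> ^ N * indicator (G \<inter> torus) v)"
      using Gs by (simp add: mult.commute)
    also have "\<dots> \<le> (LINT v|torus_measure. peak (v :: complex ^ 'n) ^ N)"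
    proof (rule integral_mono)
      show "integrable torus_measure (\<lambda>v. \<rho> ^ N * indicator (G \<inter> torus) v)"
        using Gs by (intro integrable_mult_right torus_measure.integrable_const_bound[where B=1] borel_measurable_indicator)
          (auto split: split_indicator)
      show "integrable torus_measure (\<lambda>v :: complex ^ 'n. peak v ^ N)" by (intro integrable_torus continuous_intros)
      show "\<rho> ^ N * indicator (G \<inter> torus) v \<le> peak v ^ N" if "v \<in> space torus_measure" for v :: "complex ^ 'n"
        using that peak_range(1)[of v] assms(2) by (auto simp: indicator_def G_def intro!: power_mono)
    qed
    finally show ?thesis .
  qed
  thus ?thesis using that mu by blast
qed

lemma peak_integral_positive: "0 < (LINT v|torus_measure. peak (v :: complex ^ 'n) ^ N)"
proof (rule peak_mass[of "1/2", where 'n='n])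
  fix \<mu> :: real
  assume "\<mu> > 0" and le: "\<And>N. \<mu> * (1/2) ^ N \<le> (LINT v|torus_measure. peak (v :: complex ^ 'n) ^ N)"
  hence "0 < \<mu> * (1/2) ^ N" by simp
  thus ?thesis using le[of N] by (rule less_le_trans)
qed auto

lemma peak_kernel_nonneg: "(u :: complex ^ 'n) \<in> torus \<Longrightarrow> 0 \<le> peak_kernel N u"
  using peak_integral_positive[of N, where 'n='n] peak_range(1)[of u] unfolding peak_kernel_def
  by (intro divide_nonneg_nonneg) auto

lemma peak_kernel_mean: "(LINT u|torus_measure. peak_kernel N (u :: complex ^ 'n)) = 1"
  using peak_integral_positive[of N, where 'n='n] by (simp add: peak_kernel_def)

lemma peak_kernel_cnj_vec: "peak_kernel N (cnj_vec u) = peak_kernel N u"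
  by (simp add: peak_kernel_def peak_def)

lemma continuous_on_peak_kernel [continuous_intros]: "continuous_on S (peak_kernel N :: complex ^ 'n \<Rightarrow> real)"
proof -
  have "(LINT v|torus_measure. peak (v :: complex ^ 'n) ^ N) \<noteq> 0"
    using peak_integral_positive[of N, where 'n='n] by simp
  thus ?thesis unfolding peak_kernel_def by (intro continuous_intros) auto
qed

lemma peak_kernel_trig_poly: "trig_poly (\<lambda>u :: complex ^ 'n. of_real (peak_kernel N u))"
  using trig_poly_scale[OF trig_poly_peak_power[of N], of "1 / of_real (LINT v|torus_measure. peak (v :: complex ^ 'n) ^ N)"]
  by (simp add: peak_kernel_def)

text \<open>Outside a ball around 1, compactness gives \<open>peak u \<le> r < 1\<close>. The kernel
  is then at most a constant times \<open>(r / \<rho>) ^ N\<close>, where \<open>\<rho>\<close> is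
  the midpoint of \<open>r\<close> and 1 and bounds the normalising integral from below. Inside the
  ball, \<open>f\<close> differs from its value at 1 by less than \<open>e/2\<close>.\<close>

lemma peak_kernel_concentrates:
  assumes f: "continuous_on torus f"
  shows "(\<lambda>N. LINT u|torus_measure. of_real (peak_kernel N u) * f u) \<longlonglongrightarrow> (f (1 :: complex ^ 'n) :: complex)"
proof (rule LIMSEQ_I)
  fix e :: real assume e: "e > 0"
  define g where "g = (\<lambda>u. cmod (f u - f 1))"
  have g: "continuous_on torus g" unfolding g_def by (intro continuous_intros f)
  obtain d where d: "d > 0" "\<And>u. u \<in> torus \<Longrightarrow> dist u 1 < d \<Longrightarrow> dist (f u) (f 1) < e/2"
    using f[unfolded continuous_on_iff] torus_one half_gt_zero[OF e] by metis
  obtain B where B: "\<And>u. u \<in> torus \<Longrightarrow> g u \<le> B"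
    using compact_imp_bounded[OF compact_continuous_image[OF g compact_torus]] unfolding bounded_iff by (metis abs_le_D1 imageI real_norm_def)
  have B0: "0 \<le> B" using B[OF torus_one] by (simp add: g_def)
  define K where "K = torus - ball (1 :: complex ^ 'n) d"
  have K: "compact K" unfolding K_def by (intro compact_diff compact_torus open_ball)
  obtain r where r: "0 \<le> r" "r < 1" "\<And>u. u \<in> K \<Longrightarrow> peak u \<le> r"
  proof (cases "K = {}")
    case True
    thus ?thesis using that[of 0] by auto
  next
    case False
    obtain x where x: "x \<in> K" "\<And>u. u \<in> K \<Longrightarrow> peak u \<le> peak x"
      using continuous_attains_sup[OF K False continuous_on_peak] by blast
    have "x \<in> torus" "x \<noteq> 1" using x(1) d(1) by (auto simp: K_def)
    hence "peak x < 1" "0 \<le> peak x" using peak_range[of x] by auto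
    thus ?thesis using that x(2) by blast
  qed
  define \<rho> where "\<rho> = (1 + r) / 2"
  have rho: "\<rho> < 1" "0 < \<rho>" "r < \<rho>" using r by (auto simp: \<rho>_def)
  obtain \<mu> where mu: "\<mu> > 0" "\<And>N. \<mu> * \<rho> ^ N \<le> (LINT v|torus_measure. peak (v :: complex ^ 'n) ^ N)"
    using peak_mass[OF rho(1), where 'n='n] rho(2) by (metis less_imp_le)
  have "(\<lambda>N. B / \<mu> * (r / \<rho>) ^ N) \<longlonglongrightarrow> B / \<mu> * 0"
    using r rho by (intro tendsto_intros LIMSEQ_power_zero) simp
  then obtain M where M: "\<And>N. N \<ge> M \<Longrightarrow> norm (B / \<mu> * (r / \<rho>) ^ N - 0) < e/2"
    using LIMSEQ_D[OF _ half_gt_zero[OF e]] unfolding mult_zero_right by blast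
  have "norm ((LINT u|torus_measure. of_real (peak_kernel N u) * f u) - f 1) < e" if N: "N \<ge> M" for N
  proof -
    define I where "I = (LINT v|torus_measure. peak (v :: complex ^ 'n) ^ N)"
    have I: "I > 0" using peak_integral_positive by (simp add: I_def)
    have intk: "integrable torus_measure (peak_kernel N :: complex ^ 'n \<Rightarrow> real)" by (intro integrable_torus continuous_intros)
    have "(LINT u|torus_measure. complex_of_real (peak_kernel N (u :: complex ^ 'n)) * f 1) = of_real (LINT u|torus_measure. peak_kernel N (u :: complex ^ 'n)) * f 1"
      by (subst integral_mult_left_zero) (simp add: integral_complex_of_real)
    hence "f 1 = (LINT u|torus_measure. complex_of_real (peak_kernel N (u :: complex ^ 'n)) * f 1)" by (simp add: peak_kernel_mean)
    hence "(LINT u|torus_measure. of_real (peak_kernel N u) * f u) - f 1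
        = (LINT u|torus_measure. of_real (peak_kernel N u) * f u) - (LINT u|torus_measure. of_real (peak_kernel N (u :: complex ^ 'n)) * f 1)" by simp
    also have "\<dots> = (LINT u|torus_measure. of_real (peak_kernel N u) * f u - of_real (peak_kernel N u) * f 1)"
      by (rule Bochner_Integration.integral_diff[symmetric]; intro integrable_torus continuous_intros f)
    also have "norm \<dots> \<le> (LINT u|torus_measure. norm (of_real (peak_kernel N u) * f u - of_real (peak_kernel N u) * f 1))"
      by (rule integral_norm_bound)
    also have "\<dots> \<le> (LINT u|torus_measure. e/2 * peak_kernel N (u :: complex ^ 'n) + B * (r ^ N / I))"
    proof (rule integral_mono)
      show "integrable torus_measure (\<lambda>u. norm (of_real (peak_kernel N u) * f u - of_real (peak_kernel N u) * f 1))"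
        by (intro integrable_torus continuous_intros f)
      show "integrable torus_measure (\<lambda>u :: complex ^ 'n. e/2 * peak_kernel N u + B * (r ^ N / I))"
        by (intro integrable_torus continuous_intros)
      fix u :: "complex ^ 'n" assume "u \<in> space torus_measure"
      hence u: "u \<in> torus" by simp
      have "norm (of_real (peak_kernel N u) * f u - of_real (peak_kernel N u) * f 1) = peak_kernel N u * g u"
        using peak_kernel_nonneg[OF u, of N] by (simp add: g_def norm_mult flip: right_diff_distrib)
      also have "\<dots> \<le> e/2 * peak_kernel N u + B * (r ^ N / I)"
      proof (cases "u \<in> K")
        case True
        have "peak_kernel N u \<le> r ^ N / I" unfolding peak_kernel_def I_def[symmetric]
          using r(3)[OF True] peak_range(1)[OF u] I by (intro divide_right_mono power_mono) auto
        hence "peak_kernel N u * g u \<le> (r ^ N / I) * B"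
          using B[OF u] peak_kernel_nonneg[OF u, of N] B0 by (intro mult_mono) (auto simp: g_def)
        moreover have "0 \<le> e/2 * peak_kernel N u" using peak_kernel_nonneg[OF u, of N] e by simp
        ultimately show ?thesis by (simp add: mult.commute)
      next
        case False
        hence "g u \<le> e/2" using d(2)[of u] u by (auto simp: K_def g_def dist_norm norm_minus_commute)
        hence "peak_kernel N u * g u \<le> peak_kernel N u * (e/2)" using peak_kernel_nonneg[OF u, of N] by (rule mult_left_mono)
        moreover have "0 \<le> B * (r ^ N / I)" using B0 r I by simp
        ultimately show ?thesis by (simp add: mult.commute)
      qed
      finally show "norm (of_real (peak_kernel N u) * f u - of_real (peak_kernel N u) * f 1) \<le> e/2 * peak_kernel N u + B * (r ^ N / I)" .
    qed
    also have "\<dots> = e/2 + B * (r ^ N / I)" using intk by (simp add: peak_kernel_mean)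
    also have "B * (r ^ N / I) \<le> B * (r ^ N / (\<mu> * \<rho> ^ N))"
      using B0 r mu rho by (intro mult_left_mono divide_left_mono) (auto simp: I_def peak_integral_positive)
    also have "B * (r ^ N / (\<mu> * \<rho> ^ N)) = B / \<mu> * (r / \<rho>) ^ N" by (simp add: power_divide)
    also have "\<dots> < e/2" using M[OF N] unfolding real_norm_def diff_zero by (rule abs_le_D1[OF order_refl, THEN le_less_trans])
    finally show ?thesis by simp
  qed
  thus "\<exists>M. \<forall>N\<ge>M. norm ((LINT u|torus_measure. of_real (peak_kernel N u) * f u) - f 1) < e" by blast
qed

section \<open>Holomorphic functions of several variables\<close>

text \<open>A nonempty open set has positive measure, while the complement of
  \<open>nonzero_coords\<close> is null.\<close>

lemma nonzero_coords_dense: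
  assumes "open (W :: (complex ^ 'n) set)" "z \<in> W"
  obtains w where "w \<in> W" "w \<in> nonzero_coords"
proof -
  have "W \<inter> nonzero_coords \<noteq> {}"
  proof
    assume W: "W \<inter> nonzero_coords = {}"
    have "AE w in lborel. w \<notin> W"
      by (rule AE_mp[OF AE_nonzero_coords AE_I2]) (use W in auto)
    hence "W \<in> null_sets lborel" using assms(1) by (subst AE_iff_null_sets) auto
    moreover obtain e where e: "e > 0" "ball z e \<subseteq> W" using assms open_contains_ball by blast
    ultimately have "emeasure lborel (ball z e) \<le> 0"
      using emeasure_mono[OF e(2), of lborel] assms(1) by (simp add: null_sets_def)
    thus False using content_ball_pos[OF e(1), of z] by (simp add: measure_def)
  qed
  thus ?thesis using that by blast
qed

lemma norm_vector_scalar_mult: "norm (c *s v) = cmod c * norm (v :: complex ^ 'n)"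
proof -
  have "norm (c *s v) = L2_set (\<lambda>j. cmod c * cmod (v $ j)) UNIV" by (simp add: norm_vec_def norm_mult)
  thus ?thesis by (simp add: L2_set_right_distrib norm_vec_def)
qed

lemma linear_scalar_mult_left: "bounded_linear (\<lambda>t :: complex. t *s (v :: complex ^ 'n))"
  by (rule bounded_linear_intro[where K="norm v"])
    (auto simp: vec_eq_iff algebra_simps norm_vector_scalar_mult)

section \<open>Complex derivatives and their estimates\<close>

definition deriv_Cn :: "(complex ^ 'n \<Rightarrow> complex) \<Rightarrow> complex ^ 'n \<Rightarrow> complex ^ 'n \<Rightarrow> complex" where
  "deriv_Cn f z = (SOME D. (f has_derivative D) (at z) \<and> (\<forall>c v. D (c *s v) = c * D v))"

lemma deriv_Cn:
  assumes "holomorphic_Cn f R" "z \<in> R"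
  shows "(f has_derivative deriv_Cn f z) (at z)" "deriv_Cn f z (c *s v) = c * deriv_Cn f z v"
  using assms someI_ex[of "\<lambda>D. (f has_derivative D) (at z) \<and> (\<forall>c v. D (c *s v) = c * D v)"]
  unfolding holomorphic_Cn_def deriv_Cn_def by blast+

lemma holomorphic_CnI:
  assumes "\<And>z. z \<in> R \<Longrightarrow> (f has_derivative f' z) (at z)" "\<And>z c v. z \<in> R \<Longrightarrow> f' z (c *s v) = c * f' z v"
  shows "holomorphic_Cn f R"
  using assms unfolding holomorphic_Cn_def by blast

lemma holomorphic_Cn_continuous_on: "holomorphic_Cn f R \<Longrightarrow> continuous_on R f"
  by (intro continuous_at_imp_continuous_on ballI has_derivative_continuous[OF deriv_Cn(1)])

lemma holomorphic_Cn_subset: "holomorphic_Cn f R \<Longrightarrow> S \<subseteq> R \<Longrightarrow> holomorphic_Cn f S"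
  by (auto simp: holomorphic_Cn_def)

lemma holomorphic_Cn_cong:
  assumes "open R" "holomorphic_Cn f R" "\<And>z. z \<in> R \<Longrightarrow> g z = f z"
  shows "holomorphic_Cn g R"
proof (rule holomorphic_CnI)
  fix z assume z: "z \<in> R"
  show "(g has_derivative deriv_Cn f z) (at z)"
    using has_derivative_transform_within_open[OF deriv_Cn(1)[OF assms(2) z] assms(1) z] assms(3) by simp
qed (rule deriv_Cn(2)[OF assms(2)])

lemma holomorphic_Cn_add:
  assumes "holomorphic_Cn f R" "holomorphic_Cn g R" shows "holomorphic_Cn (\<lambda>z. f z + g z) R"
  by (rule holomorphic_CnI[where f'="\<lambda>z v. deriv_Cn f z v + deriv_Cn g z v"])
    (auto intro!: has_derivative_add deriv_Cn(1)[OF assms(1)] deriv_Cn(1)[OF assms(2)]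
      simp: deriv_Cn(2)[OF assms(1)] deriv_Cn(2)[OF assms(2)] algebra_simps)

lemma holomorphic_Cn_mult:
  assumes "holomorphic_Cn f R" "holomorphic_Cn g R" shows "holomorphic_Cn (\<lambda>z. f z * g z) R"
proof (rule holomorphic_CnI)
  show "((\<lambda>z. f z * g z) has_derivative (\<lambda>v. f z * deriv_Cn g z v + deriv_Cn f z v * g z)) (at z)"
    if "z \<in> R" for z
    by (rule has_derivative_mult[OF deriv_Cn(1)[OF assms(1) that] deriv_Cn(1)[OF assms(2) that]])
qed (auto simp: deriv_Cn(2)[OF assms(1)] deriv_Cn(2)[OF assms(2)] algebra_simps)

lemma holomorphic_Cn_const: "holomorphic_Cn (\<lambda>z. c) R"
  by (rule holomorphic_CnI[where f'="\<lambda>z v. 0"]) auto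

lemma holomorphic_Cn_prod:
  "finite J \<Longrightarrow> (\<And>j. j \<in> J \<Longrightarrow> holomorphic_Cn (f j) R) \<Longrightarrow> holomorphic_Cn (\<lambda>z. \<Prod>j\<in>J. f j z) R"
  by (induction J rule: finite_induct) (auto intro: holomorphic_Cn_const holomorphic_Cn_mult)

lemma holomorphic_Cn_zpow: "holomorphic_Cn (zpow \<alpha>) (nonzero_coords :: (complex ^ 'n) set)"
proof -
  have "holomorphic_Cn (\<lambda>z. (z $ j) powi k) (nonzero_coords :: (complex ^ 'n) set)" for j k
  proof (rule holomorphic_CnI)
    fix z :: "complex ^ 'n" assume z: "z \<in> nonzero_coords"
    have "((\<lambda>x. x powi k) has_field_derivative (of_int k * (z $ j) powi (k - 1) * 1)) (at (z $ j))"
      using z by (intro DERIV_power_int derivative_intros) (auto simp: nonzero_coords_def)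
    hence "((\<lambda>x. x powi k) has_derivative (\<lambda>h. (of_int k * (z $ j) powi (k - 1)) * h)) (at (z $ j))"
      by (simp add: has_field_derivative_def)
    from has_derivative_compose[OF bounded_linear_imp_has_derivative[OF bounded_linear_vec_nth] this]
    show "((\<lambda>z. (z $ j) powi k) has_derivative (\<lambda>v. (of_int k * (z $ j) powi (k - 1)) * (v $ j))) (at z)" .
  qed simp
  thus ?thesis unfolding zpow_def by (intro holomorphic_Cn_prod) auto
qed

lemma has_field_derivative_along_line:
  assumes "holomorphic_Cn f R" "z + t *s v \<in> R"
  shows "((\<lambda>t. f (z + t *s v)) has_field_derivative deriv_Cn f (z + t *s v) v) (at t)"
proof -
  have "((\<lambda>t. z + t *s v) has_derivative (\<lambda>h. h *s v)) (at t)"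
    using bounded_linear_imp_has_derivative[OF linear_scalar_mult_left[of v]] has_derivative_add[OF has_derivative_const]
    by fastforce
  from has_derivative_compose[OF this deriv_Cn(1)[OF assms]]
  have "((\<lambda>t. f (z + t *s v)) has_derivative (\<lambda>h. h * deriv_Cn f (z + t *s v) v)) (at t)"
    by (simp add: deriv_Cn(2)[OF assms])
  thus ?thesis by (simp add: has_field_derivative_def mult.commute[of _ "deriv_Cn f (z + t *s v) v"] fun_eq_iff)
qed

text \<open>On the complex line through \<open>z\<close> in direction \<open>v\<close>,
  \<open>f\<close> is a function of one variable on the disc of radius
  \<open>r = d / norm v\<close>. Cauchy's inequality gives \<open>M / (r/2)\<close> for its first
  derivative and \<open>2 * M / (r/4)\<^sup>2\<close>, hence the constant 32, for the second
  derivative on the unit disc, which enters Taylor's formula.\<close>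

lemma holomorphic_Cn_bounds:
  fixes f :: "complex ^ 'n \<Rightarrow> complex"
  assumes hol: "holomorphic_Cn f (ball z d)" and d: "d > 0" and M: "\<And>w. w \<in> ball z d \<Longrightarrow> cmod (f w) \<le> M"
  shows "cmod (deriv_Cn f z v) \<le> 2 * M * norm v / d"
    "norm v \<le> d / 4 \<Longrightarrow> cmod (f (z + v) - f z - deriv_Cn f z v) \<le> 32 * M * (norm v)\<^sup>2 / d\<^sup>2"
proof -
  define g where "g = (\<lambda>t. f (z + t *s v))"
  have z: "z \<in> ball z d" using d by simp
  have z0: "deriv_Cn f z 0 = 0" using deriv_Cn(2)[OF hol z, of 0 0] by simp
  have M0: "0 \<le> M" using order_trans[OF norm_ge_zero M[OF z]] .
  have both: "cmod (deriv_Cn f z v) \<le> 2 * M * norm v / d \<and>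
    (norm v \<le> d / 4 \<longrightarrow> cmod (f (z + v) - f z - deriv_Cn f z v) \<le> 32 * M * (norm v)\<^sup>2 / d\<^sup>2)" if v: "v \<noteq> 0"
  proof
    define r where "r = d / norm v"
    have r: "r > 0" using d v by (simp add: r_def)
    have line: "z + t *s v \<in> ball z d" if "t \<in> ball 0 r" for t
      using that v by (simp add: dist_norm norm_vector_scalar_mult r_def pos_less_divide_eq)
    have Dg: "(g has_field_derivative deriv_Cn f (z + t *s v) v) (at t)" if "t \<in> ball 0 r" for t
      unfolding g_def by (rule has_field_derivative_along_line[OF hol line[OF that]])
    hence holg: "g holomorphic_on ball 0 r"
      unfolding holomorphic_on_def field_differentiable_def by (blast intro: has_field_derivative_at_within)
    have d0: "deriv g 0 = deriv_Cn f z v" using Dg[of 0] r by (auto intro: DERIV_imp_deriv)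
    have gM: "cmod (g t) \<le> M" if "t \<in> ball 0 r" for t unfolding g_def by (rule M[OF line[OF that]])
    have Cauchy: "cmod ((deriv ^^ n) g t) \<le> fact n * M / s ^ n" if "0 < s" "cball t s \<subseteq> ball 0 r" for n t s
    proof (rule Cauchy_inequality)
      show "g holomorphic_on ball t s" using holg that ball_subset_cball by (blast intro: holomorphic_on_subset)
      show "continuous_on (cball t s) g" using holomorphic_on_imp_continuous_on[OF holg] that(2) continuous_on_subset by blast
      show "norm (g x) \<le> M" if "norm (t - x) = s" for x
        using that \<open>cball t s \<subseteq> ball 0 r\<close> gM by (auto simp: dist_norm subset_iff)
    qed (rule that)
    have "cball 0 (r/2) \<subseteq> ball (0::complex) r" using r by auto
    from Cauchy[OF _ this, of 1] r have "cmod (deriv g 0) \<le> M / (r/2)" by simp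
    thus "cmod (deriv_Cn f z v) \<le> 2 * M * norm v / d" using d v by (simp add: d0 r_def mult_ac)
    show "norm v \<le> d / 4 \<longrightarrow> cmod (f (z + v) - f z - deriv_Cn f z v) \<le> 32 * M * (norm v)\<^sup>2 / d\<^sup>2"
    proof
      assume "norm v \<le> d / 4"
      \<comment> \<open>This room lets the discs of radius \<open>r/4\<close> around points of the
        unit disc stay in the disc of radius \<open>r\<close>.\<close>
      hence r4: "r \<ge> 4" using v d by (simp add: r_def field_simps)
      have c1: "cball t (r/4) \<subseteq> ball 0 r" if "t \<in> cball 0 1" for t :: complex
      proof
        fix x assume "x \<in> cball t (r/4)"
        hence "cmod x \<le> cmod t + r/4" using norm_triangle_sub[of x t] by (simp add: dist_norm norm_minus_commute)
        thus "x \<in> ball 0 r" using that r4 by simp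
      qed
      have sub: "cball 0 1 \<subseteq> ball (0::complex) r" using r4 by auto
      have "cmod ((deriv ^^ 0) g 1 - (\<Sum>i\<le>1. (deriv ^^ i) g 0 * (1 - 0) ^ i / (fact i))) \<le> (2 * M / (r/4)\<^sup>2) * cmod (1 - 0) ^ (Suc 1) / fact 1"
      proof (rule complex_Taylor[where S="cball 0 1" and f="\<lambda>i. (deriv ^^ i) g"])
        fix i x assume x: "x \<in> cball (0::complex) 1"
        have "(deriv ^^ i) g holomorphic_on ball 0 r" by (rule holomorphic_higher_deriv[OF holg]) simp
        hence "((deriv ^^ i) g has_field_derivative deriv ((deriv ^^ i) g) x) (at x)"
          using x sub by (intro holomorphic_derivI[of _ "ball 0 r"]) auto
        thus "((deriv ^^ i) g has_field_derivative (deriv ^^ Suc i) g x) (at x within cball 0 1)"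
          by (auto intro: has_field_derivative_at_within)
      next
        fix x assume "x \<in> cball (0::complex) 1"
        from Cauchy[OF _ c1[OF this], of 2] r
        show "cmod ((deriv ^^ Suc 1) g x) \<le> 2 * M / (r/4)\<^sup>2" by (simp add: numeral_2_eq_2 fact_numeral)
      qed auto
      hence "cmod (g 1 - g 0 - deriv g 0) \<le> 2 * M / (r/4)\<^sup>2" by (simp add: algebra_simps)
      thus "cmod (f (z + v) - f z - deriv_Cn f z v) \<le> 32 * M * (norm v)\<^sup>2 / d\<^sup>2"
        by (simp add: d0) (simp add: g_def r_def power_divide)
    qed
  qed
  show "cmod (deriv_Cn f z v) \<le> 2 * M * norm v / d" using both z0 by (cases "v = 0") auto
  show "cmod (f (z + v) - f z - deriv_Cn f z v) \<le> 32 * M * (norm v)\<^sup>2 / d\<^sup>2" if "norm v \<le> d / 4"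
    using both z0 that by (cases "v = 0") auto
qed

text \<open>An explicit quadratic estimate survives pointwise limits and integration over a
  parameter, unlike differentiability itself. Both limits of holomorphic functions and torus
  averages are differentiated through it.\<close>

lemma has_derivative_quadratic_remainder:
  fixes f :: "'a::real_normed_vector \<Rightarrow> 'b::real_normed_vector"
  assumes D: "bounded_linear D" and d: "d > 0"
    and le: "\<And>v. norm v \<le> d \<Longrightarrow> norm (f (z + v) - f z - D v) \<le> C * (norm v)\<^sup>2"
  shows "(f has_derivative D) (at z)"
  unfolding has_derivative_at
proof (intro conjI D)
  show "(\<lambda>h. norm (f (z + h) - f z - D h) / norm h) \<midarrow>0\<rightarrow> 0"
  proof (rule Lim_null_comparison)
    show "((\<lambda>h. C * norm h) \<longlongrightarrow> 0) (at 0)" by (auto intro!: tendsto_eq_intros)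
    show "\<forall>\<^sub>F h in at 0. norm (norm (f (z + h) - f z - D h) / norm h) \<le> C * norm h"
      unfolding eventually_at
    proof (intro exI[of _ d] conjI d ballI impI)
      fix h :: 'a assume h: "h \<noteq> 0 \<and> dist h 0 < d"
      thus "norm (norm (f (z + h) - f z - D h) / norm h) \<le> C * norm h"
        using le[of h] by (simp add: divide_le_eq power2_eq_square mult.assoc)
    qed
  qed
qed

lemma holomorphic_Cn_locally_bounded:
  assumes "open R" "holomorphic_Cn f R" "z \<in> R"
  obtains d M where "d > 0" "ball z d \<subseteq> R" "\<And>w. w \<in> ball z d \<Longrightarrow> cmod (f w) \<le> M"
proof -
  obtain e where e: "e > 0" "cball z e \<subseteq> R" using assms(1,3) open_contains_cball_eq by blast
  have cp: "compact (f ` cball z e)"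
    by (intro compact_continuous_image continuous_on_subset[OF holomorphic_Cn_continuous_on[OF assms(2)] e(2)]) simp
  obtain M where "\<forall>x\<in>f ` cball z e. cmod x \<le> M" using compact_imp_bounded[OF cp] unfolding bounded_iff by blast
  moreover have "ball z e \<subseteq> R" using e(2) ball_subset_cball by blast
  ultimately show ?thesis using that[of e M] e(1) by auto
qed

text \<open>The derivative estimate applied to differences makes the derivatives at \<open>z\<close>
  a Cauchy sequence. Since the functions are uniformly bounded near \<open>z\<close>, the quadratic
  remainder estimate has a common constant and passes to the limit.\<close>

theorem holomorphic_Cn_uniform_limit:
  fixes f :: "nat \<Rightarrow> complex ^ 'n \<Rightarrow> complex"
  assumes R: "open R" and hol: "\<And>n. holomorphic_Cn (f n) R"
    and lim: "\<And>z. z \<in> R \<Longrightarrow> \<exists>d>0. ball z d \<subseteq> R \<and> uniform_limit (ball z d) f g sequentially"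
  shows "holomorphic_Cn g R"
proof -
  have "\<exists>D. (g has_derivative D) (at z) \<and> (\<forall>c v. D (c *s v) = c * D v)" if z: "z \<in> R" for z
  proof -
    obtain d1 where d1: "d1 > 0" "ball z d1 \<subseteq> R" "uniform_limit (ball z d1) f g sequentially" using lim[OF z] by blast
    obtain N where N: "\<forall>n\<ge>N. \<forall>x\<in>ball z d1. dist (f n x) (g x) < 1"
      using uniform_limitD[OF d1(3), of 1] unfolding eventually_sequentially by auto
    obtain d2 M where d2: "d2 > 0" "ball z d2 \<subseteq> R" "\<And>w. w \<in> ball z d2 \<Longrightarrow> cmod (f N w) \<le> M"
      using holomorphic_Cn_locally_bounded[OF R hol z] by blast
    define d where "d = min d1 d2"
    have d: "d > 0" "ball z d \<subseteq> R" "ball z d \<subseteq> ball z d1" "ball z d \<subseteq> ball z d2" using d1 d2 by (auto simp: d_def)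
    have zd: "z \<in> ball z d" using d by simp
    have ul: "uniform_limit (ball z d) f g sequentially" by (rule uniform_limit_on_subset[OF d1(3) d(3)])
    \<comment> \<open>Each function is within 1 of the limit \<open>g\<close>, and so is
      \<open>f N\<close>, which is bounded by \<open>M\<close>.\<close>
    have bnd: "cmod (f n w) \<le> M + 2" if "n \<ge> N" "w \<in> ball z d" for n w
    proof -
      have "w \<in> ball z d1" "w \<in> ball z d2" using that(2) d by blast+
      hence "dist (f n w) (g w) < 1" "dist (f N w) (g w) < 1" "cmod (f N w) \<le> M" using N that(1) d2 by auto
      thus ?thesis using dist_triangle2[of "f n w" "f N w" "g w"] norm_triangle_sub[of "f n w" "f N w"]
        by (simp add: dist_norm)
    qed
    have hold: "holomorphic_Cn (f n) (ball z d)" for n using holomorphic_Cn_subset[OF hol d(2)] .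
    define D where "D = (\<lambda>n. deriv_Cn (f n) z)"
    have Dd: "(f n has_derivative D n) (at z)" and Dc: "D n (c *s v) = c * D n v" for n c v
      using deriv_Cn[OF hold zd] by (auto simp: D_def)
    have Dlin: "D n (v + w) = D n v + D n w" for n v w using has_derivative_linear[OF Dd] linear_add by blast
    have diff: "cmod (D m v - D n v) \<le> 2 * e * norm v / d"
      if "\<And>w. w \<in> ball z d \<Longrightarrow> cmod (f m w - f n w) \<le> e" for m n e v
    proof -
      define h where "h = (\<lambda>w. f m w - f n w)"
      have hd: "(h has_derivative (\<lambda>v. D m v - D n v)) (at z)" unfolding h_def by (intro has_derivative_diff Dd)
      have hh: "holomorphic_Cn h (ball z d)"
        using holomorphic_Cn_add[OF hold[of m] holomorphic_Cn_mult[OF holomorphic_Cn_const[of "-1"] hold[of n]]] by (simp add: h_def)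
      have "deriv_Cn h z = (\<lambda>v. D m v - D n v)" using has_derivative_unique[OF deriv_Cn(1)[OF hh zd] hd] .
      thus ?thesis using holomorphic_Cn_bounds(1)[OF hh d(1), of e v] that by (simp add: h_def)
    qed
    have "Cauchy (\<lambda>n. D n v)" for v
    proof (rule metric_CauchyI)
      fix e :: real assume e: "e > 0"
      define e' where "e' = e * d / (4 * (norm v + 1))"
      have e': "e' > 0" using e d by (simp add: e'_def add_nonneg_pos)
      have "e'/2 > 0" using e' by simp
      then obtain K where K: "\<forall>n\<ge>K. \<forall>x\<in>ball z d. dist (f n x) (g x) < e'/2"
        using uniform_limitD[OF ul, of "e'/2"] unfolding eventually_sequentially by blast
      have "dist (D m v) (D n v) < e" if mn: "m \<ge> K" "n \<ge> K" for m n
      proof -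
        have "cmod (f m w - f n w) \<le> e'" if "w \<in> ball z d" for w
        proof -
          have "dist (f m w) (g w) < e'/2" "dist (f n w) (g w) < e'/2" using K mn that by blast+
          hence "dist (f m w) (f n w) < e'" by (rule dist_triangle_half_l)
          thus ?thesis by (simp add: dist_norm)
        qed
        from diff[OF this] have "cmod (D m v - D n v) \<le> 2 * e' * norm v / d" .
        also have "\<dots> = e * (norm v / (2 * (norm v + 1)))"
        proof -
          have "norm v + 1 \<noteq> 0" using norm_ge_zero[of v] by linarith
          thus ?thesis using d(1) unfolding e'_def by (simp add: divide_simps)
        qed
        also have "\<dots> < e * 1" using e by (intro mult_strict_left_mono) (auto simp: divide_less_eq add_nonneg_pos)
        finally show ?thesis by (simp add: dist_norm)
      qed
      thus "\<exists>K. \<forall>m\<ge>K. \<forall>n\<ge>K. dist (D m v) (D n v) < e" by blast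
    qed
    hence "\<forall>v. \<exists>l. (\<lambda>n. D n v) \<longlonglongrightarrow> l" by (simp add: Cauchy_convergent_iff convergent_def)
    then obtain E where E: "\<And>v. (\<lambda>n. D n v) \<longlonglongrightarrow> E v" by metis
    have Ec: "E (c *s v) = c * E v" for c v
      using LIMSEQ_unique[OF E[of "c *s v"]] tendsto_mult_left[OF E[of v], of c] by (simp add: Dc)
    have Ea: "E (v + w) = E v + E w" for v w
      using LIMSEQ_unique[OF E[of "v + w"]] tendsto_add[OF E[of v] E[of w]] by (simp add: Dlin)
    have gl: "(\<lambda>n. f n w) \<longlonglongrightarrow> g w" if "w \<in> ball z d" for w using tendsto_uniform_limitI[OF ul that] .
    have bE: "bounded_linear E"
    proof (rule bounded_linear_intro)
      fix v and c :: real
      show "E (v + w) = E v + E w" for w by (rule Ea)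
      have "c *\<^sub>R v = complex_of_real c *s v" by (simp add: vec_eq_iff scaleR_conv_of_real[symmetric])
      thus "E (c *\<^sub>R v) = c *\<^sub>R E v" by (simp add: Ec scaleR_conv_of_real)
      show "norm (E v) \<le> norm v * (2 * (M + 2) / d)"
      proof (rule tendsto_upperbound[OF tendsto_norm[OF E]])
        show "\<forall>\<^sub>F n in sequentially. norm (D n v) \<le> norm v * (2 * (M + 2) / d)"
          using eventually_ge_at_top[of N]
          by eventually_elim (use holomorphic_Cn_bounds(1)[OF hold d(1) bnd, of _ v] in \<open>simp add: D_def mult_ac\<close>)
      qed simp
    qed
    have rem: "norm (g (z + v) - g z - E v) \<le> (32 * (M + 2) / d\<^sup>2) * (norm v)\<^sup>2" if v: "norm v \<le> d / 4" for v
    proof (rule tendsto_upperbound)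
      have "z + v \<in> ball z d" using v d by (simp add: dist_norm)
      thus "(\<lambda>n. norm (f n (z + v) - f n z - D n v)) \<longlonglongrightarrow> norm (g (z + v) - g z - E v)"
        by (intro tendsto_intros gl E zd)
      show "\<forall>\<^sub>F n in sequentially. norm (f n (z + v) - f n z - D n v) \<le> (32 * (M + 2) / d\<^sup>2) * (norm v)\<^sup>2"
        using eventually_ge_at_top[of N]
        by eventually_elim (use holomorphic_Cn_bounds(2)[OF hold d(1) bnd v] in \<open>simp add: D_def\<close>)
    qed simp
    have "(g has_derivative E) (at z)"
      using d(1) by (intro has_derivative_quadratic_remainder[OF bE _ rem, where d="d/4"]) auto
    thus ?thesis using Ec by blast
  qed
  thus ?thesis by (simp add: holomorphic_Cn_def)
qed

section \<open>Averages over torus orbits\<close>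

definition torus_invariant :: "(complex ^ 'n) set \<Rightarrow> bool" where
  "torus_invariant R \<longleftrightarrow> (\<forall>u\<in>torus. \<forall>z\<in>R. u * z \<in> R)"

text \<open>With \<open>\<kappa> = zpow (- \<alpha>)\<close> this projects to the component of
  multidegree \<alpha>; with a peak kernel it is an approximate identity.\<close>

definition torus_average :: "(complex ^ 'n \<Rightarrow> complex) \<Rightarrow> (complex ^ 'n \<Rightarrow> complex) \<Rightarrow> complex ^ 'n \<Rightarrow> complex" where
  "torus_average \<kappa> f z = (LINT u|torus_measure. \<kappa> u * f (u * z))"

lemma torus_invariantD: "torus_invariant R \<Longrightarrow> u \<in> torus \<Longrightarrow> z \<in> R \<Longrightarrow> u * z \<in> R"
  by (simp add: torus_invariant_def)

lemma torus_invariant_nonzero_coords: "torus_invariant R \<Longrightarrow> torus_invariant (R \<inter> nonzero_coords)"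
  by (auto simp: torus_invariant_def nonzero_coords_def torus_nth_nonzero)

lemma continuous_on_torus_orbit:
  assumes "continuous_on R f" "torus_invariant R" "z \<in> R"
  shows "continuous_on torus (\<lambda>u. f (u * z))"
  by (rule continuous_on_compose2[OF assms(1)]) (auto intro!: continuous_intros torus_invariantD assms)

lemma vec_scaleR_eq: "c *\<^sub>R v = complex_of_real c *s (v :: complex ^ 'n)"
  by (simp add: vec_eq_iff scaleR_conv_of_real[symmetric])

text \<open>The remainder estimate at \<open>u * z\<close> has constants independent of
  \<open>u\<close>: \<open>f\<close> is bounded on the compact set of all rotations of a ball around
  \<open>z\<close>. Integrating it over the torus gives a quadratic remainder for the
  average.\<close>

theorem torus_average_has_derivative:
  assumes R: "open R" "torus_invariant R" and hol: "holomorphic_Cn f R" and z: "z \<in> R"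
    and k: "continuous_on torus \<kappa>"
  shows "(torus_average \<kappa> f has_derivative (\<lambda>v. LINT u|torus_measure. \<kappa> u * deriv_Cn f (u * z) (u * v))) (at z)"
    "(LINT u|torus_measure. \<kappa> u * deriv_Cn f (u * z) (u * (c *s v)))
      = c * (LINT u|torus_measure. \<kappa> u * deriv_Cn f (u * z) (u * v))"
proof -
  have cont: "continuous_on R f" by (rule holomorphic_Cn_continuous_on[OF hol])
  obtain d where d: "d > 0" "cball z d \<subseteq> R" using R(1) z open_contains_cball_eq by blast
  have inR: "u * w \<in> R" if "u \<in> torus" "w \<in> cball z d" for u w
    using torus_invariantD[OF R(2) that(1)] d(2) that(2) by blast
  define K where "K = (\<lambda>(u, w). u * w) ` (torus \<times> cball z d)"
  have "compact K"
    unfolding K_def case_prod_beta by (intro compact_continuous_image compact_Times compact_torus compact_cball continuous_intros)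
  moreover have "K \<subseteq> R" using inR by (auto simp: K_def)
  hence "continuous_on K f" by (rule continuous_on_subset[OF cont])
  ultimately have "compact (f ` K)" by (intro compact_continuous_image)
  then obtain M where M: "\<forall>x\<in>f ` K. cmod x \<le> M" using compact_imp_bounded[of "f ` K"] unfolding bounded_iff by blast
  have KM: "cmod (f (u * w)) \<le> M" if "u \<in> torus" "w \<in> cball z d" for u w
    using M that by (auto simp: K_def)
  have M0: "0 \<le> M" using order_trans[OF norm_ge_zero KM[OF torus_one, of z]] d by simp
  \<comment> \<open>The ball around \<open>u * z\<close> is the rotated ball around
    \<open>z\<close>, so one radius and one bound serve for all \<open>u\<close>.\<close>
  have ballu: "ball (u * z) d \<subseteq> R" "\<And>w. w \<in> ball (u * z) d \<Longrightarrow> cmod (f w) \<le> M" if u: "u \<in> torus" for u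
  proof -
    have eq: "w = u * (cnj_vec u * w)" for w using mult_cnj_vec_cancel(1)[OF u] by simp
    have "cnj_vec u * w \<in> cball z d" if "w \<in> ball (u * z) d" for w
    proof -
      have "u * (z - cnj_vec u * w) = u * z - w" using eq[of w] by (simp add: right_diff_distrib)
      hence "norm (z - cnj_vec u * w) = norm (u * z - w)" using norm_torus_mult[OF u] by metis
      thus ?thesis using that by (simp add: dist_norm)
    qed
    thus "ball (u * z) d \<subseteq> R" "\<And>w. w \<in> ball (u * z) d \<Longrightarrow> cmod (f w) \<le> M"
      using inR[OF u] KM[OF u] eq by (metis subsetI)+
  qed
  define E where "E = (\<lambda>u v. deriv_Cn f (u * z) (u * v))"
  have uz: "u * z \<in> R" if "u \<in> torus" for u using torus_invariantD[OF R(2) that z] .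
  have Ec: "E u (c *s v) = c * E u v" if "u \<in> torus" for u c v
  proof -
    have "u * (c *s v) = c *s (u * v)" by (simp add: vec_eq_iff)
    thus ?thesis using deriv_Cn(2)[OF hol uz[OF that]] by (simp add: E_def)
  qed
  have Ea: "E u (v + w) = E u v + E u w" if "u \<in> torus" for u v w
    using linear_add[OF has_derivative_linear[OF deriv_Cn(1)[OF hol uz[OF that]]]] by (simp add: E_def distrib_left)
  have hb: "holomorphic_Cn f (ball (u * z) d)" if "u \<in> torus" for u using holomorphic_Cn_subset[OF hol ballu(1)[OF that]] .
  have Eb: "cmod (E u v) \<le> 2 * M * norm v / d" if "u \<in> torus" for u v
    using holomorphic_Cn_bounds(1)[OF hb[OF that] d(1) ballu(2)[OF that], of "u * v"] norm_torus_mult[OF that] by (simp add: E_def)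
  have Er: "cmod (f (u * (z + v)) - f (u * z) - E u v) \<le> 32 * M * (norm v)\<^sup>2 / d\<^sup>2"
    if "u \<in> torus" "norm v \<le> d / 4" for u v
    using holomorphic_Cn_bounds(2)[OF hb[OF that(1)] d(1) ballu(2)[OF that(1)], of "u * v"] norm_torus_mult[OF that(1)] that(2)
    by (simp add: E_def distrib_left)
  have contf: "continuous_on torus (\<lambda>u. f (u * w))" if "w \<in> cball z d" for w
    using continuous_on_torus_orbit[OF cont R(2)] d(2) that by blast
  obtain B where B: "\<forall>x\<in>\<kappa> ` torus. cmod x \<le> B"
    using compact_imp_bounded[OF compact_continuous_image[OF k compact_torus]] unfolding bounded_iff by blast
  hence B0: "0 \<le> B" using order_trans[OF norm_ge_zero, of "\<kappa> 1" B] by auto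
  \<comment> \<open>\<open>deriv_Cn\<close> is defined by choice, so measurability in
    \<open>u\<close> is obtained by writing the derivative as a limit of difference quotients that
    are continuous in \<open>u\<close>. The increments \<open>t n\<close> stay within the range of
    the remainder estimate.\<close>
  have Em: "(\<lambda>u. E u v) \<in> borel_measurable torus_measure" for v
  proof (rule borel_measurable_LIMSEQ_metric)
    define t where "t = (\<lambda>n::nat. d / (4 * (norm v + 1)) / (real n + 1))"
    have "norm v + 1 > 0" using norm_ge_zero[of v] by linarith
    hence t: "t n > 0" "norm (t n *\<^sub>R v) \<le> d / 4" for n
    proof -
      show "t n > 0" using d \<open>norm v + 1 > 0\<close> by (simp add: t_def)
      have "norm (t n *\<^sub>R v) = d / 4 * (norm v / (norm v + 1)) * (1 / (real n + 1))"
        using \<open>norm v + 1 > 0\<close> d by (simp add: t_def)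
      also have "\<dots> \<le> d / 4 * 1 * 1" using \<open>norm v + 1 > 0\<close> d by (intro mult_mono) auto
      finally show "norm (t n *\<^sub>R v) \<le> d / 4" by simp
    qed
    have t0: "t \<longlonglongrightarrow> 0"
      unfolding t_def using tendsto_mult_right[OF LIMSEQ_inverse_real_of_nat, of "d / (4 * (norm v + 1))"]
      by (simp add: divide_inverse add.commute mult.commute)
    show "(\<lambda>u. (f (u * (z + t n *\<^sub>R v)) - f (u * z)) / of_real (t n)) \<in> borel_measurable torus_measure" for n
    proof (rule borel_measurable_torus)
      have "z + t n *\<^sub>R v \<in> cball z d" using t(2)[of n] d(1) by (simp add: dist_norm)
      moreover have "z \<in> cball z d" using d by simp
      ultimately show "continuous_on torus (\<lambda>u. (f (u * (z + t n *\<^sub>R v)) - f (u * z)) / of_real (t n))"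
        using t(1)[of n] by (intro continuous_intros contf) auto
    qed
    fix u assume "u \<in> space (torus_measure :: (complex ^ 'a) measure)"
    hence u: "u \<in> torus" by simp
    show "(\<lambda>n. (f (u * (z + t n *\<^sub>R v)) - f (u * z)) / of_real (t n)) \<longlonglongrightarrow> E u v"
    proof (rule Lim_transform[OF _ Lim_null_comparison])
      show "(\<lambda>n. t n * (32 * M * (norm v)\<^sup>2 / d\<^sup>2)) \<longlonglongrightarrow> 0" by (rule tendsto_mult_left_zero[OF t0])
      show "\<forall>\<^sub>F n in sequentially. norm ((f (u * (z + t n *\<^sub>R v)) - f (u * z)) / of_real (t n) - E u v) \<le> t n * (32 * M * (norm v)\<^sup>2 / d\<^sup>2)"
      proof (intro always_eventually allI)
        fix n
        have "E u (t n *\<^sub>R v) = of_real (t n) * E u v" unfolding vec_scaleR_eq by (rule Ec[OF u])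
        hence "(f (u * (z + t n *\<^sub>R v)) - f (u * z)) / of_real (t n) - E u v
            = (f (u * (z + t n *\<^sub>R v)) - f (u * z) - E u (t n *\<^sub>R v)) / of_real (t n)"
          using t(1)[of n] by (simp add: field_simps)
        hence "norm ((f (u * (z + t n *\<^sub>R v)) - f (u * z)) / of_real (t n) - E u v) \<le> (32 * M * (norm (t n *\<^sub>R v))\<^sup>2 / d\<^sup>2) / t n"
          using divide_right_mono[OF Er[OF u t(2)], of "t n" n] t(1)[of n]
          by (simp add: norm_divide del: norm_scaleR)
        also have "\<dots> = t n * (32 * M * (norm v)\<^sup>2 / d\<^sup>2)"
          using t(1)[of n] by (simp add: power_mult_distrib power2_eq_square)
        finally show "norm ((f (u * (z + t n *\<^sub>R v)) - f (u * z)) / of_real (t n) - E u v) \<le> t n * (32 * M * (norm v)\<^sup>2 / d\<^sup>2)" .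
      qed
    qed simp
  qed
  have km: "\<kappa> \<in> borel_measurable torus_measure" by (rule borel_measurable_torus[OF k])
  have kEb: "cmod (\<kappa> u * E u v) \<le> B * (2 * M * norm v / d)" if "u \<in> torus" for u v
    using B Eb[OF that, of v] that B0 unfolding norm_mult by (intro mult_mono) auto
  have Ei: "integrable torus_measure (\<lambda>u. \<kappa> u * E u v)" for v
    using kEb[of _ v] by (intro torus_measure.integrable_const_bound[where B="B * (2 * M * norm v / d)"] borel_measurable_times km Em AE_I2) auto
  define D where "D = (\<lambda>v. LINT u|torus_measure. \<kappa> u * E u v)"
  have Dc: "D (c *s v) = c * D v" for c v
  proof -
    have "D (c *s v) = (LINT u|torus_measure. c * (\<kappa> u * E u v))"
      unfolding D_def by (intro Bochner_Integration.integral_cong) (auto simp: Ec)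
    thus ?thesis by (simp add: D_def)
  qed
  show "(LINT u|torus_measure. \<kappa> u * deriv_Cn f (u * z) (u * (c *s v)))
      = c * (LINT u|torus_measure. \<kappa> u * deriv_Cn f (u * z) (u * v))"
    using Dc by (simp add: D_def E_def)
  have bound_int: "cmod (LINT u|torus_measure. h u) \<le> b"
    if "\<And>u. u \<in> torus \<Longrightarrow> cmod (h u) \<le> b" "integrable torus_measure h" for h :: "complex ^ 'a \<Rightarrow> complex" and b
  proof -
    have "cmod (LINT u|torus_measure. h u) \<le> (LINT u|torus_measure. cmod (h u))" by (rule integral_norm_bound)
    also have "\<dots> \<le> (LINT u|(torus_measure :: (complex ^ 'a) measure). b)"
      using that by (intro integral_mono) auto
    finally show ?thesis by simp
  qed
  have "(torus_average \<kappa> f has_derivative D) (at z)"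
  proof (rule has_derivative_quadratic_remainder)
    show "bounded_linear D"
    proof (rule bounded_linear_intro)
      show "D (v + w) = D v + D w" for v w
      proof -
        have "D (v + w) = (LINT u|torus_measure. \<kappa> u * E u v + \<kappa> u * E u w)"
          unfolding D_def by (intro Bochner_Integration.integral_cong) (auto simp: Ea distrib_left)
        thus ?thesis using Ei by (simp add: D_def)
      qed
      show "D (c *\<^sub>R v) = c *\<^sub>R D v" for c v by (simp add: vec_scaleR_eq Dc scaleR_conv_of_real)
      show "norm (D v) \<le> norm v * (B * (2 * M / d))" for v
        using bound_int[OF kEb Ei, of v] by (simp add: D_def mult_ac)
    qed
    show "d / 4 > 0" using d by simp
    fix v :: "complex ^ 'a" assume v: "norm v \<le> d / 4"
    have zv: "z + v \<in> cball z d" "z \<in> cball z d" using v d by (auto simp: dist_norm)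
    have int: "integrable torus_measure (\<lambda>u. \<kappa> u * f (u * w))" if "w \<in> cball z d" for w
      by (intro integrable_torus continuous_intros k contf that)
    have "torus_average \<kappa> f (z + v) - torus_average \<kappa> f z - D v
        = (LINT u|torus_measure. \<kappa> u * f (u * (z + v)) - \<kappa> u * f (u * z) - \<kappa> u * E u v)"
      using int[OF zv(1)] int[OF zv(2)] Ei[of v] by (simp add: torus_average_def D_def)
    also have "norm \<dots> \<le> B * (32 * M * (norm v)\<^sup>2 / d\<^sup>2)"
    proof (rule bound_int)
      fix u :: "complex ^ 'a" assume u: "u \<in> torus"
      have "cmod (\<kappa> u * (f (u * (z + v)) - f (u * z) - E u v)) \<le> B * (32 * M * (norm v)\<^sup>2 / d\<^sup>2)"
        using B Er[OF u v] u B0 unfolding norm_mult by (intro mult_mono) auto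
      thus "cmod (\<kappa> u * f (u * (z + v)) - \<kappa> u * f (u * z) - \<kappa> u * E u v) \<le> B * (32 * M * (norm v)\<^sup>2 / d\<^sup>2)"
        by (simp add: algebra_simps)
    qed (intro Bochner_Integration.integrable_diff int zv Ei)
    finally show "norm (torus_average \<kappa> f (z + v) - torus_average \<kappa> f z - D v) \<le> (B * (32 * M / d\<^sup>2)) * (norm v)\<^sup>2"
      by (simp add: mult_ac)
  qed
  thus "(torus_average \<kappa> f has_derivative (\<lambda>v. LINT u|torus_measure. \<kappa> u * deriv_Cn f (u * z) (u * v))) (at z)"
    by (simp add: D_def E_def)
qed

corollary holomorphic_Cn_torus_average:
  assumes "open R" "torus_invariant R" "holomorphic_Cn f R" "continuous_on torus \<kappa>"
  shows "holomorphic_Cn (torus_average \<kappa> f) R"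
  using torus_average_has_derivative[OF assms(1-3) _ assms(4)] by (rule holomorphic_CnI)

text \<open>Rotating one coordinate is a curve along which \<open>G\<close> is constant; its
  velocity is \<open>\<i> * z $ j\<close> in direction \<open>j\<close>. As \<open>z $ j\<close> is
  nonzero, complex linearity gives the vanishing of the derivative in that whole complex
  direction.\<close>

lemma torus_invariant_function_derivative_zero:
  assumes R: "open R" "torus_invariant R" and hol: "holomorphic_Cn G R"
    and inv: "\<And>u w. u \<in> torus \<Longrightarrow> w \<in> R \<Longrightarrow> G (u * w) = G w" and z: "z \<in> R" "z \<in> nonzero_coords"
  shows "(G has_derivative (\<lambda>v. 0)) (at z)"
proof -
  let ?D = "deriv_Cn G z"
  have D: "(G has_derivative ?D) (at z)" by (rule deriv_Cn(1)[OF hol z(1)])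
  have lin: "linear ?D" by (rule has_derivative_linear[OF D])
  have axis0: "?D (axis j c) = 0" for j c
  proof -
    define \<gamma> where "\<gamma> = (\<lambda>t :: real. z + (cis t - 1) *s axis j (z $ j))"
    have "\<gamma> t = (\<chi> i. if i = j then cis t else 1) * z" for t
      by (simp add: \<gamma>_def vec_eq_iff axis_def algebra_simps)
    moreover have "(\<chi> i. if i = j then cis t else 1) \<in> torus" for t by (simp add: torus_def)
    ultimately have const: "G (\<gamma> t) = G z" for t using inv z(1) by metis
    have "((\<lambda>t. cis t - 1) has_derivative (\<lambda>h. h *\<^sub>R \<i>)) (at (0::real))"
      using has_derivative_diff[OF has_derivative_cis[OF has_derivative_ident, of 0] has_derivative_const[of 1]] by simp
    from has_derivative_compose[OF this bounded_linear_imp_has_derivative[OF linear_scalar_mult_left[of "axis j (z $ j)"]]]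
    have "(\<gamma> has_derivative (\<lambda>h. (h *\<^sub>R \<i>) *s axis j (z $ j))) (at 0)"
      unfolding \<gamma>_def using has_derivative_add[OF has_derivative_const] by fastforce
    hence "((\<lambda>t. G (\<gamma> t)) has_derivative (\<lambda>h. ?D ((h *\<^sub>R \<i>) *s axis j (z $ j)))) (at 0)"
      by (rule has_derivative_compose) (use D in \<open>simp add: \<gamma>_def\<close>)
    hence "(\<lambda>h :: real. ?D ((h *\<^sub>R \<i>) *s axis j (z $ j))) = (\<lambda>h. 0)"
      unfolding const by (rule has_derivative_unique) (rule has_derivative_const)
    from fun_cong[OF this, of 1] have "?D (\<i> *s axis j (z $ j)) = 0" by simp
    moreover have "axis j c = (c / (\<i> * z $ j)) *s (\<i> *s axis j (z $ j))"
      using z(2) by (simp add: vec_eq_iff axis_def nonzero_coords_def)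
    ultimately show ?thesis using deriv_Cn(2)[OF hol z(1)] by simp
  qed
  have "?D v = 0" for v
  proof -
    have "v = (\<Sum>j\<in>UNIV. axis j (v $ j))" by (simp add: vec_eq_iff axis_def)
    hence "?D v = (\<Sum>j\<in>UNIV. ?D (axis j (v $ j)))" by (metis linear_sum[OF lin])
    thus ?thesis by (simp add: axis0)
  qed
  hence "?D = (\<lambda>v. 0)" by blast
  thus ?thesis using D by simp
qed

text \<open>The complex line through \<open>x\<close> and \<open>y\<close> meets each coordinate
  hyperplane in at most one point, since \<open>x\<close> lies on none of them. A convex open set in
  the plane remains connected without finitely many points, so \<open>F\<close> is constant along
  the line.\<close>

lemma punctured_ball_derivative_zero_constant:
  fixes F :: "complex ^ 'n \<Rightarrow> complex"
  assumes D: "\<And>w. w \<in> ball c d \<inter> nonzero_coords \<Longrightarrow> (F has_derivative (\<lambda>v. 0)) (at w)"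
    and x: "x \<in> ball c d \<inter> nonzero_coords" and y: "y \<in> ball c d \<inter> nonzero_coords"
  shows "F x = F y"
proof -
  define l where "l = (\<lambda>t :: complex. x + t *s (y - x))"
  have lD: "(l has_derivative (\<lambda>h. h *s (y - x))) (at t)" for t
    unfolding l_def using has_derivative_add[OF has_derivative_const bounded_linear_imp_has_derivative[OF linear_scalar_mult_left[of "y - x"]]]
    by fastforce
  have lc: "continuous_on UNIV l"
    by (intro continuous_at_imp_continuous_on ballI has_derivative_continuous[OF lD])
  define S where "S = l -` ball c d"
  have "open S" unfolding S_def using lc by (simp add: continuous_on_open_vimage)
  have "convex S"
  proof (rule convexI)
    fix s t :: complex and a b :: real assume st: "s \<in> S" "t \<in> S" and ab: "0 \<le> a" "0 \<le> b" "a + b = 1"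
    have "l (a *\<^sub>R s + b *\<^sub>R t) = a *\<^sub>R l s + b *\<^sub>R l t"
    proof -
      have "a *\<^sub>R l s + b *\<^sub>R l t = (a + b) *\<^sub>R x + (a *\<^sub>R s + b *\<^sub>R t) *s (y - x)"
        unfolding l_def by (simp add: vec_eq_iff) (simp add: scaleR_conv_of_real algebra_simps)
      thus ?thesis by (simp add: ab l_def)
    qed
    thus "a *\<^sub>R s + b *\<^sub>R t \<in> S"
      using convexD[OF convex_ball, of "l s" c d "l t" a b] st ab by (simp add: S_def)
  qed
  define B where "B = (\<Union>j. {t. l t $ j = 0})"
  have "finite {t. l t $ j = 0}" for j
  proof -
    have "{t. l t $ j = 0} \<subseteq> {- x $ j / (y $ j - x $ j)}"
    proof
      fix t assume t: "t \<in> {t. l t $ j = 0}"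
      hence eq: "x $ j + t * (y $ j - x $ j) = 0" by (simp add: l_def right_diff_distrib)
      hence nz: "y $ j - x $ j \<noteq> 0" using x by (auto simp: nonzero_coords_def)
      have "t * (y $ j - x $ j) = - x $ j" using eq by (simp only: add_eq_0_iff)
      hence "t = - x $ j / (y $ j - x $ j)" using nonzero_eq_divide_eq[OF nz] by blast
      thus "t \<in> {- x $ j / (y $ j - x $ j)}" by blast
    qed
    thus ?thesis using finite_subset by blast
  qed
  hence "finite B" by (simp add: B_def)
  have con: "connected (S - B)"
    by (rule connected_open_diff_countable[OF _ \<open>open S\<close> convex_connected[OF \<open>convex S\<close>] countable_finite[OF \<open>finite B\<close>]]) simp
  have op: "open (S - B)" by (rule open_Diff[OF \<open>open S\<close> finite_imp_closed[OF \<open>finite B\<close>]])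
  have dz: "((\<lambda>t. F (l t)) has_derivative (\<lambda>h. 0)) (at t)" if "t \<in> S - B" for t
  proof -
    have "l t \<in> ball c d \<inter> nonzero_coords" using that by (auto simp: S_def B_def nonzero_coords_def)
    from has_derivative_compose[OF lD D[OF this]] show ?thesis .
  qed
  have "(\<lambda>t. F (l t)) constant_on (S - B)"
  proof (rule has_derivative_zero_connected_constant_on[OF con op finite.emptyI])
    show "continuous_on (S - B) (\<lambda>t. F (l t))"
      by (intro continuous_at_imp_continuous_on ballI has_derivative_continuous[OF dz])
    show "\<forall>t\<in>S - B - {}. ((\<lambda>t. F (l t)) has_derivative (\<lambda>h. 0)) (at t within S - B)"
      using has_derivative_at_withinI[OF dz] by blast
  qed
  moreover have "l 0 = x" "l 1 = y" by (simp_all add: l_def vec_eq_iff)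
  hence "0 \<in> S - B" "1 \<in> S - B" using x y by (auto simp: S_def B_def nonzero_coords_def)
  ultimately have "F (l 0) = F (l 1)" unfolding constant_on_def by metis
  thus ?thesis by (simp add: \<open>l 0 = x\<close> \<open>l 1 = y\<close>)
qed

text \<open>Connectedness of \<open>R\<close> off the hyperplanes is not established directly.
  Instead the value of \<open>F\<close> at a chosen nearby point defines a function on all of
  \<open>R\<close>; it is locally constant because overlapping balls share points off the
  hyperplanes.\<close>

lemma derivative_zero_constant_on_nonzero_coords:
  fixes F :: "complex ^ 'n \<Rightarrow> complex"
  assumes R: "open R" "connected R"
    and D: "\<And>w. w \<in> R \<inter> nonzero_coords \<Longrightarrow> (F has_derivative (\<lambda>v. 0)) (at w)"
  obtains a where "\<And>w. w \<in> R \<inter> nonzero_coords \<Longrightarrow> F w = a"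
proof -
  have "\<exists>r>0. ball z r \<subseteq> R" if "z \<in> R" for z using R(1) that open_contains_ball by blast
  then obtain r where r: "\<And>z. z \<in> R \<Longrightarrow> r z > 0 \<and> ball z (r z) \<subseteq> R" by metis
  have "\<exists>w. w \<in> ball z (r z) \<inter> nonzero_coords" if "z \<in> R" for z
    using nonzero_coords_dense[OF open_ball, of z z "r z"] r[OF that] by auto
  then obtain p where p: "\<And>z. z \<in> R \<Longrightarrow> p z \<in> ball z (r z) \<inter> nonzero_coords" by metis
  have loc: "F x = F y" if "z \<in> R" "x \<in> ball z (r z) \<inter> nonzero_coords" "y \<in> ball z (r z) \<inter> nonzero_coords" for x y z
    using punctured_ball_derivative_zero_constant[OF _ that(2,3)] D r[OF that(1)] by blast
  define H where "H = (\<lambda>z. F (p z))"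
  have "H constant_on R"
  proof (rule locally_constant_imp_constant[OF R(2)])
    fix a assume a: "a \<in> R"
    have "H x = H a" if x: "x \<in> ball a (r a)" for x
    proof -
      have xR: "x \<in> R" using r[OF a] x by blast
      have "x \<in> ball a (r a) \<inter> ball x (r x)" using x r[OF xR] by simp
      then obtain w where w: "w \<in> ball a (r a) \<inter> ball x (r x)" "w \<in> nonzero_coords"
        using nonzero_coords_dense[OF open_Int[OF open_ball open_ball]] by blast
      have "F (p x) = F w" using loc[OF xR p[OF xR]] w by blast
      moreover have "F w = F (p a)" using loc[OF a _ p[OF a]] w by blast
      ultimately show ?thesis by (simp add: H_def)
    qed
    moreover have "openin (top_of_set R) (ball a (r a))" using r[OF a] by (intro open_openin_trans[OF R(1)]) auto
    moreover have "a \<in> ball a (r a)" using r[OF a] by simp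
    ultimately show "\<exists>T. openin (top_of_set R) T \<and> a \<in> T \<and> (\<forall>x\<in>T. H x = H a)" by blast
  qed
  then obtain a where a: "\<And>z. z \<in> R \<Longrightarrow> H z = a" unfolding constant_on_def by blast
  have "F w = a" if w: "w \<in> R \<inter> nonzero_coords" for w
  proof -
    have wR: "w \<in> R" using w by blast
    have "F w = F (p w)" using loc[OF wR _ p[OF wR]] w r[OF wR] by auto
    thus ?thesis using a[OF wR] by (simp add: H_def)
  qed
  thus ?thesis using that by blast
qed

section \<open>Laurent expansions on Reinhardt domains\<close>

lemma continuous_agree_nonzero_coords:
  fixes f g :: "complex ^ 'n \<Rightarrow> complex"
  assumes "open R" "continuous_on R f" "continuous_on R g"
    and eq: "\<And>w. w \<in> R \<inter> nonzero_coords \<Longrightarrow> f w = g w" and z: "z \<in> R"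
  shows "f z = g z"
proof (rule ccontr)
  assume "f z \<noteq> g z"
  define W where "W = R \<inter> (\<lambda>w. f w - g w) -` (- {0})"
  have "open W"
    unfolding W_def by (intro continuous_open_preimage continuous_intros assms)
  moreover have "z \<in> W" using z \<open>f z \<noteq> g z\<close> by (simp add: W_def)
  ultimately obtain w where "w \<in> W" "w \<in> nonzero_coords" using nonzero_coords_dense by blast
  thus False using eq[of w] by (simp add: W_def)
qed

definition degree_abs :: "int ^ 'n \<Rightarrow> nat" where
  "degree_abs \<alpha> = (\<Sum>j\<in>UNIV. nat \<bar>\<alpha> $ j\<bar>)"

text \<open>A finite set of exponents lies in a box, over which the sum is a product of
  one-dimensional sums. Each of these is at most two geometric series, for the nonnegative and the
  nonpositive indices.\<close>

lemma summable_on_power_degree_abs: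
  assumes x: "0 \<le> x" "x < (1::real)"
  shows "(\<lambda>\<alpha> :: int ^ 'n. x ^ degree_abs \<alpha>) summable_on UNIV"
proof (rule nonneg_bdd_above_summable_on)
  show "0 \<le> x ^ degree_abs \<alpha>" for \<alpha> :: "int ^ 'n" using x by simp
  have line: "(\<Sum>k\<in>{-int N..int N}. x ^ nat \<bar>k\<bar>) \<le> 2 / (1 - x)" for N
  proof -
    have geo: "(\<Sum>k\<in>{..N}. x ^ k) \<le> 1 / (1 - x)"
      using sum_le_suminf[of "\<lambda>k. x ^ k" "{..N}"] x suminf_geometric[of x] by simp
    have sub: "{-int N..int N} \<subseteq> int ` {..N} \<union> (\<lambda>k. - int k) ` {..N}"
    proof
      fix k assume k: "k \<in> {-int N..int N}"
      show "k \<in> int ` {..N} \<union> (\<lambda>k. - int k) ` {..N}"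
      proof (cases "k \<ge> 0")
        case True
        hence "k = int (nat k)" "nat k \<in> {..N}" using k by auto
        thus ?thesis by blast
      next
        case False
        hence "k = - int (nat (- k))" "nat (- k) \<in> {..N}" using k by auto
        thus ?thesis by blast
      qed
    qed
    have "(\<Sum>k\<in>{-int N..int N}. x ^ nat \<bar>k\<bar>) \<le> (\<Sum>k\<in>int ` {..N} \<union> (\<lambda>k. - int k) ` {..N}. x ^ nat \<bar>k\<bar>)"
      using x by (intro sum_mono2 sub) auto
    also have "\<dots> \<le> (\<Sum>k\<in>int ` {..N}. x ^ nat \<bar>k\<bar>) + (\<Sum>k\<in>(\<lambda>k. - int k) ` {..N}. x ^ nat \<bar>k\<bar>)"
      using x sum.union_inter[of "int ` {..N}" "(\<lambda>k. - int k) ` {..N}" "\<lambda>k. x ^ nat \<bar>k\<bar>"]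
        sum_nonneg[of "int ` {..N} \<inter> (\<lambda>k. - int k) ` {..N}" "\<lambda>k. x ^ nat \<bar>k\<bar>"] by simp
    also have "\<dots> = (\<Sum>k\<in>{..N}. x ^ k) + (\<Sum>k\<in>{..N}. x ^ k)"
      by (subst (1 2) sum.reindex) (auto simp: inj_on_def)
    finally show ?thesis using geo by simp
  qed
  show "bdd_above (sum (\<lambda>\<alpha> :: int ^ 'n. x ^ degree_abs \<alpha>) ` {F. F \<subseteq> UNIV \<and> finite F})"
  proof (rule bdd_aboveI2)
    fix F :: "(int ^ 'n) set" assume "F \<in> {F. F \<subseteq> UNIV \<and> finite F}"
    hence F: "finite F" by simp
    define N where "N = (\<Sum>\<alpha>\<in>F. degree_abs \<alpha>)"
    have box: "\<alpha> $ j \<in> {-int N..int N}" if "\<alpha> \<in> F" for \<alpha> j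
    proof -
      have "nat \<bar>\<alpha> $ j\<bar> \<le> degree_abs \<alpha>" unfolding degree_abs_def by (intro member_le_sum) auto
      also have "\<dots> \<le> N" unfolding N_def using F that by (intro member_le_sum) auto
      finally show ?thesis by auto
    qed
    have inj: "inj_on (\<lambda>\<alpha> :: int ^ 'n. vec_nth \<alpha>) F" by (auto simp: inj_on_def vec_nth_inject)
    have "(\<Sum>\<alpha>\<in>F. x ^ degree_abs \<alpha>) = (\<Sum>\<alpha>\<in>F. \<Prod>j\<in>UNIV. x ^ nat \<bar>\<alpha> $ j\<bar>)"
      by (simp add: degree_abs_def power_sum)
    also have "\<dots> = (\<Sum>g\<in>vec_nth ` F. \<Prod>j\<in>UNIV. x ^ nat \<bar>g j\<bar>)" using inj by (simp add: sum.reindex)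
    also have "\<dots> \<le> (\<Sum>g\<in>PiE UNIV (\<lambda>_. {-int N..int N}). \<Prod>j\<in>(UNIV :: 'n set). x ^ nat \<bar>g j\<bar>)"
      using box x by (intro sum_mono2 finite_PiE prod_nonneg) (auto simp: PiE_def)
    also have "\<dots> = (\<Prod>j\<in>(UNIV :: 'n set). \<Sum>k\<in>{-int N..int N}. x ^ nat \<bar>k\<bar>)"
      by (subst prod_sum_PiE) auto
    also have "\<dots> \<le> (\<Prod>j\<in>(UNIV :: 'n set). 2 / (1 - x))"
      using line x by (intro prod_mono) (auto intro!: sum_nonneg)
    finally show "(\<Sum>\<alpha>\<in>F. x ^ degree_abs \<alpha>) \<le> (\<Prod>j\<in>(UNIV :: 'n set). 2 / (1 - x))" .
  qed
qed

section \<open>Reinhardt domains and homogeneous components\<close>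

locale reinhardt =
  fixes R :: "(complex ^ 'n) set"
  assumes reinhardt_domain: "reinhardt_domain R"
begin

lemma open_R: "open R" and connected_R: "connected R" and nonempty_R: "R \<noteq> {}"
  using reinhardt_domain by (auto simp: reinhardt_domain_def)

lemma torus_invariant_R: "torus_invariant R"
  unfolding torus_invariant_def
proof (intro ballI)
  fix u z :: "complex ^ 'n" assume u: "u \<in> torus" and z: "z \<in> R"
  have "exp (\<i> * of_real (Arg (u $ j))) = u $ j" for j
    using torus_nth[OF u, of j] Arg_eq[of "u $ j"] torus_nth_nonzero[OF u, of j] by simp
  hence "(\<chi> j. exp (\<i> * of_real ((\<chi> j. Arg (u $ j)) $ j)) * z $ j) = u * z" by (simp add: vec_eq_iff)
  moreover have "(\<chi> j. exp (\<i> * of_real ((\<chi> j. Arg (u $ j)) $ j)) * z $ j) \<in> R"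
    using reinhardt_domain z unfolding reinhardt_domain_def by blast
  ultimately show "u * z \<in> R" by simp
qed

lemma mult_mem_R: "u \<in> torus \<Longrightarrow> z \<in> R \<Longrightarrow> u * z \<in> R"
  by (rule torus_invariantD[OF torus_invariant_R])

lemma mult_mem_R_iff: "u \<in> torus \<Longrightarrow> u * z \<in> R \<longleftrightarrow> z \<in> R"
  using mult_mem_R[of u z] mult_mem_R[of "cnj_vec u" "u * z"] mult_cnj_vec_cancel(2)[of u z] by auto

lemma e_mono_eq: "z \<in> R \<Longrightarrow> e_mono R \<alpha> z = zpow \<alpha> z"
  and e_mono_outside: "z \<notin> R \<Longrightarrow> e_mono R \<alpha> z = 0"
  by (simp_all add: e_mono_def zpow_def)

lemma e_mono_mult: "u \<in> torus \<Longrightarrow> e_mono R \<alpha> (u * z) = zpow \<alpha> u * e_mono R \<alpha> z"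
  by (cases "z \<in> R") (simp_all add: mult_mem_R_iff e_mono_eq e_mono_outside zpow_mult)

lemma ex_nonzero_coords: obtains z where "z \<in> R" "z \<in> nonzero_coords"
  using nonzero_coords_dense[OF open_R] nonempty_R by blast

text \<open>Substituting \<open>cnj_vec w * u\<close> for \<open>u\<close> under the integral moves
  the rotation from the function to the character.\<close>

lemma torus_average_zpow_mult:
  assumes "continuous_on R f" "w \<in> torus" "z \<in> R"
  shows "torus_average (zpow (- \<alpha>)) f (w * z) = zpow \<alpha> w * torus_average (zpow (- \<alpha>)) f z"
proof -
  define h where "h = (\<lambda>v. zpow (- \<alpha>) (cnj_vec w * v) * f (v * z))"
  have wc: "cnj_vec w \<in> torus" using assms(2) by simp
  have "continuous_on torus (\<lambda>v. zpow (- \<alpha>) (cnj_vec w) * zpow (- \<alpha>) v * f (v * z))"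
    by (intro continuous_intros continuous_on_torus_orbit[OF assms(1) torus_invariant_R assms(3)])
  hence hm: "h \<in> borel_measurable torus_measure" by (simp add: h_def zpow_mult borel_measurable_torus)
  have "torus_average (zpow (- \<alpha>)) f (w * z) = (LINT u|torus_measure. h (w * u))"
  proof -
    have eq: "(w * u) * z = u * (w * z)" for u by (simp add: mult_ac)
    show ?thesis unfolding torus_average_def h_def mult_cnj_vec_cancel(2)[OF assms(2)] eq by (rule refl)
  qed
  also have "\<dots> = (LINT u|torus_measure. h u)" by (rule integral_torus_mult[OF assms(2) hm])
  also have "\<dots> = zpow (- \<alpha>) (cnj_vec w) * torus_average (zpow (- \<alpha>)) f z"
    by (simp add: h_def zpow_mult torus_average_def mult.assoc)
  also have "zpow (- \<alpha>) (cnj_vec w) = zpow \<alpha> w"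
    using zpow_uminus_torus[OF wc, of \<alpha>] by (simp add: zpow_cnj_vec)
  finally show ?thesis .
qed

text \<open>Dividing the homogeneous component \<open>F\<close> by the monomial gives a
  torus-invariant holomorphic function off the hyperplanes, hence a constant \<open>a\<close>. If
  \<open>R\<close> meets a hyperplane at which the monomial has a pole, then \<open>F\<close> is
  bounded there while the monomial is not, so \<open>a = 0\<close>. Otherwise the monomial extends
  across the hyperplanes, and for nonzero \<open>a\<close> it inherits holomorphy from
  \<open>F\<close>.\<close>

theorem torus_average_monomial:
  assumes hol: "holomorphic_Cn f R"
  obtains a where "\<And>z. z \<in> R \<Longrightarrow> torus_average (zpow (- \<alpha>)) f z = a * e_mono R \<alpha> z"
    "a \<noteq> 0 \<Longrightarrow> holomorphic_Cn (e_mono R \<alpha>) R"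
proof -
  define F where "F = torus_average (zpow (- \<alpha>)) f"
  have cf: "continuous_on R f" by (rule holomorphic_Cn_continuous_on[OF hol])
  have Fh: "holomorphic_Cn F R"
    unfolding F_def by (intro holomorphic_Cn_torus_average open_R torus_invariant_R hol continuous_intros)
  have Fc: "continuous_on R F" by (rule holomorphic_Cn_continuous_on[OF Fh])
  have Fm: "F (w * z) = zpow \<alpha> w * F z" if "w \<in> torus" "z \<in> R" for w z
    unfolding F_def by (rule torus_average_zpow_mult[OF cf that])
  define U where "U = R \<inter> nonzero_coords"
  have U: "open U" "torus_invariant U"
    unfolding U_def by (intro open_Int open_R open_nonzero_coords torus_invariant_nonzero_coords torus_invariant_R)+
  define G where "G = (\<lambda>z. zpow (- \<alpha>) z * F z)"
  have Gh: "holomorphic_Cn G U"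
    unfolding G_def U_def
    by (intro holomorphic_Cn_mult holomorphic_Cn_subset[OF Fh] holomorphic_Cn_subset[OF holomorphic_Cn_zpow]) auto
  have Ginv: "G (u * w) = G w" if "u \<in> torus" "w \<in> U" for u w
  proof -
    have "zpow (- \<alpha>) u * zpow \<alpha> u = 1"
      using zpow_nonzero[OF torus_subset_nonzero_coords[OF that(1)], of \<alpha>] by (simp add: zpow_uminus)
    thus ?thesis using that by (simp add: G_def zpow_mult Fm U_def)
  qed
  obtain a where a: "\<And>w. w \<in> R \<inter> nonzero_coords \<Longrightarrow> G w = a"
    using derivative_zero_constant_on_nonzero_coords[OF open_R connected_R, of G]
      torus_invariant_function_derivative_zero[OF U Gh Ginv] by (auto simp: U_def)
  have FU: "F w = a * zpow \<alpha> w" if "w \<in> R \<inter> nonzero_coords" for w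
    using a[OF that] zpow_nonzero[of w \<alpha>] that by (auto simp: G_def zpow_uminus field_simps)
  have main: "F z = a * e_mono R \<alpha> z \<and> (a \<noteq> 0 \<longrightarrow> holomorphic_Cn (e_mono R \<alpha>) R)" if zR: "z \<in> R" for z
  proof (cases "\<exists>c\<in>R. \<exists>j. c $ j = 0 \<and> \<alpha> $ j < 0")
    case True
    then obtain c j where c: "c \<in> R" "c $ j = 0" "\<alpha> $ j < 0" by blast
    obtain d where d: "d > 0" "cball c d \<subseteq> R" using open_R c(1) open_contains_cball_eq by blast
    obtain w where w: "w \<in> ball c d" "w \<in> nonzero_coords" using nonzero_coords_dense[OF open_ball, of c c d] d by auto
    \<comment> \<open>Shrinking coordinate \<open>j\<close> of \<open>w\<close> towards 0 does not
      move it away from \<open>c\<close>, whose coordinate \<open>j\<close> is 0, so the path stays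
      in the ball.\<close>
    define p where "p = (\<lambda>t. (\<chi> i. if i = j then complex_of_real t else 1) * w)"
    have pc: "p t \<in> cball c d" if "0 \<le> t" "t \<le> 1" for t
    proof -
      have "norm (c - p t) \<le> norm (c - w)"
      proof (rule norm_le_componentwise_cart)
        fix i
        have "cmod (t * w $ j) \<le> 1 * cmod (w $ j)" using that unfolding norm_mult by (intro mult_right_mono) auto
        thus "norm ((c - p t) $ i) \<le> norm ((c - w) $ i)" using c(2) by (auto simp: p_def)
      qed
      thus ?thesis using w(1) by (simp add: dist_norm)
    qed
    have pcont: "continuous_on UNIV p"
    proof -
      have "continuous_on UNIV (\<lambda>t. if i = j then complex_of_real t else 1)" for i :: 'n
        by (cases "i = j") (auto intro!: continuous_intros)
      thus ?thesis unfolding p_def by (intro continuous_intros)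
    qed
    have "p ` {0..1} \<subseteq> R"
    proof
      fix y assume "y \<in> p ` {0..1}"
      then obtain t where "y = p t" "0 \<le> t" "t \<le> 1" by auto
      thus "y \<in> R" using pc d(2) by blast
    qed
    hence "continuous_on {0..1} (\<lambda>t. F (p t))"
      by (rule continuous_on_compose2[OF Fc continuous_on_subset[OF pcont subset_UNIV]])
    hence "compact ((\<lambda>t. F (p t)) ` {0..1})" by (intro compact_continuous_image compact_Icc)
    then obtain M where M: "\<forall>x\<in>(\<lambda>t. F (p t)) ` {0..1}. cmod x \<le> M"
      using compact_imp_bounded[of "(\<lambda>t. F (p t)) ` {0..1}"] unfolding bounded_iff by blast
    have "a = 0"
    proof (rule ccontr)
      assume "a \<noteq> 0"
      define b where "b = cmod (a * zpow \<alpha> w)"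
      have b: "b > 0" using \<open>a \<noteq> 0\<close> zpow_nonzero[OF w(2)] by (simp add: b_def)
      \<comment> \<open>At \<open>t = 1 / (n + 1)\<close> the negative exponent contributes a factor
        of at least \<open>n + 1\<close>, so \<open>F (p t)\<close> would exceed its bound
        \<open>M\<close>.\<close>
      obtain n :: nat where n: "M / b < real n" using reals_Archimedean2 by blast
      define t where "t = 1 / (real n + 1)"
      have t: "0 < t" "t \<le> 1" by (auto simp: t_def)
      have "p t \<in> R \<inter> nonzero_coords"
        using pc[of t] t d(2) w(2) by (auto simp: p_def nonzero_coords_def)
      hence "F (p t) = a * zpow \<alpha> (p t)" by (rule FU)
      also have "zpow \<alpha> (p t) = of_real t powi (\<alpha> $ j) * zpow \<alpha> w"
      proof -
        have "zpow \<alpha> (\<chi> i. if i = j then complex_of_real t else 1) = (\<Prod>i\<in>UNIV. if i = j then of_real t powi (\<alpha> $ j) else 1)"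
          unfolding zpow_def by (intro prod.cong) auto
        thus ?thesis by (simp add: p_def zpow_mult)
      qed
      finally have "cmod (F (p t)) = t powi (\<alpha> $ j) * b"
        using t by (simp add: norm_mult norm_power_int b_def)
      moreover have "real n + 1 \<le> t powi (\<alpha> $ j)"
      proof -
        have "real n + 1 = t powi (-1)" by (simp add: t_def power_int_minus)
        also have "\<dots> \<le> t powi (\<alpha> $ j)" using t c(3) by (intro power_int_decreasing) auto
        finally show ?thesis .
      qed
      hence "(real n + 1) * b \<le> t powi (\<alpha> $ j) * b" using b by (intro mult_right_mono) auto
      moreover have "cmod (F (p t)) \<le> M" using M t by auto
      ultimately have "(real n + 1) * b \<le> M" by simp
      moreover have "M < real n * b" using n b by (simp add: divide_less_eq)
      ultimately show False using b by (simp add: algebra_simps)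
    qed
    have "F z = 0"
      by (rule continuous_agree_nonzero_coords[OF open_R Fc continuous_on_const _ zR]) (use FU \<open>a = 0\<close> in auto)
    thus ?thesis using \<open>a = 0\<close> by simp
  next
    case False
    \<comment> \<open>In this case the exponent is nonnegative wherever a coordinate vanishes on
      \<open>R\<close>.\<close>
    have cz: "continuous_on R (zpow \<alpha>)"
      unfolding zpow_def using False by (intro continuous_intros) (auto simp: not_less)
    have eq: "F y = a * zpow \<alpha> y" if "y \<in> R" for y
      by (rule continuous_agree_nonzero_coords[OF open_R Fc _ FU that]) (auto intro!: continuous_intros cz)
    have "holomorphic_Cn (e_mono R \<alpha>) R" if "a \<noteq> 0"
      by (rule holomorphic_Cn_cong[OF open_R holomorphic_Cn_mult[OF holomorphic_Cn_const[of "1/a"] Fh]])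
        (use that eq in \<open>simp add: e_mono_eq\<close>)
    thus ?thesis using eq[OF zR] zR by (simp add: e_mono_eq)
  qed
  show ?thesis
  proof (rule that)
    show "torus_average (zpow (- \<alpha>)) f z = a * e_mono R \<alpha> z" if "z \<in> R" for z using main[OF that] by (simp add: F_def)
    show "holomorphic_Cn (e_mono R \<alpha>) R" if "a \<noteq> 0" using main ex_nonzero_coords that by metis
  qed
qed

text \<open>Stretch each coordinate by \<open>1 + \<eta>\<close> or \<open>1 / (1 + \<eta>)\<close>,
  according to the sign of its exponent. The monomial grows by
  \<open>(1 + \<eta>) ^ degree_abs \<alpha>\<close>, while the point stays in a compact
  neighbourhood \<open>L\<close> that does not depend on \<alpha>; only the point \<open>w\<close>
  does.\<close>

lemma compact_monomial_decay:
  assumes K: "compact K" "K \<subseteq> R"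
  obtains L x where "compact L" "L \<subseteq> R" "0 \<le> x" "x < 1"
    "\<And>\<alpha> z. z \<in> K \<Longrightarrow> \<exists>w\<in>L. e_mono R \<alpha> z = of_real (x ^ degree_abs \<alpha>) * e_mono R \<alpha> w"
proof -
  obtain \<epsilon> where e: "\<epsilon> > 0" "(\<Union>x\<in>K. cball x \<epsilon>) \<subseteq> R"
    using compact_subset_open_imp_cball_epsilon_subset[OF K(1) open_R K(2)] by blast
  define L where "L = (\<lambda>(z, v). z + v) ` (K \<times> cball 0 \<epsilon>)"
  have "compact L"
    unfolding L_def case_prod_beta by (intro compact_continuous_image compact_Times K compact_cball continuous_intros)
  moreover have "L \<subseteq> R"
    using e(2) unfolding L_def by (force simp: dist_norm)
  moreover obtain B where B: "B > 0" "\<And>z. z \<in> K \<Longrightarrow> norm z \<le> B"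
    using compact_imp_bounded[OF K(1)] unfolding bounded_pos by blast
  define \<eta> where "\<eta> = \<epsilon> / B"
  have eta: "\<eta> > 0" using e B by (simp add: \<eta>_def)
  define x where "x = 1 / (1 + \<eta>)"
  have x: "0 \<le> x" "x < 1" using eta by (auto simp: x_def)
  have "\<exists>w\<in>L. e_mono R \<alpha> z = of_real (x ^ degree_abs \<alpha>) * e_mono R \<alpha> w" if z: "z \<in> K" for \<alpha> z
  proof -
    define c :: "complex ^ 'n" where "c = (\<chi> j. if 0 \<le> \<alpha> $ j then of_real (1 + \<eta>) else of_real x)"
    have c1: "cmod (c $ j - 1) \<le> \<eta>" for j
    proof -
      have "1 - x = \<eta> * x" using eta by (simp add: x_def field_simps)
      also have "\<dots> \<le> \<eta> * 1" using x eta by (intro mult_left_mono) auto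
      finally have "\<bar>x - 1\<bar> \<le> \<eta>" using x by simp
      moreover have "cmod (complex_of_real x - 1) = \<bar>x - 1\<bar>" by (metis norm_of_real of_real_1 of_real_diff)
      ultimately show ?thesis using eta by (auto simp: c_def)
    qed
    have "norm (c * z - z) \<le> \<eta> * norm z"
    proof -
      have "norm (c * z - z) = L2_set (\<lambda>j. cmod ((c $ j - 1) * z $ j)) UNIV" by (simp add: norm_vec_def left_diff_distrib)
      also have "\<dots> \<le> L2_set (\<lambda>j. \<eta> * cmod (z $ j)) UNIV"
        using c1 by (intro L2_set_mono) (auto simp: norm_mult intro!: mult_right_mono)
      finally show ?thesis using eta by (simp add: L2_set_right_distrib norm_vec_def)
    qed
    also have "\<dots> \<le> \<eta> * B" using B(2)[OF z] eta by (intro mult_left_mono) auto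
    also have "\<dots> = \<epsilon>" using B(1) by (simp add: \<eta>_def)
    finally have n: "norm (c * z - z) \<le> \<epsilon>" .
    have wL: "c * z \<in> L" unfolding L_def using z n by (intro image_eqI[of _ _ "(z, c * z - z)"]) auto
    have wR: "c * z \<in> R" "z \<in> R" using wL \<open>L \<subseteq> R\<close> z K(2) by auto
    have "zpow \<alpha> c = of_real ((1 + \<eta>) ^ degree_abs \<alpha>)"
    proof -
      have "zpow \<alpha> c = (\<Prod>j\<in>UNIV. of_real (1 + \<eta>) ^ nat \<bar>\<alpha> $ j\<bar>)"
        unfolding zpow_def
      proof (intro prod.cong refl)
        fix j
        show "(c $ j) powi (\<alpha> $ j) = complex_of_real (1 + \<eta>) ^ nat \<bar>\<alpha> $ j\<bar>"
          using eta by (simp add: c_def power_int_def x_def inverse_eq_divide)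
      qed
      thus ?thesis by (simp add: degree_abs_def power_sum)
    qed
    moreover have "x ^ degree_abs \<alpha> * (1 + \<eta>) ^ degree_abs \<alpha> = 1"
      using eta by (simp add: x_def flip: power_mult_distrib)
    ultimately have "of_real (x ^ degree_abs \<alpha>) * zpow \<alpha> c = 1"
      by (metis of_real_1 of_real_mult)
    hence "e_mono R \<alpha> z = of_real (x ^ degree_abs \<alpha>) * e_mono R \<alpha> (c * z)"
      using wR by (simp add: e_mono_eq zpow_mult flip: mult.assoc)
    thus ?thesis using wL by blast
  qed
  ultimately show ?thesis using that[of L x] x by blast
qed

lemma compact_orbits: "compact K \<Longrightarrow> compact ((\<lambda>(u, z). u * z) ` (torus \<times> (K :: (complex ^ 'n) set)))"
  unfolding case_prod_beta by (intro compact_continuous_image compact_Times compact_torus continuous_intros)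

lemma orbit_bounded:
  assumes "continuous_on R f" "compact K" "K \<subseteq> R"
  obtains M :: real where "0 \<le> M" "\<And>u z. u \<in> torus \<Longrightarrow> z \<in> K \<Longrightarrow> cmod (f (u * z)) \<le> M"
proof -
  let ?K = "(\<lambda>(u, z). u * z) ` (torus \<times> K)"
  have "?K \<subseteq> R" using assms(3) mult_mem_R by auto
  hence "compact (f ` ?K)" using assms by (intro compact_continuous_image compact_orbits continuous_on_subset[OF assms(1)])
  then obtain M where "\<forall>x\<in>f ` ?K. cmod x \<le> M" using compact_imp_bounded[of "f ` ?K"] unfolding bounded_iff by blast
  hence "cmod (f (u * z)) \<le> max M 0" if "u \<in> torus" "z \<in> K" for u z using that by fastforce
  thus ?thesis using that[of "max M 0"] by simp
qed

lemma torus_average_bound: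
  assumes "continuous_on torus \<kappa>" "continuous_on R f" "z \<in> R"
    and "\<And>u. u \<in> torus \<Longrightarrow> cmod (\<kappa> u * f (u * z)) \<le> M"
  shows "cmod (torus_average \<kappa> f z) \<le> M"
proof -
  have int: "integrable torus_measure (\<lambda>u. \<kappa> u * f (u * z))"
    by (intro integrable_torus continuous_intros assms continuous_on_torus_orbit[OF assms(2) torus_invariant_R assms(3)])
  have "cmod (torus_average \<kappa> f z) \<le> (LINT u|torus_measure. cmod (\<kappa> u * f (u * z)))"
    unfolding torus_average_def by (rule integral_norm_bound)
  also have "\<dots> \<le> (LINT u|(torus_measure :: (complex ^ 'n) measure). M)"
    using int assms(4) by (intro integral_mono) auto
  finally show ?thesis by simp
qed

text \<open>Uniform convergence on the single orbit of \<open>z\<close> suffices: the expansion may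
  be integrated against a character, and orthogonality leaves one term.\<close>

lemma torus_average_of_expansion:
  assumes f: "continuous_on R f" and z: "z \<in> R"
    and lim: "uniform_limit ((\<lambda>u. u * z) ` torus) (\<lambda>A z. \<Sum>\<alpha>\<in>A. b \<alpha> * e_mono R \<alpha> z) f (finite_subsets_at_top UNIV)"
  shows "torus_average (zpow (- \<beta>)) f z = b \<beta> * e_mono R \<beta> z"
proof -
  have "cmod (torus_average (zpow (- \<beta>)) f z - b \<beta> * e_mono R \<beta> z) \<le> e" if e: "e > 0" for e
  proof -
    define P where "P A \<longleftrightarrow> (\<forall>w\<in>(\<lambda>u. u * z) ` torus. dist (\<Sum>\<alpha>\<in>A. b \<alpha> * e_mono R \<alpha> w) (f w) < e)" for A
    have "eventually P (finite_subsets_at_top UNIV)" unfolding P_def by (rule uniform_limitD[OF lim e])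
    then obtain X where X: "finite X" "\<And>A. finite A \<Longrightarrow> X \<subseteq> A \<Longrightarrow> P A"
      unfolding eventually_finite_subsets_at_top by auto
    \<comment> \<open>The exponent \<open>\<beta>\<close> has to belong to the partial sum,
      otherwise its term would be missing after integration.\<close>
    define A where "A = insert \<beta> X"
    have A: "finite A" "\<beta> \<in> A" "P A" using X(1) X(2)[of A] by (auto simp: A_def)
    hence PA: "dist (\<Sum>\<alpha>\<in>A. b \<alpha> * e_mono R \<alpha> (u * z)) (f (u * z)) < e" if "u \<in> torus" for u
      using that unfolding P_def by blast
    have cf: "continuous_on torus (\<lambda>u. f (u * z))" by (rule continuous_on_torus_orbit[OF f torus_invariant_R z])
    have sum_eq: "(LINT u|torus_measure. zpow (- \<beta>) u * (\<Sum>\<alpha>\<in>A. b \<alpha> * e_mono R \<alpha> (u * z))) = b \<beta> * e_mono R \<beta> z"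
    proof -
      have "(LINT u|torus_measure. zpow (- \<beta>) u * (\<Sum>\<alpha>\<in>A. b \<alpha> * e_mono R \<alpha> (u * z)))
          = (LINT u|torus_measure. (\<Sum>\<alpha>\<in>A. (b \<alpha> * e_mono R \<alpha> z) * zpow (\<alpha> - \<beta>) u))"
      proof (intro Bochner_Integration.integral_cong refl)
        fix u :: "complex ^ 'n" assume "u \<in> space torus_measure"
        hence u: "u \<in> torus" by simp
        show "zpow (- \<beta>) u * (\<Sum>\<alpha>\<in>A. b \<alpha> * e_mono R \<alpha> (u * z)) = (\<Sum>\<alpha>\<in>A. (b \<alpha> * e_mono R \<alpha> z) * zpow (\<alpha> - \<beta>) u)"
          unfolding sum_distrib_left
        proof (intro sum.cong refl)
          fix \<alpha>
          have "zpow (\<alpha> - \<beta>) u = zpow \<alpha> u * zpow (- \<beta>) u"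
            using zpow_add[OF torus_subset_nonzero_coords[OF u], of \<alpha> "- \<beta>"] by simp
          thus "zpow (- \<beta>) u * (b \<alpha> * e_mono R \<alpha> (u * z)) = (b \<alpha> * e_mono R \<alpha> z) * zpow (\<alpha> - \<beta>) u"
            by (simp add: e_mono_mult[OF u] mult_ac)
        qed
      qed
      also have "\<dots> = (\<Sum>\<alpha>\<in>A. (b \<alpha> * e_mono R \<alpha> z) * (if \<alpha> - \<beta> = 0 then 1 else 0))"
        by (subst Bochner_Integration.integral_sum) (auto intro!: integrable_mult_right integrable_torus continuous_intros simp: integral_zpow_torus)
      also have "\<dots> = (\<Sum>\<alpha>\<in>A. if \<alpha> = \<beta> then b \<beta> * e_mono R \<beta> z else 0)" by (intro sum.cong) auto
      also have "\<dots> = b \<beta> * e_mono R \<beta> z" using A by simp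
      finally show ?thesis .
    qed
    have cA: "continuous_on torus (\<lambda>u. \<Sum>\<alpha>\<in>A. b \<alpha> * e_mono R \<alpha> (u * z))"
      by (rule continuous_on_eq[where f="\<lambda>u. \<Sum>\<alpha>\<in>A. b \<alpha> * (zpow \<alpha> u * e_mono R \<alpha> z)"]) (auto intro!: continuous_intros simp: e_mono_mult)
    have "torus_average (zpow (- \<beta>)) f z - b \<beta> * e_mono R \<beta> z
        = (LINT u|torus_measure. zpow (- \<beta>) u * f (u * z) - zpow (- \<beta>) u * (\<Sum>\<alpha>\<in>A. b \<alpha> * e_mono R \<alpha> (u * z)))"
      unfolding sum_eq[symmetric] torus_average_def
      by (rule Bochner_Integration.integral_diff[symmetric]; intro integrable_torus continuous_intros cf cA)
    also have "cmod \<dots> \<le> (LINT u|torus_measure. cmod (zpow (- \<beta>) u * f (u * z) - zpow (- \<beta>) u * (\<Sum>\<alpha>\<in>A. b \<alpha> * e_mono R \<alpha> (u * z))))"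
      by (rule integral_norm_bound)
    also have "\<dots> \<le> (LINT u|(torus_measure :: (complex ^ 'n) measure). e)"
    proof (rule integral_mono)
      fix u :: "complex ^ 'n" assume "u \<in> space torus_measure"
      hence u: "u \<in> torus" by simp
      have "cmod (zpow (- \<beta>) u * (f (u * z) - (\<Sum>\<alpha>\<in>A. b \<alpha> * e_mono R \<alpha> (u * z)))) \<le> e"
        using PA[OF u] u by (simp add: norm_mult cmod_zpow_torus dist_norm norm_minus_commute less_imp_le)
      thus "cmod (zpow (- \<beta>) u * f (u * z) - zpow (- \<beta>) u * (\<Sum>\<alpha>\<in>A. b \<alpha> * e_mono R \<alpha> (u * z))) \<le> e"
        by (simp add: right_diff_distrib)
    qed (auto intro!: integrable_torus continuous_intros cf cA)
    finally show ?thesis by simp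
  qed
  hence "cmod (torus_average (zpow (- \<beta>)) f z - b \<beta> * e_mono R \<beta> z) \<le> 0"
    by (intro field_le_epsilon[of _ 0]) simp
  thus ?thesis by simp
qed

section \<open>Recovering a function from its components\<close>

lemma peak_average_tendsto:
  assumes "continuous_on R f" "z \<in> R"
  shows "(\<lambda>N. torus_average (\<lambda>u. of_real (peak_kernel N u)) f z) \<longlonglongrightarrow> f z"
  using peak_kernel_concentrates[OF continuous_on_torus_orbit[OF assms(1) torus_invariant_R assms(2)]]
  by (simp add: torus_average_def)

lemma torus_average_trig_poly:
  assumes "trig_poly P"
  obtains A c where "finite A"
    "\<And>f z. continuous_on R f \<Longrightarrow> z \<in> R \<Longrightarrow> torus_average P f z = (\<Sum>\<alpha>\<in>A. c \<alpha> * torus_average (zpow (- \<alpha>)) f z)"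
proof -
  obtain A c where A: "finite A" "\<forall>u\<in>torus. P u = (\<Sum>\<alpha>\<in>A. c \<alpha> * zpow \<alpha> u)" using assms by (auto simp: trig_poly_def)
  have "torus_average P f z = (\<Sum>\<alpha>\<in>uminus ` A. c (- \<alpha>) * torus_average (zpow (- \<alpha>)) f z)"
    if "continuous_on R f" "z \<in> R" for f z
  proof -
    have "torus_average P f z = (LINT u|torus_measure. (\<Sum>\<alpha>\<in>A. c \<alpha> * (zpow \<alpha> u * f (u * z))))"
      unfolding torus_average_def using A(2)
      by (intro Bochner_Integration.integral_cong) (auto simp: sum_distrib_right mult.assoc)
    also have "\<dots> = (\<Sum>\<alpha>\<in>A. c \<alpha> * torus_average (zpow \<alpha>) f z)"
      unfolding torus_average_def
      by (subst Bochner_Integration.integral_sum)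
        (auto intro!: integrable_mult_right integrable_torus continuous_intros continuous_on_torus_orbit[OF that(1) torus_invariant_R that(2)])
    also have "\<dots> = (\<Sum>\<alpha>\<in>uminus ` A. c (- \<alpha>) * torus_average (zpow (- \<alpha>)) f z)"
      by (subst sum.reindex) (auto simp: inj_on_def)
    finally show ?thesis .
  qed
  thus ?thesis using that[of "uminus ` A" "\<lambda>\<alpha>. c (- \<alpha>)"] A(1) by blast
qed

text \<open>Peak averages are finite combinations of averages against characters, and they converge
  to the value of the function.\<close>

lemma zero_if_torus_averages_zero:
  assumes "continuous_on R f" "z \<in> R" "\<And>\<alpha>. torus_average (zpow (- \<alpha>)) f z = 0"
  shows "f z = 0"
proof -
  have "torus_average (\<lambda>u. of_real (peak_kernel N u)) f z = 0" for N
    using torus_average_trig_poly[OF peak_kernel_trig_poly[of N]] assms by (metis (no_types, lifting) mult_zero_right sum.neutral)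
  thus ?thesis using peak_average_tendsto[OF assms(1,2)] by (simp add: LIMSEQ_const_iff)
qed

text \<open>The components give the coefficients, and \<open>compact_monomial_decay\<close> makes
  their series converge absolutely and uniformly on compact sets to some \<open>S\<close>. Then
  \<open>f - S\<close> has no nonzero component, so it vanishes. Uniqueness holds because an
  expansion determines the components, read off at a point with nonzero coordinates.\<close>

theorem Laurent_expansion:
  assumes hol: "holomorphic_Cn f R"
  shows "\<exists>!a. (\<forall>\<alpha>. a \<alpha> \<noteq> 0 \<longrightarrow> holomorphic_Cn (e_mono R \<alpha>) R) \<and>
     (\<forall>K. compact K \<and> K \<subseteq> R \<longrightarrow>
        uniform_limit K (\<lambda>A z. \<Sum>\<alpha>\<in>A. a \<alpha> * e_mono R \<alpha> z) f (finite_subsets_at_top UNIV))" (is "\<exists>!a. ?P a")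
proof (rule ex_ex1I)
  have cf: "continuous_on R f" by (rule holomorphic_Cn_continuous_on[OF hol])
  have orb: "compact ((\<lambda>u. u * z) ` torus)" "(\<lambda>u. u * z) ` torus \<subseteq> R" if "z \<in> R" for z
    using that mult_mem_R by (auto intro!: compact_continuous_image compact_torus continuous_intros)
  show "a = b" if "?P a" "?P b" for a b
  proof
    fix \<alpha>
    obtain z where z: "z \<in> R" "z \<in> nonzero_coords" by (rule ex_nonzero_coords)
    have "a \<alpha> * e_mono R \<alpha> z = b \<alpha> * e_mono R \<alpha> z"
      using torus_average_of_expansion[OF cf z(1), of a \<alpha>] torus_average_of_expansion[OF cf z(1), of b \<alpha>] that orb[OF z(1)] by auto
    thus "a \<alpha> = b \<alpha>" using zpow_nonzero[OF z(2)] z(1) by (simp add: e_mono_eq)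
  qed
  have "\<forall>\<alpha>. \<exists>a. (\<forall>z\<in>R. torus_average (zpow (- \<alpha>)) f z = a * e_mono R \<alpha> z) \<and> (a \<noteq> 0 \<longrightarrow> holomorphic_Cn (e_mono R \<alpha>) R)"
    using torus_average_monomial[OF hol] by metis
  then obtain a where a: "\<And>\<alpha> z. z \<in> R \<Longrightarrow> torus_average (zpow (- \<alpha>)) f z = a \<alpha> * e_mono R \<alpha> z"
    "\<And>\<alpha>. a \<alpha> \<noteq> 0 \<Longrightarrow> holomorphic_Cn (e_mono R \<alpha>) R" by metis
  define S where "S = (\<lambda>z. \<Sum>\<^sub>\<infinity>\<alpha>\<in>UNIV. a \<alpha> * e_mono R \<alpha> z)"
  have lim: "uniform_limit K (\<lambda>A z. \<Sum>\<alpha>\<in>A. a \<alpha> * e_mono R \<alpha> z) S (finite_subsets_at_top UNIV)"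
    if K: "compact K" "K \<subseteq> R" for K
  proof -
    obtain L x where L: "compact L" "L \<subseteq> R" "0 \<le> x" "x < 1"
      and dec: "\<And>\<alpha> z. z \<in> K \<Longrightarrow> \<exists>w\<in>L. e_mono R \<alpha> z = of_real (x ^ degree_abs \<alpha>) * e_mono R \<alpha> w"
      using compact_monomial_decay[OF K] by blast
    obtain M where M: "0 \<le> M" "\<And>u z. u \<in> torus \<Longrightarrow> z \<in> L \<Longrightarrow> cmod (f (u * z)) \<le> M"
      using orbit_bounded[OF cf L(1,2)] by blast
    \<comment> \<open>The bound \<open>M\<close> for the component holds on the larger set
      \<open>L\<close>; passing from \<open>z\<close> to \<open>w\<close> there gains the geometric
      factor.\<close>
    have "cmod (a \<alpha> * e_mono R \<alpha> z) \<le> x ^ degree_abs \<alpha> * M" if z: "z \<in> K" for \<alpha> z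
    proof -
      obtain w where w: "w \<in> L" "e_mono R \<alpha> z = of_real (x ^ degree_abs \<alpha>) * e_mono R \<alpha> w" using dec[OF z] by blast
      have wR: "w \<in> R" using w L by blast
      have "cmod (torus_average (zpow (- \<alpha>)) f w) \<le> M"
        using M(2)[OF _ w(1)] by (intro torus_average_bound cf wR continuous_intros) (simp add: norm_mult cmod_zpow_torus)
      hence "cmod (a \<alpha> * e_mono R \<alpha> w) \<le> M" by (simp add: a(1)[OF wR])
      hence "x ^ degree_abs \<alpha> * cmod (a \<alpha> * e_mono R \<alpha> w) \<le> x ^ degree_abs \<alpha> * M" using L by (intro mult_left_mono) auto
      thus ?thesis using L by (simp add: w(2) norm_mult norm_power mult_ac)
    qed
    moreover have "(\<lambda>\<alpha> :: int ^ 'n. x ^ degree_abs \<alpha> * M) summable_on UNIV"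
      using summable_on_power_degree_abs[OF L(3,4)] by (rule summable_on_cmult_left)
    ultimately show ?thesis unfolding S_def by (intro Weierstrass_m_test_general) auto
  qed
  have ecR: "continuous_on R (\<lambda>z. a \<alpha> * e_mono R \<alpha> z)" for \<alpha>
  proof (cases "a \<alpha> = 0")
    case False
    thus ?thesis using a(2) by (intro continuous_intros holomorphic_Cn_continuous_on)
  qed simp
  have Sc: "continuous_on R S"
  proof -
    have "continuous (at z) S" if zR: "z \<in> R" for z
    proof -
      obtain d where d: "d > 0" "cball z d \<subseteq> R" using open_R zR open_contains_cball_eq by blast
      have "continuous_on (cball z d) S"
      proof (rule uniform_limit_theorem[OF _ lim[OF compact_cball d(2)]])
        show "\<forall>\<^sub>F A in finite_subsets_at_top UNIV. continuous_on (cball z d) (\<lambda>z. \<Sum>\<alpha>\<in>A. a \<alpha> * e_mono R \<alpha> z)"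
          by (intro always_eventually allI continuous_on_sum continuous_on_subset[OF ecR d(2)])
      qed simp
      thus ?thesis using d(1) continuous_on_interior[of "cball z d" S z] by simp
    qed
    thus ?thesis by (simp add: continuous_at_imp_continuous_on)
  qed
  have "S z = f z" if z: "z \<in> R" for z
  proof -
    have cfz: "continuous_on torus (\<lambda>u. f (u * z))" "continuous_on torus (\<lambda>u. S (u * z))"
      by (rule continuous_on_torus_orbit[OF _ torus_invariant_R z]; fact)+
    have "torus_average (zpow (- \<beta>)) (\<lambda>z. f z - S z) z = 0" for \<beta>
    proof -
      have "torus_average (zpow (- \<beta>)) (\<lambda>z. f z - S z) z = torus_average (zpow (- \<beta>)) f z - torus_average (zpow (- \<beta>)) S z"
        unfolding torus_average_def right_diff_distrib
        by (rule Bochner_Integration.integral_diff; intro integrable_torus continuous_intros cfz)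
      also have "torus_average (zpow (- \<beta>)) S z = a \<beta> * e_mono R \<beta> z"
        by (rule torus_average_of_expansion[OF Sc z lim[OF orb[OF z]]])
      finally show ?thesis by (simp add: a(1)[OF z])
    qed
    hence "f z - S z = 0" by (intro zero_if_torus_averages_zero[of "\<lambda>z. f z - S z"] z continuous_intros cf Sc)
    thus ?thesis by simp
  qed
  hence Sf: "S z = f z" if "z \<in> R" for z using that by blast
  have "uniform_limit K (\<lambda>A z. \<Sum>\<alpha>\<in>A. a \<alpha> * e_mono R \<alpha> z) f (finite_subsets_at_top UNIV)"
    if K: "compact K" "K \<subseteq> R" for K
  proof (rule uniform_limit_cong'[THEN iffD1, OF refl _ lim[OF K]])
    show "S z = f z" if "z \<in> K" for z using that K(2) Sf by blast
  qed
  thus "\<exists>a. ?P a" using a(2) by blast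
qed

text \<open>Unique existence resolves the definite description; from here on the coefficients are
  accessed only through averages over the torus.\<close>

lemma laurent_coeff:
  assumes hol: "holomorphic_Cn f R"
  shows "z \<in> R \<Longrightarrow> torus_average (zpow (- \<alpha>)) f z = laurent_coeff R f \<alpha> * e_mono R \<alpha> z"
    and "laurent_coeff R f \<alpha> \<noteq> 0 \<Longrightarrow> holomorphic_Cn (e_mono R \<alpha>) R"
proof -
  note * = theI'[OF Laurent_expansion[OF hol], folded laurent_coeff_def]
  show "laurent_coeff R f \<alpha> \<noteq> 0 \<Longrightarrow> holomorphic_Cn (e_mono R \<alpha>) R" using * by blast
  assume z: "z \<in> R"
  have "compact ((\<lambda>u. u * z) ` torus)" "(\<lambda>u. u * z) ` torus \<subseteq> R"
    using z mult_mem_R by (auto intro!: compact_continuous_image compact_torus continuous_intros)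
  thus "torus_average (zpow (- \<alpha>)) f z = laurent_coeff R f \<alpha> * e_mono R \<alpha> z"
    using * by (intro torus_average_of_expansion holomorphic_Cn_continuous_on hol z) blast
qed

end

section \<open>Bergman spaces\<close>

lemma holomorphic_Cn_translate:
  fixes f :: "complex ^ 'n \<Rightarrow> complex"
  assumes "holomorphic_Cn f (ball z d)" shows "holomorphic_Cn (\<lambda>w. f (z + w)) (ball 0 d)"
proof (rule holomorphic_CnI)
  fix w :: "complex ^ 'n" assume "w \<in> ball 0 d"
  hence w: "z + w \<in> ball z d" by (simp add: dist_norm)
  have "((\<lambda>w. z + w) has_derivative (\<lambda>h. h)) (at w)" by (auto intro!: derivative_eq_intros)
  from has_derivative_compose[OF this deriv_Cn(1)[OF assms w]]
  show "((\<lambda>w. f (z + w)) has_derivative deriv_Cn f (z + w)) (at w)" .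
  show "deriv_Cn f (z + w) (c *s v) = c * deriv_Cn f (z + w) v" for c v by (rule deriv_Cn(2)[OF assms w])
qed

lemma reinhardt_ball: "d > 0 \<Longrightarrow> reinhardt (ball (0 :: complex ^ 'n) d)"
proof
  assume "d > 0"
  moreover have "norm (\<chi> j. exp (\<i> * of_real (\<theta> $ j)) * z $ j) = norm z" for \<theta> :: "real ^ 'n" and z :: "complex ^ 'n"
    by (simp add: norm_vec_def norm_mult)
  ultimately show "reinhardt_domain (ball (0 :: complex ^ 'n) d)"
    by (auto simp: reinhardt_domain_def)
qed

text \<open>A ball around the origin is itself a Reinhardt domain. There the component of degree 0
  is a constant, so its value at \<open>w\<close> agrees with its value at the centre.\<close>

lemma torus_mean_value:
  fixes f :: "complex ^ 'n \<Rightarrow> complex"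
  assumes hol: "holomorphic_Cn f (ball z d)" and d: "d > 0" and w: "w \<in> ball 0 d"
  shows "f z = (LINT u|torus_measure. f (z + u * w))"
proof -
  define F where "F = (\<lambda>w. f (z + w))"
  interpret W: reinhardt "ball (0 :: complex ^ 'n) d" by (rule reinhardt_ball[OF d])
  obtain a where a: "\<And>w. w \<in> ball 0 d \<Longrightarrow> torus_average (zpow (- 0)) F w = a * e_mono (ball 0 d) 0 w"
    using W.torus_average_monomial[OF holomorphic_Cn_translate[OF hol], of 0] unfolding F_def by blast
  have "torus_average (zpow (- 0)) F w = a" if "w \<in> ball 0 d" for w
    using a[OF that] W.e_mono_eq[OF that, of 0] by simp
  hence "torus_average (zpow (- 0)) F 0 = torus_average (zpow (- 0)) F w" using w d by simp
  thus ?thesis by (simp add: torus_average_def F_def)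
qed

lemma sum_fun_apply: "(\<Sum>i\<in>I. f i) x = (\<Sum>i\<in>I. f i x :: complex)"
  by (induction I rule: infinite_finite_induct) auto

section \<open>Bergman spaces on a bounded Reinhardt domain: invariance, evaluation,
  completeness\<close>

locale bounded_reinhardt = reinhardt R for R :: "(complex ^ 'n) set" +
  assumes bounded_R: "bounded R"
begin

lemma sets_R [measurable, simp]: "R \<in> sets borel"
  using open_R by simp

lemma space_dV [simp]: "space (dV R) = R"
  by (simp add: space_restrict_space)

sublocale fin: finite_measure "dV R"
proof (rule finite_measureI)
  have "emeasure (dV R) (space (dV R)) = emeasure lborel R" by (simp add: emeasure_restrict_space)
  thus "emeasure (dV R) (space (dV R)) \<noteq> \<infinity>" using emeasure_bounded_finite[OF bounded_R] by simp
qed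

sublocale TM: pair_sigma_finite torus_measure "dV R"
  by (intro pair_sigma_finite.intro torus_measure.sigma_finite_measure_axioms fin.sigma_finite_measure_axioms)

lemma continuous_measurable: "continuous_on R f \<Longrightarrow> f \<in> borel_measurable (dV R)"
  using borel_measurable_continuous_on_restrict[of R f]
  by (subst measurable_cong_sets[OF sets_restrict_space_cong[OF sets_lborel] refl])

lemma isometry_dV:
  fixes L :: "complex ^ 'n \<Rightarrow> complex ^ 'n"
  assumes lin: "linear L" and iso: "\<And>x. norm (L x) = norm x" and LR: "\<And>z. L z \<in> R \<longleftrightarrow> z \<in> R"
  shows "L \<in> dV R \<rightarrow>\<^sub>M dV R" "distr (dV R) (dV R) L = dV R"
proof -
  have [measurable]: "L \<in> borel_measurable borel"
    using linear_continuous_on[of L UNIV] lin by (intro borel_measurable_continuous_onI) (auto simp: linear_conv_bounded_linear)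
  show meas: "L \<in> dV R \<rightarrow>\<^sub>M dV R"
    by (rule measurable_restrict_space3) (use LR in auto)
  show "distr (dV R) (dV R) L = dV R"
  proof (rule measure_eqI)
    fix A assume "A \<in> sets (distr (dV R) (dV R) L)"
    hence A: "A \<in> sets (dV R)" by simp
    hence AR: "A \<subseteq> R" "A \<in> sets borel" by (auto simp: sets_restrict_space_iff)
    have "emeasure (distr (dV R) (dV R) L) A = emeasure (dV R) (L -` A \<inter> R)"
      using meas A by (simp add: emeasure_distr)
    also have "L -` A \<inter> R = L -` A" using AR LR by auto
    also have "emeasure (dV R) (L -` A) = emeasure lborel (L -` A)"
      using AR LR by (subst emeasure_restrict_space) auto
    also have "\<dots> = emeasure (distr lborel borel L) A"
      using AR by (subst emeasure_distr) auto
    also have "\<dots> = emeasure (dV R) A"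
      using AR by (simp add: lborel_distr_isometry[OF lin iso] emeasure_restrict_space)
    finally show "emeasure (distr (dV R) (dV R) L) A = emeasure (dV R) A" .
  qed simp
qed

lemma mult_dV: 
  assumes "u \<in> torus"
  shows "(\<lambda>z. u * z) \<in> dV R \<rightarrow>\<^sub>M dV R" "distr (dV R) (dV R) (\<lambda>z. u * z) = dV R"
  using isometry_dV[OF linear_mult_vec norm_torus_mult[OF assms] mult_mem_R_iff[OF assms]] by auto

text \<open>Conjugating a nonzero coordinate is a rotation by \<open>cnj (z $ j) / z $ j\<close>, so
  \<open>cnj_vec z\<close> lies on the torus orbit of \<open>z\<close>.\<close>

lemma cnj_vec_mem_R: "cnj_vec z \<in> R \<longleftrightarrow> z \<in> R"
proof -
  have "cnj_vec z \<in> R" if "z \<in> R" for z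
  proof -
    define u where "u = (\<chi> j. if z $ j = 0 then 1 else cnj (z $ j) / z $ j)"
    have "u \<in> torus" by (simp add: u_def torus_def norm_divide)
    moreover have "u * z = cnj_vec z" by (simp add: u_def vec_eq_iff)
    ultimately show ?thesis using mult_mem_R[of u z] that by simp
  qed
  from this[of z] this[of "cnj_vec z"] show ?thesis by auto
qed

lemma cnj_dV: "cnj_vec \<in> dV R \<rightarrow>\<^sub>M dV R" "distr (dV R) (dV R) cnj_vec = dV R"
  using isometry_dV[OF linear_cnj_vec norm_cnj_vec cnj_vec_mem_R] by auto

lemma integral_mult_dV:
  fixes f :: "complex ^ 'n \<Rightarrow> 'b::{banach, second_countable_topology}"
  assumes "u \<in> torus" "f \<in> borel_measurable (dV R)"
  shows "(LINT z|dV R. f (u * z)) = (LINT z|dV R. f z)"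
  using integral_distr[OF mult_dV(1)[OF assms(1)] assms(2)] mult_dV(2)[OF assms(1)] by simp

lemma nn_integral_mult_dV:
  assumes "u \<in> torus" "f \<in> borel_measurable (dV R)"
  shows "(\<integral>\<^sup>+z. f (u * z) \<partial>dV R) = (\<integral>\<^sup>+z. f z \<partial>dV R)"
  using nn_integral_distr[OF mult_dV(1)[OF assms(1)], of f] assms(2) mult_dV(2)[OF assms(1)] by simp

lemma measurable_action [measurable]: "(\<lambda>(u, z). u * z) \<in> torus_measure \<Otimes>\<^sub>M dV R \<rightarrow>\<^sub>M dV R"
proof (rule measurable_restrict_space2)
  show "(\<lambda>(u, z). u * z) \<in> space (torus_measure \<Otimes>\<^sub>M dV R) \<rightarrow> R"
    by (auto simp: space_pair_measure mult_mem_R)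
  have um: "(\<lambda>u. u) \<in> torus_measure \<rightarrow>\<^sub>M (borel :: (complex ^ 'n) measure)"
    by (rule borel_measurable_torus) (rule continuous_on_id)
  have zm: "(\<lambda>z. z) \<in> dV R \<rightarrow>\<^sub>M borel" by (rule continuous_measurable) (rule continuous_on_id)
  note m = measurable_compose[OF measurable_fst[of torus_measure "dV R"] um]
    measurable_compose[OF measurable_snd[of torus_measure "dV R"] zm]
  have "(\<lambda>x. fst x * snd x) \<in> torus_measure \<Otimes>\<^sub>M dV R \<rightarrow>\<^sub>M (borel :: (complex ^ 'n) measure)"
    by (rule borel_measurable_continuous_Pair[OF m]) (intro continuous_intros)
  thus "(\<lambda>(u, z). u * z) \<in> torus_measure \<Otimes>\<^sub>M dV R \<rightarrow>\<^sub>M lborel" by (simp add: case_prod_beta)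
qed

lemma bergmanD:
  assumes "f \<in> bergman R r"
  shows "f \<in> lp_space (dV R) r" "holomorphic_Cn f R" "z \<notin> R \<Longrightarrow> f z = 0" "continuous_on R f"
  using assms holomorphic_Cn_continuous_on by (auto simp: bergman_def Lp_eq_lp_space)

lemma bergmanI: "f \<in> lp_space (dV R) r \<Longrightarrow> holomorphic_Cn f R \<Longrightarrow> (\<And>z. z \<notin> R \<Longrightarrow> f z = 0) \<Longrightarrow> f \<in> bergman R r"
  by (auto simp: bergman_def Lp_eq_lp_space)

lemma bergman_sub_lp: "bergman R r \<subseteq> lp_space (dV R) r"
  using bergmanD(1) by blast

text \<open>The mean value over torus orbits is integrated over a ball. Exchanging the integrals,
  each rotation preserves the ball and Lebesgue measure, so the torus drops out and a volume
  integral remains.\<close>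

lemma evaluation_bound_L1:
  assumes f: "f \<in> bergman R r" "integrable (dV R) f" and d: "d > 0" "ball z d \<subseteq> R"
  shows "measure lborel (ball (0 :: complex ^ 'n) d) * cmod (f z) \<le> (LINT w|dV R. cmod (f w))"
proof -
  define B where "B = ball (0 :: complex ^ 'n) d"
  let ?I = "indicator B :: complex ^ 'n \<Rightarrow> ennreal"
  note bD = bergmanD[OF f(1)]
  have hol: "holomorphic_Cn f (ball z d)" by (rule holomorphic_Cn_subset[OF bD(2) d(2)])
  have fm [measurable]: "f \<in> borel_measurable borel"
  proof -
    have "(\<lambda>x. indicator R x *\<^sub>R f x) \<in> borel_measurable lborel"
      using lp_spaceD(1)[OF bD(1)] by (subst (asm) borel_measurable_restrict_space_iff) auto
    moreover have "(\<lambda>x. indicator R x *\<^sub>R f x) = f" using bD(3) by (auto simp: indicator_def fun_eq_iff)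
    ultimately show ?thesis by simp
  qed
  have Bm [measurable]: "B \<in> sets borel" by (simp add: B_def)
  interpret BT: pair_sigma_finite "lborel :: (complex ^ 'n) measure" torus_measure
    by (intro pair_sigma_finite.intro torus_measure.sigma_finite_measure_axioms sigma_finite_lborel)
  have um [measurable]: "(\<lambda>u. u) \<in> torus_measure \<rightarrow>\<^sub>M (borel :: (complex ^ 'n) measure)"
    by (rule borel_measurable_torus) (rule continuous_on_id)
  have prodm [measurable]: "(\<lambda>x. snd x * fst x) \<in> lborel \<Otimes>\<^sub>M torus_measure \<rightarrow>\<^sub>M (borel :: (complex ^ 'n) measure)"
  proof (rule borel_measurable_continuous_Pair[where H="\<lambda>u z. u * z"])
    show "(\<lambda>x. snd x) \<in> lborel \<Otimes>\<^sub>M torus_measure \<rightarrow>\<^sub>M (borel :: (complex ^ 'n) measure)"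
      by (rule measurable_compose[OF measurable_snd um])
    show "(\<lambda>x. fst x) \<in> (lborel :: (complex ^ 'n) measure) \<Otimes>\<^sub>M (torus_measure :: (complex ^ 'n) measure) \<rightarrow>\<^sub>M borel"
      using measurable_fst[of "lborel :: (complex ^ 'n) measure" torus_measure] by simp
  qed (intro continuous_intros)
  have "emeasure lborel B * ennreal (cmod (f z)) = (\<integral>\<^sup>+w. ?I w * ennreal (cmod (f z)) \<partial>lborel)"
    by (simp add: nn_integral_multc)
  also have "\<dots> \<le> (\<integral>\<^sup>+w. (\<integral>\<^sup>+u. ?I w * ennreal (cmod (f (z + u * w))) \<partial>torus_measure) \<partial>lborel)"
  proof (rule nn_integral_mono)
    fix w :: "complex ^ 'n"
    show "?I w * ennreal (cmod (f z)) \<le> (\<integral>\<^sup>+u. ?I w * ennreal (cmod (f (z + u * w))) \<partial>torus_measure)"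
    proof (cases "w \<in> B")
      case True
      hence w: "w \<in> ball 0 d" by (simp add: B_def)
      have "continuous_on torus (\<lambda>u. f (z + u * w))"
        using w by (intro continuous_on_compose2[OF holomorphic_Cn_continuous_on[OF hol]] continuous_intros)
          (auto simp: dist_norm norm_torus_mult)
      hence int: "integrable torus_measure (\<lambda>u. f (z + u * w))" by (rule integrable_torus)
      have "ennreal (cmod (f z)) = ennreal (cmod (LINT u|torus_measure. f (z + u * w)))"
        using torus_mean_value[OF hol d(1) w] by simp
      also have "\<dots> \<le> (\<integral>\<^sup>+u. cmod (f (z + u * w)) \<partial>torus_measure)" by (rule integral_norm_bound_ennreal[OF int])
      finally show ?thesis using True by simp
    qed simp
  qed
  also have "\<dots> = (\<integral>\<^sup>+u. (\<integral>\<^sup>+w. ?I w * ennreal (cmod (f (z + u * w))) \<partial>lborel) \<partial>torus_measure)"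
  proof (rule BT.Fubini'[symmetric])
    show "(\<lambda>(w, u). ?I w * ennreal (cmod (f (z + u * w)))) \<in> borel_measurable (lborel \<Otimes>\<^sub>M torus_measure)"
      unfolding case_prod_beta by measurable
  qed
  also have "\<dots> = (\<integral>\<^sup>+u. (\<integral>\<^sup>+w. ?I w * ennreal (cmod (f (z + w))) \<partial>lborel) \<partial>(torus_measure :: (complex ^ 'n) measure))"
  proof (rule nn_integral_cong)
    fix u :: "complex ^ 'n" assume "u \<in> space torus_measure"
    hence u: "u \<in> torus" by simp
    define h where "h = (\<lambda>w. ?I w * ennreal (cmod (f (z + w))))"
    have hm: "h \<in> borel_measurable borel" unfolding h_def by measurable
    have Lm: "(\<lambda>w. u * w) \<in> lborel \<rightarrow>\<^sub>M (borel :: (complex ^ 'n) measure)"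
      using borel_measurable_continuous_onI[of "\<lambda>w. u * w"] by (simp add: continuous_intros)
    have "(\<integral>\<^sup>+w. h (u * w) \<partial>lborel) = (\<integral>\<^sup>+w. h w \<partial>distr lborel borel (\<lambda>w. u * w))"
      using nn_integral_distr[OF Lm, of h] hm by simp
    also have "\<dots> = (\<integral>\<^sup>+w. h w \<partial>lborel)"
      by (simp add: lborel_distr_isometry[OF linear_mult_vec norm_torus_mult[OF u]])
    finally have "(\<integral>\<^sup>+w. h (u * w) \<partial>lborel) = (\<integral>\<^sup>+w. h w \<partial>lborel)" .
    moreover have "h (u * w) = ?I w * ennreal (cmod (f (z + u * w)))" for w
      by (simp add: h_def B_def indicator_def norm_torus_mult[OF u])
    ultimately show "(\<integral>\<^sup>+w. ?I w * ennreal (cmod (f (z + u * w))) \<partial>lborel) = (\<integral>\<^sup>+w. ?I w * ennreal (cmod (f (z + w))) \<partial>lborel)"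
      by (simp add: h_def)
  qed
  also have "\<dots> = (\<integral>\<^sup>+w. ?I w * ennreal (cmod (f (z + w))) \<partial>lborel)" by simp
  also have "\<dots> \<le> (\<integral>\<^sup>+w. ennreal (cmod (f (z + w))) \<partial>lborel)"
    by (intro nn_integral_mono) (simp add: indicator_def)
  also have "\<dots> = (\<integral>\<^sup>+w. ennreal (cmod (f w)) \<partial>lborel)"
    by (rule nn_integral_lborel_translate) measurable
  also have "\<dots> = (\<integral>\<^sup>+w. ennreal (cmod (f w)) \<partial>dV R)"
  proof -
    have "ennreal (cmod (f w)) = ennreal (cmod (f w)) * indicator R w" for w using bD(3) by (simp add: indicator_def)
    thus ?thesis by (simp add: nn_integral_restrict_space)
  qed
  also have "\<dots> = ennreal (LINT w|dV R. cmod (f w))"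
    using f(2) by (intro nn_integral_eq_integral integrable_norm) auto
  finally have "emeasure lborel B * ennreal (cmod (f z)) \<le> ennreal (LINT w|dV R. cmod (f w))" .
  moreover have "emeasure lborel B = ennreal (measure lborel B)"
    using emeasure_lborel_ball_finite[of "0 :: complex ^ 'n" d] by (intro emeasure_eq_ennreal_measure) (simp add: B_def top.not_eq_extremum)
  ultimately have "ennreal (measure lborel B * cmod (f z)) \<le> ennreal (LINT w|dV R. cmod (f w))" by (simp add: ennreal_mult)
  thus ?thesis by (simp add: B_def ennreal_le_iff)
qed

lemma lp_space_const: "(\<lambda>z. c) \<in> lp_space (dV R) r"
  by (simp add: lp_space_def)

text \<open>One radius \<open>d\<close> works for all points of the compact set \<open>K\<close>.
  Hoelder's inequality against the constant 1 passes from the \<open>L^1\<close> bound to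
  \<open>L^r\<close>.\<close>

lemma evaluation_bound:
  assumes r: "1 < r" and K: "compact K" "K \<subseteq> R"
  obtains C where "0 \<le> C" "\<And>f z. f \<in> bergman R r \<Longrightarrow> z \<in> K \<Longrightarrow> cmod (f z) \<le> C * Lp_norm R r f"
proof -
  obtain d where d: "d > 0" "(\<Union>x\<in>K. cball x d) \<subseteq> R"
    using compact_subset_open_imp_cball_epsilon_subset[OF K(1) open_R K(2)] by blast
  define s where "s = r / (r - 1)"
  have s: "1 < s" "1 / r + 1 / s = 1" using r by (auto simp: s_def field_simps)
  define m where "m = measure lborel (ball (0 :: complex ^ 'n) d)"
  have m: "m > 0" using content_ball_pos[OF d(1)] by (simp add: m_def)
  define C where "C = lp_norm (dV R) s (\<lambda>z. 1) / m"
  have "cmod (f z) \<le> C * Lp_norm R r f" if f: "f \<in> bergman R r" and z: "z \<in> K" for f z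
  proof -
    note fl = bergmanD(1)[OF f]
    have "ball z d \<subseteq> R" using d(2) z ball_subset_cball by blast
    hence "m * cmod (f z) \<le> (LINT w|dV R. cmod (f w))"
      unfolding m_def using evaluation_bound_L1[OF f fin.lp_space_integrable[OF r fl] d(1)] by blast
    also have "\<dots> \<le> lp_norm (dV R) r f * lp_norm (dV R) s (\<lambda>z. 1)"
      using lp_Holder(2)[OF r s fl lp_space_const[of 1]] by simp
    finally show ?thesis using m by (simp add: C_def Lp_norm_eq_lp_norm field_simps)
  qed
  moreover have "0 \<le> C" unfolding C_def by (rule divide_nonneg_pos[OF lp_norm_nonneg m])
  ultimately show ?thesis using that by blast
qed

lemma subspace_bergman: "1 < r \<Longrightarrow> cfun.subspace (bergman R r)"
proof (rule cfun.subspaceI)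
  assume r: "1 < r"
  show "0 \<in> bergman R r"
    by (rule bergmanI) (auto simp: lp_space_zero zero_fun_def holomorphic_Cn_const lp_space_const)
  fix f g c assume f: "f \<in> bergman R r"
  show "f + g \<in> bergman R r" if g: "g \<in> bergman R r"
    using bergmanD[OF f] bergmanD[OF g] holomorphic_Cn_add[of f R g]
    by (intro bergmanI lp_space_add r) (auto simp: plus_fun_def)
  show "fscale c f \<in> bergman R r"
    using bergmanD[OF f] holomorphic_Cn_mult[OF holomorphic_Cn_const[of c], of f R]
    by (intro bergmanI lp_space_fscale) (auto simp: fscale_def)
qed

lemma normed_bergman: "1 < r \<Longrightarrow> normed_function_space (bergman R r) (lp_norm (dV R) r)"
proof (rule normed_function_space.intro)
  assume r: "1 < r"
  show "cfun.subspace (bergman R r)" by (rule subspace_bergman[OF r])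
  show "norm_on (bergman R r) (lp_norm (dV R) r)"
    unfolding norm_on_def
  proof (intro conjI ballI allI)
    fix f g c assume f: "f \<in> bergman R r"
    show "0 \<le> lp_norm (dV R) r f" by (rule lp_norm_nonneg)
    show "lp_norm (dV R) r (fscale c f) = cmod c * lp_norm (dV R) r f" using r by (intro lp_norm_fscale) simp
    show "lp_norm (dV R) r (f + g) \<le> lp_norm (dV R) r f + lp_norm (dV R) r g" if "g \<in> bergman R r"
      using bergmanD(1)[OF f] bergmanD(1)[OF that] by (intro lp_norm_add r)
    \<comment> \<open>The integral only sees \<open>f\<close> almost everywhere; continuity of point
      evaluation makes a function of norm 0 vanish at every point.\<close>
    show "lp_norm (dV R) r f = 0 \<longleftrightarrow> f = 0"
    proof
      assume 0: "lp_norm (dV R) r f = 0"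
      have "f z = 0" for z
      proof (cases "z \<in> R")
        case True
        show ?thesis
        proof (rule evaluation_bound[OF r, of "{z}"])
          fix C assume "\<And>f y. f \<in> bergman R r \<Longrightarrow> y \<in> {z} \<Longrightarrow> cmod (f y) \<le> C * Lp_norm R r f"
          from this[OF f, of z] show "f z = 0" by (simp add: Lp_norm_eq_lp_norm 0)
        qed (use True in auto)
      qed (rule bergmanD(3)[OF f])
      thus "f = 0" by (simp add: fun_eq_iff)
    next
      assume "f = 0"
      thus "lp_norm (dV R) r f = 0" by (simp add: lp_norm_def)
    qed
  qed
qed

text \<open>By the evaluation bound a Cauchy sequence in norm converges uniformly on compact sets,
  so its limit is holomorphic. Fatou's lemma turns the Cauchy estimate into convergence in
  norm.\<close>

lemma complete_bergman: "1 < r \<Longrightarrow> complete_lp_subspace (bergman R r) (dV R) r"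
proof (intro complete_lp_subspace.intro complete_lp_subspace_axioms.intro normed_bergman bergman_sub_lp)
  assume r: "1 < r"
  interpret normed_function_space "bergman R r" "lp_norm (dV R) r" by (rule normed_bergman[OF r])
  show "mcomplete"
  proof (rule mcompleteI)
    fix s assume s: "\<And>n::nat. s n \<in> bergman R r"
      and C: "\<And>e. e > 0 \<Longrightarrow> \<exists>M. \<forall>m\<ge>M. \<forall>n\<ge>M. lp_norm (dV R) r (s m - s n) < e"
    have sd: "s m - s n \<in> bergman R r" for m n by (rule mem_diff[OF s s])
    have unif: "\<exists>M. \<forall>m\<ge>M. \<forall>n\<ge>M. \<forall>z\<in>K. dist (s m z) (s n z) < e"
      if K: "compact K" "K \<subseteq> R" and e: "e > 0" for K e
    proof -
      obtain B where B: "0 \<le> B" "\<And>f z. f \<in> bergman R r \<Longrightarrow> z \<in> K \<Longrightarrow> cmod (f z) \<le> B * Lp_norm R r f"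
        using evaluation_bound[OF r K] by blast
      have "e / (B + 1) > 0" using e B by simp
      then obtain M where M: "\<forall>m\<ge>M. \<forall>n\<ge>M. lp_norm (dV R) r (s m - s n) < e / (B + 1)" using C by blast
      have "dist (s m z) (s n z) < e" if "m \<ge> M" "n \<ge> M" "z \<in> K" for m n z
      proof -
        have "dist (s m z) (s n z) \<le> B * lp_norm (dV R) r (s m - s n)"
          using B(2)[OF sd that(3), of m n] by (simp add: dist_norm Lp_norm_eq_lp_norm)
        also have "\<dots> \<le> (B + 1) * lp_norm (dV R) r (s m - s n)" by (intro mult_right_mono lp_norm_nonneg) simp
        also have "\<dots> < e" using M that B by (simp add: pos_less_divide_eq mult.commute)
        finally show ?thesis .
      qed
      thus ?thesis by blast
    qed
    have "Cauchy (\<lambda>n. s n z)" if "z \<in> R" for z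
    proof (rule metric_CauchyI)
      fix e :: real assume "e > 0"
      thus "\<exists>M. \<forall>m\<ge>M. \<forall>n\<ge>M. dist (s m z) (s n z) < e" using unif[of "{z}" e] that by simp
    qed
    hence "\<forall>z\<in>R. \<exists>l. (\<lambda>n. s n z) \<longlonglongrightarrow> l" by (simp add: Cauchy_convergent_iff convergent_def)
    then obtain l where l: "\<And>z. z \<in> R \<Longrightarrow> (\<lambda>n. s n z) \<longlonglongrightarrow> l z" by metis
    define f where "f = (\<lambda>z. if z \<in> R then l z else 0)"
    have lim: "(\<lambda>n. s n z) \<longlonglongrightarrow> f z" for z
      using l[of z] bergmanD(3)[OF s, of z] by (auto simp: f_def)
    have ul: "uniform_limit K s f sequentially" if K: "compact K" "K \<subseteq> R" for K
    proof (rule uniform_limitI)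
      fix e :: real assume e: "e > 0"
      obtain M where M: "\<forall>m\<ge>M. \<forall>n\<ge>M. \<forall>z\<in>K. dist (s m z) (s n z) < e/2" using unif[OF K half_gt_zero[OF e]] by blast
      have "dist (s n z) (f z) < e" if "n \<ge> M" "z \<in> K" for n z
      proof -
        have "dist (s n z) (f z) \<le> e/2"
        proof (rule tendsto_upperbound[OF tendsto_dist[OF tendsto_const lim]])
          show "\<forall>\<^sub>F m in sequentially. dist (s n z) (s m z) \<le> e/2"
            using eventually_ge_at_top[of M] by eventually_elim (use M that in \<open>simp add: less_imp_le\<close>)
        qed simp
        thus ?thesis using e by simp
      qed
      thus "\<forall>\<^sub>F n in sequentially. \<forall>z\<in>K. dist (s n z) (f z) < e" unfolding eventually_sequentially by blast
    qed
    have hol: "holomorphic_Cn f R"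
    proof (rule holomorphic_Cn_uniform_limit[OF open_R bergmanD(2)[OF s]])
      fix z assume "z \<in> R"
      then obtain d where d: "d > 0" "cball z d \<subseteq> R" using open_R open_contains_cball_eq by blast
      show "\<exists>d>0. ball z d \<subseteq> R \<and> uniform_limit (ball z d) s f sequentially"
        using d(1) subset_trans[OF ball_subset_cball d(2)] uniform_limit_on_subset[OF ul[OF compact_cball d(2)] ball_subset_cball] by blast
    qed
    have fm: "f \<in> borel_measurable (dV R)" by (rule continuous_measurable[OF holomorphic_Cn_continuous_on[OF hol]])
    have sm: "s n \<in> borel_measurable (dV R)" for n using lp_spaceD(1)[OF bergmanD(1)[OF s]] .
    have close: "s n - f \<in> lp_space (dV R) r \<and> lp_norm (dV R) r (s n - f) \<le> e"
      if e: "e > 0" and M: "\<forall>m\<ge>M. \<forall>n\<ge>M. lp_norm (dV R) r (s m - s n) < e" and n: "n \<ge> M" for e M n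
    proof -
      have int: "integrable (dV R) (\<lambda>z. cmod ((s n - s m) z) powr r)" for m
        using lp_spaceD(2)[OF bergmanD(1)[OF sd]] .
      have "(\<integral>\<^sup>+z. ennreal (cmod ((s n - f) z) powr r) \<partial>dV R) = (\<integral>\<^sup>+z. liminf (\<lambda>m. ennreal (cmod ((s n - s m) z) powr r)) \<partial>dV R)"
      proof (rule nn_integral_cong)
        fix z
        have "(\<lambda>m. cmod ((s n - s m) z) powr r) \<longlonglongrightarrow> cmod ((s n - f) z) powr r"
          using r by (intro tendsto_powr2) (auto intro!: tendsto_intros lim)
        hence "(\<lambda>m. ennreal (cmod ((s n - s m) z) powr r)) \<longlonglongrightarrow> ennreal (cmod ((s n - f) z) powr r)" by (rule tendsto_ennrealI)
        thus "ennreal (cmod ((s n - f) z) powr r) = liminf (\<lambda>m. ennreal (cmod ((s n - s m) z) powr r))"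
          using lim_imp_Liminf[OF sequentially_bot] by metis
      qed
      also have "\<dots> \<le> liminf (\<lambda>m. \<integral>\<^sup>+z. ennreal (cmod ((s n - s m) z) powr r) \<partial>dV R)"
        using int by (intro nn_integral_liminf) auto
      also have "\<dots> \<le> ennreal (e powr r)"
      proof (rule Liminf_le)
        show "\<forall>\<^sub>F m in sequentially. (\<integral>\<^sup>+z. ennreal (cmod ((s n - s m) z) powr r) \<partial>dV R) \<le> ennreal (e powr r)"
          using eventually_ge_at_top[of M]
        proof eventually_elim
          case (elim m)
          have "lp_norm (dV R) r (s n - s m) powr r \<le> e powr r"
            using M n elim r lp_norm_nonneg by (intro powr_mono2) (auto simp: less_imp_le)
          thus ?case using r int[of m] by (simp add: nn_integral_eq_integral lp_norm_powr)
        qed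
      qed simp
      finally have le: "(\<integral>\<^sup>+z. ennreal (cmod ((s n - f) z) powr r) \<partial>dV R) \<le> ennreal (e powr r)" .
      have "integrable (dV R) (\<lambda>z. cmod ((s n - f) z) powr r)"
        using le_less_trans[OF le ennreal_less_top] fm sm by (intro integrableI_bounded) auto
      moreover from this le have "(LINT z|dV R. cmod ((s n - f) z) powr r) \<le> e powr r"
        by (simp add: nn_integral_eq_integral)
      moreover have "s n - f \<in> borel_measurable (dV R)"
        using borel_measurable_diff[OF sm[of n] fm] by (simp add: fun_diff_def)
      ultimately show ?thesis using e r by (auto simp: lp_space_def intro!: lp_norm_leI)
    qed
    have "f \<in> bergman R r"
    proof (rule bergmanI[OF _ hol])
      obtain M where "\<forall>m\<ge>M. \<forall>n\<ge>M. lp_norm (dV R) r (s m - s n) < 1" using C[OF zero_less_one] by blast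
      hence "s M - f \<in> lp_space (dV R) r" using close[of 1 M M] by simp
      hence "s M - (s M - f) \<in> lp_space (dV R) r"
        using cfun.subspace_diff[OF subspace_lp_space[OF r]] bergmanD(1)[OF s] by blast
      thus "f \<in> lp_space (dV R) r" by simp
    qed (simp add: f_def)
    moreover have "(\<lambda>n. lp_norm (dV R) r (s n - f)) \<longlonglongrightarrow> 0"
    proof (rule LIMSEQ_I)
      fix e :: real assume e: "e > 0"
      obtain M where M: "\<forall>m\<ge>M. \<forall>n\<ge>M. lp_norm (dV R) r (s m - s n) < e/2" using C[OF half_gt_zero[OF e]] by blast
      have "norm (lp_norm (dV R) r (s n - f) - 0) < e" if "n \<ge> M" for n
        using close[OF half_gt_zero[OF e] M that] lp_norm_nonneg[of "dV R" r "s n - f"] e by auto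
      thus "\<exists>M. \<forall>n\<ge>M. norm (lp_norm (dV R) r (s n - f) - 0) < e" by blast
    qed
    ultimately show "\<exists>x\<in>bergman R r. (\<lambda>n. lp_norm (dV R) r (s n - x)) \<longlonglongrightarrow> 0" by blast
  qed
qed (assumption+)

end

section \<open>Averaging operators on Bergman spaces\<close>

context bounded_reinhardt
begin

lemma borel_measurable_action:
  assumes "f \<in> borel_measurable (dV R)"
  shows "(\<lambda>x. f (fst x * snd x)) \<in> borel_measurable (torus_measure \<Otimes>\<^sub>M dV R)"
  using measurable_compose[OF measurable_action assms] by (simp add: case_prod_unfold)

lemma borel_measurable_fst_torus:
  assumes "\<kappa> \<in> borel_measurable torus_measure"
  shows "(\<lambda>x. \<kappa> (fst x)) \<in> borel_measurable (torus_measure \<Otimes>\<^sub>M dV R)"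
  using measurable_compose[OF measurable_fst assms] .

lemma torus_average_measurable:
  assumes "\<kappa> \<in> borel_measurable torus_measure" "f \<in> borel_measurable (dV R)"
  shows "torus_average \<kappa> f \<in> borel_measurable (dV R)"
proof -
  have "(\<lambda>x. \<kappa> (fst x) * f (fst x * snd x)) \<in> borel_measurable (torus_measure \<Otimes>\<^sub>M dV R)"
    by (intro borel_measurable_times borel_measurable_fst_torus borel_measurable_action assms)
  from measurable_compose[OF measurable_pair_swap' this]
  have "(\<lambda>(z, u). \<kappa> u * f (u * z)) \<in> borel_measurable (dV R \<Otimes>\<^sub>M torus_measure)"
    by (simp add: case_prod_unfold)
  from torus_measure.borel_measurable_lebesgue_integral[OF this]
  show ?thesis by (simp add: torus_average_def[abs_def])
qed

text \<open>The tangent inequality at the weighted mean \<open>x\<close> of the moduli, integrated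
  against \<open>cmod (\<kappa> u)\<close>: as the weights have total mass 1, the linear term
  integrates to 0.\<close>

lemma torus_average_Jensen:
  assumes r: "1 < r" and k: "continuous_on torus \<kappa>" "(LINT u|torus_measure. cmod (\<kappa> u)) = 1"
    and f: "continuous_on R f" and z: "z \<in> R"
  shows "cmod (torus_average \<kappa> f z) powr r \<le> (LINT u|torus_measure. cmod (\<kappa> u) * cmod (f (u * z)) powr r)"
proof -
  have cf: "continuous_on torus (\<lambda>u. cmod (f (u * z)))"
    by (intro continuous_intros continuous_on_torus_orbit[OF f torus_invariant_R z])
  have cfr: "continuous_on torus (\<lambda>u. cmod (f (u * z)) powr r)"
    using r by (intro continuous_on_powr' cf continuous_on_const) auto
  define x where "x = (LINT u|torus_measure. cmod (\<kappa> u) * cmod (f (u * z)))"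
  have x0: "0 \<le> x" unfolding x_def by (intro integral_nonneg_AE AE_I2) simp
  define d where "d = r * x powr (r - 1)"
  have i1: "integrable torus_measure (\<lambda>u. cmod (\<kappa> u))"
    and i2: "integrable torus_measure (\<lambda>u. cmod (\<kappa> u) * cmod (f (u * z)))"
    and i3: "integrable torus_measure (\<lambda>u. cmod (\<kappa> u) * cmod (f (u * z)) powr r)"
    by (intro integrable_torus continuous_intros k cf cfr)+
  have "cmod (torus_average \<kappa> f z) \<le> (LINT u|torus_measure. cmod (\<kappa> u * f (u * z)))"
    unfolding torus_average_def by (rule integral_norm_bound)
  also have "\<dots> = x" by (simp add: x_def norm_mult)
  finally have "cmod (torus_average \<kappa> f z) powr r \<le> x powr r" using r by (intro powr_mono2) auto
  also have "x powr r = (LINT u|torus_measure. (x powr r - d * x) * cmod (\<kappa> u) + d * (cmod (\<kappa> u) * cmod (f (u * z))))"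
    using i1 i2 by (simp add: k(2) x_def[symmetric])
  also have "\<dots> \<le> (LINT u|torus_measure. cmod (\<kappa> u) * cmod (f (u * z)) powr r)"
  proof (rule integral_mono[OF _ i3])
    show "integrable torus_measure (\<lambda>u. (x powr r - d * x) * cmod (\<kappa> u) + d * (cmod (\<kappa> u) * cmod (f (u * z))))"
      using i1 i2 by auto
    fix u
    have "cmod (\<kappa> u) * (x powr r + d * (cmod (f (u * z)) - x)) \<le> cmod (\<kappa> u) * cmod (f (u * z)) powr r"
      using powr_tangent[OF r x0, of "cmod (f (u * z))"] by (intro mult_left_mono) (auto simp: d_def)
    thus "(x powr r - d * x) * cmod (\<kappa> u) + d * (cmod (\<kappa> u) * cmod (f (u * z))) \<le> cmod (\<kappa> u) * cmod (f (u * z)) powr r"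
      by (simp add: algebra_simps)
  qed
  finally show ?thesis .
qed

text \<open>Jensen's inequality reduces the claim to an integral over torus and domain; Tonelli's
  theorem and rotation invariance of the inner integral evaluate it.\<close>

lemma torus_average_contraction:
  assumes r: "1 < r" and k: "continuous_on torus \<kappa>" "(LINT u|torus_measure. cmod (\<kappa> u)) = 1"
    and f: "continuous_on R f" "f \<in> lp_space (dV R) r"
  shows "torus_average \<kappa> f \<in> lp_space (dV R) r" "lp_norm (dV R) r (torus_average \<kappa> f) \<le> lp_norm (dV R) r f"
proof -
  have fm: "f \<in> borel_measurable (dV R)" by (rule lp_spaceD(1)[OF f(2)])
  have km: "\<kappa> \<in> borel_measurable torus_measure" by (rule borel_measurable_torus[OF k(1)])
  have am: "torus_average \<kappa> f \<in> borel_measurable (dV R)" by (rule torus_average_measurable[OF km fm])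
  define I where "I = (LINT z|dV R. cmod (f z) powr r)"
  have I: "(\<integral>\<^sup>+z. ennreal (cmod (f z) powr r) \<partial>dV R) = ennreal I"
    unfolding I_def by (rule nn_integral_eq_integral[OF lp_spaceD(2)[OF f(2)]]) simp
  have frm: "(\<lambda>z. ennreal (cmod (f z) powr r)) \<in> borel_measurable (dV R)" using fm by measurable
  have "(\<integral>\<^sup>+z. ennreal (cmod (torus_average \<kappa> f z) powr r) \<partial>dV R)
      \<le> (\<integral>\<^sup>+z. (\<integral>\<^sup>+u. ennreal (cmod (\<kappa> u)) * ennreal (cmod (f (u * z)) powr r) \<partial>torus_measure) \<partial>dV R)"
  proof (rule nn_integral_mono)
    fix z assume "z \<in> space (dV R)"
    hence z: "z \<in> R" by simp
    have "continuous_on torus (\<lambda>u. cmod (f (u * z)) powr r)"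
      using r by (intro continuous_on_powr' continuous_on_torus_orbit[OF f(1) torus_invariant_R z] continuous_intros) auto
    hence int: "integrable torus_measure (\<lambda>u. cmod (\<kappa> u) * cmod (f (u * z)) powr r)"
      by (intro integrable_torus continuous_on_mult continuous_on_norm k)
    have "ennreal (cmod (torus_average \<kappa> f z) powr r) \<le> ennreal (LINT u|torus_measure. cmod (\<kappa> u) * cmod (f (u * z)) powr r)"
      by (intro ennreal_leI torus_average_Jensen r k f z)
    also have "\<dots> = (\<integral>\<^sup>+u. ennreal (cmod (\<kappa> u) * cmod (f (u * z)) powr r) \<partial>torus_measure)"
      by (rule nn_integral_eq_integral[symmetric, OF int]) simp
    finally show "ennreal (cmod (torus_average \<kappa> f z) powr r) \<le> (\<integral>\<^sup>+u. ennreal (cmod (\<kappa> u)) * ennreal (cmod (f (u * z)) powr r) \<partial>torus_measure)"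
      by (simp add: ennreal_mult)
  qed
  also have "\<dots> = (\<integral>\<^sup>+u. (\<integral>\<^sup>+z. ennreal (cmod (\<kappa> u)) * ennreal (cmod (f (u * z)) powr r) \<partial>dV R) \<partial>torus_measure)"
  proof (rule TM.Fubini')
    have "(\<lambda>x. ennreal (cmod (\<kappa> (fst x))) * ennreal (cmod (f (fst x * snd x)) powr r)) \<in> borel_measurable (torus_measure \<Otimes>\<^sub>M dV R)"
      using borel_measurable_fst_torus[OF km] borel_measurable_action[OF fm] by measurable
    thus "(\<lambda>(u, z). ennreal (cmod (\<kappa> u)) * ennreal (cmod (f (u * z)) powr r)) \<in> borel_measurable (torus_measure \<Otimes>\<^sub>M dV R)"
      by (simp add: case_prod_unfold)
  qed
  also have "\<dots> = (\<integral>\<^sup>+u. ennreal (cmod (\<kappa> u)) * ennreal I \<partial>torus_measure)"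
  proof (rule nn_integral_cong)
    fix u assume "u \<in> space (torus_measure :: (complex ^ 'n) measure)"
    hence u: "u \<in> torus" by simp
    have "(\<lambda>z. ennreal (cmod (f (u * z)) powr r)) \<in> borel_measurable (dV R)"
      using measurable_compose[OF mult_dV(1)[OF u] frm] .
    thus "(\<integral>\<^sup>+z. ennreal (cmod (\<kappa> u)) * ennreal (cmod (f (u * z)) powr r) \<partial>dV R) = ennreal (cmod (\<kappa> u)) * ennreal I"
      using nn_integral_mult_dV[OF u frm] by (simp add: nn_integral_cmult I)
  qed
  also have "\<dots> = (\<integral>\<^sup>+u. ennreal (cmod (\<kappa> u)) \<partial>torus_measure) * ennreal I"
    by (intro nn_integral_multc measurable_compose[OF km]) measurable
  also have "(\<integral>\<^sup>+u. ennreal (cmod (\<kappa> u)) \<partial>torus_measure) = 1"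
    by (subst nn_integral_eq_integral) (auto intro!: integrable_torus continuous_intros k simp: k(2))
  finally have le: "(\<integral>\<^sup>+z. ennreal (cmod (torus_average \<kappa> f z) powr r) \<partial>dV R) \<le> ennreal I" by simp
  have int: "integrable (dV R) (\<lambda>z. cmod (torus_average \<kappa> f z) powr r)"
    using le_less_trans[OF le ennreal_less_top] am by (intro integrableI_bounded) auto
  thus "torus_average \<kappa> f \<in> lp_space (dV R) r" using am by (simp add: lp_space_def)
  have "I \<ge> 0" by (simp add: I_def)
  hence "(LINT z|dV R. cmod (torus_average \<kappa> f z) powr r) \<le> I" using le int by (simp add: nn_integral_eq_integral)
  thus "lp_norm (dV R) r (torus_average \<kappa> f) \<le> lp_norm (dV R) r f"
    unfolding lp_norm_def I_def using r by (intro powr_mono2) auto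
qed

lemma zpow_mean: "(LINT u|torus_measure. cmod (zpow \<alpha> (u :: complex ^ 'n))) = 1"
proof -
  have "(LINT u|torus_measure. cmod (zpow \<alpha> u)) = (LINT u|(torus_measure :: (complex ^ 'n) measure). 1)"
    by (intro Bochner_Integration.integral_cong) (auto simp: cmod_zpow_torus)
  thus ?thesis by simp
qed

section \<open>Peak averages and adjoints\<close>

abbreviation peak_average :: "nat \<Rightarrow> (complex ^ 'n \<Rightarrow> complex) \<Rightarrow> complex ^ 'n \<Rightarrow> complex" where
  "peak_average N \<equiv> torus_average (\<lambda>u. of_real (peak_kernel N u))"

lemma peak_kernel_norm_mean: "(LINT u|torus_measure. cmod (of_real (peak_kernel N (u :: complex ^ 'n)))) = 1"
proof -
  have "(LINT u|torus_measure. cmod (of_real (peak_kernel N (u :: complex ^ 'n)))) = (LINT u|torus_measure. peak_kernel N (u :: complex ^ 'n))"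
    by (intro Bochner_Integration.integral_cong) (auto simp: peak_kernel_nonneg)
  thus ?thesis by (simp add: peak_kernel_mean)
qed

lemma continuous_of_real_peak_kernel: "continuous_on torus (\<lambda>u :: complex ^ 'n. complex_of_real (peak_kernel N u))"
  by (intro continuous_intros)

lemmas peak_average_contraction = torus_average_contraction[OF _ continuous_of_real_peak_kernel peak_kernel_norm_mean]
  and zpow_average_contraction = torus_average_contraction[OF _ continuous_on_zpow_torus zpow_mean]

text \<open>Continuity of \<open>f\<close> provides pointwise convergence, and contractivity is the
  bound on norms that the Scheffe argument asks for.\<close>

lemma peak_average_tendsto_lp:
  assumes r: "1 < r" and f: "continuous_on R f" "f \<in> lp_space (dV R) r"
  shows "(\<lambda>N. lp_norm (dV R) r (peak_average N f - f)) \<longlonglongrightarrow> 0"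
proof (rule lp_Scheffe[OF r _ f(2)])
  show "peak_average N f \<in> lp_space (dV R) r" "lp_norm (dV R) r (peak_average N f) \<le> lp_norm (dV R) r f" for N
    by (rule peak_average_contraction[OF r f])+
  thus "peak_average N f \<in> borel_measurable (dV R)" for N using lp_spaceD(1) by blast
  show "(\<lambda>N. peak_average N f z) \<longlonglongrightarrow> f z" if "z \<in> space (dV R)" for z
    using peak_average_tendsto[OF f(1)] that by simp
qed

text \<open>The map \<open>\<phi>\<close> stands for the identity, the constant 1 or the inversion
  \<open>cnj_vec\<close>, so that rotated, fixed and inversely rotated functions are treated at
  once.\<close>

lemma integrable_action:
  fixes f :: "complex ^ 'n \<Rightarrow> real" and \<phi> :: "complex ^ 'n \<Rightarrow> complex ^ 'n"
  assumes f: "integrable (dV R) f" and phi: "\<phi> \<in> torus_measure \<rightarrow>\<^sub>M torus_measure"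
  shows "integrable (torus_measure \<Otimes>\<^sub>M dV R) (\<lambda>x. f (\<phi> (fst x) * snd x))"
proof (rule integrableI_bounded)
  have fm: "f \<in> borel_measurable (dV R)" using f by simp
  have "(\<lambda>x. (\<phi> (fst x), snd x)) \<in> torus_measure \<Otimes>\<^sub>M dV R \<rightarrow>\<^sub>M torus_measure \<Otimes>\<^sub>M dV R"
    using measurable_compose[OF measurable_fst phi] measurable_snd by (rule measurable_Pair)
  from measurable_compose[OF this measurable_compose[OF measurable_action fm]]
  show m: "(\<lambda>x. f (\<phi> (fst x) * snd x)) \<in> borel_measurable (torus_measure \<Otimes>\<^sub>M dV R)" by simp
  have "(\<integral>\<^sup>+x. ennreal (norm (f (\<phi> (fst x) * snd x))) \<partial>(torus_measure \<Otimes>\<^sub>M dV R))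
      = (\<integral>\<^sup>+u. (\<integral>\<^sup>+z. ennreal (norm (f (\<phi> u * z))) \<partial>dV R) \<partial>torus_measure)"
    using m by (subst fin.nn_integral_fst[symmetric]) auto
  also have "\<dots> = (\<integral>\<^sup>+u. (\<integral>\<^sup>+z. ennreal (norm (f z)) \<partial>dV R) \<partial>(torus_measure :: (complex ^ 'n) measure))"
  proof (rule nn_integral_cong)
    fix u assume "u \<in> space (torus_measure :: (complex ^ 'n) measure)"
    hence "\<phi> u \<in> torus" using measurable_space[OF phi] by simp
    moreover have "(\<lambda>z. ennreal (norm (f z))) \<in> borel_measurable (dV R)" using fm by measurable
    ultimately show "(\<integral>\<^sup>+z. ennreal (norm (f (\<phi> u * z))) \<partial>dV R) = (\<integral>\<^sup>+z. ennreal (norm (f z)) \<partial>dV R)"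
      by (rule nn_integral_mult_dV)
  qed
  also have "\<dots> = (\<integral>\<^sup>+z. ennreal (norm (f z)) \<partial>dV R)" by simp
  also have "\<dots> < \<infinity>" using f by (simp add: integrable_iff_bounded)
  finally show "(\<integral>\<^sup>+x. ennreal (norm (f (\<phi> (fst x) * snd x))) \<partial>(torus_measure \<Otimes>\<^sub>M dV R)) < \<infinity>" .
qed

text \<open>Young's inequality majorises the product by a sum of two powers, each integrable because
  rotations preserve the measure. This justifies Fubini's theorem in the adjoint formula.\<close>

lemma integrable_action_product:
  fixes \<phi> \<psi> :: "complex ^ 'n \<Rightarrow> complex ^ 'n"
  assumes pq: "1 < r" "1 < s" "1 / r + 1 / s = 1" and f: "f \<in> lp_space (dV R) r" and k: "k \<in> lp_space (dV R) s"
    and kap: "continuous_on torus \<kappa>"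
    and phi: "\<phi> \<in> torus_measure \<rightarrow>\<^sub>M torus_measure" and psi: "\<psi> \<in> torus_measure \<rightarrow>\<^sub>M torus_measure"
  shows "integrable (torus_measure \<Otimes>\<^sub>M dV R) (\<lambda>x. \<kappa> (fst x) * f (\<phi> (fst x) * snd x) * cnj (k (\<psi> (fst x) * snd x)))"
proof -
  obtain B where B: "\<forall>x\<in>\<kappa> ` torus. cmod x \<le> B"
    using compact_imp_bounded[OF compact_continuous_image[OF kap compact_torus]] unfolding bounded_iff by blast
  let ?g = "\<lambda>x. B * (cmod (f (\<phi> (fst x) * snd x)) powr r / r + cmod (k (\<psi> (fst x) * snd x)) powr s / s)"
  show ?thesis
  proof (rule Bochner_Integration.integrable_bound)
  show "integrable (torus_measure \<Otimes>\<^sub>M dV R) ?g"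
    using integrable_action[OF lp_spaceD(2)[OF f] phi] integrable_action[OF lp_spaceD(2)[OF k] psi]
    by (intro integrable_mult_right Bochner_Integration.integrable_add integrable_divide) auto
  have meas: "(\<lambda>x. h (\<phi> (fst x) * snd x)) \<in> borel_measurable (torus_measure \<Otimes>\<^sub>M dV R)"
    if "h \<in> borel_measurable (dV R)" "\<phi> \<in> torus_measure \<rightarrow>\<^sub>M torus_measure" for h :: "complex ^ 'n \<Rightarrow> complex" and \<phi> :: "complex ^ 'n \<Rightarrow> complex ^ 'n"
  proof -
    have "(\<lambda>x. (\<phi> (fst x), snd x)) \<in> torus_measure \<Otimes>\<^sub>M dV R \<rightarrow>\<^sub>M torus_measure \<Otimes>\<^sub>M dV R"
      using measurable_compose[OF measurable_fst that(2)] measurable_snd by (rule measurable_Pair)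
    from measurable_compose[OF this measurable_compose[OF measurable_action that(1)]] show ?thesis by simp
  qed
  have kcm: "(\<lambda>z. cnj (k z)) \<in> borel_measurable (dV R)" using lp_spaceD(1)[OF lp_space_cnj[OF k]] .
  show "(\<lambda>x. \<kappa> (fst x) * f (\<phi> (fst x) * snd x) * cnj (k (\<psi> (fst x) * snd x))) \<in> borel_measurable (torus_measure \<Otimes>\<^sub>M dV R)"
    by (intro borel_measurable_times borel_measurable_fst_torus borel_measurable_torus kap meas[OF lp_spaceD(1)[OF f] phi] meas[OF kcm psi])
  show "AE x in torus_measure \<Otimes>\<^sub>M dV R. norm (\<kappa> (fst x) * f (\<phi> (fst x) * snd x) * cnj (k (\<psi> (fst x) * snd x))) \<le> norm (?g x)"
  proof (rule AE_I2)
    fix x :: "(complex ^ 'n) \<times> (complex ^ 'n)" assume "x \<in> space (torus_measure \<Otimes>\<^sub>M dV R)"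
    hence "fst x \<in> torus" by (auto simp: space_pair_measure)
    hence kB: "cmod (\<kappa> (fst x)) \<le> B" using B by blast
    hence B0: "0 \<le> B" using order_trans[OF norm_ge_zero] by blast
    let ?a = "cmod (f (\<phi> (fst x) * snd x))" and ?b = "cmod (k (\<psi> (fst x) * snd x))"
    have "norm (\<kappa> (fst x) * f (\<phi> (fst x) * snd x) * cnj (k (\<psi> (fst x) * snd x))) = cmod (\<kappa> (fst x)) * (?a * ?b)"
      by (simp add: norm_mult)
    also have "\<dots> \<le> B * (?a powr r / r + ?b powr s / s)"
      using kB B0 by (intro mult_mono Youngs_inequality pq) auto
    also have "\<dots> \<le> norm (?g x)" by (simp only: real_norm_def abs_ge_self)
    finally show "norm (\<kappa> (fst x) * f (\<phi> (fst x) * snd x) * cnj (k (\<psi> (fst x) * snd x))) \<le> norm (?g x)" .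
  qed
  qed
qed

text \<open>Rotating the variable of integration moves the rotation from \<open>f\<close> to
  \<open>k\<close> in inverted form, and inversion on the torus restores an average. The condition
  on \<open>\<kappa>\<close> is the symmetry of a self-adjoint convolution kernel; characters and
  peak kernels have it.\<close>

lemma torus_average_adjoint:
  assumes pq: "1 < r" "1 < s" "1 / r + 1 / s = 1"
    and f: "f \<in> lp_space (dV R) r" and k: "k \<in> lp_space (dV R) s" "continuous_on R k"
    and kap: "continuous_on torus \<kappa>" "\<And>u. u \<in> torus \<Longrightarrow> cnj (\<kappa> u) = \<kappa> (cnj_vec u)"
  shows "(LINT z|dV R. torus_average \<kappa> f z * cnj (k z)) = (LINT z|dV R. f z * cnj (torus_average \<kappa> k z))"
proof -
  have id: "(\<lambda>u :: complex ^ 'n. u) \<in> torus_measure \<rightarrow>\<^sub>M (torus_measure :: (complex ^ 'n) measure)" by simp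
  have one: "(\<lambda>u :: complex ^ 'n. 1) \<in> torus_measure \<rightarrow>\<^sub>M (torus_measure :: (complex ^ 'n) measure)" by simp
  have i1: "integrable (torus_measure \<Otimes>\<^sub>M dV R) (\<lambda>x. \<kappa> (fst x) * f (fst x * snd x) * cnj (k (snd x)))"
    using integrable_action_product[OF pq f k(1) kap(1) id one] by simp
  have i2: "integrable (torus_measure \<Otimes>\<^sub>M dV R) (\<lambda>x. \<kappa> (fst x) * f (snd x) * cnj (k (cnj_vec (fst x) * snd x)))"
    using integrable_action_product[OF pq f k(1) kap(1) one measurable_torus_cnj] by simp
  have fm: "f \<in> borel_measurable (dV R)" by (rule lp_spaceD(1)[OF f])
  have kcm: "(\<lambda>z. cnj (k z)) \<in> borel_measurable (dV R)" using lp_spaceD(1)[OF lp_space_cnj[OF k(1)]] .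
  have "(LINT z|dV R. torus_average \<kappa> f z * cnj (k z)) = (LINT z|dV R. (LINT u|torus_measure. \<kappa> u * f (u * z) * cnj (k z)))"
    by (simp add: torus_average_def)
  also have "\<dots> = (LINT u|torus_measure. (LINT z|dV R. \<kappa> u * f (u * z) * cnj (k z)))"
    by (rule TM.Fubini_integral) (use i1 in \<open>simp add: case_prod_unfold\<close>)
  also have "\<dots> = (LINT u|torus_measure. (LINT z|dV R. \<kappa> u * f z * cnj (k (cnj_vec u * z))))"
  proof (rule Bochner_Integration.integral_cong[OF refl])
    fix u assume "u \<in> space (torus_measure :: (complex ^ 'n) measure)"
    hence u: "u \<in> torus" by simp
    hence uc: "cnj_vec u \<in> torus" by simp
    define h where "h = (\<lambda>z. \<kappa> u * f z * cnj (k (cnj_vec u * z)))"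
    have "h \<in> borel_measurable (dV R)"
      unfolding h_def using measurable_compose[OF mult_dV(1)[OF uc] kcm] fm
      by (intro borel_measurable_times borel_measurable_const)
    from integral_mult_dV[OF u this]
    show "(LINT z|dV R. \<kappa> u * f (u * z) * cnj (k z)) = (LINT z|dV R. \<kappa> u * f z * cnj (k (cnj_vec u * z)))"
      by (simp add: h_def mult_cnj_vec_cancel[OF u])
  qed
  also have "\<dots> = (LINT z|dV R. (LINT u|torus_measure. \<kappa> u * f z * cnj (k (cnj_vec u * z))))"
    by (rule TM.Fubini_integral[symmetric]) (use i2 in \<open>simp add: case_prod_unfold\<close>)
  also have "\<dots> = (LINT z|dV R. f z * cnj (torus_average \<kappa> k z))"
  proof (rule Bochner_Integration.integral_cong[OF refl])
    fix z assume "z \<in> space (dV R)"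
    hence z: "z \<in> R" by simp
    have "(\<lambda>u. \<kappa> u * k (u * z)) \<in> borel_measurable torus_measure"
      by (intro borel_measurable_torus continuous_intros kap(1) continuous_on_torus_orbit[OF k(2) torus_invariant_R z])
    hence "torus_average \<kappa> k z = (LINT u|torus_measure. \<kappa> (cnj_vec u) * k (cnj_vec u * z))"
      using integral_torus_cnj[of "\<lambda>u. \<kappa> u * k (u * z)"] by (simp add: torus_average_def)
    also have "\<dots> = (LINT u|torus_measure. cnj (\<kappa> u * cnj (k (cnj_vec u * z))))"
      by (intro Bochner_Integration.integral_cong) (auto simp: kap(2))
    also have "\<dots> = cnj (LINT u|torus_measure. \<kappa> u * cnj (k (cnj_vec u * z)))" by (rule Bochner_Integration.integral_cnj)
    finally have "cnj (torus_average \<kappa> k z) = (LINT u|torus_measure. \<kappa> u * cnj (k (cnj_vec u * z)))" by simp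
    moreover have "(LINT u|torus_measure. \<kappa> u * f z * cnj (k (cnj_vec u * z))) = (LINT u|torus_measure. f z * (\<kappa> u * cnj (k (cnj_vec u * z))))"
      by (rule Bochner_Integration.integral_cong[OF refl]) (simp only: mult_ac)
    ultimately show "(LINT u|torus_measure. \<kappa> u * f z * cnj (k (cnj_vec u * z))) = f z * cnj (torus_average \<kappa> k z)"
      by (simp only: integral_mult_right_zero)
  qed
  finally show ?thesis .
qed

lemma peak_kernel_cnj: "u \<in> torus \<Longrightarrow> cnj (of_real (peak_kernel N u)) = of_real (peak_kernel N (cnj_vec u))"
  by (simp add: peak_kernel_cnj_vec)

lemma zpow_kernel_cnj: "cnj (zpow \<alpha> u) = zpow \<alpha> (cnj_vec u)"
  by (simp add: zpow_cnj_vec)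

lemmas peak_average_adjoint = torus_average_adjoint[OF _ _ _ _ _ _ continuous_of_real_peak_kernel peak_kernel_cnj]
  and zpow_average_adjoint = torus_average_adjoint[OF _ _ _ _ _ _ continuous_on_zpow_torus zpow_kernel_cnj]

section \<open>Laurent coefficients on Bergman spaces\<close>

abbreviation coeff :: "(complex ^ 'n \<Rightarrow> complex) \<Rightarrow> int ^ 'n \<Rightarrow> complex" where
  "coeff \<equiv> laurent_coeff R"

lemma mono_expsD: "\<alpha> \<in> mono_exps R r \<Longrightarrow> e_mono R \<alpha> \<in> bergman R r"
  by (simp add: mono_exps_def)

lemma bergman_average: 
  assumes "f \<in> bergman R r"
  shows "torus_average (zpow (- \<alpha>)) f = fscale (coeff f \<alpha>) (e_mono R \<alpha>)"
proof
  fix z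
  show "torus_average (zpow (- \<alpha>)) f z = fscale (coeff f \<alpha>) (e_mono R \<alpha>) z"
  proof (cases "z \<in> R")
    case True
    thus ?thesis using laurent_coeff(1)[OF bergmanD(2)[OF assms]] by (simp add: fscale_def)
  next
    case False
    have "torus_average (zpow (- \<alpha>)) f z = (LINT u|(torus_measure :: (complex ^ 'n) measure). 0)"
      unfolding torus_average_def using bergmanD(3)[OF assms] False mult_mem_R_iff
      by (intro Bochner_Integration.integral_cong) auto
    thus ?thesis using False by (simp add: fscale_def e_mono_outside)
  qed
qed

text \<open>The component of \<open>f\<close> of degree \<alpha> is a multiple of the monomial, and
  it lies in \<open>L^r\<close> because averaging is a contraction.\<close>

lemma coeff_nonzero_mono_exps:
  assumes r: "1 < r" and f: "f \<in> bergman R r" and a: "coeff f \<alpha> \<noteq> 0"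
  shows "\<alpha> \<in> mono_exps R r"
proof -
  have "fscale (coeff f \<alpha>) (e_mono R \<alpha>) \<in> lp_space (dV R) r"
    using zpow_average_contraction(1)[OF r bergmanD(4)[OF f] bergmanD(1)[OF f]] bergman_average[OF f] by metis
  hence "fscale (1 / coeff f \<alpha>) (fscale (coeff f \<alpha>) (e_mono R \<alpha>)) \<in> lp_space (dV R) r" by (rule lp_space_fscale)
  hence "e_mono R \<alpha> \<in> lp_space (dV R) r" using a by (simp add: fscale_def)
  thus ?thesis
    using laurent_coeff(2)[OF bergmanD(2)[OF f] a] by (auto simp: mono_exps_def e_mono_outside intro!: bergmanI)
qed

lemma coeff_bound:
  assumes r: "1 < r" and f: "f \<in> bergman R r"
  shows "cmod (coeff f \<alpha>) * lp_norm (dV R) r (e_mono R \<alpha>) \<le> lp_norm (dV R) r f"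
  using zpow_average_contraction(2)[OF r bergmanD(4)[OF f] bergmanD(1)[OF f], of "- \<alpha>"] r
  by (simp add: bergman_average[OF f] lp_norm_fscale)

lemma e_mono_norm_pos:
  assumes r: "1 < r" and "\<alpha> \<in> mono_exps R r"
  shows "0 < lp_norm (dV R) r (e_mono R \<alpha>)"
proof -
  interpret normed_function_space "bergman R r" "lp_norm (dV R) r" by (rule normed_bergman[OF r])
  obtain z where z: "z \<in> R" "z \<in> nonzero_coords" by (rule ex_nonzero_coords)
  hence "e_mono R \<alpha> z \<noteq> 0" by (simp add: e_mono_eq zpow_nonzero)
  hence "e_mono R \<alpha> \<noteq> 0" by auto
  thus ?thesis using norm_eq_0[OF mono_expsD[OF assms(2)]] lp_norm_nonneg[of "dV R" r "e_mono R \<alpha>"] by simp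
qed

lemma coeff_e_mono:
  assumes "\<beta> \<in> mono_exps R r"
  shows "coeff (e_mono R \<beta>) \<alpha> = (if \<alpha> = \<beta> then 1 else 0)"
proof -
  obtain z where z: "z \<in> R" "z \<in> nonzero_coords" by (rule ex_nonzero_coords)
  have "coeff (e_mono R \<beta>) \<alpha> * e_mono R \<alpha> z = torus_average (zpow (- \<alpha>)) (e_mono R \<beta>) z"
    using laurent_coeff(1)[OF bergmanD(2)[OF mono_expsD[OF assms]] z(1)] by simp
  also have "\<dots> = (LINT u|torus_measure. e_mono R \<beta> z * zpow (\<beta> - \<alpha>) u)"
    unfolding torus_average_def
  proof (rule Bochner_Integration.integral_cong[OF refl])
    fix u assume "u \<in> space (torus_measure :: (complex ^ 'n) measure)"
    hence u: "u \<in> torus" by simp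
    thus "zpow (- \<alpha>) u * e_mono R \<beta> (u * z) = e_mono R \<beta> z * zpow (\<beta> - \<alpha>) u"
      using zpow_add[OF torus_subset_nonzero_coords[OF u], of \<beta> "- \<alpha>"] by (simp add: e_mono_mult)
  qed
  also have "\<dots> = e_mono R \<beta> z * (if \<alpha> = \<beta> then 1 else 0)" by (simp add: integral_zpow_torus)
  finally show ?thesis using zpow_nonzero[OF z(2), of \<alpha>] z(1) by (auto simp: e_mono_eq split: if_splits)
qed

lemma coeff_add: "f \<in> bergman R r \<Longrightarrow> g \<in> bergman R r \<Longrightarrow> coeff (f + g) \<alpha> = coeff f \<alpha> + coeff g \<alpha>"
  and coeff_fscale: "f \<in> bergman R r \<Longrightarrow> coeff (fscale c f) \<alpha> = c * coeff f \<alpha>" if r: "1 < r"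
proof -
  note sub = subspace_bergman[OF r]
  obtain z where z: "z \<in> R" "z \<in> nonzero_coords" by (rule ex_nonzero_coords)
  have e: "e_mono R \<alpha> z \<noteq> 0" using z by (simp add: e_mono_eq zpow_nonzero)
  have av: "coeff f \<alpha> * e_mono R \<alpha> z = torus_average (zpow (- \<alpha>)) f z" if "f \<in> bergman R r" for f
    using laurent_coeff(1)[OF bergmanD(2)[OF that] z(1)] by simp
  show "coeff (f + g) \<alpha> = coeff f \<alpha> + coeff g \<alpha>" if f: "f \<in> bergman R r" and g: "g \<in> bergman R r"
  proof -
    have int: "integrable torus_measure (\<lambda>u. zpow (- \<alpha>) u * h (u * z))" if "h \<in> bergman R r" for h
      by (intro integrable_torus continuous_intros continuous_on_torus_orbit[OF bergmanD(4)[OF that] torus_invariant_R z(1)])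
    have "torus_average (zpow (- \<alpha>)) (f + g) z = torus_average (zpow (- \<alpha>)) f z + torus_average (zpow (- \<alpha>)) g z"
      using int[OF f] int[OF g] by (simp add: torus_average_def distrib_left)
    hence "coeff (f + g) \<alpha> * e_mono R \<alpha> z = (coeff f \<alpha> + coeff g \<alpha>) * e_mono R \<alpha> z"
      using av[OF f] av[OF g] av[OF cfun.subspace_add[OF sub f g]] by (simp add: distrib_right)
    thus ?thesis using e by simp
  qed
  show "coeff (fscale c f) \<alpha> = c * coeff f \<alpha>" if f: "f \<in> bergman R r"
  proof -
    have "torus_average (zpow (- \<alpha>)) (fscale c f) z = c * torus_average (zpow (- \<alpha>)) f z"
      by (simp add: torus_average_def fscale_def mult.left_commute)
    hence "coeff (fscale c f) \<alpha> * e_mono R \<alpha> z = (c * coeff f \<alpha>) * e_mono R \<alpha> z"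
      using av[OF f] av[OF cfun.subspace_scale[OF sub f]] by (simp add: mult.assoc)
    thus ?thesis using e by simp
  qed
qed

text \<open>\<open>A\<close> and \<open>c\<close> depend on \<open>N\<close> alone, not on
  \<open>f\<close> or \<open>r\<close>; the density of coefficient functionals relies on this
  uniformity. Exponents outside \<open>mono_exps R r\<close> drop out because their coefficients
  vanish.\<close>

lemma peak_average_expansion:
  obtains A c where "finite A"
    "\<And>f r. 1 < r \<Longrightarrow> f \<in> bergman R r \<Longrightarrow> peak_average N f = (\<Sum>\<alpha>\<in>A \<inter> mono_exps R r. fscale (c \<alpha> * coeff f \<alpha>) (e_mono R \<alpha>))"
proof -
  obtain A c where A: "finite A" "\<And>f z. continuous_on R f \<Longrightarrow> z \<in> R \<Longrightarrow>
      peak_average N f z = (\<Sum>\<alpha>\<in>A. c \<alpha> * torus_average (zpow (- \<alpha>)) f z)"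
    using torus_average_trig_poly[OF peak_kernel_trig_poly[of N]] by blast
  have "peak_average N f = (\<Sum>\<alpha>\<in>A \<inter> mono_exps R r. fscale (c \<alpha> * coeff f \<alpha>) (e_mono R \<alpha>))"
    if r: "1 < r" and f: "f \<in> bergman R r" for f r
  proof
    fix z
    have rhs: "(\<Sum>\<alpha>\<in>A \<inter> mono_exps R r. fscale (c \<alpha> * coeff f \<alpha>) (e_mono R \<alpha>)) z = (\<Sum>\<alpha>\<in>A. c \<alpha> * (coeff f \<alpha> * e_mono R \<alpha> z))"
    proof -
      have "(\<Sum>\<alpha>\<in>A \<inter> mono_exps R r. fscale (c \<alpha> * coeff f \<alpha>) (e_mono R \<alpha>)) z
          = (\<Sum>\<alpha>\<in>A \<inter> mono_exps R r. c \<alpha> * (coeff f \<alpha> * e_mono R \<alpha> z))"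
        by (simp add: sum_fun_apply fscale_def mult.assoc)
      also have "\<dots> = (\<Sum>\<alpha>\<in>A. c \<alpha> * (coeff f \<alpha> * e_mono R \<alpha> z))"
        using A(1) coeff_nonzero_mono_exps[OF r f] by (intro sum.mono_neutral_left) auto
      finally show ?thesis .
    qed
    show "peak_average N f z = (\<Sum>\<alpha>\<in>A \<inter> mono_exps R r. fscale (c \<alpha> * coeff f \<alpha>) (e_mono R \<alpha>)) z"
    proof (cases "z \<in> R")
      case True
      thus ?thesis unfolding rhs A(2)[OF bergmanD(4)[OF f] True] bergman_average[OF f] by (simp add: fscale_def)
    next
      case False
      have "peak_average N f z = (LINT u|(torus_measure :: (complex ^ 'n) measure). 0)"
        unfolding torus_average_def using bergmanD(3)[OF f] False mult_mem_R_iff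
        by (intro Bochner_Integration.integral_cong) auto
      thus ?thesis unfolding rhs using False by (simp add: e_mono_outside)
    qed
  qed
  thus ?thesis using that A(1) by blast
qed

text \<open>The approximant has coefficients proportional to those of \<open>f\<close>. Hence an
  exponent at which \<open>f\<close> has coefficient 0 does not contribute, which identifies the
  kernel later.\<close>

lemma monomials_dense:
  assumes r: "1 < r" and f: "f \<in> bergman R r" and e: "0 < e"
  obtains A c where "finite A" "A \<subseteq> mono_exps R r"
    "lp_norm (dV R) r (f - (\<Sum>\<alpha>\<in>A. fscale (c \<alpha> * coeff f \<alpha>) (e_mono R \<alpha>))) < e"
proof -
  interpret normed_function_space "bergman R r" "lp_norm (dV R) r" by (rule normed_bergman[OF r])
  obtain N where "norm (lp_norm (dV R) r (peak_average N f - f) - 0) < e"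
    using LIMSEQ_D[OF peak_average_tendsto_lp[OF r bergmanD(4)[OF f] bergmanD(1)[OF f]] e] by blast
  hence N: "lp_norm (dV R) r (peak_average N f - f) < e" using lp_norm_nonneg by simp
  show ?thesis
  proof (rule peak_average_expansion[of N])
    fix A c
    assume A: "finite A" "\<And>f r. 1 < r \<Longrightarrow> f \<in> bergman R r \<Longrightarrow> peak_average N f = (\<Sum>\<alpha>\<in>A \<inter> mono_exps R r. fscale (c \<alpha> * coeff f \<alpha>) (e_mono R \<alpha>))"
    have mem: "(\<Sum>\<alpha>\<in>A \<inter> mono_exps R r. fscale (c \<alpha> * coeff f \<alpha>) (e_mono R \<alpha>)) \<in> bergman R r"
      by (intro cfun.subspace_sum[OF cfun_subspace] mem_fscale mono_expsD) blast
    have "lp_norm (dV R) r (f - (\<Sum>\<alpha>\<in>A \<inter> mono_exps R r. fscale (c \<alpha> * coeff f \<alpha>) (e_mono R \<alpha>))) < e"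
      using N norm_diff_commute[OF f mem] A(2)[OF r f] by simp
    thus ?thesis using that[of "A \<inter> mono_exps R r" c] A(1) by blast
  qed
qed

text \<open>Projection to the component of degree \<open>\<beta>\<close> is self-adjoint and fixes
  the monomial. If the monomial is not square integrable, the integral on the right is the default
  0, and the left-hand side vanishes as well.\<close>

lemma pairing_e_mono:
  assumes pq: "1 < r" "1 < s" "1 / r + 1 / s = 1" and g: "g \<in> bergman R r" and b: "\<beta> \<in> mono_exps R s"
  shows "(LINT z|dV R. g z * cnj (e_mono R \<beta> z)) = coeff g \<beta> * (LINT z|dV R. e_mono R \<beta> z * cnj (e_mono R \<beta> z))"
proof -
  note eb = mono_expsD[OF b]
  have "torus_average (zpow (- \<beta>)) (e_mono R \<beta>) = e_mono R \<beta>"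
    using bergman_average[OF eb, of \<beta>] coeff_e_mono[OF b, of \<beta>] by (simp add: fscale_def)
  hence "(LINT z|dV R. g z * cnj (e_mono R \<beta> z)) = (LINT z|dV R. g z * cnj (torus_average (zpow (- \<beta>)) (e_mono R \<beta>) z))" by simp
  also have "\<dots> = (LINT z|dV R. torus_average (zpow (- \<beta>)) g z * cnj (e_mono R \<beta> z))"
    by (rule zpow_average_adjoint[symmetric, OF pq bergmanD(1)[OF g] bergmanD(1,4)[OF eb]])
  also have "\<dots> = coeff g \<beta> * (LINT z|dV R. e_mono R \<beta> z * cnj (e_mono R \<beta> z))"
    by (simp add: bergman_average[OF g] fscale_def mult.assoc)
  finally show ?thesis .
qed

text \<open>The representing function is a constant times the continuous duality map applied to a
  holomorphic function, hence continuous on \<open>R\<close>; peak averages then approximate it in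
  norm.\<close>

lemma bergman_Riesz:
  assumes pq: "1 < r" "1 < s" "1 / r + 1 / s = 1" and phi: "\<phi> \<in> bergman_dual R r"
  obtains h where "h \<in> lp_space (dV R) s" "continuous_on R h" "lp_norm (dV R) s h \<le> bergman_dual_norm R r \<phi>"
    "\<And>u. u \<in> bergman R r \<Longrightarrow> \<phi> u = (LINT z|dV R. u z * cnj (h z))"
proof -
  interpret complete_lp_subspace "bergman R r" "dV R" r by (rule complete_bergman[OF pq(1)])
  show ?thesis
  proof (rule Riesz[OF pq(2,3) phi[unfolded Lp_norm_eq_lp_norm]])
    fix f c h
    assume h: "f \<in> bergman R r" "h = (\<lambda>z. c * lp_dual_map r (f z))" "h \<in> lp_space (dV R) s"
      "lp_norm (dV R) s h \<le> dual_norm (bergman R r) (lp_norm (dV R) r) \<phi>"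
      "\<And>u. u \<in> bergman R r \<Longrightarrow> \<phi> u = (LINT z|dV R. u z * cnj (h z))"
    have "continuous_on R (\<lambda>z. lp_dual_map r (f z))"
      by (rule continuous_on_compose2[OF continuous_on_lp_dual_map[OF pq(1), of UNIV] bergmanD(4)[OF h(1)] subset_UNIV])
    hence "continuous_on R h" unfolding h(2) by (rule continuous_on_mult_left)
    thus ?thesis using that[OF h(3)] h(4,5) by (simp add: Lp_norm_eq_lp_norm)
  qed
qed

end

section \<open>Duality\<close>

context bounded_reinhardt
begin

abbreviation bnorm :: "real \<Rightarrow> (complex ^ 'n \<Rightarrow> complex) \<Rightarrow> real" where
  "bnorm r \<equiv> lp_norm (dV R) r"

abbreviation bdual :: "real \<Rightarrow> ((complex ^ 'n \<Rightarrow> complex) \<Rightarrow> complex) set" where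
  "bdual r \<equiv> dual_space (bergman R r) (bnorm r)"

abbreviation bdual_norm :: "real \<Rightarrow> ((complex ^ 'n \<Rightarrow> complex) \<Rightarrow> complex) \<Rightarrow> real" where
  "bdual_norm r \<equiv> dual_norm (bergman R r) (bnorm r)"

lemma normed_bdual: "1 < r \<Longrightarrow> normed_function_space (bdual r) (bdual_norm r)"
  by (rule normed_function_space.normed_dual_space[OF normed_bergman])

lemma bergman_mono:
  assumes "1 < r" "r \<le> s" "f \<in> bergman R s" shows "f \<in> bergman R r"
  using bergmanD[OF assms(3)] fin.lp_space_mono(1)[OF assms(1,2)] by (auto intro: bergmanI)

lemma mono_exps_mono: "1 < r \<Longrightarrow> r \<le> s \<Longrightarrow> mono_exps R s \<subseteq> mono_exps R r"
  using bergman_mono by (auto simp: mono_exps_def)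

lemma bergman_eqI_coeff:
  assumes "f \<in> bergman R r" "\<And>\<alpha>. coeff f \<alpha> = 0"
  shows "f = 0"
proof
  fix z
  show "f z = 0 z"
  proof (cases "z \<in> R")
    case True
    have "torus_average (zpow (- \<alpha>)) f z = 0" for \<alpha> by (simp add: bergman_average[OF assms(1)] assms(2) fscale_def)
    thus ?thesis using zero_if_torus_averages_zero[OF bergmanD(4)[OF assms(1)] True] by simp
  qed (simp add: bergmanD(3)[OF assms(1)])
qed

section \<open>The sesquilinear pairing and the functionals it induces\<close>

definition pairing :: "(complex ^ 'n \<Rightarrow> complex) \<Rightarrow> (complex ^ 'n \<Rightarrow> complex) \<Rightarrow> complex" where
  "pairing f g = (LINT z|dV R. f z * cnj (g z))"

lemma pairing_cnj: "pairing g f = cnj (pairing f g)"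
  unfolding pairing_def by (subst Bochner_Integration.integral_cnj[symmetric]) (simp add: mult.commute)

lemma Phi_eq: "f \<in> bergman R r \<Longrightarrow> Phi R r g f = pairing f g"
  and Phi_outside: "f \<notin> bergman R r \<Longrightarrow> Phi R r g f = 0"
  by (simp_all add: Phi_def pairing_def)

context
  fixes r s :: real
  assumes rs: "1 < r" "1 < s" "1 / r + 1 / s = 1"
begin

lemma pairing_add_left: "f \<in> lp_space (dV R) r \<Longrightarrow> g \<in> lp_space (dV R) r \<Longrightarrow> h \<in> lp_space (dV R) s \<Longrightarrow>
    pairing (f + g) h = pairing f h + pairing g h"
  using lp_Holder_cnj(1)[OF rs, of f "dV R" h] lp_Holder_cnj(1)[OF rs, of g "dV R" h]
  by (simp add: pairing_def distrib_right)

lemma pairing_add_right: "f \<in> lp_space (dV R) r \<Longrightarrow> g \<in> lp_space (dV R) s \<Longrightarrow> h \<in> lp_space (dV R) s \<Longrightarrow>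
    pairing f (g + h) = pairing f g + pairing f h"
  using lp_Holder_cnj(1)[OF rs, of f "dV R" g] lp_Holder_cnj(1)[OF rs, of f "dV R" h]
  by (simp add: pairing_def distrib_left)

lemma pairing_fscale_left: "pairing (fscale c f) h = c * pairing f h"
  by (simp add: pairing_def fscale_def mult.assoc)

lemma pairing_fscale_right: "pairing f (fscale c h) = cnj c * pairing f h"
  by (simp add: pairing_def fscale_def mult.left_commute)

lemma pairing_bound: "f \<in> lp_space (dV R) r \<Longrightarrow> g \<in> lp_space (dV R) s \<Longrightarrow> cmod (pairing f g) \<le> bnorm r f * bnorm s g"
  unfolding pairing_def by (rule lp_Holder_cnj(2)[OF rs])

lemma pairing_diff_right: "f \<in> lp_space (dV R) r \<Longrightarrow> g \<in> lp_space (dV R) s \<Longrightarrow> h \<in> lp_space (dV R) s \<Longrightarrow>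
    pairing f (g - h) = pairing f g - pairing f h"
  using lp_Holder_cnj(1)[OF rs, of f "dV R" g] lp_Holder_cnj(1)[OF rs, of f "dV R" h]
  by (simp add: pairing_def right_diff_distrib)

lemma Phi_mem_dual:
  assumes g: "g \<in> bergman R s"
  shows "Phi R r g \<in> bdual r" "bdual_norm r (Phi R r g) \<le> bnorm s g"
proof -
  interpret normed_function_space "bergman R r" "bnorm r" by (rule normed_bergman[OF rs(1)])
  note gl = bergmanD(1)[OF g]
  have b: "cmod (Phi R r g f) \<le> bnorm s g * bnorm r f" if "f \<in> bergman R r" for f
    using pairing_bound[OF bergmanD(1)[OF that] gl] by (simp add: Phi_eq[OF that] mult.commute)
  show "Phi R r g \<in> bdual r"
  proof (rule dual_spaceI[where C="bnorm s g"])
    show "cmod (Phi R r g f) \<le> bnorm s g * bnorm r f" if "f \<in> bergman R r" for f by (rule b[OF that])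
  qed (simp_all add: Phi_eq Phi_outside mem_add mem_fscale pairing_add_left bergmanD(1) gl pairing_fscale_left)
  show "bdual_norm r (Phi R r g) \<le> bnorm s g"
    by (rule dual_norm_le[OF lp_norm_nonneg b])
qed

lemma Phi_add: "g \<in> bergman R s \<Longrightarrow> h \<in> bergman R s \<Longrightarrow> Phi R r (g + h) = Phi R r g + Phi R r h"
  and Phi_diff: "g \<in> bergman R s \<Longrightarrow> h \<in> bergman R s \<Longrightarrow> Phi R r (g - h) = Phi R r g - Phi R r h"
  and Phi_fscale: "Phi R r (fscale c g) = fscale (cnj c) (Phi R r g)"
proof -
  show "Phi R r (g + h) = Phi R r g + Phi R r h" if "g \<in> bergman R s" "h \<in> bergman R s"
  proof
    show "Phi R r (g + h) f = (Phi R r g + Phi R r h) f" for f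
      using that by (cases "f \<in> bergman R r") (simp_all add: Phi_eq Phi_outside pairing_add_right bergmanD(1))
  qed
  show "Phi R r (g - h) = Phi R r g - Phi R r h" if "g \<in> bergman R s" "h \<in> bergman R s"
  proof
    show "Phi R r (g - h) f = (Phi R r g - Phi R r h) f" for f
      using that by (cases "f \<in> bergman R r") (simp_all add: Phi_eq Phi_outside pairing_diff_right bergmanD(1))
  qed
  show "Phi R r (fscale c g) = fscale (cnj c) (Phi R r g)"
  proof
    show "Phi R r (fscale c g) f = fscale (cnj c) (Phi R r g) f" for f
      by (cases "f \<in> bergman R r") (simp_all add: Phi_eq Phi_outside pairing_fscale_right fscale_def[of "cnj c"])
  qed
qed

lemma coeff_functional_mem_dual:
  assumes a: "\<alpha> \<in> mono_exps R r"
  shows "coeff_functional R r \<alpha> \<in> bdual r"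
proof -
  interpret normed_function_space "bergman R r" "bnorm r" by (rule normed_bergman[OF rs(1)])
  have pos: "0 < bnorm r (e_mono R \<alpha>)" by (rule e_mono_norm_pos[OF rs(1) a])
  show ?thesis
  proof (rule dual_spaceI[where C="1 / bnorm r (e_mono R \<alpha>)"])
    show "cmod (coeff_functional R r \<alpha> f) \<le> 1 / bnorm r (e_mono R \<alpha>) * bnorm r f" if "f \<in> bergman R r" for f
      using coeff_bound[OF rs(1) that, of \<alpha>] that pos by (simp add: coeff_functional_def field_simps)
  qed (simp_all add: coeff_functional_def mem_add mem_fscale coeff_add[OF rs(1)] coeff_fscale[OF rs(1)])
qed

text \<open>
  By the Riesz representation, approximating the functional by trigonometric averages amounts to
  approximating the continuous \<open>L\<^sup>s\<close> function that represents it.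
\<close>

lemma coeff_functionals_dense:
  assumes phi: "\<phi> \<in> bdual r" and e: "0 < e"
  obtains A c where "finite A" "A \<subseteq> mono_exps R r"
    "bdual_norm r (\<phi> - (\<Sum>\<alpha>\<in>A. fscale (c \<alpha> * \<phi> (e_mono R \<alpha>)) (coeff_functional R r \<alpha>))) < e"
proof -
  interpret normed_function_space "bergman R r" "bnorm r" by (rule normed_bergman[OF rs(1)])
  have main: "\<exists>A c. finite A \<and> A \<subseteq> mono_exps R r \<and>
    bdual_norm r (\<phi> - (\<Sum>\<alpha>\<in>A. fscale (c \<alpha> * \<phi> (e_mono R \<alpha>)) (coeff_functional R r \<alpha>))) < e"
    if h: "h \<in> lp_space (dV R) s" "continuous_on R h" and rep: "\<And>u. u \<in> bergman R r \<Longrightarrow> \<phi> u = pairing u h" for h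
  proof -
    obtain N where "norm (bnorm s (peak_average N h - h) - 0) < e"
      using LIMSEQ_D[OF peak_average_tendsto_lp[OF rs(2) h(2,1)] e] by blast
    hence N: "bnorm s (peak_average N h - h) < e" using lp_norm_nonneg[of "dV R" s "peak_average N h - h"] by simp
    show ?thesis
    proof (rule peak_average_expansion[of N])
      fix A c
      assume A: "finite A" "\<And>f r. 1 < r \<Longrightarrow> f \<in> bergman R r \<Longrightarrow> peak_average N f = (\<Sum>\<alpha>\<in>A \<inter> mono_exps R r. fscale (c \<alpha> * coeff f \<alpha>) (e_mono R \<alpha>))"
      define B where "B = A \<inter> mono_exps R r"
      define \<psi> where "\<psi> = (\<Sum>\<alpha>\<in>B. fscale (c \<alpha> * \<phi> (e_mono R \<alpha>)) (coeff_functional R r \<alpha>))"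
      have B: "finite B" "B \<subseteq> mono_exps R r" using A(1) by (auto simp: B_def)
      have hA: "peak_average N h \<in> lp_space (dV R) s" by (rule peak_average_contraction(1)[OF rs(2) h(2,1)])
      have "cmod ((\<phi> - \<psi>) f) \<le> bnorm s (peak_average N h - h) * bnorm r f" if f: "f \<in> bergman R r" for f
      proof -
        have ex: "peak_average N f = (\<Sum>\<alpha>\<in>B. fscale (c \<alpha> * coeff f \<alpha>) (e_mono R \<alpha>))"
          using A(2)[OF rs(1) f] by (simp add: B_def)
        have "\<phi> (peak_average N f) = (\<Sum>\<alpha>\<in>B. \<phi> (fscale (c \<alpha> * coeff f \<alpha>) (e_mono R \<alpha>))) \<and> peak_average N f \<in> bergman R r"
          unfolding ex using B by (intro dual_space_sum[OF phi]) (auto intro: mem_fscale mono_expsD)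
        moreover have "\<phi> (fscale (c \<alpha> * coeff f \<alpha>) (e_mono R \<alpha>)) = fscale (c \<alpha> * \<phi> (e_mono R \<alpha>)) (coeff_functional R r \<alpha>) f"
          if "\<alpha> \<in> B" for \<alpha>
          using dual_space_fscale[OF phi mono_expsD] that B(2) f
          by (auto simp: fscale_def[of "c \<alpha> * \<phi> (e_mono R \<alpha>)"] coeff_functional_def mult_ac)
        ultimately have "\<phi> (peak_average N f) = \<psi> f" and pf: "peak_average N f \<in> bergman R r"
          by (simp_all add: \<psi>_def sum_fun_apply)
        hence "\<psi> f = pairing (peak_average N f) h" using rep by simp
        \<comment> \<open>Moving the average from \<open>f\<close> to \<open>h\<close> makes the
          error uniform over all \<open>f\<close>: it is one norm that depends only on
          \<open>h\<close> and \<open>N\<close>.\<close>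
        also have "\<dots> = pairing f (peak_average N h)"
          unfolding pairing_def by (rule peak_average_adjoint[OF rs bergmanD(1)[OF f] h])
        finally have "(\<phi> - \<psi>) f = pairing f h - pairing f (peak_average N h)" using rep[OF f] by simp
        hence "cmod ((\<phi> - \<psi>) f) = cmod (pairing f (peak_average N h - h))"
          using pairing_diff_right[OF bergmanD(1)[OF f] hA h(1)] by (simp add: norm_minus_commute)
        also have "\<dots> \<le> bnorm r f * bnorm s (peak_average N h - h)"
          by (intro pairing_bound bergmanD(1)[OF f] cfun.subspace_diff[OF subspace_lp_space[OF rs(2)] hA h(1)])
        finally show ?thesis by (simp add: mult.commute)
      qed
      hence "bdual_norm r (\<phi> - \<psi>) \<le> bnorm s (peak_average N h - h)" by (intro dual_norm_le lp_norm_nonneg)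
      hence "bdual_norm r (\<phi> - \<psi>) < e" using N by simp
      thus ?thesis unfolding \<psi>_def using B by blast
    qed
  qed
  have "\<exists>A c. finite A \<and> A \<subseteq> mono_exps R r \<and>
    bdual_norm r (\<phi> - (\<Sum>\<alpha>\<in>A. fscale (c \<alpha> * \<phi> (e_mono R \<alpha>)) (coeff_functional R r \<alpha>))) < e"
  proof (rule bergman_Riesz[OF rs phi[folded Lp_norm_eq_lp_norm]])
    fix h assume "h \<in> lp_space (dV R) s" "continuous_on R h" "\<And>u. u \<in> bergman R r \<Longrightarrow> \<phi> u = (LINT z|dV R. u z * cnj (h z))"
    thus ?thesis using main[of h] by (simp add: pairing_def)
  qed
  thus ?thesis using that by blast
qed

text \<open>Monomials are dense in \<open>A^r\<close> and the pairing is continuous;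
  \<open>k\<close> need not be holomorphic, which permits differences such as a projection minus the
  original function.\<close>

lemma pairing_zero_on_monomials:
  assumes k: "k \<in> lp_space (dV R) s" and z: "\<And>\<alpha>. \<alpha> \<in> mono_exps R r \<Longrightarrow> pairing (e_mono R \<alpha>) k = 0"
    and u: "u \<in> bergman R r"
  shows "pairing u k = 0"
proof -
  interpret normed_function_space "bergman R r" "bnorm r" by (rule normed_bergman[OF rs(1)])
  have "cmod (pairing u k) \<le> e" if e: "0 < e" for e
  proof -
    have e': "0 < e / (bnorm s k + 1)" using e lp_norm_nonneg[of "dV R" s k] by (intro divide_pos_pos) auto
    show ?thesis
    proof (rule monomials_dense[OF rs(1) u e'])
      fix A c assume A: "finite A" "A \<subseteq> mono_exps R r"
        and lt: "bnorm r (u - (\<Sum>\<alpha>\<in>A. fscale (c \<alpha> * coeff u \<alpha>) (e_mono R \<alpha>))) < e / (bnorm s k + 1)"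
      define v where "v = (\<Sum>\<alpha>\<in>A. fscale (c \<alpha> * coeff u \<alpha>) (e_mono R \<alpha>))"
      define Z where "Z = {v \<in> bergman R r. pairing v k = 0}"
      have "cfun.subspace Z"
        using mem_zero mem_add mem_fscale pairing_add_left[OF bergmanD(1) bergmanD(1) k] pairing_fscale_left
        by (intro cfun.subspaceI) (auto simp: Z_def pairing_def)
      hence "v \<in> Z"
        unfolding v_def
      proof (intro cfun.subspace_sum cfun.subspace_scale)
        show "e_mono R \<alpha> \<in> Z" if "\<alpha> \<in> A" for \<alpha> using that A(2) z mono_expsD by (auto simp: Z_def)
      qed
      hence v: "pairing v k = 0" "v \<in> bergman R r" by (auto simp: Z_def)
      have "u = (u - v) + v" by simp
      hence "pairing u k = pairing (u - v) k"
        using pairing_add_left[OF bergmanD(1)[OF mem_diff[OF u v(2)]] bergmanD(1)[OF v(2)] k] v(1) by simp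
      also have "cmod \<dots> \<le> bnorm r (u - v) * bnorm s k"
        by (rule pairing_bound[OF bergmanD(1)[OF mem_diff[OF u v(2)]] k])
      also have "\<dots> \<le> bnorm r (u - v) * (bnorm s k + 1)" by (intro mult_left_mono lp_norm_nonneg) simp
      also have "\<dots> \<le> e" using lt lp_norm_nonneg[of "dV R" s k] by (simp add: v_def[symmetric] pos_less_divide_eq)
      finally show "cmod (pairing u k) \<le> e" .
    qed
  qed
  hence "cmod (pairing u k) \<le> 0" by (intro field_le_epsilon[of _ 0]) simp
  thus ?thesis by simp
qed

end

text \<open>If the monomial is not square integrable this is the default value 0. The pairing of the
  monomial with itself then has the same default, so the next identity holds for all
  exponents.\<close>

definition e_square :: "int ^ 'n \<Rightarrow> real" where
  "e_square \<alpha> = (bnorm 2 (e_mono R \<alpha>))\<^sup>2"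

lemma pairing_e_mono_self: "pairing (e_mono R \<alpha>) (e_mono R \<alpha>) = of_real (e_square \<alpha>)"
proof -
  have "e_square \<alpha> = bnorm 2 (e_mono R \<alpha>) powr 2"
    using lp_norm_nonneg[of "dV R" 2 "e_mono R \<alpha>"] by (cases "bnorm 2 (e_mono R \<alpha>) = 0") (simp_all add: e_square_def)
  also have "\<dots> = (LINT z|dV R. cmod (e_mono R \<alpha> z) powr 2)" by (rule lp_norm_powr) simp
  finally have "complex_of_real (e_square \<alpha>) = (LINT z|dV R. of_real (cmod (e_mono R \<alpha> z) powr 2))"
    by (simp only: integral_complex_of_real)
  also have "\<dots> = pairing (e_mono R \<alpha>) (e_mono R \<alpha>)"
    unfolding pairing_def
  proof (rule Bochner_Integration.integral_cong[OF refl])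
    fix z
    show "complex_of_real (cmod (e_mono R \<alpha> z) powr 2) = e_mono R \<alpha> z * cnj (e_mono R \<alpha> z)"
      by (cases "e_mono R \<alpha> z = 0") (simp_all add: complex_norm_square[symmetric])
  qed
  finally show ?thesis by simp
qed

lemma e_square_pos: "\<alpha> \<in> mono_exps R 2 \<Longrightarrow> 0 < e_square \<alpha>"
  using e_mono_norm_pos[of 2 \<alpha>] by (simp add: e_square_def)

lemma pairing_coeff:
  assumes "1 < r" "1 < s" "1 / r + 1 / s = 1" "g \<in> bergman R r" "\<beta> \<in> mono_exps R s"
  shows "pairing g (e_mono R \<beta>) = coeff g \<beta> * of_real (e_square \<beta>)"
  using pairing_e_mono[OF assms] by (simp add: pairing_def[symmetric] pairing_e_mono_self)

text \<open>The conjugate-linear involution that conjugates the Laurent coefficients. It preserves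
  the norms and fixes every monomial, so it can correct a conjugate-linear isomorphism into a linear
  one.\<close>

definition star :: "(complex ^ 'n \<Rightarrow> complex) \<Rightarrow> complex ^ 'n \<Rightarrow> complex" where
  "star g z = cnj (g (cnj_vec z))"

lemma star_star [simp]: "star (star g) = g"
  and star_add: "star (f + g) = star f + star g"
  and star_diff: "star (f - g) = star f - star g"
  and star_fscale: "star (fscale c g) = fscale (cnj c) (star g)"
  by (auto simp: star_def fun_eq_iff fscale_def)

lemma star_e_mono: "star (e_mono R \<alpha>) = e_mono R \<alpha>"
proof
  show "star (e_mono R \<alpha>) z = e_mono R \<alpha> z" for z
    by (cases "z \<in> R") (simp_all add: star_def e_mono_eq e_mono_outside cnj_vec_mem_R zpow_cnj_vec)
qed

text \<open>Two conjugations make the derivative complex-linear again, and \<open>cnj_vec\<close>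
  preserves \<open>R\<close> with its measure.\<close>

lemma star_bergman:
  assumes "g \<in> bergman R r"
  shows "star g \<in> bergman R r" "bnorm r (star g) = bnorm r g"
proof -
  note gD = bergmanD[OF assms]
  have gm: "(\<lambda>z. cnj (g z)) \<in> borel_measurable (dV R)" using lp_spaceD(1)[OF lp_space_cnj[OF gD(1)]] .
  have gi: "(\<lambda>z. cmod (g z) powr r) \<in> borel_measurable (dV R)" using lp_spaceD(1)[OF gD(1)] by measurable
  have sm: "star g \<in> borel_measurable (dV R)"
    using measurable_compose[OF cnj_dV(1) gm] by (simp add: star_def[abs_def])
  have "integrable (distr (dV R) (dV R) cnj_vec) (\<lambda>z. cmod (g z) powr r)"
    using lp_spaceD(2)[OF gD(1)] by (simp add: cnj_dV(2))
  hence "integrable (dV R) (\<lambda>z. cmod (star g z) powr r)"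
    by (subst (asm) integrable_distr_eq[OF cnj_dV(1) gi]) (simp add: star_def)
  hence sl: "star g \<in> lp_space (dV R) r" using sm by (simp add: lp_space_def)
  show "star g \<in> bergman R r"
  proof (rule bergmanI[OF sl])
    show "star g z = 0" if "z \<notin> R" for z using that gD(3) cnj_vec_mem_R by (simp add: star_def)
    show "holomorphic_Cn (star g) R"
    proof (rule holomorphic_CnI)
      fix z assume "z \<in> R"
      hence z: "cnj_vec z \<in> R" by (simp add: cnj_vec_mem_R)
      have "(cnj_vec has_derivative cnj_vec) (at z)"
        using linear_cnj_vec by (intro bounded_linear_imp_has_derivative) (simp add: linear_conv_bounded_linear)
      from has_derivative_compose[OF this deriv_Cn(1)[OF gD(2) z]]
      have "((\<lambda>z. g (cnj_vec z)) has_derivative (\<lambda>v. deriv_Cn g (cnj_vec z) (cnj_vec v))) (at z)" .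
      from has_derivative_compose[OF this bounded_linear_imp_has_derivative[OF bounded_linear_cnj]]
      show "(star g has_derivative (\<lambda>v. cnj (deriv_Cn g (cnj_vec z) (cnj_vec v)))) (at z)"
        by (simp add: star_def[abs_def])
      have "cnj_vec (c *s v) = cnj c *s cnj_vec v" for c and v :: "complex ^ 'n" by (simp add: vec_eq_iff)
      thus "cnj (deriv_Cn g (cnj_vec z) (cnj_vec (c *s v))) = c * cnj (deriv_Cn g (cnj_vec z) (cnj_vec v))" for c v
        by (simp add: deriv_Cn(2)[OF gD(2) z])
    qed
  qed
  have "(LINT z|dV R. cmod (star g z) powr r) = (LINT z|dV R. cmod (g z) powr r)"
    using integral_distr[OF cnj_dV(1) gi] by (simp add: star_def cnj_dV(2))
  thus "bnorm r (star g) = bnorm r g" by (simp add: lp_norm_def)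
qed

end

section \<open>The sub-Bergman projection\<close>

context bounded_reinhardt
begin

text \<open>The evaluation bound on the larger compact set gives a constant independent of \<alpha>;
  passing to that set gains the geometric factor.\<close>

lemma monomial_bound:
  assumes r: "1 < r" and K: "compact K" "K \<subseteq> R"
  obtains C x where "0 \<le> C" "0 \<le> x" "x < 1"
    "\<And>\<alpha> z. \<alpha> \<in> mono_exps R r \<Longrightarrow> z \<in> K \<Longrightarrow> cmod (e_mono R \<alpha> z) \<le> C * bnorm r (e_mono R \<alpha>) * x ^ degree_abs \<alpha>"
proof (rule compact_monomial_decay[OF K])
  fix L x
  assume L: "compact L" "L \<subseteq> R" and x: "0 \<le> x" "x < 1"
    and w: "\<And>\<alpha> z. z \<in> K \<Longrightarrow> \<exists>w\<in>L. e_mono R \<alpha> z = of_real (x ^ degree_abs \<alpha>) * e_mono R \<alpha> w"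
  assume that': "\<And>C x. 0 \<le> C \<Longrightarrow> 0 \<le> x \<Longrightarrow> x < 1 \<Longrightarrow>
    (\<And>\<alpha> z. \<alpha> \<in> mono_exps R r \<Longrightarrow> z \<in> K \<Longrightarrow> cmod (e_mono R \<alpha> z) \<le> C * bnorm r (e_mono R \<alpha>) * x ^ degree_abs \<alpha>) \<Longrightarrow> thesis"
  show thesis
  proof (rule evaluation_bound[OF r L])
    fix C assume C: "0 \<le> C" "\<And>f z. f \<in> bergman R r \<Longrightarrow> z \<in> L \<Longrightarrow> cmod (f z) \<le> C * Lp_norm R r f"
    show thesis
    proof (rule that'[OF C(1) x])
      fix \<alpha> z assume a: "\<alpha> \<in> mono_exps R r" and z: "z \<in> K"
      obtain w where w: "w \<in> L" "e_mono R \<alpha> z = of_real (x ^ degree_abs \<alpha>) * e_mono R \<alpha> w" using w[OF z] by blast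
      have "cmod (e_mono R \<alpha> w) * x ^ degree_abs \<alpha> \<le> C * bnorm r (e_mono R \<alpha>) * x ^ degree_abs \<alpha>"
        using C(2)[OF mono_expsD[OF a] w(1)] x by (intro mult_right_mono) (simp_all add: Lp_norm_eq_lp_norm)
      thus "cmod (e_mono R \<alpha> z) \<le> C * bnorm r (e_mono R \<alpha>) * x ^ degree_abs \<alpha>"
        using x w(2) by (simp add: norm_mult norm_power mult.commute)
    qed
  qed
qed

lemma enumerate_exponents:
  obtains en :: "nat \<Rightarrow> int ^ 'n" where "bij en"
proof -
  have "infinite (UNIV :: (int ^ 'n) set)" by (rule infinite_UNIV_vec) simp
  hence "bij (from_nat_into (UNIV :: (int ^ 'n) set))" by (intro bij_betw_from_nat_into) auto
  thus ?thesis by (rule that)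
qed

text \<open>Boundedness of the single terms in norm already yields a geometric majorant on compact
  sets, so no convergence in norm is asked for. The enumeration enters because limits of holomorphic
  functions were treated for sequences.\<close>

lemma monomial_series:
  fixes t :: "int ^ 'n \<Rightarrow> complex"
  assumes r: "1 < r" and t: "\<And>\<alpha>. t \<alpha> \<noteq> 0 \<Longrightarrow> \<alpha> \<in> mono_exps R r" "\<And>\<alpha>. cmod (t \<alpha>) * bnorm r (e_mono R \<alpha>) \<le> M"
  defines "b \<equiv> \<lambda>z. \<Sum>\<^sub>\<infinity>\<alpha>. t \<alpha> * e_mono R \<alpha> z"
  shows "holomorphic_Cn b R" "\<And>z. z \<notin> R \<Longrightarrow> b z = 0"
    "\<And>\<alpha> z. z \<in> R \<Longrightarrow> torus_average (zpow (- \<alpha>)) b z = t \<alpha> * e_mono R \<alpha> z"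
    "\<And>en z. bij en \<Longrightarrow> z \<in> R \<Longrightarrow> b z = (\<Sum>i. t (en i) * e_mono R (en i) z)"
proof -
  have bound: "\<exists>m. m summable_on UNIV \<and> (\<forall>\<alpha>. \<forall>z\<in>K. cmod (t \<alpha> * e_mono R \<alpha> z) \<le> m \<alpha>)"
    if K: "compact K" "K \<subseteq> R" for K
  proof (rule monomial_bound[OF r K])
    fix C x assume C: "0 \<le> C" and x: "0 \<le> x" "x < 1"
      and e: "\<And>\<alpha> z. \<alpha> \<in> mono_exps R r \<Longrightarrow> z \<in> K \<Longrightarrow> cmod (e_mono R \<alpha> z) \<le> C * bnorm r (e_mono R \<alpha>) * x ^ degree_abs \<alpha>"
    have M: "0 \<le> M" using order_trans[OF _ t(2)[of 0]] lp_norm_nonneg[of "dV R" r "e_mono R 0"] by simp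
    have "cmod (t \<alpha> * e_mono R \<alpha> z) \<le> x ^ degree_abs \<alpha> * (M * C)" if z: "z \<in> K" for \<alpha> z
    proof (cases "t \<alpha> = 0")
      case False
      have "cmod (t \<alpha> * e_mono R \<alpha> z) \<le> cmod (t \<alpha>) * (C * bnorm r (e_mono R \<alpha>) * x ^ degree_abs \<alpha>)"
        using e[OF t(1)[OF False] z] by (simp add: norm_mult mult_left_mono)
      also have "\<dots> = (cmod (t \<alpha>) * bnorm r (e_mono R \<alpha>)) * (C * x ^ degree_abs \<alpha>)" by (simp add: mult_ac)
      also have "\<dots> \<le> M * (C * x ^ degree_abs \<alpha>)" using t(2) C x by (intro mult_right_mono) auto
      finally show ?thesis by (simp add: mult_ac)
    qed (use M C x in simp)
    moreover have "(\<lambda>\<alpha> :: int ^ 'n. x ^ degree_abs \<alpha> * (M * C)) summable_on UNIV"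
      by (rule summable_on_cmult_left[OF summable_on_power_degree_abs[OF x]])
    ultimately show ?thesis by blast
  qed
  have enum: "((\<lambda>\<alpha>. t \<alpha> * e_mono R \<alpha> z) has_sum b z) UNIV" if z: "z \<in> R" for z
  proof -
    obtain m where m: "m summable_on UNIV" "\<And>\<alpha>. cmod (t \<alpha> * e_mono R \<alpha> z) \<le> m \<alpha>"
      using bound[of "{z}"] z by auto
    have "(\<lambda>\<alpha>. cmod (t \<alpha> * e_mono R \<alpha> z)) summable_on UNIV"
      by (rule summable_on_comparison_test[OF m(1) m(2) norm_ge_zero])
    thus ?thesis unfolding b_def by (rule has_sum_infsum[OF abs_summable_summable])
  qed
  show en: "b z = (\<Sum>i. t (en i) * e_mono R (en i) z)" if "bij en" "z \<in> R" for en z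
    using has_sum_imp_sums[OF has_sum_reindex_bij_betw[OF that(1), THEN iffD2, OF enum[OF that(2)]]]
    by (simp add: sums_iff)
  show "b z = 0" if "z \<notin> R" for z using that by (simp add: b_def e_mono_outside)
  have hol_e: "holomorphic_Cn (\<lambda>z. t \<alpha> * e_mono R \<alpha> z) R" for \<alpha>
    using bergmanD(2)[OF mono_expsD[OF t(1)]] by (cases "t \<alpha> = 0") (auto intro: holomorphic_Cn_const holomorphic_Cn_mult)
  show hol: "holomorphic_Cn b R"
  proof -
    obtain en :: "nat \<Rightarrow> int ^ 'n" where bij: "bij en" by (rule enumerate_exponents)
    show ?thesis
    proof (rule holomorphic_Cn_uniform_limit[OF open_R])
      show "holomorphic_Cn (\<lambda>z. \<Sum>i<n. t (en i) * e_mono R (en i) z) R" for n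
        by (induction n) (auto intro: holomorphic_Cn_const holomorphic_Cn_add hol_e)
      fix z assume "z \<in> R"
      then obtain d where d: "d > 0" "cball z d \<subseteq> R" using open_R open_contains_cball_eq by blast
      obtain m where m: "m summable_on UNIV" "\<And>\<alpha> w. w \<in> cball z d \<Longrightarrow> cmod (t \<alpha> * e_mono R \<alpha> w) \<le> m \<alpha>"
        using bound[OF compact_cball d(2)] by auto
      have "summable (\<lambda>i. m (en i))"
        by (rule summable_on_imp_summable[OF summable_on_reindex_bij_betw[OF bij, THEN iffD2, OF m(1)]])
      hence "uniform_limit (ball z d) (\<lambda>n w. \<Sum>i<n. t (en i) * e_mono R (en i) w) (\<lambda>w. \<Sum>i. t (en i) * e_mono R (en i) w) sequentially"
        by (rule Weierstrass_m_test[rotated]) (rule m(2), simp)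
      moreover have "b w = (\<Sum>i. t (en i) * e_mono R (en i) w)" if "w \<in> ball z d" for w
        using en[OF bij] d(2) that by force
      ultimately have "uniform_limit (ball z d) (\<lambda>n w. \<Sum>i<n. t (en i) * e_mono R (en i) w) b sequentially"
        by (subst uniform_limit_cong'[OF refl, where i="\<lambda>w. \<Sum>i. t (en i) * e_mono R (en i) w"]) simp_all
      thus "\<exists>d>0. ball z d \<subseteq> R \<and> uniform_limit (ball z d) (\<lambda>n w. \<Sum>i<n. t (en i) * e_mono R (en i) w) b sequentially"
        using d by (intro exI[of _ d]) force
    qed
  qed
  show "torus_average (zpow (- \<alpha>)) b z = t \<alpha> * e_mono R \<alpha> z" if z: "z \<in> R" for \<alpha> z
  proof (rule torus_average_of_expansion[OF holomorphic_Cn_continuous_on[OF hol] z])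
    have "compact ((\<lambda>u. u * z) ` torus)" by (intro compact_continuous_image compact_torus continuous_intros)
    moreover have "(\<lambda>u. u * z) ` torus \<subseteq> R" using z mult_mem_R by auto
    ultimately obtain m where "m summable_on UNIV" "\<And>\<alpha> w. w \<in> (\<lambda>u. u * z) ` torus \<Longrightarrow> cmod (t \<alpha> * e_mono R \<alpha> w) \<le> m \<alpha>"
      using bound[of "(\<lambda>u. u * z) ` torus"] by auto
    thus "uniform_limit ((\<lambda>u. u * z) ` torus) (\<lambda>A z. \<Sum>\<alpha>\<in>A. t \<alpha> * e_mono R \<alpha> z) b (finite_subsets_at_top UNIV)"
      unfolding b_def by (intro Weierstrass_m_test_general) auto
  qed
qed

lemma pairing_bound_2:
  assumes "f \<in> lp_space (dV R) 2" "g \<in> lp_space (dV R) 2"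
  shows "cmod (pairing f g) \<le> bnorm 2 f * bnorm 2 g"
  using pairing_bound[of 2 2] assms by simp

lemma e_square_eq: "(Lp_norm R 2 (e_mono R \<alpha>))\<^sup>2 = e_square \<alpha>"
  by (simp add: e_square_def Lp_norm_eq_lp_norm)

text \<open>The projection is given by its orthogonal series instead of by the kernel, so that
  holomorphy and coefficients are at hand for every \<open>h\<close> in \<open>L^2\<close>. The sum
  runs over all exponents, with coefficient 0 off \<open>mono_exps R p\<close>.\<close>

definition sub_projection :: "real \<Rightarrow> (complex ^ 'n \<Rightarrow> complex) \<Rightarrow> complex ^ 'n \<Rightarrow> complex" where
  "sub_projection p h z =
     (\<Sum>\<^sub>\<infinity>\<alpha>. (if \<alpha> \<in> mono_exps R p then pairing h (e_mono R \<alpha>) / of_real (e_square \<alpha>) else 0) * e_mono R \<alpha> z)"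

context
  fixes p :: real and h :: "complex ^ 'n \<Rightarrow> complex"
  assumes p: "2 \<le> p" and h: "h \<in> lp_space (dV R) 2"
begin

lemma sub_projection_coeff_bound:
  assumes a: "\<alpha> \<in> mono_exps R p"
  shows "cmod (pairing h (e_mono R \<alpha>) / of_real (e_square \<alpha>)) * bnorm 2 (e_mono R \<alpha>) \<le> bnorm 2 h"
proof -
  have a2: "\<alpha> \<in> mono_exps R 2" using mono_exps_mono[of 2 p] p a by auto
  have n: "0 < bnorm 2 (e_mono R \<alpha>)" by (rule e_mono_norm_pos) (use a2 in simp_all)
  have "cmod (pairing h (e_mono R \<alpha>)) \<le> bnorm 2 h * bnorm 2 (e_mono R \<alpha>)"
    by (rule pairing_bound_2[OF h bergmanD(1)[OF mono_expsD[OF a2]]])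
  thus ?thesis using n by (simp add: e_square_def norm_divide norm_power norm_mult field_simps power2_eq_square)
qed

lemma sub_projection_series:
  "holomorphic_Cn (sub_projection p h) R" "\<And>z. z \<notin> R \<Longrightarrow> sub_projection p h z = 0"
  "\<And>\<alpha> z. \<alpha> \<in> mono_exps R p \<Longrightarrow> z \<in> R \<Longrightarrow>
     torus_average (zpow (- \<alpha>)) (sub_projection p h) z = pairing h (e_mono R \<alpha>) / of_real (e_square \<alpha>) * e_mono R \<alpha> z"
  "\<And>en z. bij en \<Longrightarrow> z \<in> R \<Longrightarrow> sub_projection p h z =
     (\<Sum>i. (if en i \<in> mono_exps R p then pairing h (e_mono R (en i)) / of_real (e_square (en i)) else 0) * e_mono R (en i) z)"
proof -
  let ?t = "\<lambda>\<alpha>. if \<alpha> \<in> mono_exps R p then pairing h (e_mono R \<alpha>) / of_real (e_square \<alpha>) else 0"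
  have t1: "?t \<alpha> \<noteq> 0 \<Longrightarrow> \<alpha> \<in> mono_exps R 2" for \<alpha> using mono_exps_mono[of 2 p] p by (auto split: if_splits)
  have t2: "cmod (?t \<alpha>) * bnorm 2 (e_mono R \<alpha>) \<le> bnorm 2 h" for \<alpha>
    using sub_projection_coeff_bound[of \<alpha>] lp_norm_nonneg[of "dV R" 2 h] by simp
  note S = monomial_series[of 2 ?t "bnorm 2 h", OF _ t1 t2]
  have eq: "sub_projection p h = (\<lambda>z. \<Sum>\<^sub>\<infinity>\<alpha>. ?t \<alpha> * e_mono R \<alpha> z)" by (simp add: fun_eq_iff sub_projection_def)
  show "holomorphic_Cn (sub_projection p h) R" unfolding eq by (rule S(1)) simp_all
  show "sub_projection p h z = 0" if "z \<notin> R" for z unfolding eq by (rule S(2)) (simp_all add: that)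
  show "torus_average (zpow (- \<alpha>)) (sub_projection p h) z = pairing h (e_mono R \<alpha>) / of_real (e_square \<alpha>) * e_mono R \<alpha> z"
    if "\<alpha> \<in> mono_exps R p" "z \<in> R" for \<alpha> z unfolding eq using S(3)[of z \<alpha>] that by simp
  show "sub_projection p h z =
     (\<Sum>i. (if en i \<in> mono_exps R p then pairing h (e_mono R (en i)) / of_real (e_square (en i)) else 0) * e_mono R (en i) z)"
    if "bij en" "z \<in> R" for en z unfolding eq by (rule S(4)) (simp_all add: that)
qed

text \<open>Sum and integral are exchanged through a geometric majorant of the integrals of the
  single terms: decay of the monomials at the fixed point \<open>z\<close>, and Cauchy-Schwarz for
  the integral over \<open>w\<close>.\<close>

lemma sub_projection_integral:
  assumes z: "z \<in> R"
  shows "sub_projection p h z = (LINT w|dV R. sub_bergman_kernel R p z w * h w)"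
proof -
  define k where "k \<alpha> w = (if \<alpha> \<in> mono_exps R p then e_mono R \<alpha> z * cnj (e_mono R \<alpha> w) / of_real (e_square \<alpha>) else 0)" for \<alpha> w
  note h2 = lp_Holder_cnj(1)[OF _ _ _ h]
  have Sp2: "\<alpha> \<in> mono_exps R 2" if "\<alpha> \<in> mono_exps R p" for \<alpha> using mono_exps_mono[of 2 p] p that by auto
  have el: "e_mono R \<alpha> \<in> lp_space (dV R) 2" if "\<alpha> \<in> mono_exps R p" for \<alpha> by (rule bergmanD(1)[OF mono_expsD[OF Sp2[OF that]]])
  have pos: "0 < bnorm 2 (e_mono R \<alpha>)" if "\<alpha> \<in> mono_exps R p" for \<alpha> by (rule e_mono_norm_pos) (use Sp2 that in simp_all)
  have "\<exists>C x. 0 \<le> C \<and> 0 \<le> x \<and> x < 1 \<and>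
    (\<forall>\<alpha>\<in>mono_exps R 2. cmod (e_mono R \<alpha> z) \<le> C * bnorm 2 (e_mono R \<alpha>) * x ^ degree_abs \<alpha>)"
  proof (rule monomial_bound[of 2 "{z}"])
    fix C x assume "0 \<le> C" "0 \<le> x" "x < 1"
      "\<And>\<alpha> w. \<alpha> \<in> mono_exps R 2 \<Longrightarrow> w \<in> {z} \<Longrightarrow> cmod (e_mono R \<alpha> w) \<le> C * bnorm 2 (e_mono R \<alpha>) * x ^ degree_abs \<alpha>"
    thus ?thesis by blast
  qed (use z in auto)
  then obtain C x where C: "0 \<le> C" and x: "0 \<le> x" "x < 1"
    and e: "\<And>\<alpha>. \<alpha> \<in> mono_exps R 2 \<Longrightarrow> cmod (e_mono R \<alpha> z) \<le> C * bnorm 2 (e_mono R \<alpha>) * x ^ degree_abs \<alpha>"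
    by blast
  have sx: "(\<lambda>\<alpha> :: int ^ 'n. x ^ degree_abs \<alpha> * D) summable_on UNIV" for D
    by (rule summable_on_cmult_left[OF summable_on_power_degree_abs[OF x]])
  have kb: "cmod (k \<alpha> w) \<le> C * x ^ degree_abs \<alpha> / bnorm 2 (e_mono R \<alpha>) * cmod (e_mono R \<alpha> w)"
    if a: "\<alpha> \<in> mono_exps R p" for \<alpha> w
  proof -
    have "cmod (k \<alpha> w) = cmod (e_mono R \<alpha> z) * (cmod (e_mono R \<alpha> w) / (bnorm 2 (e_mono R \<alpha>))\<^sup>2)"
      using a by (simp add: k_def norm_mult norm_divide norm_power e_square_def)
    also have "\<dots> \<le> (C * bnorm 2 (e_mono R \<alpha>) * x ^ degree_abs \<alpha>) * (cmod (e_mono R \<alpha> w) / (bnorm 2 (e_mono R \<alpha>))\<^sup>2)"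
      by (intro mult_right_mono e Sp2 a) simp
    also have "\<dots> = C * x ^ degree_abs \<alpha> / bnorm 2 (e_mono R \<alpha>) * cmod (e_mono R \<alpha> w)"
      using pos[OF a] by (simp add: field_simps power2_eq_square)
    finally show ?thesis .
  qed
  \<comment> \<open>The decay comes from \<open>z\<close> alone; at \<open>w\<close> the plain
    evaluation bound suffices.\<close>
  have ksum: "(\<lambda>\<alpha>. cmod (k \<alpha> w)) summable_on UNIV" if w: "w \<in> R" for w
  proof -
    have "\<exists>D\<ge>0. \<forall>f\<in>bergman R 2. cmod (f w) \<le> D * bnorm 2 f"
    proof (rule evaluation_bound[of 2 "{w}"])
      fix D assume "0 \<le> D" "\<And>f z. f \<in> bergman R 2 \<Longrightarrow> z \<in> {w} \<Longrightarrow> cmod (f z) \<le> D * Lp_norm R 2 f"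
      thus ?thesis unfolding Lp_norm_eq_lp_norm by blast
    qed (use w in auto)
    then obtain D where D: "0 \<le> D" "\<And>f. f \<in> bergman R 2 \<Longrightarrow> cmod (f w) \<le> D * bnorm 2 f" by blast
    have "cmod (k \<alpha> w) \<le> x ^ degree_abs \<alpha> * (C * D)" for \<alpha>
    proof (cases "\<alpha> \<in> mono_exps R p")
      case True
      have "cmod (k \<alpha> w) \<le> C * x ^ degree_abs \<alpha> / bnorm 2 (e_mono R \<alpha>) * (D * bnorm 2 (e_mono R \<alpha>))"
        by (rule order_trans[OF kb[OF True]], intro mult_left_mono D(2) mono_expsD Sp2 True)
          (use C x in \<open>auto intro!: divide_nonneg_nonneg lp_norm_nonneg\<close>)
      thus ?thesis using pos[OF True] by (simp add: mult_ac)
    qed (use C D x in \<open>simp add: k_def\<close>)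
    thus ?thesis by (rule summable_on_comparison_test[OF sx _ norm_ge_zero])
  qed
  have kernel: "sub_bergman_kernel R p z w = (\<Sum>\<^sub>\<infinity>\<alpha>. k \<alpha> w)" for w
    unfolding sub_bergman_kernel_def e_square_eq by (rule infsum_cong_neutral) (auto simp: k_def)
  have int: "integrable (dV R) (\<lambda>w. k \<alpha> w * h w)" 
    and int_eq: "(LINT w|dV R. k \<alpha> w * h w) =
      (if \<alpha> \<in> mono_exps R p then pairing h (e_mono R \<alpha>) / of_real (e_square \<alpha>) else 0) * e_mono R \<alpha> z" for \<alpha>
  proof -
    have kf: "(\<lambda>w. k \<alpha> w * h w) = (\<lambda>w. (e_mono R \<alpha> z / of_real (e_square \<alpha>)) * (h w * cnj (e_mono R \<alpha> w)))" if "\<alpha> \<in> mono_exps R p"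
      using that by (auto simp: k_def)
    show "integrable (dV R) (\<lambda>w. k \<alpha> w * h w)"
    proof (cases "\<alpha> \<in> mono_exps R p")
      case True
      show ?thesis unfolding kf[OF True] using h2[OF _ _ _ el[OF True]] by simp
    qed (simp add: k_def)
    show "(LINT w|dV R. k \<alpha> w * h w) =
      (if \<alpha> \<in> mono_exps R p then pairing h (e_mono R \<alpha>) / of_real (e_square \<alpha>) else 0) * e_mono R \<alpha> z"
    proof (cases "\<alpha> \<in> mono_exps R p")
      case True
      show ?thesis unfolding kf[OF True] using True by (simp add: pairing_def)
    qed (simp add: k_def)
  qed
  have intn: "(LINT w|dV R. cmod (k \<alpha> w * h w)) \<le> x ^ degree_abs \<alpha> * (C * bnorm 2 h)" for \<alpha>
  proof (cases "\<alpha> \<in> mono_exps R p")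
    case True
    define B where "B = C * x ^ degree_abs \<alpha> / bnorm 2 (e_mono R \<alpha>)"
    have B: "0 \<le> B" using C x by (auto simp: B_def intro!: divide_nonneg_nonneg lp_norm_nonneg)
    have "integrable (dV R) (\<lambda>w. h w * e_mono R \<alpha> w)" using lp_Holder(1)[OF _ _ _ h el[OF True]] by simp
    hence "(LINT w|dV R. cmod (k \<alpha> w * h w)) \<le> (LINT w|dV R. B * cmod (h w * e_mono R \<alpha> w))"
    proof (intro integral_mono integrable_norm int integrable_mult_right)
      fix w
      show "cmod (k \<alpha> w * h w) \<le> B * cmod (h w * e_mono R \<alpha> w)"
        using mult_right_mono[OF kb[OF True, of w], of "cmod (h w)"] by (simp add: norm_mult B_def mult_ac)
    qed
    also have "\<dots> = B * (LINT w|dV R. cmod (h w * e_mono R \<alpha> w))" by simp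
    also have "\<dots> \<le> B * (bnorm 2 h * bnorm 2 (e_mono R \<alpha>))"
      using lp_Holder(2)[OF _ _ _ h el[OF True]] B by (intro mult_left_mono) simp_all
    finally show ?thesis using pos[OF True] by (simp add: B_def mult_ac)
  qed (use C x lp_norm_nonneg[of "dV R" 2 h] in \<open>simp add: k_def\<close>)
  obtain en :: "nat \<Rightarrow> int ^ 'n" where bij: "bij en" by (rule enumerate_exponents)
  have "sub_projection p h z = (\<Sum>i. LINT w|dV R. k (en i) w * h w)"
    using sub_projection_series(4)[OF bij z] by (simp add: int_eq)
  also have "\<dots> = (LINT w|dV R. (\<Sum>i. k (en i) w * h w))"
  proof (rule integral_suminf[symmetric])
    show "integrable (dV R) (\<lambda>w. k (en i) w * h w)" for i by (rule int)
    have "summable (\<lambda>i. cmod (k (en i) w))" if "w \<in> R" for w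
      by (rule summable_on_imp_summable[OF summable_on_reindex_bij_betw[OF bij, THEN iffD2, OF ksum[OF that]]])
    thus "AE w in dV R. summable (\<lambda>i. norm (k (en i) w * h w))"
      by (intro AE_I2) (simp add: norm_mult summable_mult2)
    have "summable (\<lambda>i. x ^ degree_abs (en i) * (C * bnorm 2 h))"
      by (rule summable_on_imp_summable[OF summable_on_reindex_bij_betw[OF bij, THEN iffD2, OF sx]])
    thus "summable (\<lambda>i. LINT w|dV R. norm (k (en i) w * h w))"
      by (rule summable_comparison_test'[where N=0]) (use intn in simp)
  qed
  also have "\<dots> = (LINT w|dV R. sub_bergman_kernel R p z w * h w)"
  proof (rule Bochner_Integration.integral_cong[OF refl])
    fix w assume "w \<in> space (dV R)"
    hence w: "w \<in> R" by simp
    have "((\<lambda>\<alpha>. k \<alpha> w) has_sum sub_bergman_kernel R p z w) UNIV"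
      unfolding kernel by (rule has_sum_infsum[OF abs_summable_summable[OF ksum[OF w]]])
    from has_sum_imp_sums[OF has_sum_reindex_bij_betw[OF bij, THEN iffD2, OF this]]
    have "(\<lambda>i. k (en i) w) sums sub_bergman_kernel R p z w" .
    from sums_mult2[OF this, of "h w"]
    show "(\<Sum>i. k (en i) w * h w) = sub_bergman_kernel R p z w * h w" by (simp add: sums_iff)
  qed
  finally show ?thesis .
qed

text \<open>Here the absolute value of the kernel enters: the triangle inequality for the integral
  yields a pointwise majorant whose \<open>L^p\<close> norm the hypothesis controls.\<close>

lemma sub_projection_le: 
  assumes z: "z \<in> R"
  shows "cmod (sub_projection p h z) \<le> cmod (abs_sub_bergman R p (\<lambda>w. of_real (cmod (h w))) z)"
proof -
  have "cmod (sub_projection p h z) \<le> (LINT w|dV R. cmod (sub_bergman_kernel R p z w * h w))"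
    unfolding sub_projection_integral[OF z] by (rule integral_norm_bound)
  also have "\<dots> = (LINT w|dV R. cmod (sub_bergman_kernel R p z w) * cmod (h w))" by (simp add: norm_mult)
  also have "\<dots> \<le> cmod (abs_sub_bergman R p (\<lambda>w. of_real (cmod (h w))) z)"
  proof -
    have "abs_sub_bergman R p (\<lambda>w. of_real (cmod (h w))) z = of_real (LINT w|dV R. cmod (sub_bergman_kernel R p z w) * cmod (h w))"
      unfolding abs_sub_bergman_def by (simp only: of_real_mult[symmetric] integral_complex_of_real)
    thus ?thesis by simp
  qed
  finally show ?thesis .
qed

end

lemma conjugate_exponent_le_2:
  assumes "2 \<le> p" "1 / p + 1 / q = (1 :: real)"
  shows "1 < q" "q \<le> 2"
proof -
  have "1 / p \<le> 1 / 2" "0 < 1 / p" using assms(1) by (simp_all add: field_simps)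
  hence *: "1 / 2 \<le> 1 / q" "1 / q < 1" using assms(2) by linarith+
  hence "0 < 1 / q" by linarith
  hence "0 < q" by simp
  thus "1 < q" "q \<le> 2" using * by (simp_all add: field_simps)
qed

text \<open>Membership in \<open>A^p\<close> and the norm estimate follow from the pointwise
  majorant. The identity of pairings holds on monomials by the choice of coefficients, and density
  carries it to all of \<open>A^p\<close>.\<close>

lemma sub_projection_bounded:
  assumes pq: "2 \<le> p" "1 / p + 1 / q = 1" and bd: "abs_sub_bergman_bounded R p"
  obtains C where "0 \<le> C" "\<And>h. h \<in> lp_space (dV R) p \<Longrightarrow> sub_projection p h \<in> bergman R p"
    "\<And>h. h \<in> lp_space (dV R) p \<Longrightarrow> bnorm p (sub_projection p h) \<le> C * bnorm p h"
    "\<And>h u. h \<in> lp_space (dV R) p \<Longrightarrow> u \<in> bergman R p \<Longrightarrow> pairing u (sub_projection p h) = pairing u h"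
proof -
  have p1: "1 < p" using pq by simp
  note q = conjugate_exponent_le_2[OF pq]
  obtain C0 where C0: "\<And>f. f \<in> lp_space (dV R) p \<Longrightarrow> abs_sub_bergman R p f \<in> lp_space (dV R) p"
    "\<And>f. f \<in> lp_space (dV R) p \<Longrightarrow> bnorm p (abs_sub_bergman R p f) \<le> C0 * bnorm p f"
    using bd unfolding abs_sub_bergman_bounded_def Lp_eq_lp_space Lp_norm_eq_lp_norm by blast
  show ?thesis
  proof (rule that[of "max C0 0"])
    \<comment> \<open>The constant in \<open>abs_sub_bergman_bounded\<close> may be any real number,
      hence the maximum with 0.\<close>
    show "0 \<le> max C0 0" by simp
    fix h assume h: "h \<in> lp_space (dV R) p"
    have h2: "h \<in> lp_space (dV R) 2" by (rule fin.lp_space_mono(1)[OF _ pq(1) h]) simp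
    define H where "H = (\<lambda>w. complex_of_real (cmod (h w)))"
    have H: "H \<in> lp_space (dV R) p" "bnorm p H = bnorm p h"
      using lp_spaceD[OF h] by (simp_all add: H_def lp_space_def lp_norm_def)
    note S = sub_projection_series[OF pq(1) h2]
    have m: "sub_projection p h \<in> borel_measurable (dV R)"
      by (rule continuous_measurable[OF holomorphic_Cn_continuous_on[OF S(1)]])
    have dom: "sub_projection p h \<in> lp_space (dV R) p" "bnorm p (sub_projection p h) \<le> bnorm p (abs_sub_bergman R p H)"
      using lp_space_dominated[OF m C0(1)[OF H(1)]] sub_projection_le[OF pq(1) h2] pq(1) by (simp_all add: H_def)
    show b: "sub_projection p h \<in> bergman R p" by (rule bergmanI[OF dom(1) S(1,2)])
    have "bnorm p (sub_projection p h) \<le> C0 * bnorm p h" using dom(2) C0(2)[OF H(1)] H(2) by simp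
    also have "\<dots> \<le> max C0 0 * bnorm p h" by (intro mult_right_mono lp_norm_nonneg) simp
    finally show "bnorm p (sub_projection p h) \<le> max C0 0 * bnorm p h" .
    fix u assume u: "u \<in> bergman R p"
    have qp: "q \<le> p" using q pq by simp
    note lq = fin.lp_space_mono(1)[OF q(1) qp]
    \<comment> \<open>The functions paired with \<open>u\<close> have to be in \<open>L^q\<close>;
      this holds since the domain has finite measure and \<open>q \<le> p\<close>.\<close>
    have hq: "h \<in> lp_space (dV R) q" "sub_projection p h \<in> lp_space (dV R) q"
      using lq h dom(1) by auto
    have "pairing u (sub_projection p h - h) = 0"
    proof (rule pairing_zero_on_monomials[OF p1 q(1) pq(2) _ _ u])
      show "sub_projection p h - h \<in> lp_space (dV R) q"
        by (rule cfun.subspace_diff[OF subspace_lp_space[OF q(1)] hq(2,1)])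
      fix \<alpha> assume a: "\<alpha> \<in> mono_exps R p"
      hence aq: "\<alpha> \<in> mono_exps R q" and a2: "\<alpha> \<in> mono_exps R 2"
        using mono_exps_mono[OF q(1) qp] mono_exps_mono[of 2 p] pq by auto
      have "e_mono R \<alpha> \<noteq> (\<lambda>z. 0)" using e_mono_norm_pos[OF p1 a] by (auto simp: lp_norm_def)
      then obtain z where ez: "e_mono R \<alpha> z \<noteq> 0" by (auto simp: fun_eq_iff)
      have "z \<in> R"
      proof (rule ccontr)
        assume "z \<notin> R"
        thus False using ez by (simp add: e_mono_outside)
      qed
      note z = this ez
      have "coeff (sub_projection p h) \<alpha> * e_mono R \<alpha> z = pairing h (e_mono R \<alpha>) / of_real (e_square \<alpha>) * e_mono R \<alpha> z"
        using bergman_average[OF b, of \<alpha>] S(3)[OF a z(1)] by (simp add: fscale_def)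
      hence "coeff (sub_projection p h) \<alpha> = pairing h (e_mono R \<alpha>) / of_real (e_square \<alpha>)"
        by (simp only: mult_right_cancel[OF z(2)])
      hence "pairing (sub_projection p h) (e_mono R \<alpha>) = pairing h (e_mono R \<alpha>)"
        using e_square_pos[OF a2] by (simp add: pairing_coeff[OF p1 q(1) pq(2) b aq])
      hence "pairing (e_mono R \<alpha>) (sub_projection p h) = pairing (e_mono R \<alpha>) h"
        using pairing_cnj[of "e_mono R \<alpha>"] by simp
      thus "pairing (e_mono R \<alpha>) (sub_projection p h - h) = 0"
        by (simp add: pairing_diff_right[OF p1 q(1) pq(2) bergmanD(1)[OF mono_expsD[OF a]] hq(2,1)])
    qed
    thus "pairing u (sub_projection p h) = pairing u h"
      by (simp add: pairing_diff_right[OF p1 q(1) pq(2) bergmanD(1)[OF u] hq(2,1)])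
  qed
qed

end

section \<open>Duality for a bounded absolute sub-Bergman operator\<close>

locale bounded_sub_bergman = bounded_reinhardt R for R :: "(complex ^ 'n) set" +
  fixes p q :: real
  assumes p_ge: "2 \<le> p" and pq: "1 / p + 1 / q = 1" and bdd: "abs_sub_bergman_bounded R p"
begin

lemma p1: "1 < p" and q1: "1 < q" and qp: "q \<le> p" and qp_conj: "1 / q + 1 / p = 1"
  using p_ge pq conjugate_exponent_le_2[OF p_ge pq] by auto

lemmas Sp_sub_Sq = mono_exps_mono[OF q1 qp] and bergman_p_q = bergman_mono[OF q1 qp]

lemma e_square_pos_p: "\<alpha> \<in> mono_exps R p \<Longrightarrow> 0 < e_square \<alpha>"
  using mono_exps_mono[of 2 p] p_ge e_square_pos by auto

sublocale P: normed_function_space "bergman R p" "bnorm p" by (rule normed_bergman[OF p1])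
sublocale Q: normed_function_space "bergman R q" "bnorm q" by (rule normed_bergman[OF q1])
sublocale P': normed_function_space "bdual p" "bdual_norm p" by (rule normed_bdual[OF p1])
sublocale Q': normed_function_space "bdual q" "bdual_norm q" by (rule normed_bdual[OF q1])

text \<open>Some admissible bound of the sub-projection on \<open>L^p\<close>, not its operator
  norm; it is fixed once so that it can serve as a constant in all estimates.\<close>

definition B_norm :: real where
  "B_norm = (SOME C. 0 \<le> C \<and> (\<forall>h\<in>lp_space (dV R) p. sub_projection p h \<in> bergman R p \<and>
     bnorm p (sub_projection p h) \<le> C * bnorm p h \<and>
     (\<forall>u\<in>bergman R p. pairing u (sub_projection p h) = pairing u h)))"

lemma B_norm_nonneg: "0 \<le> B_norm"
  and sub_projection: "h \<in> lp_space (dV R) p \<Longrightarrow> sub_projection p h \<in> bergman R p"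
    "h \<in> lp_space (dV R) p \<Longrightarrow> bnorm p (sub_projection p h) \<le> B_norm * bnorm p h"
    "h \<in> lp_space (dV R) p \<Longrightarrow> u \<in> bergman R p \<Longrightarrow> pairing u (sub_projection p h) = pairing u h"
proof -
  have "\<exists>C. 0 \<le> C \<and> (\<forall>h\<in>lp_space (dV R) p. sub_projection p h \<in> bergman R p \<and>
     bnorm p (sub_projection p h) \<le> C * bnorm p h \<and>
     (\<forall>u\<in>bergman R p. pairing u (sub_projection p h) = pairing u h))"
    by (rule sub_projection_bounded[OF p_ge pq bdd], blast)
  from someI_ex[OF this, folded B_norm_def]
  show "0 \<le> B_norm" "h \<in> lp_space (dV R) p \<Longrightarrow> sub_projection p h \<in> bergman R p"
    "h \<in> lp_space (dV R) p \<Longrightarrow> bnorm p (sub_projection p h) \<le> B_norm * bnorm p h"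
    "h \<in> lp_space (dV R) p \<Longrightarrow> u \<in> bergman R p \<Longrightarrow> pairing u (sub_projection p h) = pairing u h"
    by blast+
qed

text \<open>Pairing \<open>g\<close> with its dual function gives \<open>bnorm q g powr q\<close>.
  The dual function is not holomorphic, but its projection is and has the same pairing with
  \<open>g\<close>, so \<open>Phi R p g\<close> can be evaluated at it. Cancelling
  \<open>bnorm q g powr (q - 1)\<close> leaves the claim.\<close>

lemma Phi_lower_bound_bergman:
  assumes g: "g \<in> bergman R p"
  shows "bnorm q g \<le> B_norm * bdual_norm p (Phi R p g)"
proof (cases "bnorm q g = 0")
  case True
  thus ?thesis using B_norm_nonneg P'.norm_nonneg[OF Phi_mem_dual(1)[OF p1 q1 pq bergman_p_q[OF g]]] by simp
next
  case False
  note gq = bergman_p_q[OF g]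
  have pos: "0 < bnorm q g" using False lp_norm_nonneg[of "dV R" q g] by simp
  define f where "f = (\<lambda>z. lp_dual_map q (g z))"
  have f: "f \<in> lp_space (dV R) p" "bnorm p f = bnorm q g powr (q - 1)"
    unfolding f_def by (rule lp_dual_map_mem[OF q1 p1 qp_conj bergmanD(1)[OF gq]])+
  define b where "b = sub_projection p f"
  note b = sub_projection[OF f(1), folded b_def]
  have "complex_of_real (bnorm q g powr q) = (LINT z|dV R. of_real (cmod (g z) powr q))"
    using lp_norm_powr[of q "dV R" g] q1 by (simp only: integral_complex_of_real)
  also have "\<dots> = pairing g f" by (simp add: pairing_def f_def mult_cnj_lp_dual_map)
  \<comment> \<open>Replacing \<open>f\<close> by \<open>b\<close> uses that \<open>g\<close> itself
    lies in \<open>A^p\<close>; elements of the closed span are reached only by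
    approximation.\<close>
  also have "\<dots> = cnj (pairing b g)" using b(3)[OF g] pairing_cnj[of g b] by simp
  finally have "bnorm q g powr q = cmod (Phi R p g b)"
    using Phi_eq[OF b(1)] by (metis abs_of_nonneg complex_mod_cnj norm_of_real powr_ge_zero)
  also have "\<dots> \<le> bdual_norm p (Phi R p g) * bnorm p b"
    by (rule P.dual_norm_bound[OF Phi_mem_dual(1)[OF p1 q1 pq gq] b(1)])
  also have "\<dots> \<le> bdual_norm p (Phi R p g) * (B_norm * bnorm q g powr (q - 1))"
    using b(2) P'.norm_nonneg[OF Phi_mem_dual(1)[OF p1 q1 pq gq]] f(2) by (intro mult_left_mono) simp_all
  finally have "bnorm q g * bnorm q g powr (q - 1) \<le> (B_norm * bdual_norm p (Phi R p g)) * bnorm q g powr (q - 1)"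
    using pos powr_add[of "bnorm q g" 1 "q - 1"] by (simp add: mult_ac)
  thus ?thesis using pos by simp
qed

section \<open>The closed span of the monomials of \<open>A^p\<close> and the map
  \<open>Phi\<close>\<close>

abbreviation G :: "(complex ^ 'n \<Rightarrow> complex) set" where
  "G \<equiv> closed_span (bergman R q) (bnorm q) (e_mono R ` mono_exps R p)"

lemma monomials_sub: "e_mono R ` mono_exps R p \<subseteq> bergman R p" "e_mono R ` mono_exps R p \<subseteq> bergman R q"
  using mono_expsD bergman_p_q by auto

lemma G_iff: "g \<in> G \<longleftrightarrow> g \<in> bergman R q \<and> (\<forall>e>0. \<exists>s\<in>cfun.span (e_mono R ` mono_exps R p). bnorm q (g - s) < e)"
  by (rule Q.closed_span_iff[OF monomials_sub(2)])

sublocale G: normed_function_space G "bnorm q" by (rule Q.normed_closed_span[OF monomials_sub(2)])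

lemma Phi_lower_bound:
  assumes g: "g \<in> G"
  shows "bnorm q g \<le> B_norm * bdual_norm p (Phi R p g)"
proof (rule field_le_epsilon)
  fix e :: real assume e: "0 < e"
  have gq: "g \<in> bergman R q" using g by (simp add: G_iff)
  \<comment> \<open>The approximation error enters once directly and once multiplied by
    \<open>B_norm\<close>.\<close>
  have "0 < e / (B_norm + 1)" using e B_norm_nonneg by simp
  then obtain s where s: "s \<in> cfun.span (e_mono R ` mono_exps R p)" "bnorm q (g - s) < e / (B_norm + 1)"
    using g unfolding G_iff by blast
  have sp: "s \<in> bergman R p" using P.span_subset[OF monomials_sub(1)] s(1) by blast
  note sq = bergman_p_q[OF sp]
  have d: "g - s \<in> bergman R q" by (rule Q.mem_diff[OF gq sq])
  have "Phi R p s = Phi R p g - Phi R p (g - s)" using Phi_diff[OF p1 q1 pq gq sq] by simp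
  hence "bdual_norm p (Phi R p s) \<le> bdual_norm p (Phi R p g) + bdual_norm p (Phi R p (g - s))"
    using P'.norm_diff[OF Phi_mem_dual(1)[OF p1 q1 pq gq] Phi_mem_dual(1)[OF p1 q1 pq d]] by simp
  also have "\<dots> \<le> bdual_norm p (Phi R p g) + bnorm q (g - s)" using Phi_mem_dual(2)[OF p1 q1 pq d] by simp
  finally have *: "B_norm * bdual_norm p (Phi R p s) \<le> B_norm * (bdual_norm p (Phi R p g) + bnorm q (g - s))"
    by (rule mult_left_mono) (rule B_norm_nonneg)
  have "bnorm q g \<le> bnorm q (g - s) + bnorm q s" using Q.norm_add[OF d sq] by simp
  also have "\<dots> \<le> bnorm q (g - s) + B_norm * (bdual_norm p (Phi R p g) + bnorm q (g - s))"
    using Phi_lower_bound_bergman[OF sp] * by simp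
  also have "\<dots> = B_norm * bdual_norm p (Phi R p g) + (B_norm + 1) * bnorm q (g - s)" by (simp add: algebra_simps)
  also have "\<dots> \<le> B_norm * bdual_norm p (Phi R p g) + e"
    using s(2) B_norm_nonneg by (simp add: pos_less_divide_eq mult.commute)
  finally show "bnorm q g \<le> B_norm * bdual_norm p (Phi R p g) + e" .
qed

text \<open>Used in both directions: where \<open>e_square \<alpha>\<close> is positive it puts
  coefficient functionals into the image of \<open>Phi\<close>, and where the coefficient functional
  is 0 it puts monomials into the kernel.\<close>

lemma Phi_e_mono:
  assumes "1 < r" "1 < s" "1 / r + 1 / s = 1" "\<alpha> \<in> mono_exps R s"
  shows "Phi R r (e_mono R \<alpha>) = fscale (of_real (e_square \<alpha>)) (coeff_functional R r \<alpha>)"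
proof
  show "Phi R r (e_mono R \<alpha>) f = fscale (of_real (e_square \<alpha>)) (coeff_functional R r \<alpha>) f" for f
    using pairing_coeff[OF assms(1-3) _ assms(4)]
    by (cases "f \<in> bergman R r") (simp_all add: Phi_eq Phi_outside fscale_def coeff_functional_def)
qed

lemma Phi_zero: "Phi R r 0 = 0"
  by (auto simp: Phi_def)

lemma Phi_image_subspace:
  assumes "1 < r" "1 < s" "1 / r + 1 / s = 1" "cfun.subspace S" "S \<subseteq> bergman R s"
  shows "cfun.subspace (Phi R r ` S)"
proof (rule cfun.subspaceI)
  note S = cfun.subspace_0[OF assms(4)] cfun.subspace_add[OF assms(4)] cfun.subspace_scale[OF assms(4)]
  show "0 \<in> Phi R r ` S" using S(1) by (intro image_eqI[of _ _ 0]) (simp_all add: Phi_zero)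
  fix x y c assume "x \<in> Phi R r ` S"
  then obtain f where f: "f \<in> S" "x = Phi R r f" by blast
  show "fscale c x \<in> Phi R r ` S"
    using f S(3)[of f "cnj c"] by (intro image_eqI[of _ _ "fscale (cnj c) f"]) (simp_all add: Phi_fscale[OF assms(1-3)])
  assume "y \<in> Phi R r ` S"
  then obtain g where g: "g \<in> S" "y = Phi R r g" by blast
  show "x + y \<in> Phi R r ` S"
    using f g S(2) Phi_add[OF assms(1-3) subsetD[OF assms(5)] subsetD[OF assms(5)], of f g] by (intro image_eqI[of _ _ "f + g"]) simp_all
qed

text \<open>Polynomials whose images approximate \<open>\<phi>\<close> exist because the coefficient
  functionals are dense. The lower bound makes these polynomials a Cauchy sequence in
  \<open>L^q\<close>, and continuity identifies the image of the limit.\<close>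

lemma Phi_surj_G:
  assumes phi: "\<phi> \<in> bdual p"
  shows "\<exists>g\<in>G. Phi R p g = \<phi>"
proof -
  define E where "E = cfun.span (e_mono R ` mono_exps R p)"
  have E: "cfun.subspace E" "E \<subseteq> bergman R p" "E \<subseteq> bergman R q" "E \<subseteq> G"
    using P.span_subset[OF monomials_sub(1)] Q.span_subset[OF monomials_sub(2)] Q.span_subset_closed_span[OF monomials_sub(2)]
    by (auto simp: E_def cfun.subspace_span)
  note W = Phi_image_subspace[OF p1 q1 pq E(1,3)]
  have cf: "coeff_functional R p \<alpha> \<in> Phi R p ` E" if a: "\<alpha> \<in> mono_exps R p" for \<alpha>
  proof -
    have "Phi R p (e_mono R \<alpha>) \<in> Phi R p ` E" using a by (auto simp: E_def intro: cfun.span_base)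
    from cfun.subspace_scale[OF W this, of "1 / of_real (e_square \<alpha>)"]
    have "fscale (1 / of_real (e_square \<alpha>) * of_real (e_square \<alpha>)) (coeff_functional R p \<alpha>) \<in> Phi R p ` E"
      using Sp_sub_Sq a by (auto simp: Phi_e_mono[OF p1 q1 pq])
    moreover have "0 < e_square \<alpha>" by (rule e_square_pos_p[OF a])
    ultimately show ?thesis by simp
  qed
  have "\<exists>g\<in>E. bdual_norm p (\<phi> - Phi R p g) < e" if e: "0 < e" for e
  proof (rule coeff_functionals_dense[OF p1 q1 pq phi e])
    fix A c assume A: "finite A" "A \<subseteq> mono_exps R p"
      and lt: "bdual_norm p (\<phi> - (\<Sum>\<alpha>\<in>A. fscale (c \<alpha> * \<phi> (e_mono R \<alpha>)) (coeff_functional R p \<alpha>))) < e"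
    have "(\<Sum>\<alpha>\<in>A. fscale (c \<alpha> * \<phi> (e_mono R \<alpha>)) (coeff_functional R p \<alpha>)) \<in> Phi R p ` E"
      using A(2) cf by (intro cfun.subspace_sum[OF W] cfun.subspace_scale[OF W]) auto
    thus ?thesis using lt by auto
  qed
  hence "\<exists>g\<in>E. bdual_norm p (\<phi> - Phi R p g) < inverse (real (Suc n))" for n by simp
  then obtain g where g: "\<And>n. g n \<in> E" "\<And>n. bdual_norm p (\<phi> - Phi R p (g n)) < inverse (real (Suc n))" by metis
  have gq: "g n \<in> bergman R q" for n using g(1) E by blast
  note Pd = Phi_mem_dual[OF p1 q1 pq] and Pdiff = Phi_diff[OF p1 q1 pq]
  have cauchy: "\<exists>M. \<forall>m\<ge>M. \<forall>n\<ge>M. bnorm q (g m - g n) < e" if e: "0 < e" for e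
  proof -
    have e2: "0 < e / (2 * (B_norm + 1))" using e B_norm_nonneg by simp
    obtain M where M: "inverse (real (Suc M)) < e / (2 * (B_norm + 1))" using reals_Archimedean[OF e2] by blast
    have "bnorm q (g m - g n) < e" if "m \<ge> M" "n \<ge> M" for m n
    proof -
      have small: "bdual_norm p (\<phi> - Phi R p (g k)) < e / (2 * (B_norm + 1))" if "k \<ge> M" for k
      proof -
        have "inverse (real (Suc k)) \<le> inverse (real (Suc M))" using that by (intro le_imp_inverse_le) simp_all
        thus ?thesis using g(2)[of k] M by linarith
      qed
      have "bdual_norm p (Phi R p (g m) - Phi R p (g n)) \<le>
          bdual_norm p (Phi R p (g m) - \<phi>) + bdual_norm p (\<phi> - Phi R p (g n))"
        by (rule P'.norm_triangle[OF Pd(1)[OF gq] phi Pd(1)[OF gq]])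
      also have "\<dots> \<le> e / (2 * (B_norm + 1)) + e / (2 * (B_norm + 1))"
        using small[OF \<open>m \<ge> M\<close>] small[OF \<open>n \<ge> M\<close>] P'.norm_diff_commute[OF Pd(1)[OF gq] phi, of m] by linarith
      also have "\<dots> = e / (B_norm + 1)"
        by (subst add_divide_distrib[symmetric], subst mult_2[symmetric], rule mult_divide_mult_cancel_left) simp
      finally have *: "bdual_norm p (Phi R p (g m) - Phi R p (g n)) \<le> e / (B_norm + 1)" .
      have "bnorm q (g m - g n) \<le> B_norm * bdual_norm p (Phi R p (g m - g n))"
        using cfun.subspace_diff[OF E(1) g(1) g(1)] E(4) by (intro Phi_lower_bound) blast
      also have "\<dots> \<le> B_norm * (e / (B_norm + 1))"
        using * B_norm_nonneg by (simp only: Pdiff[OF gq gq]) (rule mult_left_mono)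
      also have "\<dots> < e" using e B_norm_nonneg by (simp add: field_simps)
      finally show ?thesis .
    qed
    thus ?thesis by blast
  qed
  show ?thesis
  proof (rule Q.mcompleteD[OF complete_lp_subspace.complete[OF complete_bergman[OF q1]] gq cauchy])
    fix x assume x: "x \<in> bergman R q" and lim: "(\<lambda>n. bnorm q (g n - x)) \<longlonglongrightarrow> 0"
    have "x \<in> G"
    proof (rule Q.closed_span_closed[OF monomials_sub(2) x])
      fix e :: real assume "0 < e"
      then obtain n where "bnorm q (g n - x) < e" using order_tendstoD(2)[OF lim] eventually_sequentially by force
      thus "\<exists>s\<in>G. bnorm q (x - s) < e" using g(1) E(4) Q.norm_diff_commute[OF x gq] by (intro bexI[of _ "g n"]) auto
    qed
    moreover have "Phi R p x = \<phi>"
    proof -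
      have "bdual_norm p (\<phi> - Phi R p x) \<le> inverse (real (Suc n)) + bnorm q (g n - x)" for n
      proof -
        have "bdual_norm p (\<phi> - Phi R p x) \<le> bdual_norm p (\<phi> - Phi R p (g n)) + bdual_norm p (Phi R p (g n) - Phi R p x)"
          by (rule P'.norm_triangle[OF phi Pd(1)[OF gq] Pd(1)[OF x]])
        also have "bdual_norm p (Phi R p (g n) - Phi R p x) \<le> bnorm q (g n - x)"
          unfolding Pdiff[OF gq x, symmetric] by (rule Pd(2)[OF Q.mem_diff[OF gq x]])
        finally show ?thesis using g(2)[of n] by linarith
      qed
      moreover have "(\<lambda>n. inverse (real (Suc n)) + bnorm q (g n - x)) \<longlonglongrightarrow> 0 + 0"
        by (intro tendsto_add LIMSEQ_inverse_real_of_nat lim)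
      ultimately have "bdual_norm p (\<phi> - Phi R p x) \<le> 0 + 0" by (intro LIMSEQ_le_const) auto
      moreover have d: "\<phi> - Phi R p x \<in> bdual p" by (rule P'.mem_diff[OF phi Pd(1)[OF x]])
      ultimately have "\<phi> - Phi R p x = 0" using P'.norm_nonneg[OF d] P'.norm_eq_0[OF d] by simp
      thus ?thesis by simp
    qed
    ultimately show ?thesis by blast
  qed
qed

lemma Phi_image: "Phi R p ` bergman R q = bdual p"
  using Phi_mem_dual(1)[OF p1 q1 pq] Phi_surj_G G_iff by (auto simp: image_iff) metis

text \<open>No function in \<open>A^p\<close> has a nonzero coefficient outside
  \<open>mono_exps R p\<close>, so the monomials there are annihilated, and so is their closed span
  by continuity. Conversely, testing an element of the kernel against the monomials of
  \<open>A^p\<close> kills its coefficients there, so its approximants contain only the other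
  monomials.\<close>

lemma Phi_kernel:
  "{g \<in> bergman R q. Phi R p g = 0} =
    closed_span (bergman R q) (bnorm q) (e_mono R ` (mono_exps R q - mono_exps R p))" (is "?K = closed_span _ _ ?E")
proof -
  have E: "?E \<subseteq> bergman R q" using mono_expsD by auto
  note iff = Q.closed_span_iff[OF E]
  have K: "cfun.subspace ?K"
  proof (rule cfun.subspaceI)
    show "0 \<in> ?K" by (simp add: Q.mem_zero Phi_zero)
  qed (auto simp: Q.mem_add Q.mem_fscale Phi_add[OF p1 q1 pq] Phi_fscale[OF p1 q1 pq])
  have "e_mono R \<alpha> \<in> ?K" if a: "\<alpha> \<in> mono_exps R q - mono_exps R p" for \<alpha>
  proof -
    have "coeff_functional R p \<alpha> = 0"
      using a coeff_nonzero_mono_exps[OF p1, of _ \<alpha>] by (auto simp: coeff_functional_def fun_eq_iff)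
    thus ?thesis using a by (auto simp: Phi_e_mono[OF p1 q1 pq] mono_expsD)
  qed
  hence EK: "cfun.span ?E \<subseteq> ?K" by (intro cfun.span_minimal K) auto
  have "g \<in> ?K" if g: "g \<in> closed_span (bergman R q) (bnorm q) ?E" for g
  proof -
    have gq: "g \<in> bergman R q" using g by (simp add: iff)
    have "bdual_norm p (Phi R p g) \<le> 0 + e" if "0 < e" for e
    proof -
      obtain s where s: "s \<in> cfun.span ?E" "bnorm q (g - s) < e" using g \<open>0 < e\<close> unfolding iff by blast
      have sK: "s \<in> bergman R q" "Phi R p s = 0" using EK s(1) by auto
      have "Phi R p (g - s) = Phi R p g" by (simp add: Phi_diff[OF p1 q1 pq gq sK(1)] sK(2))
      thus ?thesis using s(2) Phi_mem_dual(2)[OF p1 q1 pq Q.mem_diff[OF gq sK(1)]] by simp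
    qed
    hence "bdual_norm p (Phi R p g) \<le> 0" by (rule field_le_epsilon)
    hence "Phi R p g = 0" 
      using P'.norm_nonneg[OF Phi_mem_dual(1)[OF p1 q1 pq gq]] P'.norm_eq_0[OF Phi_mem_dual(1)[OF p1 q1 pq gq]] by simp
    thus ?thesis using gq by simp
  qed
  moreover have "g \<in> closed_span (bergman R q) (bnorm q) ?E" if g: "g \<in> bergman R q" "Phi R p g = 0" for g
  proof -
    have c0: "coeff g \<alpha> = 0" if a: "\<alpha> \<in> mono_exps R p" for \<alpha>
    proof -
      have "pairing (e_mono R \<alpha>) g = 0" using g(2) Phi_eq[OF mono_expsD[OF a], of g] by simp
      hence "coeff g \<alpha> * of_real (e_square \<alpha>) = 0"
        using pairing_coeff[OF q1 p1 qp_conj g(1) a] pairing_cnj[of g] by simp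
      moreover have "0 < e_square \<alpha>" by (rule e_square_pos_p[OF a])
      ultimately show ?thesis by simp
    qed
    have "\<exists>s\<in>cfun.span ?E. bnorm q (g - s) < e" if e: "0 < e" for e
    proof (rule monomials_dense[OF q1 g(1) e])
      fix A c assume A: "finite A" "A \<subseteq> mono_exps R q"
        and lt: "bnorm q (g - (\<Sum>\<alpha>\<in>A. fscale (c \<alpha> * coeff g \<alpha>) (e_mono R \<alpha>))) < e"
      have "(\<Sum>\<alpha>\<in>A. fscale (c \<alpha> * coeff g \<alpha>) (e_mono R \<alpha>)) \<in> cfun.span ?E"
      proof (rule cfun.span_sum)
        fix \<alpha> assume "\<alpha> \<in> A"
        show "fscale (c \<alpha> * coeff g \<alpha>) (e_mono R \<alpha>) \<in> cfun.span ?E"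
        proof (cases "\<alpha> \<in> mono_exps R p")
          case True
          thus ?thesis by (simp add: c0 cfun.span_zero)
        next
          case False
          thus ?thesis using A(2) \<open>\<alpha> \<in> A\<close> by (intro cfun.span_scale cfun.span_base) auto
        qed
      qed
      thus ?thesis using lt by blast
    qed
    thus ?thesis using g(1) unfolding iff by blast
  qed
  ultimately show ?thesis by blast
qed

lemma Phi_bij_G: "bij_betw (Phi R p) G (bdual p)"
  unfolding bij_betw_def
proof
  show "inj_on (Phi R p) G"
  proof (rule inj_onI)
    fix g h assume g: "g \<in> G" and h: "h \<in> G" and eq: "Phi R p g = Phi R p h"
    have "Phi R p (g - h) = 0" using Phi_diff[OF p1 q1 pq] g h eq by (simp add: G_iff)
    hence "bnorm q (g - h) \<le> 0" using Phi_lower_bound[OF G.mem_diff[OF g h]] P'.norm_of_zero by simp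
    thus "g = h" using G.norm_eq_0[OF G.mem_diff[OF g h]] G.norm_nonneg[OF G.mem_diff[OF g h]] by simp
  qed
  show "Phi R p ` G = bdual p"
    using Phi_surj_G Phi_mem_dual(1)[OF p1 q1 pq] by (auto simp: G_iff image_iff)
qed

text \<open>The involution fixes the generators and preserves the norm; conjugating scalars does not
  change a span.\<close>

lemma star_G: "g \<in> G \<Longrightarrow> star g \<in> G"
proof -
  define E where "E = cfun.span (e_mono R ` mono_exps R p)"
  have E: "cfun.subspace E" by (simp add: E_def cfun.subspace_span)
  have "cfun.subspace {s. star s \<in> E}"
  proof (rule cfun.subspaceI)
    have "star 0 = 0" by (auto simp: star_def fun_eq_iff)
    thus "0 \<in> {s. star s \<in> E}" using cfun.subspace_0[OF E] by simp
  qed (auto simp: star_add star_fscale cfun.subspace_add[OF E] cfun.subspace_scale[OF E])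
  moreover have "e_mono R ` mono_exps R p \<subseteq> {s. star s \<in> E}"
    by (auto simp: star_e_mono E_def intro: cfun.span_base)
  ultimately have sE: "s \<in> E \<Longrightarrow> star s \<in> E" for s using cfun.span_minimal unfolding E_def by blast
  assume g: "g \<in> G"
  hence gq: "g \<in> bergman R q" by (simp add: G_iff)
  have "\<exists>s\<in>E. bnorm q (star g - s) < e" if "0 < e" for e
  proof -
    obtain s where s: "s \<in> E" "bnorm q (g - s) < e" using g \<open>0 < e\<close> unfolding G_iff E_def by blast
    have "g - s \<in> bergman R q" using s(1) gq Q.span_subset[OF monomials_sub(2)] by (auto simp: E_def intro: Q.mem_diff)
    hence "bnorm q (star g - star s) < e" using star_bergman(2) s(2) by (simp add: star_diff[symmetric])
    thus ?thesis using sE[OF s(1)] by blast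
  qed
  thus "star g \<in> G" using star_bergman(1)[OF gq] unfolding G_iff E_def by blast
qed

text \<open>
  The inverse of \<^term>\<open>Phi R p\<close> is conjugate-linear; composing it with \<^term>\<open>star\<close> makes it linear.
\<close>

lemma dual_homeomorphic_G: "linearly_homeomorphic (bdual p) (bdual_norm p) G (bnorm q)"
proof -
  define \<Psi> where "\<Psi> = inv_into G (Phi R p)"
  define T where "T = (\<lambda>\<phi>. star (\<Psi> \<phi>))"
  have Psi: "\<Psi> \<phi> \<in> G" "Phi R p (\<Psi> \<phi>) = \<phi>" if "\<phi> \<in> bdual p" for \<phi>
    using Phi_bij_G that unfolding \<Psi>_def bij_betw_def by (auto simp: inv_into_into f_inv_into_f)
  have PsiI: "\<Psi> (Phi R p g) = g" if "g \<in> G" for g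
    using Phi_bij_G that unfolding \<Psi>_def bij_betw_def by (simp add: inv_into_f_f)
  have GD: "g \<in> G \<Longrightarrow> g \<in> bergman R q" for g by (simp add: G_iff)
  have lin: "linear_map_on (bdual p) T"
    unfolding linear_map_on_def
  proof (intro conjI ballI allI)
    fix \<phi> \<psi> c assume p: "\<phi> \<in> bdual p"
    have "\<Psi> (Phi R p (fscale (cnj c) (\<Psi> \<phi>))) = fscale (cnj c) (\<Psi> \<phi>)" by (rule PsiI[OF G.mem_fscale[OF Psi(1)[OF p]]])
    thus "T (fscale c \<phi>) = fscale c (T \<phi>)" by (simp add: Phi_fscale[OF p1 q1 pq] Psi(2)[OF p] T_def star_fscale)
    assume q: "\<psi> \<in> bdual p"
    have "\<Psi> (Phi R p (\<Psi> \<phi> + \<Psi> \<psi>)) = \<Psi> \<phi> + \<Psi> \<psi>" by (rule PsiI[OF G.mem_add[OF Psi(1)[OF p] Psi(1)[OF q]]])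
    thus "T (\<phi> + \<psi>) = T \<phi> + T \<psi>"
      by (simp add: Phi_add[OF p1 q1 pq GD[OF Psi(1)[OF p]] GD[OF Psi(1)[OF q]]] Psi(2)[OF p] Psi(2)[OF q] T_def star_add)
  qed
  have bij: "bij_betw T (bdual p) G"
  proof (rule bij_betw_byWitness[where f'="\<lambda>g. Phi R p (star g)"])
    show "\<forall>\<phi>\<in>bdual p. Phi R p (star (T \<phi>)) = \<phi>" using Psi(2) by (simp add: T_def)
    show "\<forall>g\<in>G. T (Phi R p (star g)) = g" using PsiI star_G by (simp add: T_def)
    show "T ` bdual p \<subseteq> G" using Psi(1) star_G by (auto simp: T_def)
    show "(\<lambda>g. Phi R p (star g)) ` G \<subseteq> bdual p" using star_G GD Phi_mem_dual(1)[OF p1 q1 pq] by auto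
  qed
  \<comment> \<open>One constant is the lower bound of \<open>Phi\<close>, the other is Hoelder's
    inequality; the involution is isometric and does not change them.\<close>
  have T: "bnorm q (T \<phi> - T \<psi>) \<le> B_norm * bdual_norm p (\<phi> - \<psi>)" "bdual_norm p (\<phi> - \<psi>) \<le> 1 * bnorm q (T \<phi> - T \<psi>)"
    if p: "\<phi> \<in> bdual p" and q: "\<psi> \<in> bdual p" for \<phi> \<psi>
  proof -
    have d: "\<Psi> \<phi> - \<Psi> \<psi> \<in> G" by (rule G.mem_diff[OF Psi(1)[OF p] Psi(1)[OF q]])
    have n: "bnorm q (T \<phi> - T \<psi>) = bnorm q (\<Psi> \<phi> - \<Psi> \<psi>)"
      unfolding T_def star_diff[symmetric] by (rule star_bergman(2)[OF GD[OF d]])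
    have "Phi R p (\<Psi> \<phi> - \<Psi> \<psi>) = \<phi> - \<psi>"
      by (simp add: Phi_diff[OF p1 q1 pq GD[OF Psi(1)[OF p]] GD[OF Psi(1)[OF q]]] Psi(2)[OF p] Psi(2)[OF q])
    thus "bnorm q (T \<phi> - T \<psi>) \<le> B_norm * bdual_norm p (\<phi> - \<psi>)" "bdual_norm p (\<phi> - \<psi>) \<le> 1 * bnorm q (T \<phi> - T \<psi>)"
      using Phi_lower_bound[OF d] Phi_mem_dual(2)[OF p1 q1 pq GD[OF d]] n by simp_all
  qed
  have "homeomorphic_map (norm_topology (bdual p) (bdual_norm p)) (norm_topology G (bnorm q)) T"
    by (rule P'.bilipschitz_homeomorphic_map[OF G.normed_function_space_axioms bij T])
  thus ?thesis using lin unfolding linearly_homeomorphic_def by blast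
qed

text \<open>The projection of a representing function carries the action of the functional on the
  monomials of \<open>A^p\<close>. What remains vanishes on these monomials, so its approximants by
  coefficient functionals contain only the remaining exponents. Riesz representation and projection
  bound the first component.\<close>

lemma dual_direct_sum:
  "topological_direct_sum (bdual q) (bdual_norm q) (Phi R q ` bergman R p)
     (closed_span (bdual q) (bdual_norm q) (coeff_functional R q ` (mono_exps R q - mono_exps R p)))"
  (is "topological_direct_sum _ _ ?A (closed_span _ _ ?E)")
proof (rule Q'.topological_direct_sumI)
  note Pd = Phi_mem_dual[OF q1 p1 qp_conj]
  have E: "?E \<subseteq> bdual q" using coeff_functional_mem_dual[OF q1 p1 qp_conj] by auto
  note iff = Q'.closed_span_iff[OF E]
  show "cfun.subspace ?A" by (rule Phi_image_subspace[OF q1 p1 qp_conj P.cfun_subspace order_refl])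
  show "?A \<subseteq> bdual q" using Pd(1) by auto
  show "cfun.subspace (closed_span (bdual q) (bdual_norm q) ?E)" by (rule Q'.subspace_closed_span[OF E])
  show "closed_span (bdual q) (bdual_norm q) ?E \<subseteq> bdual q" using iff by blast
  \<comment> \<open>Vanishing at a fixed monomial is a closed condition, and the generating
    coefficient functionals satisfy it.\<close>
  have vanish: "\<phi> (e_mono R \<alpha>) = 0" if phi: "\<phi> \<in> closed_span (bdual q) (bdual_norm q) ?E" and a: "\<alpha> \<in> mono_exps R p" for \<phi> \<alpha>
  proof (rule ccontr)
    assume ne: "\<phi> (e_mono R \<alpha>) \<noteq> 0"
    have aq: "\<alpha> \<in> mono_exps R q" using a Sp_sub_Sq by blast
    have pos: "0 < bnorm q (e_mono R \<alpha>)" by (rule e_mono_norm_pos[OF q1 aq])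
    have "0 < cmod (\<phi> (e_mono R \<alpha>)) / bnorm q (e_mono R \<alpha>)" using ne pos by simp
    then obtain s where s: "s \<in> cfun.span ?E" "bdual_norm q (\<phi> - s) < cmod (\<phi> (e_mono R \<alpha>)) / bnorm q (e_mono R \<alpha>)"
      using phi unfolding iff by blast
    have "cfun.subspace {s. s (e_mono R \<alpha>) = 0}" by (rule cfun.subspaceI) (auto simp: fscale_def)
    moreover have "?E \<subseteq> {s. s (e_mono R \<alpha>) = 0}"
      using a by (auto simp: coeff_functional_def coeff_e_mono[OF aq])
    ultimately have "s (e_mono R \<alpha>) = 0" using cfun.span_minimal s(1) by blast
    hence "cmod (\<phi> (e_mono R \<alpha>)) = cmod ((\<phi> - s) (e_mono R \<alpha>))" by simp
    also have "\<dots> \<le> bdual_norm q (\<phi> - s) * bnorm q (e_mono R \<alpha>)"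
    proof (rule Q.dual_norm_bound[OF _ mono_expsD[OF aq]])
      show "\<phi> - s \<in> bdual q" using phi s(1) Q'.span_subset[OF E] by (auto simp: iff intro: Q'.mem_diff)
    qed
    also have "\<dots> < cmod (\<phi> (e_mono R \<alpha>))" using s(2) pos by (simp add: pos_less_divide_eq)
    finally show False by simp
  qed
  \<comment> \<open>A function in \<open>A^p\<close> has coefficients only at exponents of
    \<open>A^p\<close>, and those vanish for an element of both summands.\<close>
  show "?A \<inter> closed_span (bdual q) (bdual_norm q) ?E \<subseteq> {0}"
  proof
    fix \<phi> assume phi: "\<phi> \<in> ?A \<inter> closed_span (bdual q) (bdual_norm q) ?E"
    then obtain g where g: "g \<in> bergman R p" "\<phi> = Phi R q g" by blast
    have "coeff g \<alpha> = 0" for \<alpha>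
    proof (cases "\<alpha> \<in> mono_exps R p")
      case True
      hence aq: "\<alpha> \<in> mono_exps R q" using Sp_sub_Sq by blast
      have "pairing (e_mono R \<alpha>) g = 0" using vanish[of \<phi> \<alpha>] phi True g(2) Phi_eq[OF mono_expsD[OF aq], of g] by simp
      hence "coeff g \<alpha> * of_real (e_square \<alpha>) = 0"
        using pairing_coeff[OF p1 q1 pq g(1) aq] pairing_cnj[of g] by simp
      moreover have "0 < e_square \<alpha>" by (rule e_square_pos_p[OF True])
      ultimately show ?thesis by simp
    qed (use coeff_nonzero_mono_exps[OF p1 g(1)] in blast)
    hence "g = 0" by (rule bergman_eqI_coeff[OF g(1)])
    thus "\<phi> \<in> {0}" using g(2) by (simp add: Phi_zero)
  qed
  fix \<phi> assume phi: "\<phi> \<in> bdual q"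
  show "\<exists>a\<in>?A. \<exists>b\<in>closed_span (bdual q) (bdual_norm q) ?E. \<phi> = a + b \<and> bdual_norm q a \<le> B_norm * bdual_norm q \<phi>"
  proof (rule bergman_Riesz[OF q1 p1 qp_conj phi[folded Lp_norm_eq_lp_norm]])
    fix h assume h: "h \<in> lp_space (dV R) p" and hn: "bnorm p h \<le> bergman_dual_norm R q \<phi>"
      and rep: "\<And>u. u \<in> bergman R q \<Longrightarrow> \<phi> u = (LINT z|dV R. u z * cnj (h z))"
    define b where "b = sub_projection p h"
    note b = sub_projection[OF h, folded b_def]
    define \<psi> where "\<psi> = \<phi> - Phi R q b"
    have psi: "\<psi> \<in> bdual q" unfolding \<psi>_def by (rule Q'.mem_diff[OF phi Pd(1)[OF b(1)]])
    have "bdual_norm q (Phi R q b) \<le> B_norm * bnorm p h" using Pd(2)[OF b(1)] b(2) by simp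
    also have "\<dots> \<le> B_norm * bdual_norm q \<phi>"
      using hn B_norm_nonneg by (intro mult_left_mono) (simp_all add: Lp_norm_eq_lp_norm)
    finally have norm: "bdual_norm q (Phi R q b) \<le> B_norm * bdual_norm q \<phi>" .
    \<comment> \<open>The projection has the same pairing as \<open>h\<close> with elements of
      \<open>A^p\<close>, in particular with its monomials.\<close>
    have psi0: "\<psi> (e_mono R \<alpha>) = 0" if a: "\<alpha> \<in> mono_exps R p" for \<alpha>
    proof -
      have aq: "e_mono R \<alpha> \<in> bergman R q" using a Sp_sub_Sq mono_expsD by blast
      show ?thesis using b(3)[OF mono_expsD[OF a]] rep[OF aq] by (simp add: \<psi>_def Phi_eq[OF aq] pairing_def)
    qed
    have "\<exists>s\<in>cfun.span ?E. bdual_norm q (\<psi> - s) < e" if e: "0 < e" for e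
    proof (rule coeff_functionals_dense[OF q1 p1 qp_conj psi e])
      fix A c assume A: "finite A" "A \<subseteq> mono_exps R q"
        and lt: "bdual_norm q (\<psi> - (\<Sum>\<alpha>\<in>A. fscale (c \<alpha> * \<psi> (e_mono R \<alpha>)) (coeff_functional R q \<alpha>))) < e"
      have "(\<Sum>\<alpha>\<in>A. fscale (c \<alpha> * \<psi> (e_mono R \<alpha>)) (coeff_functional R q \<alpha>)) \<in> cfun.span ?E"
      proof (rule cfun.span_sum)
        fix \<alpha> assume "\<alpha> \<in> A"
        show "fscale (c \<alpha> * \<psi> (e_mono R \<alpha>)) (coeff_functional R q \<alpha>) \<in> cfun.span ?E"
        proof (cases "\<alpha> \<in> mono_exps R p")
          case True
          thus ?thesis by (simp add: psi0 cfun.span_zero)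
        next
          case False
          thus ?thesis using A(2) \<open>\<alpha> \<in> A\<close> by (intro cfun.span_scale cfun.span_base) auto
        qed
      qed
      thus ?thesis using lt by blast
    qed
    hence "\<psi> \<in> closed_span (bdual q) (bdual_norm q) ?E" using psi unfolding iff by blast
    moreover have "\<phi> = Phi R q b + \<psi>" by (simp add: \<psi>_def)
    ultimately show ?thesis using norm b(1) by blast
  qed
qed

end

theorem proposition3p27:
  fixes R :: "(complex ^ 'n) set" and p q :: real
  assumes "reinhardt_domain R" and "bounded R"
    and "2 \<le> p" and "1 / p + 1 / q = 1"
    and "abs_sub_bergman_bounded R p"
  shows "(Phi R p ` bergman R q = bergman_dual R p \<and>
          {g \<in> bergman R q. Phi R p g = 0} = N_space R q p) \<and>
         (banach_on (bergman_dual R p) (bergman_dual_norm R p) \<and>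
          banach_on (G_space R q p) (Lp_norm R q) \<and>
          linearly_homeomorphic (bergman_dual R p) (bergman_dual_norm R p) (G_space R q p) (Lp_norm R q)) \<and>
         topological_direct_sum (bergman_dual R q) (bergman_dual_norm R q)
           (Phi R q ` bergman R p)
           (closed_span (bergman_dual R q) (bergman_dual_norm R q)
              (coeff_functional R q ` (mono_exps R q - mono_exps R p)))"
proof -
  interpret bounded_sub_bergman R p q by unfold_locales (use assms in auto)
  have "banach_on (bdual p) (bdual_norm p)" by (rule P.banach_dual_space)
  moreover have "banach_on G (bnorm q)"
    by (rule Q.banach_closed_span[OF complete_lp_subspace.complete[OF complete_bergman[OF q1]] monomials_sub(2)])
  ultimately show ?thesis
    unfolding Lp_norm_eq_lp_norm G_space_def N_space_def
    using Phi_image Phi_kernel dual_homeomorphic_G dual_direct_sum by blast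
qed

end
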